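(* Let $n\ge1$ and let $(C,\oplus,0,\zeta^\oplus)$ be a small permutative category. The $n$-fold monoidal category operad $\mathsf{Mon}^n$ parametrizes $E_n$-monoidal category structures on $C$: there is a canonical bijective correspondence between $\mathsf{Cat}$-enriched multifunctors $\mathsf{Mon}^n\to\mathsf{PermCat}^{\mathsf{su}}$ sending the unique object of $\mathsf{Mon}^n$ to $C$, and data $(\{\otimes_i,\partial^{l,i},\partial^{r,i}\}_{1\le i\le n},1,\{\eta^{i,j}\}_{1\le i<j\le n})$ making $(C,\oplus,0,\zeta^\oplus)$ into an $E_n$-monoidal category.
   Context: A permutative category is a symmetric strict monoidal category. The $\mathsf{Cat}$-enriched multicategory $\mathsf{PermCat}^{\mathsf{su}}$ has small permutative categories as objects. For $k\ge1$, its category of $k$-ary operations $(C_1,\dots,C_k)\to D$ has as objects the $k$-linear functors: functors $F:C_1\times\cdots\times C_k\to D$ with, for each $i$, a natural transformation $F^2_i:F(\dots,A_i,\dots)\oplus F(\dots,A_i',\dots)\to F(\dots,A_i\oplus A_i',\dots)$ (the other entries fixed), such that: $F=0$ if some entry is $0$ and $F=1_0$ if some entry is $1_0$; $F^2_i$ is an identity if any of the objects $A_j$ or $A'_i$ is $0$; each $F^2_i$ is associative, $F_i^2(F_i^2\oplus1)=F_i^2(1\oplus F_i^2)$; each $F^2_i$ is symmetric, $F(\dots,\zeta^\oplus,\dots)F^2_i=F^2_i\zeta^\oplus$; and for $i\ne p$, the two morphisms $F(A_i,A_p)\oplus F(A_i',A_p)\oplus F(A_i,A_p')\oplus F(A_i',A_p')\to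 F(A_i\oplus A_i',A_p\oplus A_p')$ given by $F^2_p(F^2_i\oplus F^2_i)$ and $F^2_i(F^2_p\oplus F^2_p)(1\oplus\zeta^\oplus\oplus1)$ agree. Its morphisms are the $k$-linear transformations: natural transformations that commute with all $F^2_i$ and are $1_0$ whenever some entry is $0$. The category of $0$-ary operations into $D$ is $D$. Composition is composition of functors, with the linearity constraint of $F\circ(G_1,\dots,G_k)$ in a variable of $G_j$ equal to $F(\dots,G_j^2,\dots)\circ F^2_j$; the symmetric groups permute the variables. An $n$-fold monoidal category is a category with strict monoidal structures $\otimes_1,\dots,\otimes_n$ having a common unit $1$, and natural transformations (exchanges) $\eta^{i,j}_{A,B,C,D}:(A\otimes_jB)\otimes_i(C\otimes_jD)\to(A\otimes_iC)\otimes_j(B\otimes_iD)$ for $1\le i<j\le n$, such that, writing $\eta=\eta^{i,j}$: $\eta_{A,B,1,1}$, $\eta_{1,1,A,B}$, $\eta_{A,1,B,1}$, $\eta_{1,A,1,B}$ are identities; $\eta_{U\otimes_iW,V\otimes_iX,Y,Z}(\eta_{U,V,W,X}\otimes_i1)=\eta_{U,V,W\otimes_iY,X\otimes_iZ}(1\otimes_i\eta_{W,X,Y,Z})$; $(\eta_{U,V,X,Y}\otimes_j1)\eta_{U\otimes_jV,W,X\otimes_jY,Z}=(1\otimes_j\eta_{V,W,Y,Z})\eta_{U,V\otimes_jW,X,Y\otimes_jZ}$; and for $i<j<k$, $(\eta^{i,j}_{A,B,C,D}\otimes_k\eta^{i,j}_{A',B',C',D'})\,\eta^{i,k}_{A\otimes_jB,A'\otimes_jB',C\otimes_jD,C'\otimes_jD'}\,(\eta^{j,k}_{A,A',B,B'}\otimes_i\eta^{j,k}_{C,C',D,D'})=\eta^{j,k}_{A\otimes_iC,A'\otimes_iC',B\otimes_iD,B'\otimes_iD'}\,(\eta^{i,k}_{A,A',C,C'}\otimes_j\eta^{i,k}_{B,B',D,D'})\,\eta^{i,j}_{A\otimes_kA',B\otimes_kB',C\otimes_kC',D\otimes_kD'}$.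 The $\mathsf{Cat}$-enriched operad (one-object multicategory) $\mathsf{Mon}^n$: $\mathsf{Mon}^n(k)$ is the full subcategory of the free $n$-fold monoidal category on the set $\{1,\dots,k\}$ whose objects are the words in which each of $1,\dots,k$ occurs exactly once; $\Sigma_k$ acts by permuting the letters, and operadic composition substitutes words (and morphisms) with shifted labels for the letters; $\mathsf{Mon}^n(0)$ is the terminal category on the object $1$. A ring category structure on $(C,\oplus,0,\zeta^\oplus)$ consists of a strict monoidal structure $(\otimes,1)$ on $C$ and natural transformations $\partial^l_{A,B,C}:(A\otimes C)\oplus(B\otimes C)\to(A\oplus B)\otimes C$ and $\partial^r_{A,B,C}:(A\otimes B)\oplus(A\otimes C)\to A\otimes(B\oplus C)$ such that (writing $AB$ for $A\otimes B$): $0A=0=A0$ on objects and $1_0\otimes f=1_0=f\otimes 1_0$ on morphisms; $\partial^l$ and $\partial^r$ are identities whenever one of the three objects is $0$; $\partial^l_{A,B,1}$ and $\partial^r_{1,A,B}$ are identities; $\partial^l_{B,A,C}\zeta^\oplus_{AC,BC}=(\zeta^\oplus_{A,B}\otimes1)\partial^l_{A,B,C}$ and $\partial^r_{A,C,B}\zeta^\oplus_{AB,AC}=(1\otimes\zeta^\oplus_{B,C})\partial^r_{A,B,C}$; $\partial^l_{A\oplus A',A'',B}(\partial^l_{A,A',B}\oplus1)=\partial^l_{A,A'\oplus A'',B}(1\oplus\partial^l_{A',A'',B})$ and $\partial^r_{A,B\oplus B',B''}(\partial^r_{A,B,B'}\oplus1)=\partial^r_{A,B,B'\oplus B''}(1\oplus\partial^r_{A,B',B''})$;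 $\partial^l_{A,B,CD}=(\partial^l_{A,B,C}\otimes1_D)\partial^l_{AC,BC,D}$, $\partial^r_{AB,C,D}=(1_A\otimes\partial^r_{B,C,D})\partial^r_{A,BC,BD}$, $(\partial^r_{A,B,C}\otimes1_D)\partial^l_{AB,AC,D}=(1_A\otimes\partial^l_{B,C,D})\partial^r_{A,BD,CD}$; and $\partial^r_{A\oplus B,C,D}(\partial^l_{A,B,C}\oplus\partial^l_{A,B,D})(1\oplus\zeta^\oplus_{AD,BC}\oplus1)=\partial^l_{A,B,C\oplus D}(\partial^r_{A,C,D}\oplus\partial^r_{B,C,D})$. An $E_n$-monoidal category structure on $(C,\oplus,0,\zeta^\oplus)$ consists of an $n$-fold monoidal structure $(\{\otimes_i\},1,\{\eta^{i,j}\})$ on $C$ and, for each $i$, natural transformations $\partial^{l,i},\partial^{r,i}$ making $(\oplus,\otimes_i,\partial^{l,i},\partial^{r,i})$ a ring category, such that for $i<j$: $\eta^{i,j}_{A,B,C,D}=1_0$ if any of $A,B,C,D$ is $0$ (zero exchange axiom); and $\eta^{i,j}$ is compatible with sums in each variable (exchange factorization axioms), i.e. $\eta^{i,j}_{A\oplus A',B,C,D}\circ(\partial^{l,j}\otimes_i1)\partial^{l,i}=(\partial^{l,i}\otimes_j1)\partial^{l,j}\circ(\eta^{i,j}_{A,B,C,D}\oplus\eta^{i,j}_{A',B,C,D})$, $\eta^{i,j}_{A,B\oplus B',C,D}\circ(\partial^{r,j}\otimes_i1)\partial^{l,i}=(1\otimes_j\partial^{l,i})\partial^{r,j}\circ(\eta^{i,j}_{A,B,C,D}\oplus\eta^{i,j}_{A,B',C,D})$,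 $\eta^{i,j}_{A,B,C\oplus C',D}\circ(1\otimes_i\partial^{l,j})\partial^{r,i}=(\partial^{r,i}\otimes_j1)\partial^{l,j}\circ(\eta^{i,j}_{A,B,C,D}\oplus\eta^{i,j}_{A,B,C',D})$, $\eta^{i,j}_{A,B,C,D\oplus D'}\circ(1\otimes_i\partial^{r,j})\partial^{r,i}=(1\otimes_j\partial^{r,i})\partial^{r,j}\circ(\eta^{i,j}_{A,B,C,D}\oplus\eta^{i,j}_{A,B,C,D'})$. *)

theory Defs
  imports Main "HOL-Library.FuncSet" "HOL-Combinatorics.Permutations"
begin

section \<open>Small categories, functors, natural transformations\<close>

record ('o, 'm) cat =
  Obj :: "'o set"
  Arr :: "'m set"
  Dom :: "'m \<Rightarrow> 'o"
  Cod :: "'m \<Rightarrow> 'o"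
  Ide :: "'o \<Rightarrow> 'm"
  Cmp :: "'m \<Rightarrow> 'm \<Rightarrow> 'm" (infixr "\<cdot>\<index>" 60)

definition hom :: "('o, 'm, 'z) cat_scheme \<Rightarrow> 'o \<Rightarrow> 'o \<Rightarrow> 'm set" where
  "hom C A B = {f \<in> Arr C. Dom C f = A \<and> Cod C f = B}"

locale category =
  fixes C :: "('o, 'm, 'z) cat_scheme" (structure)
  assumes Dom_Obj: "f \<in> Arr C \<Longrightarrow> Dom C f \<in> Obj C"
    and Cod_Obj: "f \<in> Arr C \<Longrightarrow> Cod C f \<in> Obj C"
    and Ide_hom: "A \<in> Obj C \<Longrightarrow> Ide C A \<in> hom C A A"
    and Cmp_hom: "f \<in> hom C A B \<Longrightarrow> g \<in> hom C B D \<Longrightarrow> g \<cdot> f \<in> hom C A D"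
    and Cmp_Ide: "f \<in> hom C A B \<Longrightarrow> f \<cdot> Ide C A = f"
    and Ide_Cmp: "f \<in> hom C A B \<Longrightarrow> Ide C B \<cdot> f = f"
    and Cmp_assoc: "f \<in> hom C A B \<Longrightarrow> g \<in> hom C B D \<Longrightarrow> h \<in> hom C D E \<Longrightarrow>
      (h \<cdot> g) \<cdot> f = h \<cdot> (g \<cdot> f)"

definition is_functor :: "('o, 'm, 'z) cat_scheme \<Rightarrow> ('p, 'l, 'y) cat_scheme \<Rightarrow>
    ('o \<Rightarrow> 'p) \<Rightarrow> ('m \<Rightarrow> 'l) \<Rightarrow> bool" where
  "is_functor C D Fo Fm \<longleftrightarrow>
     (\<forall>A \<in> Obj C. Fo A \<in> Obj D) \<and>
     (\<forall>f \<in> Arr C. Fm f \<in> hom D (Fo (Dom C f)) (Fo (Cod C f))) \<and>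
     (\<forall>A \<in> Obj C. Fm (Ide C A) = Ide D (Fo A)) \<and>
     (\<forall>f \<in> Arr C. \<forall>g \<in> Arr C. Dom C g = Cod C f \<longrightarrow>
        Fm (g \<cdot>\<^bsub>C\<^esub> f) = Fm g \<cdot>\<^bsub>D\<^esub> Fm f)"

definition is_nat_trans :: "('o, 'm, 'z) cat_scheme \<Rightarrow> ('p, 'l, 'y) cat_scheme \<Rightarrow>
    ('o \<Rightarrow> 'p) \<Rightarrow> ('m \<Rightarrow> 'l) \<Rightarrow> ('o \<Rightarrow> 'p) \<Rightarrow> ('m \<Rightarrow> 'l) \<Rightarrow> ('o \<Rightarrow> 'l) \<Rightarrow> bool" where
  "is_nat_trans C D Fo Fm Go Gm t \<longleftrightarrow>
     (\<forall>A \<in> Obj C. t A \<in> hom D (Fo A) (Go A)) \<and>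
     (\<forall>f \<in> Arr C. t (Cod C f) \<cdot>\<^bsub>D\<^esub> Fm f = Gm f \<cdot>\<^bsub>D\<^esub> t (Dom C f))"

definition full_subcat :: "('o, 'm) cat \<Rightarrow> 'o set \<Rightarrow> ('o, 'm) cat" where
  "full_subcat C S = C\<lparr>Obj := Obj C \<inter> S, Arr := {f \<in> Arr C. Dom C f \<in> S \<and> Cod C f \<in> S}\<rparr>"

text \<open>Objects and arrows of \<open>C\<^sub>1 \<times> \<dots> \<times> C\<^sub>k\<close> are lists of length \<open>k\<close>. Positions
  are numbered from \<open>0\<close>.\<close>

definition prod_cat :: "('o, 'm, 'z) cat_scheme list \<Rightarrow> ('o list, 'm list) cat" where
  "prod_cat Cs = \<lparr>
     Obj = {As. list_all2 (\<lambda>C A. A \<in> Obj C) Cs As},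
     Arr = {fs. list_all2 (\<lambda>C f. f \<in> Arr C) Cs fs},
     Dom = map2 Dom Cs,
     Cod = map2 Cod Cs,
     Ide = map2 Ide Cs,
     Cmp = (\<lambda>gs fs. map2 (\<lambda>C (g, f). g \<cdot>\<^bsub>C\<^esub> f) Cs (zip gs fs))\<rparr>"

section \<open>Strict monoidal and permutative categories\<close>

locale strict_monoidal = category C for C :: "('o, 'm, 'z) cat_scheme" (structure) +
  fixes tn :: "'o \<Rightarrow> 'o \<Rightarrow> 'o" (infixl "\<otimes>" 75)
    and tm :: "'m \<Rightarrow> 'm \<Rightarrow> 'm" (infixl "\<odot>" 75)
    and u :: 'o
  assumes unit_Obj: "u \<in> Obj C"
    and tn_Obj: "A \<in> Obj C \<Longrightarrow> B \<in> Obj C \<Longrightarrow> A \<otimes> B \<in> Obj C"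
    and tm_hom: "f \<in> hom C A A' \<Longrightarrow> g \<in> hom C B B' \<Longrightarrow> f \<odot> g \<in> hom C (A \<otimes> B) (A' \<otimes> B')"
    and tm_Ide: "A \<in> Obj C \<Longrightarrow> B \<in> Obj C \<Longrightarrow> Ide C A \<odot> Ide C B = Ide C (A \<otimes> B)"
    and tm_Cmp: "f \<in> hom C A A' \<Longrightarrow> f' \<in> hom C A' A'' \<Longrightarrow> g \<in> hom C B B' \<Longrightarrow>
      g' \<in> hom C B' B'' \<Longrightarrow> (f' \<cdot> f) \<odot> (g' \<cdot> g) = (f' \<odot> g') \<cdot> (f \<odot> g)"
    and tn_assoc: "A \<in> Obj C \<Longrightarrow> B \<in> Obj C \<Longrightarrow> D \<in> Obj C \<Longrightarrow> (A \<otimes> B) \<otimes> D = A \<otimes> (B \<otimes> D)"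
    and tm_assoc: "f \<in> Arr C \<Longrightarrow> g \<in> Arr C \<Longrightarrow> h \<in> Arr C \<Longrightarrow> (f \<odot> g) \<odot> h = f \<odot> (g \<odot> h)"
    and tn_unit: "A \<in> Obj C \<Longrightarrow> u \<otimes> A = A" "A \<in> Obj C \<Longrightarrow> A \<otimes> u = A"
    and tm_unit: "f \<in> Arr C \<Longrightarrow> Ide C u \<odot> f = f" "f \<in> Arr C \<Longrightarrow> f \<odot> Ide C u = f"

text \<open>The sum of objects is written \<open>\<oplus>\<close>, the sum of morphisms \<open>\<boxplus>\<close>.\<close>

record ('o, 'm) permcat = "('o, 'm) cat" +
  plus_o :: "'o \<Rightarrow> 'o \<Rightarrow> 'o" (infixl "\<oplus>\<index>" 65)
  plus_m :: "'m \<Rightarrow> 'm \<Rightarrow> 'm" (infixl "\<boxplus>\<index>" 65)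
  zero :: 'o ("\<zero>\<index>")
  zeta :: "'o \<Rightarrow> 'o \<Rightarrow> 'm" ("\<zeta>\<index>")

locale permutative_category =
  strict_monoidal C "plus_o C" "plus_m C" "zero C"
  for C :: "('o, 'm) permcat" (structure) +
  assumes zeta_hom: "A \<in> Obj C \<Longrightarrow> B \<in> Obj C \<Longrightarrow> \<zeta> A B \<in> hom C (A \<oplus> B) (B \<oplus> A)"
    and zeta_nat: "f \<in> hom C A A' \<Longrightarrow> g \<in> hom C B B' \<Longrightarrow>
      \<zeta> A' B' \<cdot> (f \<boxplus> g) = (g \<boxplus> f) \<cdot> \<zeta> A B"
    and zeta_sym: "A \<in> Obj C \<Longrightarrow> B \<in> Obj C \<Longrightarrow> \<zeta> B A \<cdot> \<zeta> A B = Ide C (A \<oplus> B)"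
    and zeta_zero: "A \<in> Obj C \<Longrightarrow> \<zeta> A \<zero> = Ide C A"
    and zeta_hexagon: "A \<in> Obj C \<Longrightarrow> B \<in> Obj C \<Longrightarrow> D \<in> Obj C \<Longrightarrow>
      \<zeta> A (B \<oplus> D) = (Ide C B \<boxplus> \<zeta> A D) \<cdot> (\<zeta> A B \<boxplus> Ide C D)"

section \<open>\<open>n\<close>-fold monoidal categories\<close>

locale exchange = category C for C :: "('o, 'm, 'z) cat_scheme" (structure) +
  fixes tni (infixl "\<otimes>\<^sub>i" 75) and tmi (infixl "\<odot>\<^sub>i" 75)
    and tnj (infixl "\<otimes>\<^sub>j" 75) and tmj (infixl "\<odot>\<^sub>j" 75)
    and u :: 'o
    and ex :: "'o \<Rightarrow> 'o \<Rightarrow> 'o \<Rightarrow> 'o \<Rightarrow> 'm" ("\<eta>")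
  assumes ex_hom: "A \<in> Obj C \<Longrightarrow> B \<in> Obj C \<Longrightarrow> X \<in> Obj C \<Longrightarrow> Y \<in> Obj C \<Longrightarrow>
      \<eta> A B X Y \<in> hom C ((A \<otimes>\<^sub>j B) \<otimes>\<^sub>i (X \<otimes>\<^sub>j Y)) ((A \<otimes>\<^sub>i X) \<otimes>\<^sub>j (B \<otimes>\<^sub>i Y))"
    and ex_nat: "f \<in> hom C A A' \<Longrightarrow> g \<in> hom C B B' \<Longrightarrow> h \<in> hom C X X' \<Longrightarrow> k \<in> hom C Y Y' \<Longrightarrow>
      \<eta> A' B' X' Y' \<cdot> ((f \<odot>\<^sub>j g) \<odot>\<^sub>i (h \<odot>\<^sub>j k)) = ((f \<odot>\<^sub>i h) \<odot>\<^sub>j (g \<odot>\<^sub>i k)) \<cdot> \<eta> A B X Y"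
    and ex_unit:
      "A \<in> Obj C \<Longrightarrow> B \<in> Obj C \<Longrightarrow> \<eta> A B u u = Ide C (A \<otimes>\<^sub>j B)"
      "A \<in> Obj C \<Longrightarrow> B \<in> Obj C \<Longrightarrow> \<eta> u u A B = Ide C (A \<otimes>\<^sub>j B)"
      "A \<in> Obj C \<Longrightarrow> B \<in> Obj C \<Longrightarrow> \<eta> A u B u = Ide C (A \<otimes>\<^sub>i B)"
      "A \<in> Obj C \<Longrightarrow> B \<in> Obj C \<Longrightarrow> \<eta> u A u B = Ide C (A \<otimes>\<^sub>i B)"
    and ex_assoc_outer:
      "U \<in> Obj C \<Longrightarrow> V \<in> Obj C \<Longrightarrow> W \<in> Obj C \<Longrightarrow> X \<in> Obj C \<Longrightarrow> Y \<in> Obj C \<Longrightarrow> Z \<in> Obj C \<Longrightarrow>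
      \<eta> (U \<otimes>\<^sub>i W) (V \<otimes>\<^sub>i X) Y Z \<cdot> (\<eta> U V W X \<odot>\<^sub>i Ide C (Y \<otimes>\<^sub>j Z)) =
      \<eta> U V (W \<otimes>\<^sub>i Y) (X \<otimes>\<^sub>i Z) \<cdot> (Ide C (U \<otimes>\<^sub>j V) \<odot>\<^sub>i \<eta> W X Y Z)"
    and ex_assoc_inner:
      "U \<in> Obj C \<Longrightarrow> V \<in> Obj C \<Longrightarrow> W \<in> Obj C \<Longrightarrow> X \<in> Obj C \<Longrightarrow> Y \<in> Obj C \<Longrightarrow> Z \<in> Obj C \<Longrightarrow>
      (\<eta> U V X Y \<odot>\<^sub>j Ide C (W \<otimes>\<^sub>i Z)) \<cdot> \<eta> (U \<otimes>\<^sub>j V) W (X \<otimes>\<^sub>j Y) Z =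
      (Ide C (U \<otimes>\<^sub>i X) \<odot>\<^sub>j \<eta> V W Y Z) \<cdot> \<eta> U (V \<otimes>\<^sub>j W) X (Y \<otimes>\<^sub>j Z)"

locale exchange_hexagon =
  fixes C :: "('o, 'm, 'z) cat_scheme" (structure)
    and tni (infixl "\<otimes>\<^sub>i" 75) and tmi (infixl "\<odot>\<^sub>i" 75)
    and tnj (infixl "\<otimes>\<^sub>j" 75) and tmj (infixl "\<odot>\<^sub>j" 75)
    and tnk (infixl "\<otimes>\<^sub>k" 75) and tmk (infixl "\<odot>\<^sub>k" 75)
    and exij :: "'o \<Rightarrow> 'o \<Rightarrow> 'o \<Rightarrow> 'o \<Rightarrow> 'm" ("\<eta>\<^sub>i\<^sub>j")
    and exik :: "'o \<Rightarrow> 'o \<Rightarrow> 'o \<Rightarrow> 'o \<Rightarrow> 'm" ("\<eta>\<^sub>i\<^sub>k")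
    and exjk :: "'o \<Rightarrow> 'o \<Rightarrow> 'o \<Rightarrow> 'o \<Rightarrow> 'm" ("\<eta>\<^sub>j\<^sub>k")
  assumes hexagon:
    "A \<in> Obj C \<Longrightarrow> B \<in> Obj C \<Longrightarrow> X \<in> Obj C \<Longrightarrow> Y \<in> Obj C \<Longrightarrow>
     A' \<in> Obj C \<Longrightarrow> B' \<in> Obj C \<Longrightarrow> X' \<in> Obj C \<Longrightarrow> Y' \<in> Obj C \<Longrightarrow>
      (\<eta>\<^sub>i\<^sub>j A B X Y \<odot>\<^sub>k \<eta>\<^sub>i\<^sub>j A' B' X' Y') \<cdot>
      \<eta>\<^sub>i\<^sub>k (A \<otimes>\<^sub>j B) (A' \<otimes>\<^sub>j B') (X \<otimes>\<^sub>j Y) (X' \<otimes>\<^sub>j Y') \<cdot>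
      (\<eta>\<^sub>j\<^sub>k A A' B B' \<odot>\<^sub>i \<eta>\<^sub>j\<^sub>k X X' Y Y') =
      \<eta>\<^sub>j\<^sub>k (A \<otimes>\<^sub>i X) (A' \<otimes>\<^sub>i X') (B \<otimes>\<^sub>i Y) (B' \<otimes>\<^sub>i Y') \<cdot>
      (\<eta>\<^sub>i\<^sub>k A A' X X' \<odot>\<^sub>j \<eta>\<^sub>i\<^sub>k B B' Y Y') \<cdot>
      \<eta>\<^sub>i\<^sub>j (A \<otimes>\<^sub>k A') (B \<otimes>\<^sub>k B') (X \<otimes>\<^sub>k X') (Y \<otimes>\<^sub>k Y')"

definition nfold_monoidal :: "('o, 'm, 'z) cat_scheme \<Rightarrow> nat \<Rightarrow>
    (nat \<Rightarrow> 'o \<Rightarrow> 'o \<Rightarrow> 'o) \<Rightarrow> (nat \<Rightarrow> 'm \<Rightarrow> 'm \<Rightarrow> 'm) \<Rightarrow> 'o \<Rightarrow>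
    (nat \<Rightarrow> nat \<Rightarrow> 'o \<Rightarrow> 'o \<Rightarrow> 'o \<Rightarrow> 'o \<Rightarrow> 'm) \<Rightarrow> bool" where
  "nfold_monoidal C n tn tm u ex \<longleftrightarrow>
     (\<forall>i. 1 \<le> i \<and> i \<le> n \<longrightarrow> strict_monoidal C (tn i) (tm i) u) \<and>
     (\<forall>i j. 1 \<le> i \<and> i < j \<and> j \<le> n \<longrightarrow>
        exchange C (tn i) (tm i) (tn j) (tm j) u (ex i j)) \<and>
     (\<forall>i j k. 1 \<le> i \<and> i < j \<and> j < k \<and> k \<le> n \<longrightarrow>
        exchange_hexagon C (tn i) (tm i) (tn j) (tm j) (tn k) (tm k) (ex i j) (ex i k) (ex j k))"

section \<open>Ring categories and \<open>E\<^sub>n\<close>-monoidal structures\<close>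

locale ring_category = permutative_category C for C :: "('o, 'm) permcat" (structure) +
  fixes tn (infixl "\<otimes>" 75) and tm (infixl "\<odot>" 75) and u :: 'o
    and dl :: "'o \<Rightarrow> 'o \<Rightarrow> 'o \<Rightarrow> 'm" ("\<partial>\<^sup>l")
    and dr :: "'o \<Rightarrow> 'o \<Rightarrow> 'o \<Rightarrow> 'm" ("\<partial>\<^sup>r")
  assumes tensor: "strict_monoidal C (\<otimes>) (\<odot>) u"
    and dl_hom: "A \<in> Obj C \<Longrightarrow> B \<in> Obj C \<Longrightarrow> D \<in> Obj C \<Longrightarrow>
      \<partial>\<^sup>l A B D \<in> hom C (A \<otimes> D \<oplus> B \<otimes> D) ((A \<oplus> B) \<otimes> D)"
    and dl_nat: "f \<in> hom C A A' \<Longrightarrow> g \<in> hom C B B' \<Longrightarrow> h \<in> hom C D D' \<Longrightarrow>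
      \<partial>\<^sup>l A' B' D' \<cdot> (f \<odot> h \<boxplus> g \<odot> h) = ((f \<boxplus> g) \<odot> h) \<cdot> \<partial>\<^sup>l A B D"
    and dr_hom: "A \<in> Obj C \<Longrightarrow> B \<in> Obj C \<Longrightarrow> D \<in> Obj C \<Longrightarrow>
      \<partial>\<^sup>r A B D \<in> hom C (A \<otimes> B \<oplus> A \<otimes> D) (A \<otimes> (B \<oplus> D))"
    and dr_nat: "f \<in> hom C A A' \<Longrightarrow> g \<in> hom C B B' \<Longrightarrow> h \<in> hom C D D' \<Longrightarrow>
      \<partial>\<^sup>r A' B' D' \<cdot> (f \<odot> g \<boxplus> f \<odot> h) = (f \<odot> (g \<boxplus> h)) \<cdot> \<partial>\<^sup>r A B D"
    and zero_tn: "A \<in> Obj C \<Longrightarrow> \<zero> \<otimes> A = \<zero>" "A \<in> Obj C \<Longrightarrow> A \<otimes> \<zero> = \<zero>"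
    and zero_tm: "f \<in> Arr C \<Longrightarrow> Ide C \<zero> \<odot> f = Ide C \<zero>"
      "f \<in> Arr C \<Longrightarrow> f \<odot> Ide C \<zero> = Ide C \<zero>"
    and dl_zero: "A \<in> Obj C \<Longrightarrow> B \<in> Obj C \<Longrightarrow> D \<in> Obj C \<Longrightarrow> \<zero> \<in> {A, B, D} \<Longrightarrow>
      \<partial>\<^sup>l A B D = Ide C ((A \<oplus> B) \<otimes> D)"
    and dr_zero: "A \<in> Obj C \<Longrightarrow> B \<in> Obj C \<Longrightarrow> D \<in> Obj C \<Longrightarrow> \<zero> \<in> {A, B, D} \<Longrightarrow>
      \<partial>\<^sup>r A B D = Ide C (A \<otimes> (B \<oplus> D))"
    and dl_unit: "A \<in> Obj C \<Longrightarrow> B \<in> Obj C \<Longrightarrow> \<partial>\<^sup>l A B u = Ide C (A \<oplus> B)"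
    and dr_unit: "A \<in> Obj C \<Longrightarrow> B \<in> Obj C \<Longrightarrow> \<partial>\<^sup>r u A B = Ide C (A \<oplus> B)"
    and dl_zeta: "A \<in> Obj C \<Longrightarrow> B \<in> Obj C \<Longrightarrow> D \<in> Obj C \<Longrightarrow>
      \<partial>\<^sup>l B A D \<cdot> \<zeta> (A \<otimes> D) (B \<otimes> D) = (\<zeta> A B \<odot> Ide C D) \<cdot> \<partial>\<^sup>l A B D"
    and dr_zeta: "A \<in> Obj C \<Longrightarrow> B \<in> Obj C \<Longrightarrow> D \<in> Obj C \<Longrightarrow>
      \<partial>\<^sup>r A D B \<cdot> \<zeta> (A \<otimes> B) (A \<otimes> D) = (Ide C A \<odot> \<zeta> B D) \<cdot> \<partial>\<^sup>r A B D"
    and dl_assoc: "A \<in> Obj C \<Longrightarrow> A' \<in> Obj C \<Longrightarrow> A'' \<in> Obj C \<Longrightarrow> B \<in> Obj C \<Longrightarrow>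
      \<partial>\<^sup>l (A \<oplus> A') A'' B \<cdot> (\<partial>\<^sup>l A A' B \<boxplus> Ide C (A'' \<otimes> B)) =
      \<partial>\<^sup>l A (A' \<oplus> A'') B \<cdot> (Ide C (A \<otimes> B) \<boxplus> \<partial>\<^sup>l A' A'' B)"
    and dr_assoc: "A \<in> Obj C \<Longrightarrow> B \<in> Obj C \<Longrightarrow> B' \<in> Obj C \<Longrightarrow> B'' \<in> Obj C \<Longrightarrow>
      \<partial>\<^sup>r A (B \<oplus> B') B'' \<cdot> (\<partial>\<^sup>r A B B' \<boxplus> Ide C (A \<otimes> B'')) =
      \<partial>\<^sup>r A B (B' \<oplus> B'') \<cdot> (Ide C (A \<otimes> B) \<boxplus> \<partial>\<^sup>r A B' B'')"
    and dl_dl: "A \<in> Obj C \<Longrightarrow> B \<in> Obj C \<Longrightarrow> X \<in> Obj C \<Longrightarrow> Y \<in> Obj C \<Longrightarrow>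
      \<partial>\<^sup>l A B (X \<otimes> Y) = (\<partial>\<^sup>l A B X \<odot> Ide C Y) \<cdot> \<partial>\<^sup>l (A \<otimes> X) (B \<otimes> X) Y"
    and dr_dr: "A \<in> Obj C \<Longrightarrow> B \<in> Obj C \<Longrightarrow> X \<in> Obj C \<Longrightarrow> Y \<in> Obj C \<Longrightarrow>
      \<partial>\<^sup>r (A \<otimes> B) X Y = (Ide C A \<odot> \<partial>\<^sup>r B X Y) \<cdot> \<partial>\<^sup>r A (B \<otimes> X) (B \<otimes> Y)"
    and dr_dl: "A \<in> Obj C \<Longrightarrow> B \<in> Obj C \<Longrightarrow> X \<in> Obj C \<Longrightarrow> Y \<in> Obj C \<Longrightarrow>
      (\<partial>\<^sup>r A B X \<odot> Ide C Y) \<cdot> \<partial>\<^sup>l (A \<otimes> B) (A \<otimes> X) Y =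
      (Ide C A \<odot> \<partial>\<^sup>l B X Y) \<cdot> \<partial>\<^sup>r A (B \<otimes> Y) (X \<otimes> Y)"
    and dl_dr: "A \<in> Obj C \<Longrightarrow> B \<in> Obj C \<Longrightarrow> X \<in> Obj C \<Longrightarrow> Y \<in> Obj C \<Longrightarrow>
      \<partial>\<^sup>r (A \<oplus> B) X Y \<cdot> (\<partial>\<^sup>l A B X \<boxplus> \<partial>\<^sup>l A B Y) \<cdot>
        (Ide C (A \<otimes> X) \<boxplus> \<zeta> (A \<otimes> Y) (B \<otimes> X) \<boxplus> Ide C (B \<otimes> Y)) =
      \<partial>\<^sup>l A B (X \<oplus> Y) \<cdot> (\<partial>\<^sup>r A X Y \<boxplus> \<partial>\<^sup>r B X Y)"

locale exchange_sum =
  fixes C :: "('o, 'm) permcat" (structure)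
    and tni (infixl "\<otimes>\<^sub>i" 75) and tmi (infixl "\<odot>\<^sub>i" 75)
    and tnj (infixl "\<otimes>\<^sub>j" 75) and tmj (infixl "\<odot>\<^sub>j" 75)
    and ex :: "'o \<Rightarrow> 'o \<Rightarrow> 'o \<Rightarrow> 'o \<Rightarrow> 'm" ("\<eta>")
    and dli :: "'o \<Rightarrow> 'o \<Rightarrow> 'o \<Rightarrow> 'm" ("\<partial>\<^sup>l\<^sub>i") and dri :: "'o \<Rightarrow> 'o \<Rightarrow> 'o \<Rightarrow> 'm" ("\<partial>\<^sup>r\<^sub>i")
    and dlj :: "'o \<Rightarrow> 'o \<Rightarrow> 'o \<Rightarrow> 'm" ("\<partial>\<^sup>l\<^sub>j") and drj :: "'o \<Rightarrow> 'o \<Rightarrow> 'o \<Rightarrow> 'm" ("\<partial>\<^sup>r\<^sub>j")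
  assumes ex_zero: "A \<in> Obj C \<Longrightarrow> B \<in> Obj C \<Longrightarrow> X \<in> Obj C \<Longrightarrow> Y \<in> Obj C \<Longrightarrow>
      \<zero> \<in> {A, B, X, Y} \<Longrightarrow> \<eta> A B X Y = Ide C \<zero>"
    and ex_sum1: "A \<in> Obj C \<Longrightarrow> A' \<in> Obj C \<Longrightarrow> B \<in> Obj C \<Longrightarrow> X \<in> Obj C \<Longrightarrow> Y \<in> Obj C \<Longrightarrow>
      \<eta> (A \<oplus> A') B X Y \<cdot> (\<partial>\<^sup>l\<^sub>j A A' B \<odot>\<^sub>i Ide C (X \<otimes>\<^sub>j Y)) \<cdot> \<partial>\<^sup>l\<^sub>i (A \<otimes>\<^sub>j B) (A' \<otimes>\<^sub>j B) (X \<otimes>\<^sub>j Y) =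
      (\<partial>\<^sup>l\<^sub>i A A' X \<odot>\<^sub>j Ide C (B \<otimes>\<^sub>i Y)) \<cdot> \<partial>\<^sup>l\<^sub>j (A \<otimes>\<^sub>i X) (A' \<otimes>\<^sub>i X) (B \<otimes>\<^sub>i Y) \<cdot>
        (\<eta> A B X Y \<boxplus> \<eta> A' B X Y)"
    and ex_sum2: "A \<in> Obj C \<Longrightarrow> B \<in> Obj C \<Longrightarrow> B' \<in> Obj C \<Longrightarrow> X \<in> Obj C \<Longrightarrow> Y \<in> Obj C \<Longrightarrow>
      \<eta> A (B \<oplus> B') X Y \<cdot> (\<partial>\<^sup>r\<^sub>j A B B' \<odot>\<^sub>i Ide C (X \<otimes>\<^sub>j Y)) \<cdot> \<partial>\<^sup>l\<^sub>i (A \<otimes>\<^sub>j B) (A \<otimes>\<^sub>j B') (X \<otimes>\<^sub>j Y) =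
      (Ide C (A \<otimes>\<^sub>i X) \<odot>\<^sub>j \<partial>\<^sup>l\<^sub>i B B' Y) \<cdot> \<partial>\<^sup>r\<^sub>j (A \<otimes>\<^sub>i X) (B \<otimes>\<^sub>i Y) (B' \<otimes>\<^sub>i Y) \<cdot>
        (\<eta> A B X Y \<boxplus> \<eta> A B' X Y)"
    and ex_sum3: "A \<in> Obj C \<Longrightarrow> B \<in> Obj C \<Longrightarrow> X \<in> Obj C \<Longrightarrow> X' \<in> Obj C \<Longrightarrow> Y \<in> Obj C \<Longrightarrow>
      \<eta> A B (X \<oplus> X') Y \<cdot> (Ide C (A \<otimes>\<^sub>j B) \<odot>\<^sub>i \<partial>\<^sup>l\<^sub>j X X' Y) \<cdot> \<partial>\<^sup>r\<^sub>i (A \<otimes>\<^sub>j B) (X \<otimes>\<^sub>j Y) (X' \<otimes>\<^sub>j Y) =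
      (\<partial>\<^sup>r\<^sub>i A X X' \<odot>\<^sub>j Ide C (B \<otimes>\<^sub>i Y)) \<cdot> \<partial>\<^sup>l\<^sub>j (A \<otimes>\<^sub>i X) (A \<otimes>\<^sub>i X') (B \<otimes>\<^sub>i Y) \<cdot>
        (\<eta> A B X Y \<boxplus> \<eta> A B X' Y)"
    and ex_sum4: "A \<in> Obj C \<Longrightarrow> B \<in> Obj C \<Longrightarrow> X \<in> Obj C \<Longrightarrow> Y \<in> Obj C \<Longrightarrow> Y' \<in> Obj C \<Longrightarrow>
      \<eta> A B X (Y \<oplus> Y') \<cdot> (Ide C (A \<otimes>\<^sub>j B) \<odot>\<^sub>i \<partial>\<^sup>r\<^sub>j X Y Y') \<cdot> \<partial>\<^sup>r\<^sub>i (A \<otimes>\<^sub>j B) (X \<otimes>\<^sub>j Y) (X \<otimes>\<^sub>j Y') =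
      (Ide C (A \<otimes>\<^sub>i X) \<odot>\<^sub>j \<partial>\<^sup>r\<^sub>i B Y Y') \<cdot> \<partial>\<^sup>r\<^sub>j (A \<otimes>\<^sub>i X) (B \<otimes>\<^sub>i Y) (B \<otimes>\<^sub>i Y') \<cdot>
        (\<eta> A B X Y \<boxplus> \<eta> A B X Y')"

record ('o, 'm) en_data =
  ten_o :: "nat \<Rightarrow> 'o \<Rightarrow> 'o \<Rightarrow> 'o"
  ten_m :: "nat \<Rightarrow> 'm \<Rightarrow> 'm \<Rightarrow> 'm"
  ten_unit :: 'o
  distl :: "nat \<Rightarrow> 'o \<Rightarrow> 'o \<Rightarrow> 'o \<Rightarrow> 'm"
  distr :: "nat \<Rightarrow> 'o \<Rightarrow> 'o \<Rightarrow> 'o \<Rightarrow> 'm"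
  exch :: "nat \<Rightarrow> nat \<Rightarrow> 'o \<Rightarrow> 'o \<Rightarrow> 'o \<Rightarrow> 'o \<Rightarrow> 'm"

definition En_monoidal :: "nat \<Rightarrow> ('o, 'm) permcat \<Rightarrow> ('o, 'm) en_data \<Rightarrow> bool" where
  "En_monoidal n C S \<longleftrightarrow>
     nfold_monoidal C n (ten_o S) (ten_m S) (ten_unit S) (exch S) \<and>
     (\<forall>i. 1 \<le> i \<and> i \<le> n \<longrightarrow>
        ring_category C (ten_o S i) (ten_m S i) (ten_unit S) (distl S i) (distr S i)) \<and>
     (\<forall>i j. 1 \<le> i \<and> i < j \<and> j \<le> n \<longrightarrow>
        exchange_sum C (ten_o S i) (ten_m S i) (ten_o S j) (ten_m S j) (exch S i j)
          (distl S i) (distr S i) (distl S j) (distr S j))"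

text \<open>HOL functions are total. Structures that agree wherever they are meaningful are identified
  by requiring the value \<open>undefined\<close> everywhere else.\<close>

definition En_extensional :: "nat \<Rightarrow> ('o, 'm) permcat \<Rightarrow> ('o, 'm) en_data \<Rightarrow> bool" where
  "En_extensional n C S \<longleftrightarrow>
     (\<forall>i A B. \<not> (1 \<le> i \<and> i \<le> n \<and> A \<in> Obj C \<and> B \<in> Obj C) \<longrightarrow> ten_o S i A B = undefined) \<and>
     (\<forall>i f g. \<not> (1 \<le> i \<and> i \<le> n \<and> f \<in> Arr C \<and> g \<in> Arr C) \<longrightarrow> ten_m S i f g = undefined) \<and>
     (\<forall>i A B D. \<not> (1 \<le> i \<and> i \<le> n \<and> A \<in> Obj C \<and> B \<in> Obj C \<and> D \<in> Obj C) \<longrightarrow>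
        distl S i A B D = undefined \<and> distr S i A B D = undefined) \<and>
     (\<forall>i j A B X Y. \<not> (1 \<le> i \<and> i < j \<and> j \<le> n \<and>
          A \<in> Obj C \<and> B \<in> Obj C \<and> X \<in> Obj C \<and> Y \<in> Obj C) \<longrightarrow>
        exch S i j A B X Y = undefined)"

definition En_structures :: "nat \<Rightarrow> ('o, 'm) permcat \<Rightarrow> ('o, 'm) en_data set" where
  "En_structures n C = {S. En_monoidal n C S \<and> En_extensional n C S}"

section \<open>\<open>Cat\<close>-enriched multicategories and multifunctors\<close>

text \<open>The data of a \<open>Cat\<close>-enriched multicategory. \<open>Ops M cs d\<close> is the category of operations
  \<open>cs \<rightarrow> d\<close>; its objects are the \<open>1\<close>-cells and its arrows the \<open>2\<close>-cells of \<open>M\<close>. The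
  composition of operations \<open>bss ! j \<rightarrow> cs ! j\<close> with an operation \<open>cs \<rightarrow> d\<close> is given by
  \<open>comp1 M bss cs d\<close> and \<open>comp2 M bss cs d\<close>; the right action of a permutation \<open>p\<close> of
  \<open>{..<length cs}\<close>, from \<open>Ops M cs d\<close> to \<open>Ops M (permute_list p cs) d\<close>, is given by
  \<open>act1 M cs d p\<close> and \<open>act2 M cs d p\<close>.\<close>

record ('c, 'f, 't) mcat =
  MObj :: "'c set"
  Ops :: "'c list \<Rightarrow> 'c \<Rightarrow> ('f, 't) cat"
  ident :: "'c \<Rightarrow> 'f"
  comp1 :: "'c list list \<Rightarrow> 'c list \<Rightarrow> 'c \<Rightarrow> 'f \<Rightarrow> 'f list \<Rightarrow> 'f"
  comp2 :: "'c list list \<Rightarrow> 'c list \<Rightarrow> 'c \<Rightarrow> 't \<Rightarrow> 't list \<Rightarrow> 't"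
  act1 :: "'c list \<Rightarrow> 'c \<Rightarrow> (nat \<Rightarrow> nat) \<Rightarrow> 'f \<Rightarrow> 'f"
  act2 :: "'c list \<Rightarrow> 'c \<Rightarrow> (nat \<Rightarrow> nat) \<Rightarrow> 't \<Rightarrow> 't"

record ('c, 'f, 't, 'd, 'g, 's) mfunctor =
  on_obj :: "'c \<Rightarrow> 'd"
  on1 :: "'c list \<Rightarrow> 'c \<Rightarrow> 'f \<Rightarrow> 'g"
  on2 :: "'c list \<Rightarrow> 'c \<Rightarrow> 't \<Rightarrow> 's"

definition profile :: "('c, 'f, 't) mcat \<Rightarrow> 'c list \<Rightarrow> 'c \<Rightarrow> bool" where
  "profile M cs d \<longleftrightarrow> set cs \<subseteq> MObj M \<and> d \<in> MObj M"

definition profiles :: "('c, 'f, 't) mcat \<Rightarrow> 'c list list \<Rightarrow> 'c list \<Rightarrow> 'c \<Rightarrow> bool" where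
  "profiles M bss cs d \<longleftrightarrow> profile M cs d \<and> list_all2 (profile M) bss cs"

locale cat_multifunctor =
  fixes M :: "('c, 'f, 't) mcat" and N :: "('d, 'g, 's) mcat"
    and \<Phi> :: "('c, 'f, 't, 'd, 'g, 's) mfunctor"
  assumes obj: "on_obj \<Phi> \<in> MObj M \<rightarrow>\<^sub>E MObj N"
    and is_functor: "profile M cs d \<Longrightarrow>
      is_functor (Ops M cs d) (Ops N (map (on_obj \<Phi>) cs) (on_obj \<Phi> d)) (on1 \<Phi> cs d) (on2 \<Phi> cs d)"
    and extensional: "profile M cs d \<Longrightarrow> on1 \<Phi> cs d \<in> extensional (Obj (Ops M cs d))"
      "profile M cs d \<Longrightarrow> on2 \<Phi> cs d \<in> extensional (Arr (Ops M cs d))"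
      "\<not> profile M cs d \<Longrightarrow> on1 \<Phi> cs d = (\<lambda>_. undefined)"
      "\<not> profile M cs d \<Longrightarrow> on2 \<Phi> cs d = (\<lambda>_. undefined)"
    and ident: "c \<in> MObj M \<Longrightarrow> on1 \<Phi> [c] c (ident M c) = ident N (on_obj \<Phi> c)"
    and comp1: "profiles M bss cs d \<Longrightarrow> x \<in> Obj (Ops M cs d) \<Longrightarrow>
      ys \<in> Obj (prod_cat (map2 (Ops M) bss cs)) \<Longrightarrow>
      on1 \<Phi> (concat bss) d (comp1 M bss cs d x ys) =
      comp1 N (map (map (on_obj \<Phi>)) bss) (map (on_obj \<Phi>) cs) (on_obj \<Phi> d)
        (on1 \<Phi> cs d x) (map2 (\<lambda>(bs, c). on1 \<Phi> bs c) (zip bss cs) ys)"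
    and comp2: "profiles M bss cs d \<Longrightarrow> f \<in> Arr (Ops M cs d) \<Longrightarrow>
      gs \<in> Arr (prod_cat (map2 (Ops M) bss cs)) \<Longrightarrow>
      on2 \<Phi> (concat bss) d (comp2 M bss cs d f gs) =
      comp2 N (map (map (on_obj \<Phi>)) bss) (map (on_obj \<Phi>) cs) (on_obj \<Phi> d)
        (on2 \<Phi> cs d f) (map2 (\<lambda>(bs, c). on2 \<Phi> bs c) (zip bss cs) gs)"
    and act1: "profile M cs d \<Longrightarrow> p permutes {..<length cs} \<Longrightarrow> x \<in> Obj (Ops M cs d) \<Longrightarrow>
      on1 \<Phi> (permute_list p cs) d (act1 M cs d p x) =
      act1 N (map (on_obj \<Phi>) cs) (on_obj \<Phi> d) p (on1 \<Phi> cs d x)"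
    and act2: "profile M cs d \<Longrightarrow> p permutes {..<length cs} \<Longrightarrow> f \<in> Arr (Ops M cs d) \<Longrightarrow>
      on2 \<Phi> (permute_list p cs) d (act2 M cs d p f) =
      act2 N (map (on_obj \<Phi>) cs) (on_obj \<Phi> d) p (on2 \<Phi> cs d f)"

section \<open>The multicategory of permutative categories\<close>

text \<open>\<open>lin F i As A'\<close> is the linearity constraint \<open>F\<^sup>2\<^sub>i\<close> at the objects \<open>As\<close> and the second
  \<open>i\<close>-th object \<open>A'\<close>.\<close>

record ('o, 'm) mlfun =
  fun_o :: "'o list \<Rightarrow> 'o"
  fun_m :: "'m list \<Rightarrow> 'm"
  lin :: "nat \<Rightarrow> 'o list \<Rightarrow> 'o \<Rightarrow> 'm"

text \<open>For \<open>Cs = []\<close> this is a functor from the terminal category to \<open>D\<close>, that is, an object of \<open>D\<close>;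
  the multilinear transformations below are then the arrows of \<open>D\<close>.\<close>

locale multilinear =
  fixes Cs :: "('o, 'm) permcat list" and D :: "('o, 'm) permcat" (structure)
    and F :: "('o, 'm) mlfun"
  assumes is_functor: "is_functor (prod_cat Cs) D (fun_o F) (fun_m F)"
    and lin_hom: "i < length Cs \<Longrightarrow> As \<in> Obj (prod_cat Cs) \<Longrightarrow> A' \<in> Obj (Cs ! i) \<Longrightarrow>
      lin F i As A' \<in> hom D (fun_o F As \<oplus> fun_o F (As[i := A']))
        (fun_o F (As[i := As ! i \<oplus>\<^bsub>Cs ! i\<^esub> A']))"
    and lin_nat: "i < length Cs \<Longrightarrow> fs \<in> hom (prod_cat Cs) As Bs \<Longrightarrow> f' \<in> hom (Cs ! i) A' B' \<Longrightarrow>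
      lin F i Bs B' \<cdot> (fun_m F fs \<boxplus> fun_m F (fs[i := f'])) =
      fun_m F (fs[i := fs ! i \<boxplus>\<^bsub>Cs ! i\<^esub> f']) \<cdot> lin F i As A'"
    and zero_o: "i < length Cs \<Longrightarrow> As \<in> Obj (prod_cat Cs) \<Longrightarrow> As ! i = \<zero>\<^bsub>Cs ! i\<^esub> \<Longrightarrow>
      fun_o F As = \<zero>"
    and zero_m: "i < length Cs \<Longrightarrow> fs \<in> Arr (prod_cat Cs) \<Longrightarrow> fs ! i = Ide (Cs ! i) \<zero>\<^bsub>Cs ! i\<^esub> \<Longrightarrow>
      fun_m F fs = Ide D \<zero>"
    and lin_zero: "i < length Cs \<Longrightarrow> As \<in> Obj (prod_cat Cs) \<Longrightarrow> A' \<in> Obj (Cs ! i) \<Longrightarrow>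
      (\<exists>j < length Cs. As ! j = \<zero>\<^bsub>Cs ! j\<^esub>) \<or> A' = \<zero>\<^bsub>Cs ! i\<^esub> \<Longrightarrow>
      lin F i As A' = Ide D (fun_o F (As[i := As ! i \<oplus>\<^bsub>Cs ! i\<^esub> A']))"
    and lin_assoc: "i < length Cs \<Longrightarrow> As \<in> Obj (prod_cat Cs) \<Longrightarrow> A' \<in> Obj (Cs ! i) \<Longrightarrow>
      A'' \<in> Obj (Cs ! i) \<Longrightarrow>
      lin F i (As[i := As ! i \<oplus>\<^bsub>Cs ! i\<^esub> A']) A'' \<cdot>
        (lin F i As A' \<boxplus> Ide D (fun_o F (As[i := A'']))) =
      lin F i As (A' \<oplus>\<^bsub>Cs ! i\<^esub> A'') \<cdot> (Ide D (fun_o F As) \<boxplus> lin F i (As[i := A']) A'')"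
    and lin_zeta: "i < length Cs \<Longrightarrow> As \<in> Obj (prod_cat Cs) \<Longrightarrow> A' \<in> Obj (Cs ! i) \<Longrightarrow>
      fun_m F ((Ide (prod_cat Cs) As)[i := \<zeta>\<^bsub>Cs ! i\<^esub> (As ! i) A']) \<cdot> lin F i As A' =
      lin F i (As[i := A']) (As ! i) \<cdot> \<zeta> (fun_o F As) (fun_o F (As[i := A']))"
    and lin_lin: "i < length Cs \<Longrightarrow> p < length Cs \<Longrightarrow> i \<noteq> p \<Longrightarrow> As \<in> Obj (prod_cat Cs) \<Longrightarrow>
      A' \<in> Obj (Cs ! i) \<Longrightarrow> B' \<in> Obj (Cs ! p) \<Longrightarrow>
      lin F p (As[i := As ! i \<oplus>\<^bsub>Cs ! i\<^esub> A']) B' \<cdot>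
        (lin F i As A' \<boxplus> lin F i (As[p := B']) A') =
      lin F i (As[p := As ! p \<oplus>\<^bsub>Cs ! p\<^esub> B']) A' \<cdot>
        (lin F p As B' \<boxplus> lin F p (As[i := A']) B') \<cdot>
        (Ide D (fun_o F As) \<boxplus> \<zeta> (fun_o F (As[i := A'])) (fun_o F (As[p := B'])) \<boxplus>
          Ide D (fun_o F (As[i := A', p := B'])))"
    and extensional: "fun_o F \<in> extensional (Obj (prod_cat Cs))"
      "fun_m F \<in> extensional (Arr (prod_cat Cs))"
      "\<not> (i < length Cs \<and> As \<in> Obj (prod_cat Cs) \<and> A' \<in> Obj (Cs ! i)) \<Longrightarrow>
        lin F i As A' = undefined"

record ('o, 'm) mltrans =
  src :: "('o, 'm) mlfun"
  tgt :: "('o, 'm) mlfun"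
  component :: "'o list \<Rightarrow> 'm"

locale multilinear_trans =
  fixes Cs :: "('o, 'm) permcat list" and D :: "('o, 'm) permcat" (structure)
    and t :: "('o, 'm) mltrans"
  assumes src: "multilinear Cs D (src t)"
    and tgt: "multilinear Cs D (tgt t)"
    and nat_trans: "is_nat_trans (prod_cat Cs) D (fun_o (src t)) (fun_m (src t))
      (fun_o (tgt t)) (fun_m (tgt t)) (component t)"
    and lin: "i < length Cs \<Longrightarrow> As \<in> Obj (prod_cat Cs) \<Longrightarrow> A' \<in> Obj (Cs ! i) \<Longrightarrow>
      component t (As[i := As ! i \<oplus>\<^bsub>Cs ! i\<^esub> A']) \<cdot> lin (src t) i As A' =
      lin (tgt t) i As A' \<cdot> (component t As \<boxplus> component t (As[i := A']))"
    and zero: "i < length Cs \<Longrightarrow> As \<in> Obj (prod_cat Cs) \<Longrightarrow> As ! i = \<zero>\<^bsub>Cs ! i\<^esub> \<Longrightarrow>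
      component t As = Ide D \<zero>"
    and extensional: "component t \<in> extensional (Obj (prod_cat Cs))"

definition multilinear_cat :: "('o, 'm) permcat list \<Rightarrow> ('o, 'm) permcat \<Rightarrow>
    (('o, 'm) mlfun, ('o, 'm) mltrans) cat" where
  "multilinear_cat Cs D = \<lparr>
     Obj = {F. multilinear Cs D F},
     Arr = {t. multilinear_trans Cs D t},
     Dom = src,
     Cod = tgt,
     Ide = (\<lambda>F. \<lparr>src = F, tgt = F, component = (\<lambda>As \<in> Obj (prod_cat Cs). Ide D (fun_o F As))\<rparr>),
     Cmp = (\<lambda>s t. \<lparr>src = src t, tgt = tgt s,
       component = (\<lambda>As \<in> Obj (prod_cat Cs). component s As \<cdot>\<^bsub>D\<^esub> component t As)\<rparr>)\<rparr>"

definition id_linear :: "('o, 'm) permcat \<Rightarrow> ('o, 'm) mlfun" where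
  "id_linear C = \<lparr>
     fun_o = (\<lambda>As \<in> Obj (prod_cat [C]). As ! 0),
     fun_m = (\<lambda>fs \<in> Arr (prod_cat [C]). fs ! 0),
     lin = (\<lambda>i As A'. if i = 0 \<and> As \<in> Obj (prod_cat [C]) \<and> A' \<in> Obj C
       then Ide C (As ! 0 \<oplus>\<^bsub>C\<^esub> A') else undefined)\<rparr>"

text \<open>\<open>blocks ns xs\<close> cuts \<open>xs\<close> into consecutive blocks of lengths \<open>ns\<close>; \<open>locate ns p\<close> consists of the
  number of the block that contains position \<open>p\<close> and of the position within that block.\<close>

fun blocks :: "nat list \<Rightarrow> 'a list \<Rightarrow> 'a list list" where
  "blocks [] xs = []"
| "blocks (n # ns) xs = take n xs # blocks ns (drop n xs)"

fun locate :: "nat list \<Rightarrow> nat \<Rightarrow> nat \<times> nat" where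
  "locate [] p = (0, p)"
| "locate (n # ns) p = (if p < n then (0, p) else apfst Suc (locate ns (p - n)))"

definition comp_linear :: "('o, 'm) permcat list list \<Rightarrow> ('o, 'm) permcat list \<Rightarrow> ('o, 'm) permcat \<Rightarrow>
    ('o, 'm) mlfun \<Rightarrow> ('o, 'm) mlfun list \<Rightarrow> ('o, 'm) mlfun" where
  "comp_linear Bss Cs D F Gs =
    (let split = blocks (map length Bss); split_m = blocks (map length Bss); P = prod_cat (concat Bss) in \<lparr>
      fun_o = (\<lambda>Xs \<in> Obj P. fun_o F (map2 fun_o Gs (split Xs))),
      fun_m = (\<lambda>fs \<in> Arr P. fun_m F (map2 fun_m Gs (split_m fs))),
      lin = (\<lambda>p Xs X'.
        if p < length (concat Bss) \<and> Xs \<in> Obj P \<and> X' \<in> Obj (concat Bss ! p)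
        then let (j, q) = locate (map length Bss) p;
                 Ys = map2 fun_o Gs (split Xs);
                 Y' = fun_o (Gs ! j) ((split Xs ! j)[q := X'])
             in fun_m F ((Ide (prod_cat Cs) Ys)[j := lin (Gs ! j) q (split Xs ! j) X']) \<cdot>\<^bsub>D\<^esub>
                lin F j Ys Y'
        else undefined)\<rparr>)"

definition comp_trans :: "('o, 'm) permcat list list \<Rightarrow> ('o, 'm) permcat list \<Rightarrow> ('o, 'm) permcat \<Rightarrow>
    ('o, 'm) mltrans \<Rightarrow> ('o, 'm) mltrans list \<Rightarrow> ('o, 'm) mltrans" where
  "comp_trans Bss Cs D t us = \<lparr>
     src = comp_linear Bss Cs D (src t) (map src us),
     tgt = comp_linear Bss Cs D (tgt t) (map tgt us),
     component = (\<lambda>Xs \<in> Obj (prod_cat (concat Bss)). let Xss = blocks (map length Bss) Xs in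
       component t (map2 (\<lambda>s. fun_o (tgt s)) us Xss) \<cdot>\<^bsub>D\<^esub>
       fun_m (src t) (map2 component us Xss))\<rparr>"

text \<open>\<open>(F p)(A\<^sub>0, \<dots>)\<close> is \<open>F\<close> with \<open>A\<^sub>i\<close> in position \<open>p i\<close>.\<close>

definition act_linear :: "('o, 'm) permcat list \<Rightarrow> (nat \<Rightarrow> nat) \<Rightarrow> ('o, 'm) mlfun \<Rightarrow> ('o, 'm) mlfun" where
  "act_linear Cs p F = (let P = prod_cat (permute_list p Cs) in \<lparr>
     fun_o = (\<lambda>As \<in> Obj P. fun_o F (permute_list (inv p) As)),
     fun_m = (\<lambda>fs \<in> Arr P. fun_m F (permute_list (inv p) fs)),
     lin = (\<lambda>i As A'. if i < length Cs \<and> As \<in> Obj P \<and> A' \<in> Obj (Cs ! p i)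
       then lin F (p i) (permute_list (inv p) As) A' else undefined)\<rparr>)"

definition act_trans :: "('o, 'm) permcat list \<Rightarrow> (nat \<Rightarrow> nat) \<Rightarrow> ('o, 'm) mltrans \<Rightarrow> ('o, 'm) mltrans" where
  "act_trans Cs p t = \<lparr>
     src = act_linear Cs p (src t),
     tgt = act_linear Cs p (tgt t),
     component = (\<lambda>As \<in> Obj (prod_cat (permute_list p Cs)). component t (permute_list (inv p) As))\<rparr>"

definition PermCat_su :: "(('o, 'm) permcat, ('o, 'm) mlfun, ('o, 'm) mltrans) mcat" where
  "PermCat_su = \<lparr>
     MObj = {C. permutative_category C},
     Ops = multilinear_cat,
     ident = id_linear,
     comp1 = comp_linear,
     comp2 = comp_trans,
     act1 = (\<lambda>Cs D. act_linear Cs),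
     act2 = (\<lambda>Cs D. act_trans Cs)\<rparr>"

section \<open>The free \<open>n\<close>-fold monoidal category on a set\<close>

text \<open>The objects are the elements of the free algebra on the set \<open>X\<close> for \<open>n\<close> associative operations
  with a common unit, in normal form: \<open>Prod i ws\<close> is the \<open>i\<close>-th product of at least two factors,
  none of which is the unit or itself an \<open>i\<close>-th product.\<close>

datatype 'x word = Unit | Letter 'x | Prod nat "'x word list"

fun irreducible_for :: "nat \<Rightarrow> 'x word \<Rightarrow> bool" where
  "irreducible_for i Unit \<longleftrightarrow> False"
| "irreducible_for i (Letter x) \<longleftrightarrow> True"
| "irreducible_for i (Prod j ws) \<longleftrightarrow> j \<noteq> i"

fun is_word :: "nat \<Rightarrow> 'x set \<Rightarrow> 'x word \<Rightarrow> bool" where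
  "is_word n X Unit \<longleftrightarrow> True"
| "is_word n X (Letter x) \<longleftrightarrow> x \<in> X"
| "is_word n X (Prod i ws) \<longleftrightarrow> 1 \<le> i \<and> i \<le> n \<and> 2 \<le> length ws \<and>
     (\<forall>w \<in> set ws. irreducible_for i w \<and> is_word n X w)"

fun factors :: "nat \<Rightarrow> 'x word \<Rightarrow> 'x word list" where
  "factors i Unit = []"
| "factors i (Letter x) = [Letter x]"
| "factors i (Prod j ws) = (if j = i then ws else [Prod j ws])"

definition wten :: "nat \<Rightarrow> 'x word \<Rightarrow> 'x word \<Rightarrow> 'x word" where
  "wten i v w = (if v = Unit then w else if w = Unit then v else Prod i (factors i v @ factors i w))"

lemma wten_Unit [simp]: "wten i Unit w = w" "wten i w Unit = w"
  by (auto simp: wten_def)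

lemma factors_wten: "factors i (wten i v w) = factors i v @ factors i w"
  by (cases v; cases w) (auto simp: wten_def)

lemma wten_assoc: "wten i (wten i u v) w = wten i u (wten i v w)"
proof -
  have "wten i a b = Unit \<longleftrightarrow> a = Unit \<and> b = Unit" for a b :: "'a word"
    by (auto simp: wten_def)
  then show ?thesis
    by (cases "u = Unit"; cases "v = Unit"; cases "w = Unit")
      (simp_all add: wten_def[of i "wten i u v"] wten_def[of i u "wten i v w"] factors_wten)
qed

lemma wten_word:
  assumes "1 \<le> i" "i \<le> n" "is_word n X v" "is_word n X w"
  shows "is_word n X (wten i v w)"
proof -
  have 1: "irreducible_for i y \<and> is_word n X y" if "is_word n X w" "y \<in> set (factors i w)" for w y
    using that by (cases w) (auto split: if_splits)
  have 2: "length (factors i w) \<ge> 1" if "is_word n X w" "w \<noteq> Unit" for w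
    using that by (cases w) auto
  show ?thesis
    using assms 1[of v] 1[of w] 2[of v] 2[of w] by (auto simp: wten_def)
qed

lemma Prod_eq_wten:
  assumes "is_word n X (Prod i ws)"
  shows "Prod i ws = foldr (wten i) ws Unit"
proof -
  have *: "irreducible_for i a \<Longrightarrow> factors i a = [a] \<and> a \<noteq> Unit" for a :: "'a word"
    by (cases a) auto
  have "\<forall>w \<in> set vs. irreducible_for i w \<Longrightarrow> vs \<noteq> [] \<Longrightarrow>
      foldr (wten i) vs Unit = (if length vs = 1 then hd vs else Prod i vs)" for vs :: "'a word list"
    by (induction vs) (auto simp: wten_def * length_Suc_conv split: if_splits)
  moreover have "\<forall>w \<in> set ws. irreducible_for i w" "ws \<noteq> []" "length ws \<noteq> 1"
    using assms by auto
  ultimately show ?thesis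
    by presburger
qed

text \<open>The morphisms are the formal composites and products of identities and exchanges, modulo the
  congruence generated by the axioms of an \<open>n\<close>-fold monoidal category.\<close>

datatype 'x mor =
    Idt "'x word"
  | Seq "'x mor" "'x mor" (infixr "\<bullet>" 60)
  | Ten nat "'x mor" "'x mor"
  | Exch nat nat "'x word" "'x word" "'x word" "'x word"

primrec mdom :: "'x mor \<Rightarrow> 'x word" where
  "mdom (Idt w) = w"
| "mdom (g \<bullet> f) = mdom f"
| "mdom (Ten i f g) = wten i (mdom f) (mdom g)"
| "mdom (Exch i j a b c d) = wten i (wten j a b) (wten j c d)"

primrec mcod :: "'x mor \<Rightarrow> 'x word" where
  "mcod (Idt w) = w"
| "mcod (g \<bullet> f) = mcod g"
| "mcod (Ten i f g) = wten i (mcod f) (mcod g)"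
| "mcod (Exch i j a b c d) = wten j (wten i a c) (wten i b d)"

primrec is_mor :: "nat \<Rightarrow> 'x set \<Rightarrow> 'x mor \<Rightarrow> bool" where
  "is_mor n X (Idt w) \<longleftrightarrow> is_word n X w"
| "is_mor n X (g \<bullet> f) \<longleftrightarrow> is_mor n X g \<and> is_mor n X f \<and> mdom g = mcod f"
| "is_mor n X (Ten i f g) \<longleftrightarrow> 1 \<le> i \<and> i \<le> n \<and> is_mor n X f \<and> is_mor n X g"
| "is_mor n X (Exch i j a b c d) \<longleftrightarrow> 1 \<le> i \<and> i < j \<and> j \<le> n \<and>
     is_word n X a \<and> is_word n X b \<and> is_word n X c \<and> is_word n X d"

inductive mor_eq :: "nat \<Rightarrow> 'x set \<Rightarrow> 'x mor \<Rightarrow> 'x mor \<Rightarrow> bool" for n :: nat and X :: "'x set" where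
  refl: "is_mor n X f \<Longrightarrow> mor_eq n X f f"
| sym: "mor_eq n X f g \<Longrightarrow> mor_eq n X g f"
| trans: "mor_eq n X f g \<Longrightarrow> mor_eq n X g h \<Longrightarrow> mor_eq n X f h"
| Seq_cong: "mor_eq n X g g' \<Longrightarrow> mor_eq n X f f' \<Longrightarrow> mdom g = mcod f \<Longrightarrow> mor_eq n X (g \<bullet> f) (g' \<bullet> f')"
| Ten_cong: "1 \<le> i \<Longrightarrow> i \<le> n \<Longrightarrow> mor_eq n X f f' \<Longrightarrow> mor_eq n X g g' \<Longrightarrow>
    mor_eq n X (Ten i f g) (Ten i f' g')"
| Idt_Seq: "is_mor n X f \<Longrightarrow> mor_eq n X (Idt (mcod f) \<bullet> f) f"
| Seq_Idt: "is_mor n X f \<Longrightarrow> mor_eq n X (f \<bullet> Idt (mdom f)) f"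
| Seq_assoc: "is_mor n X ((h \<bullet> g) \<bullet> f) \<Longrightarrow> mor_eq n X ((h \<bullet> g) \<bullet> f) (h \<bullet> (g \<bullet> f))"
| Ten_Idt: "1 \<le> i \<Longrightarrow> i \<le> n \<Longrightarrow> is_word n X v \<Longrightarrow> is_word n X w \<Longrightarrow>
    mor_eq n X (Ten i (Idt v) (Idt w)) (Idt (wten i v w))"
| Ten_Seq: "1 \<le> i \<Longrightarrow> i \<le> n \<Longrightarrow> is_mor n X (f' \<bullet> f) \<Longrightarrow> is_mor n X (g' \<bullet> g) \<Longrightarrow>
    mor_eq n X (Ten i (f' \<bullet> f) (g' \<bullet> g)) (Ten i f' g' \<bullet> Ten i f g)"
| Ten_assoc: "1 \<le> i \<Longrightarrow> i \<le> n \<Longrightarrow> is_mor n X f \<Longrightarrow> is_mor n X g \<Longrightarrow> is_mor n X h \<Longrightarrow>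
    mor_eq n X (Ten i (Ten i f g) h) (Ten i f (Ten i g h))"
| Unit_Ten: "1 \<le> i \<Longrightarrow> i \<le> n \<Longrightarrow> is_mor n X f \<Longrightarrow> mor_eq n X (Ten i (Idt Unit) f) f"
| Ten_Unit: "1 \<le> i \<Longrightarrow> i \<le> n \<Longrightarrow> is_mor n X f \<Longrightarrow> mor_eq n X (Ten i f (Idt Unit)) f"
| Exch_nat: "1 \<le> i \<Longrightarrow> i < j \<Longrightarrow> j \<le> n \<Longrightarrow>
    is_mor n X f \<Longrightarrow> is_mor n X g \<Longrightarrow> is_mor n X h \<Longrightarrow> is_mor n X k \<Longrightarrow>
    mor_eq n X
      (Exch i j (mcod f) (mcod g) (mcod h) (mcod k) \<bullet> Ten i (Ten j f g) (Ten j h k))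
      (Ten j (Ten i f h) (Ten i g k) \<bullet> Exch i j (mdom f) (mdom g) (mdom h) (mdom k))"
| Exch_unit1: "1 \<le> i \<Longrightarrow> i < j \<Longrightarrow> j \<le> n \<Longrightarrow> is_word n X a \<Longrightarrow> is_word n X b \<Longrightarrow>
    mor_eq n X (Exch i j a b Unit Unit) (Idt (wten j a b))"
| Exch_unit2: "1 \<le> i \<Longrightarrow> i < j \<Longrightarrow> j \<le> n \<Longrightarrow> is_word n X a \<Longrightarrow> is_word n X b \<Longrightarrow>
    mor_eq n X (Exch i j Unit Unit a b) (Idt (wten j a b))"
| Exch_unit3: "1 \<le> i \<Longrightarrow> i < j \<Longrightarrow> j \<le> n \<Longrightarrow> is_word n X a \<Longrightarrow> is_word n X b \<Longrightarrow>
    mor_eq n X (Exch i j a Unit b Unit) (Idt (wten i a b))"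
| Exch_unit4: "1 \<le> i \<Longrightarrow> i < j \<Longrightarrow> j \<le> n \<Longrightarrow> is_word n X a \<Longrightarrow> is_word n X b \<Longrightarrow>
    mor_eq n X (Exch i j Unit a Unit b) (Idt (wten i a b))"
| Exch_outer: "1 \<le> i \<Longrightarrow> i < j \<Longrightarrow> j \<le> n \<Longrightarrow> is_word n X u \<Longrightarrow> is_word n X v \<Longrightarrow>
    is_word n X w \<Longrightarrow> is_word n X x \<Longrightarrow> is_word n X y \<Longrightarrow> is_word n X z \<Longrightarrow>
    mor_eq n X
      (Exch i j (wten i u w) (wten i v x) y z \<bullet> Ten i (Exch i j u v w x) (Idt (wten j y z)))
      (Exch i j u v (wten i w y) (wten i x z) \<bullet> Ten i (Idt (wten j u v)) (Exch i j w x y z))"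
| Exch_inner: "1 \<le> i \<Longrightarrow> i < j \<Longrightarrow> j \<le> n \<Longrightarrow> is_word n X u \<Longrightarrow> is_word n X v \<Longrightarrow>
    is_word n X w \<Longrightarrow> is_word n X x \<Longrightarrow> is_word n X y \<Longrightarrow> is_word n X z \<Longrightarrow>
    mor_eq n X
      (Ten j (Exch i j u v x y) (Idt (wten i w z)) \<bullet> Exch i j (wten j u v) w (wten j x y) z)
      (Ten j (Idt (wten i u x)) (Exch i j v w y z) \<bullet> Exch i j u (wten j v w) x (wten j y z))"
| Exch_hexagon: "1 \<le> i \<Longrightarrow> i < j \<Longrightarrow> j < k \<Longrightarrow> k \<le> n \<Longrightarrow>
    is_word n X a \<Longrightarrow> is_word n X b \<Longrightarrow> is_word n X c \<Longrightarrow> is_word n X d \<Longrightarrow>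
    is_word n X a' \<Longrightarrow> is_word n X b' \<Longrightarrow> is_word n X c' \<Longrightarrow> is_word n X d' \<Longrightarrow>
    mor_eq n X
      (Ten k (Exch i j a b c d) (Exch i j a' b' c' d') \<bullet>
       Exch i k (wten j a b) (wten j a' b') (wten j c d) (wten j c' d') \<bullet>
       Ten i (Exch j k a a' b b') (Exch j k c c' d d'))
      (Exch j k (wten i a c) (wten i a' c') (wten i b d) (wten i b' d') \<bullet>
       Ten j (Exch i k a a' c c') (Exch i k b b' d d') \<bullet>
       Exch i j (wten k a a') (wten k b b') (wten k c c') (wten k d d'))"

definition mor_class :: "nat \<Rightarrow> 'x set \<Rightarrow> 'x mor \<Rightarrow> 'x mor set" where
  "mor_class n X f = {g. mor_eq n X f g}"

definition rep :: "'x mor set \<Rightarrow> 'x mor" where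
  "rep c = (SOME f. f \<in> c)"

definition free_nfold :: "nat \<Rightarrow> 'x set \<Rightarrow> ('x word, 'x mor set) cat" where
  "free_nfold n X = \<lparr>
     Obj = {w. is_word n X w},
     Arr = mor_class n X ` {f. is_mor n X f},
     Dom = (\<lambda>c. mdom (rep c)),
     Cod = (\<lambda>c. mcod (rep c)),
     Ide = (\<lambda>w. mor_class n X (Idt w)),
     Cmp = (\<lambda>d c. mor_class n X (rep d \<bullet> rep c))\<rparr>"

section \<open>The operad \<open>Mon\<^sup>n\<close>\<close>

text \<open>The letters of a \<open>k\<close>-ary operation are numbered \<open>0, \<dots>, k - 1\<close>.\<close>

fun letters :: "'x word \<Rightarrow> 'x list" where
  "letters Unit = []"
| "letters (Letter x) = [x]"
| "letters (Prod i ws) = concat (map letters ws)"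

definition Mon_ops :: "nat \<Rightarrow> nat \<Rightarrow> (nat word, nat mor set) cat" where
  "Mon_ops n k =
     full_subcat (free_nfold n {..<k}) {w. distinct (letters w) \<and> set (letters w) = {..<k}}"

fun subst_word :: "('x \<Rightarrow> 'y word) \<Rightarrow> 'x word \<Rightarrow> 'y word" where
  "subst_word s Unit = Unit"
| "subst_word s (Letter x) = s x"
| "subst_word s (Prod i ws) = foldr (wten i) (map (subst_word s) ws) Unit"

text \<open>Morphisms \<open>m x\<close> substituted for the letters \<open>x\<close> of a word:\<close>

fun word_mor :: "('x \<Rightarrow> 'y mor) \<Rightarrow> 'x word \<Rightarrow> 'y mor" where
  "word_mor m Unit = Idt Unit"
| "word_mor m (Letter x) = m x"
| "word_mor m (Prod i ws) = foldr (Ten i) (map (word_mor m) ws) (Idt Unit)"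

text \<open>Words \<open>s x\<close> substituted for the letters \<open>x\<close> of a morphism:\<close>

primrec subst_mor :: "('x \<Rightarrow> 'y word) \<Rightarrow> 'x mor \<Rightarrow> 'y mor" where
  "subst_mor s (Idt w) = Idt (subst_word s w)"
| "subst_mor s (g \<bullet> f) = subst_mor s g \<bullet> subst_mor s f"
| "subst_mor s (Ten i f g) = Ten i (subst_mor s f) (subst_mor s g)"
| "subst_mor s (Exch i j a b c d) =
     Exch i j (subst_word s a) (subst_word s b) (subst_word s c) (subst_word s d)"

definition Mon_comp1 :: "nat list \<Rightarrow> nat word \<Rightarrow> nat word list \<Rightarrow> nat word" where
  "Mon_comp1 ks w vs = subst_word (\<lambda>l. map_word (\<lambda>x. sum_list (take l ks) + x) (vs ! l)) w"

definition Mon_comp2 :: "nat \<Rightarrow> nat list \<Rightarrow> nat mor set \<Rightarrow> nat mor set list \<Rightarrow> nat mor set" where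
  "Mon_comp2 n ks c ds =
    (let m = (\<lambda>l. map_mor (\<lambda>x. sum_list (take l ks) + x) (rep (ds ! l))); f = rep c in
     mor_class n {..<sum_list ks} (word_mor m (mcod f) \<bullet> subst_mor (\<lambda>l. mdom (m l)) f))"

definition Mon :: "nat \<Rightarrow> (unit, nat word, nat mor set) mcat" where
  "Mon n = \<lparr>
     MObj = UNIV,
     Ops = (\<lambda>cs d. Mon_ops n (length cs)),
     ident = (\<lambda>c. Letter 0),
     comp1 = (\<lambda>bss cs d. Mon_comp1 (map length bss)),
     comp2 = (\<lambda>bss cs d. Mon_comp2 n (map length bss)),
     act1 = (\<lambda>cs d p. map_word (inv p)),
     act2 = (\<lambda>cs d p c. mor_class n {..<length cs} (map_mor (inv p) (rep c)))\<rparr>"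

section \<open>The structure determined by a multifunctor\<close>

text \<open>The unit, the products and the exchanges are the images of the generators of \<open>Mon\<^sup>n\<close>; the
  distributivity morphisms are the linearity constraints of the products.\<close>

definition En_structure_of :: "nat \<Rightarrow> ('o, 'm) permcat \<Rightarrow>
    (unit, nat word, nat mor set, ('o, 'm) permcat, ('o, 'm) mlfun, ('o, 'm) mltrans) mfunctor \<Rightarrow>
    ('o, 'm) en_data" where
  "En_structure_of n C \<Phi> =
    (let T = (\<lambda>i. on1 \<Phi> [(), ()] () (wten i (Letter 0) (Letter 1)));
         E = (\<lambda>i j. on2 \<Phi> [(), (), (), ()] ()
                (mor_class n {..<4} (Exch i j (Letter 0) (Letter 1) (Letter 2) (Letter 3)))) in \<lparr>
     ten_o = (\<lambda>i A B. if 1 \<le> i \<and> i \<le> n then fun_o (T i) [A, B] else undefined),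
     ten_m = (\<lambda>i f g. if 1 \<le> i \<and> i \<le> n then fun_m (T i) [f, g] else undefined),
     ten_unit = fun_o (on1 \<Phi> [] () Unit) [],
     distl = (\<lambda>i A B D. if 1 \<le> i \<and> i \<le> n then lin (T i) 0 [A, D] B else undefined),
     distr = (\<lambda>i A B D. if 1 \<le> i \<and> i \<le> n then lin (T i) 1 [A, B] D else undefined),
     exch = (\<lambda>i j A B X Y. if 1 \<le> i \<and> i < j \<and> j \<le> n then component (E i j) [A, B, X, Y]
       else undefined)\<rparr>)"

end

theory Submission
  imports Defs
begin

text \<open>The operad \<open>Mon\<^sup>n\<close> is given by generators and relations. Under operadic composition,
  composition of 2-cells and relabelling it is generated by the unit, the \<open>n\<close> products of two
  letters and the exchanges of four letters; the relations are the associativity and unit laws of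
  words and the defining relations between formal morphisms. A multifunctor takes the products to
  bilinear functors, whose linearity constraints are the two distributivity morphisms, and the
  exchanges to multilinear transformations. The axioms of an \<open>E\<^sub>n\<close>-monoidal category are then of two
  kinds. Some of them state that these functors and transformations are multilinear. The others are
  the images of the relations: two factorizations of a word yield two descriptions of the same
  multilinear functor, and comparing the effects on objects and arrows yields associativity, while
  comparing the linearity constraints yields the distributivity axioms for iterated products
  (\<open>S_ring_category\<close>); the axioms on exchanges are images of relations between formal morphisms
  (\<open>S_exchange\<close>, \<open>S_hexagon\<close>). To read off these images, a multifunctor is evaluated at words and
  formal morphisms whose letters are arbitrary names (\<open>eval_obj_wten\<close>, \<open>eval_lin_wten\<close>,
  \<open>eval_mor_Exch\<close>). A multifunctor is determined by its structure because two multifunctors agree on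
  everything that is generated by operations on which they agree (\<open>functors_eq\<close>).

  Conversely, given an \<open>E\<^sub>n\<close>-monoidal structure, words and formal morphisms are evaluated at
  assignments of objects to named letters. The linearity constraint in a letter \<open>x\<close> distributes a sum
  over the products on the path from the root of the word to \<open>x\<close>, and the distributivity axioms make
  it independent of the factorization of the word (\<open>lin_val_wten\<close>). So the conditions on a multilinear
  functor follow by induction on products: in one variable because additive functors compose
  (\<open>additive_word\<close>), in two variables by \<open>lin_val_lin_val\<close>. The \<open>n\<close>-fold monoidal axioms make the
  evaluation of formal morphisms well defined (\<open>mor_val_sound\<close>), and the exchange factorization axioms
  make it linear (\<open>mor_val_lin\<close>). Operadic composition is substitution for named letters, and
  evaluation is compatible with it (\<open>lin_val_subst\<close>, \<open>comp_linear_word_fun\<close>, \<open>comp_trans_mor_trans\<close>), so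
  that this defines a multifunctor, which has the given structure.\<close>

section \<open>Words\<close>

lemma concat_letters_factors [simp]: "concat (map letters (factors i v)) = letters v"
  by (cases v) auto

lemma letters_wten [simp]: "letters (wten i v w) = letters v @ letters w"
  by (auto simp: wten_def)

lemma map_word_eq_Unit [simp]: "map_word h v = Unit \<longleftrightarrow> v = Unit"
  by (cases v) auto

lemma factors_map_word: "factors i (map_word h v) = map (map_word h) (factors i v)"
  by (cases v) auto

lemma map_word_wten [simp]: "map_word h (wten i v w) = wten i (map_word h v) (map_word h w)"
  by (auto simp: wten_def factors_map_word)

lemma letters_map_word [simp]: "letters (map_word h w) = map h (letters w)"
  by (induction w) (auto simp: map_concat comp_def cong: map_cong)

lemma set_letters: "set (letters w) = set_word w"
  by (induction w) auto

lemma map_word_cong_letters: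
  "(\<And>x. x \<in> set (letters w) \<Longrightarrow> h x = h' x) \<Longrightarrow> map_word h w = map_word h' w"
  by (rule word.map_cong) (auto simp: set_letters)

lemma map_word_map_word: "map_word h (map_word h' w) = map_word (\<lambda>x. h (h' x)) w"
  by (simp add: word.map_comp comp_def)

lemma map_word_idem:
  "(\<And>x. x \<in> set (letters w) \<Longrightarrow> h x = x) \<Longrightarrow> map_word h w = w"
  using map_word_cong_letters[of w h "\<lambda>x. x"] by (simp add: word.map_ident)

lemma irreducible_map_word [simp]: "irreducible_for i (map_word h w) \<longleftrightarrow> irreducible_for i w"
  by (cases w) auto

lemma is_word_iff: "is_word n X w \<longleftrightarrow> is_word n UNIV w \<and> set (letters w) \<subseteq> X"
  by (induction w) auto

lemma is_word_map_word [simp]: "is_word n UNIV (map_word h w) \<longleftrightarrow> is_word n UNIV w"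
  by (induction w) auto

text \<open>Every word in normal form arises from the unit and the letters by iterated products. All
  properties of words below are proved by this induction, since the structures under consideration
  are specified by what they do on binary products.\<close>

lemma is_word_induct [consumes 1, case_names Unit Letter wten]:
  assumes "is_word n X w"
    and "P Unit" and "\<And>x. x \<in> X \<Longrightarrow> P (Letter x)"
    and "\<And>i v w. 1 \<le> i \<Longrightarrow> i \<le> n \<Longrightarrow> is_word n X v \<Longrightarrow> is_word n X w \<Longrightarrow> P v \<Longrightarrow> P w \<Longrightarrow>
      P (wten i v w)"
  shows "P w"
  using assms(1)
proof (induction w)
  case (Prod i ws)
  have i: "1 \<le> i" "i \<le> n" and ws: "\<forall>w \<in> set ws. is_word n X w \<and> P w"
    using Prod by auto
  have "is_word n X (foldr (wten i) ws Unit) \<and> P (foldr (wten i) ws Unit)"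
    using ws by (induction ws) (auto intro!: assms(2,4) i wten_word)
  then show ?case
    using Prod_eq_wten[OF Prod.prems] by simp
qed (auto intro: assms(2,3))

lemma foldr_wten_append:
  "foldr (wten i) (ws @ vs) Unit = wten i (foldr (wten i) ws Unit) (foldr (wten i) vs Unit)"
  by (induction ws) (auto simp: wten_assoc)

lemma foldr_subst_factors: "foldr (wten i) (map (subst_word s) (factors i v)) Unit = subst_word s v"
  by (cases v) auto

lemma subst_word_wten [simp]: "subst_word s (wten i v w) = wten i (subst_word s v) (subst_word s w)"
  using foldr_wten_append[of i "map (subst_word s) (factors i v)" "map (subst_word s) (factors i w)"]
  by (auto simp: wten_def foldr_subst_factors simp del: foldr_append foldr_map)

lemma subst_word_cong:
  "(\<And>x. x \<in> set (letters w) \<Longrightarrow> s x = s' x) \<Longrightarrow> subst_word s w = subst_word s' w"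
proof (induction w)
  case (Prod i ws)
  then have "map (subst_word s) ws = map (subst_word s') ws"
    by auto
  then show ?case
    by (simp only: subst_word.simps)
qed auto

lemma letters_subst_word: "letters (subst_word s w) = concat (map (\<lambda>x. letters (s x)) (letters w))"
proof (induction w)
  case (Prod i ws)
  then show ?case
    by simp (induction ws, auto)
qed auto

lemma is_word_subst_word:
  assumes "is_word n X w" "\<And>x. x \<in> set (letters w) \<Longrightarrow> is_word n Y (s x)"
  shows "is_word n Y (subst_word s w)"
  using assms by (induction rule: is_word_induct) (auto intro!: wten_word)

lemma map_word_eq_subst_word:
  "is_word n X w \<Longrightarrow> map_word h w = subst_word (\<lambda>x. Letter (h x)) w"
  by (induction rule: is_word_induct) auto

section \<open>Formal morphisms\<close>

lemma is_mor_word: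
  assumes "is_mor n X f"
  shows "is_word n X (mdom f)" "is_word n X (mcod f)"
  using assms by (induction f) (auto intro!: wten_word)

lemma mset_letters_mcod: "is_mor n X f \<Longrightarrow> mset (letters (mcod f)) = mset (letters (mdom f))"
  by (induction f) auto

lemma set_letters_mcod: "is_mor n X f \<Longrightarrow> set (letters (mcod f)) = set (letters (mdom f))"
  by (metis mset_letters_mcod set_mset_mset)

lemma distinct_letters_mcod:
  "is_mor n X f \<Longrightarrow> distinct (letters (mcod f)) \<longleftrightarrow> distinct (letters (mdom f))"
  by (metis mset_letters_mcod mset_eq_imp_distinct_iff)

lemma set_mor_eq: "is_mor n X f \<Longrightarrow> set_mor f = set (letters (mdom f))"
  by (induction f) (auto simp: set_letters_mcod simp flip: set_letters)

lemma mdom_map_mor [simp]: "mdom (map_mor h f) = map_word h (mdom f)"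
  and mcod_map_mor [simp]: "mcod (map_mor h f) = map_word h (mcod f)"
  by (induction f) auto

lemma mdom_subst_mor [simp]: "mdom (subst_mor s f) = subst_word s (mdom f)"
  and mcod_subst_mor [simp]: "mcod (subst_mor s f) = subst_word s (mcod f)"
  by (induction f) auto

lemma is_mor_UNIV: "is_mor n X f \<Longrightarrow> is_mor n UNIV f"
  by (induction f) (auto simp: is_word_iff[of n X])

lemma is_mor_iff: "is_mor n X f \<longleftrightarrow> is_mor n UNIV f \<and> set (letters (mdom f)) \<subseteq> X"
proof -
  have "is_mor n UNIV f \<Longrightarrow> set (letters (mdom f)) \<subseteq> X \<Longrightarrow> is_mor n X f"
    by (induction f) (auto simp: is_word_iff[of n X] set_letters_mcod)
  moreover have "is_mor n X f \<Longrightarrow> set (letters (mdom f)) \<subseteq> X"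
    using is_mor_word(1)[of n X f] by (auto simp: is_word_iff[of n X])
  ultimately show ?thesis
    using is_mor_UNIV by blast
qed

text \<open>A relabelling substitutes letters for letters, so that the congruence has to be followed
  through the defining relations for substitutions only.\<close>

lemma map_mor_eq_subst_mor:
  "is_mor n X f \<Longrightarrow> map_mor h f = subst_mor (\<lambda>x. Letter (h x)) f"
  by (induction f) (auto simp: map_word_eq_subst_word)

lemma is_mor_subst_mor:
  assumes "is_mor n X f" "\<And>x. x \<in> X \<Longrightarrow> is_word n Y (s x)"
  shows "is_mor n Y (subst_mor s f)"
  using assms by (induction f) (auto intro!: is_word_subst_word simp: is_word_iff[of n X])

lemma mor_eq_is_mor:
  assumes "mor_eq n X f g"
  shows "is_mor n X f \<and> is_mor n X g \<and> mdom f = mdom g \<and> mcod f = mcod g"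
  using assms
  by induction (auto simp: wten_assoc is_mor_word intro!: wten_word)

lemma mor_eq_subst_mor:
  assumes "mor_eq n X f g" "\<And>x. x \<in> X \<Longrightarrow> is_word n Y (s x)"
  shows "mor_eq n Y (subst_mor s f) (subst_mor s g)"
proof -
  have w: "is_word n X w \<Longrightarrow> is_word n Y (subst_word s w)" for w
    using assms(2) by (auto intro!: is_word_subst_word simp: is_word_iff[of n X])
  have m: "is_mor n X f \<Longrightarrow> is_mor n Y (subst_mor s f)" for f
    using assms(2) by (auto intro!: is_mor_subst_mor)
  show ?thesis
    using assms(1)
  proof induction
    case (refl f) then show ?case by (auto intro: m mor_eq.refl)
  next
    case (sym f g) then show ?case by (auto intro: mor_eq.sym)
  next
    case (trans f g h) then show ?case by (auto intro: mor_eq.trans)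
  next
    case (Seq_cong g g' f f') then show ?case by (auto intro: mor_eq.Seq_cong)
  next
    case (Ten_cong i f f' g g') then show ?case by (auto intro: mor_eq.Ten_cong)
  next
    case (Idt_Seq f) then show ?case using mor_eq.Idt_Seq[OF m] by simp
  next
    case (Seq_Idt f) then show ?case using mor_eq.Seq_Idt[OF m] by simp
  next
    case (Seq_assoc h g f) then show ?case using mor_eq.Seq_assoc[of n Y "subst_mor s h" "subst_mor s g" "subst_mor s f"] m[OF Seq_assoc]
      by simp
  next
    case (Ten_Idt i v w) then show ?case using mor_eq.Ten_Idt[OF _ _ w w] by simp
  next
    case (Ten_Seq i f' f g' g)
    then show ?case using mor_eq.Ten_Seq[of i n Y "subst_mor s f'" "subst_mor s f" "subst_mor s g'" "subst_mor s g"]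
      m[OF Ten_Seq(3)] m[OF Ten_Seq(4)] by simp
  next
    case (Ten_assoc i f g h) then show ?case using mor_eq.Ten_assoc[OF _ _ m m m] by simp
  next
    case (Unit_Ten i f) then show ?case using mor_eq.Unit_Ten[OF _ _ m] by simp
  next
    case (Ten_Unit i f) then show ?case using mor_eq.Ten_Unit[OF _ _ m] by simp
  next
    case (Exch_nat i j f g h k)
    then show ?case using mor_eq.Exch_nat[OF Exch_nat(1-3) m m m m, of f g h k] by simp
  next
    case (Exch_unit1 i j a b)
    then show ?case using mor_eq.Exch_unit1[OF _ _ _ w w] by simp
  next
    case (Exch_unit2 i j a b)
    then show ?case using mor_eq.Exch_unit2[OF _ _ _ w w] by simp
  next
    case (Exch_unit3 i j a b)
    then show ?case using mor_eq.Exch_unit3[OF _ _ _ w w] by simp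
  next
    case (Exch_unit4 i j a b)
    then show ?case using mor_eq.Exch_unit4[OF _ _ _ w w] by simp
  next
    case Exch_outer
    then show ?case by (simp add: mor_eq.Exch_outer w)
  next
    case Exch_inner
    then show ?case by (simp add: mor_eq.Exch_inner w)
  next
    case Exch_hexagon
    then show ?case by (simp add: mor_eq.Exch_hexagon w)
  qed
qed

lemma is_mor_map_mor:
  assumes "is_mor n X f" "h ` set (letters (mdom f)) \<subseteq> Y"
  shows "is_mor n Y (map_mor h f)"
proof -
  have "is_mor n (set (letters (mdom f))) f"
    using assms(1) by (auto simp: is_mor_iff[of n "set _"] intro: is_mor_UNIV)
  then show ?thesis
    using assms is_mor_subst_mor[of n "set (letters (mdom f))" f Y "\<lambda>x. Letter (h x)"]
    by (auto simp: map_mor_eq_subst_mor)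
qed

lemma mor_eq_map_mor:
  assumes "mor_eq n X f g" "h ` X \<subseteq> Y"
  shows "mor_eq n Y (map_mor h f) (map_mor h g)"
proof -
  have "mor_eq n Y (subst_mor (\<lambda>x. Letter (h x)) f) (subst_mor (\<lambda>x. Letter (h x)) g)"
    using assms by (intro mor_eq_subst_mor[OF assms(1)]) auto
  then show ?thesis
    using mor_eq_is_mor[OF assms(1)] map_mor_eq_subst_mor by metis
qed

lemma map_mor_map_mor: "map_mor h (map_mor h' f) = map_mor (\<lambda>x. h (h' x)) f"
  by (simp add: mor.map_comp comp_def)

lemma map_mor_cong_letters:
  assumes "is_mor n X f" "\<And>x. x \<in> set (letters (mdom f)) \<Longrightarrow> h x = h' x"
  shows "map_mor h f = map_mor h' f"
  by (rule mor.map_cong) (auto simp: set_mor_eq[OF assms(1)] assms(2))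

lemma map_mor_idem:
  assumes "is_mor n X f" "\<And>x. x \<in> set (letters (mdom f)) \<Longrightarrow> h x = x"
  shows "map_mor h f = f"
  using map_mor_cong_letters[OF assms(1), of h "\<lambda>x. x"] assms(2) by (simp add: mor.map_ident)

lemma mdom_word_mor [simp]: "mdom (word_mor m w) = subst_word (\<lambda>x. mdom (m x)) w"
  and mcod_word_mor [simp]: "mcod (word_mor m w) = subst_word (\<lambda>x. mcod (m x)) w"
proof (induction w)
  case (Prod i ws)
  show "mdom (word_mor m (Prod i ws)) = subst_word (\<lambda>x. mdom (m x)) (Prod i ws)"
    "mcod (word_mor m (Prod i ws)) = subst_word (\<lambda>x. mcod (m x)) (Prod i ws)"
    using Prod by (simp_all, (induction ws; auto)+)
qed auto

lemma word_mor_cong: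
  "(\<And>x. x \<in> set (letters w) \<Longrightarrow> m x = m' x) \<Longrightarrow> word_mor m w = word_mor m' w"
proof (induction w)
  case (Prod i ws)
  then have "map (word_mor m) ws = map (word_mor m') ws"
    by auto
  then show ?case
    by (simp only: word_mor.simps)
qed auto

lemma is_mor_word_mor:
  assumes "is_word n X w" "\<And>x. x \<in> set (letters w) \<Longrightarrow> is_mor n Y (m x)"
  shows "is_mor n Y (word_mor m w)"
  using assms
proof (induction w)
  case (Prod i ws)
  then have "\<forall>w \<in> set ws. is_mor n Y (word_mor m w)" and "1 \<le> i" "i \<le> n"
    by auto
  then show ?case
    by simp (induction ws, auto)
qed auto

lemma mor_eq_word_mor:
  assumes "is_word n X w" "\<And>x. x \<in> set (letters w) \<Longrightarrow> mor_eq n Y (m x) (m' x)"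
  shows "mor_eq n Y (word_mor m w) (word_mor m' w)"
  using assms
proof (induction w)
  case (Prod i ws)
  then have "\<forall>w \<in> set ws. mor_eq n Y (word_mor m w) (word_mor m' w)" and "1 \<le> i" "i \<le> n"
    by auto
  then show ?case
    by simp (induction ws, auto intro!: mor_eq.refl mor_eq.Ten_cong)
qed (auto intro: mor_eq.refl)

lemma mor_eq_word_mor_Idt:
  assumes "is_word n X w" "\<And>x. x \<in> set (letters w) \<Longrightarrow> is_word n Y (s x)"
  shows "mor_eq n Y (word_mor (\<lambda>x. Idt (s x)) w) (Idt (subst_word s w))"
  using assms
proof (induction w)
  case (Prod i ws)
  have "\<forall>w \<in> set ws. mor_eq n Y (word_mor (\<lambda>x. Idt (s x)) w) (Idt (subst_word s w)) \<and>
      is_word n Y (subst_word s w)" and i: "1 \<le> i" "i \<le> n"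
    using Prod by (auto intro!: is_word_subst_word[of n X])
  then have "mor_eq n Y (foldr (Ten i) (map (word_mor (\<lambda>x. Idt (s x))) ws) (Idt Unit))
      (Idt (foldr (wten i) (map (subst_word s) ws) Unit)) \<and>
      is_word n Y (foldr (wten i) (map (subst_word s) ws) Unit)"
    by (induction ws)
      (auto intro!: mor_eq.refl wten_word
        intro: mor_eq.trans[OF mor_eq.Ten_cong[OF i] mor_eq.Ten_Idt[OF i]])
  then show ?case
    by simp
qed (auto intro!: mor_eq.refl)

section \<open>The operad \<open>Mon\<^sup>n\<close>\<close>

lemma rep_mor_class:
  assumes "is_mor n X f"
  shows "mor_eq n X f (rep (mor_class n X f))"
  unfolding rep_def by (rule someI2[of _ f]) (auto simp: mor_class_def intro: mor_eq.refl assms)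

lemma mor_class_eqI: "mor_eq n X f g \<Longrightarrow> mor_class n X f = mor_class n X g"
  by (auto simp: mor_class_def intro: mor_eq.trans mor_eq.sym)

lemma rep_props [simp]:
  assumes "is_mor n X f"
  shows "is_mor n X (rep (mor_class n X f))"
    "mdom (rep (mor_class n X f)) = mdom f" "mcod (rep (mor_class n X f)) = mcod f"
  using mor_eq_is_mor[OF rep_mor_class[OF assms]] by auto

definition is_op :: "nat \<Rightarrow> nat \<Rightarrow> nat word \<Rightarrow> bool" where
  "is_op n k w \<longleftrightarrow> is_word n {..<k} w \<and> distinct (letters w) \<and> set (letters w) = {..<k}"

text \<open>Formal morphisms permute the letters, so that the codomain is an operation because the domain is.\<close>

definition is_op_mor :: "nat \<Rightarrow> nat \<Rightarrow> nat mor \<Rightarrow> bool" where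
  "is_op_mor n k f \<longleftrightarrow> is_mor n {..<k} f \<and> is_op n k (mdom f)"

lemma is_op_mor_mcod: "is_op_mor n k f \<Longrightarrow> is_op n k (mcod f)"
  unfolding is_op_mor_def is_op_def
  using set_letters_mcod distinct_letters_mcod is_mor_word by metis

lemma is_op_mor_is_mor: "is_op_mor n k f \<Longrightarrow> is_mor n {..<k} f"
  by (simp add: is_op_mor_def)

lemma Obj_Mon_ops [simp]: "w \<in> Obj (Mon_ops n k) \<longleftrightarrow> is_op n k w"
  by (auto simp: Mon_ops_def full_subcat_def free_nfold_def is_op_def)

lemma Arr_Mon_ops: "Arr (Mon_ops n k) = mor_class n {..<k} ` {f. is_op_mor n k f}"
proof -
  have "c \<in> Arr (Mon_ops n k) \<longleftrightarrow> (\<exists>f. is_op_mor n k f \<and> c = mor_class n {..<k} f)" for c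
  proof -
    have "c \<in> Arr (Mon_ops n k) \<longleftrightarrow> (\<exists>f. is_mor n {..<k} f \<and> c = mor_class n {..<k} f \<and>
        (distinct (letters (mdom f)) \<and> set (letters (mdom f)) = {..<k}) \<and>
        (distinct (letters (mcod f)) \<and> set (letters (mcod f)) = {..<k}))"
      unfolding Mon_ops_def full_subcat_def free_nfold_def by (simp add: image_iff) (metis rep_props(2,3))
    also have "\<dots> \<longleftrightarrow> (\<exists>f. is_op_mor n k f \<and> c = mor_class n {..<k} f)"
      unfolding is_op_mor_def is_op_def
      by (metis set_letters_mcod distinct_letters_mcod is_mor_word(1))
    finally show ?thesis .
  qed
  then show ?thesis
    by blast
qed

lemma Mon_ops_simps [simp]:
  "is_mor n {..<k} f \<Longrightarrow> Dom (Mon_ops n k) (mor_class n {..<k} f) = mdom f"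
  "is_mor n {..<k} f \<Longrightarrow> Cod (Mon_ops n k) (mor_class n {..<k} f) = mcod f"
  "Ide (Mon_ops n k) w = mor_class n {..<k} (Idt w)"
  by (auto simp: Mon_ops_def full_subcat_def free_nfold_def)

lemma Cmp_Mon_ops:
  assumes "is_mor n {..<k} (g \<bullet> f)"
  shows "Cmp (Mon_ops n k) (mor_class n {..<k} g) (mor_class n {..<k} f) = mor_class n {..<k} (g \<bullet> f)"
  using assms rep_mor_class[of n "{..<k}"]
  by (auto simp: Mon_ops_def full_subcat_def free_nfold_def
      intro!: mor_class_eqI mor_eq.Seq_cong intro: mor_eq.sym)

text \<open>Composition of 2-cells is defined on chosen representatives. The choice does not matter, as
  both substitutions, of words for letters and of morphisms for letters, respect the congruence.\<close>

lemma Mon_comp2_mor_class: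
  assumes f: "is_mor n {..<length ks} f" and len: "length gs = length ks"
    and gs: "\<And>l. l < length ks \<Longrightarrow> is_mor n {..<ks ! l} (gs ! l)"
  defines "m \<equiv> \<lambda>l. map_mor (\<lambda>x. sum_list (take l ks) + x) (gs ! l)"
  shows "Mon_comp2 n ks (mor_class n {..<length ks} f)
      (map2 (\<lambda>k. mor_class n {..<k}) ks gs) =
    mor_class n {..<sum_list ks} (word_mor m (mcod f) \<bullet> subst_mor (\<lambda>l. mdom (m l)) f)"
proof -
  let ?f = "rep (mor_class n {..<length ks} f)"
  define m' where "m' = (\<lambda>l. map_mor (\<lambda>x. sum_list (take l ks) + x)
    (rep (map2 (\<lambda>k. mor_class n {..<k}) ks gs ! l)))"
  have shift: "(\<lambda>x. sum_list (take l ks) + x) ` {..<ks ! l} \<subseteq> {..<sum_list ks}" if "l < length ks" for l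
  proof -
    have "sum_list ks = sum_list (take l ks) + ks ! l + sum_list (drop (Suc l) ks)"
      using that by (metis id_take_nth_drop sum_list.append sum_list.Cons add.assoc)
    then show ?thesis by auto
  qed
  have m: "mor_eq n {..<sum_list ks} (m' l) (m l)" if "l < length ks" for l
    using that len gs unfolding m_def m'_def
    by (auto intro!: mor_eq_map_mor[OF _ shift] mor_eq.sym[OF rep_mor_class])
  have mm: "is_mor n {..<sum_list ks} (m l)" "is_mor n {..<sum_list ks} (m' l)" "mdom (m' l) = mdom (m l)"
    if "l < length ks" for l
    using mor_eq_is_mor[OF m[OF that]] by auto
  have wd: "is_word n {..<length ks} (mcod f)"
    using f by (rule is_mor_word)
  then have lt: "x \<in> set (letters (mcod f)) \<Longrightarrow> x < length ks" for x
    by (auto simp: is_word_iff[of n "{..<_}"])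
  have sub: "subst_mor (\<lambda>l. mdom (m' l)) ?f = subst_mor (\<lambda>l. mdom (m l)) ?f"
  proof -
    have "is_mor n {..<length ks} g \<Longrightarrow> subst_mor (\<lambda>l. mdom (m' l)) g = subst_mor (\<lambda>l. mdom (m l)) g" for g
      by (induction g) (auto intro!: subst_word_cong simp: mm is_word_iff[of n "{..<_}"])
    then show ?thesis
      using f by simp
  qed
  have "mor_eq n {..<sum_list ks} (word_mor m' (mcod ?f) \<bullet> subst_mor (\<lambda>l. mdom (m' l)) ?f)
     (word_mor m (mcod f) \<bullet> subst_mor (\<lambda>l. mdom (m l)) f)"
    unfolding sub
  proof (rule mor_eq.Seq_cong)
    show "mor_eq n {..<sum_list ks} (word_mor m' (mcod ?f)) (word_mor m (mcod f))"
      using f lt by (auto intro!: mor_eq_word_mor[OF wd] m)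
    show "mor_eq n {..<sum_list ks} (subst_mor (\<lambda>l. mdom (m l)) ?f) (subst_mor (\<lambda>l. mdom (m l)) f)"
      using f mm is_mor_word by (fastforce intro!: mor_eq_subst_mor intro: mor_eq.sym rep_mor_class)
    show "mdom (word_mor m' (mcod ?f)) = mcod (subst_mor (\<lambda>l. mdom (m l)) ?f)"
      using f lt mm by (auto intro!: subst_word_cong)
  qed
  then show ?thesis
    unfolding Mon_comp2_def Let_def m'_def by (rule mor_class_eqI)
qed

section \<open>Calculating in permutative categories\<close>

text \<open>The axioms in terms of \<open>hom\<close> mention objects that do not occur in the composites, so that they
  cannot serve as rewrite rules. These are their forms in terms of domains and codomains.\<close>

context category
begin

lemma hom_iff: "f \<in> hom C A B \<longleftrightarrow> f \<in> Arr C \<and> Dom C f = A \<and> Cod C f = B"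
  by (auto simp: hom_def)

lemma arr_simps [simp]:
  "f \<in> Arr C \<Longrightarrow> Dom C f \<in> Obj C"
  "f \<in> Arr C \<Longrightarrow> Cod C f \<in> Obj C"
  "A \<in> Obj C \<Longrightarrow> Ide C A \<in> Arr C"
  "A \<in> Obj C \<Longrightarrow> Dom C (Ide C A) = A"
  "A \<in> Obj C \<Longrightarrow> Cod C (Ide C A) = A"
  using Dom_Obj Cod_Obj Ide_hom by (auto simp: hom_iff)

lemma cmp_simps [simp]:
  assumes "f \<in> Arr C" "g \<in> Arr C" "Dom C g = Cod C f"
  shows "g \<cdot> f \<in> Arr C" "Dom C (g \<cdot> f) = Dom C f" "Cod C (g \<cdot> f) = Cod C g"
  using Cmp_hom[of f "Dom C f" "Cod C f" g "Cod C g"] assms by (auto simp: hom_iff)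

lemma cmp_Ide [simp]:
  "f \<in> Arr C \<Longrightarrow> Dom C f = A \<Longrightarrow> f \<cdot> Ide C A = f"
  "f \<in> Arr C \<Longrightarrow> Cod C f = A \<Longrightarrow> Ide C A \<cdot> f = f"
  using Cmp_Ide[of f "Dom C f" "Cod C f"] Ide_Cmp[of f "Dom C f" "Cod C f"] by (auto simp: hom_iff)

lemma cmp_assoc:
  assumes "f \<in> Arr C" "g \<in> Arr C" "h \<in> Arr C" "Dom C g = Cod C f" "Dom C h = Cod C g"
  shows "(h \<cdot> g) \<cdot> f = h \<cdot> (g \<cdot> f)"
  using Cmp_assoc[of f "Dom C f" "Cod C f" g "Cod C g" h "Cod C h"] assms by (auto simp: hom_iff)

text \<open>Assignments have a value at every letter, whether or not it occurs in the word at hand; so no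
  side condition has to refer to a set of letters.\<close>

definition asg :: "('x \<Rightarrow> 'o) \<Rightarrow> bool" where "asg a \<longleftrightarrow> (\<forall>x. a x \<in> Obj C)"
definition arr_asg :: "('x \<Rightarrow> 'm) \<Rightarrow> bool" where "arr_asg m \<longleftrightarrow> (\<forall>x. m x \<in> Arr C)"

lemma asg_simps [simp]:
  "asg a \<Longrightarrow> a x \<in> Obj C"
  "asg a \<Longrightarrow> A \<in> Obj C \<Longrightarrow> asg (a(x := A))"
  "arr_asg m \<Longrightarrow> m x \<in> Arr C"
  "arr_asg m \<Longrightarrow> f \<in> Arr C \<Longrightarrow> arr_asg (m(x := f))"
  "arr_asg m \<Longrightarrow> asg (\<lambda>x. Dom C (m x))"
  "arr_asg m \<Longrightarrow> asg (\<lambda>x. Cod C (m x))"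
  "asg a \<Longrightarrow> arr_asg (\<lambda>x. Ide C (a x))"
  by (auto simp: asg_def arr_asg_def)

end

context strict_monoidal
begin

lemmas [simp] = unit_Obj tn_Obj tn_unit

lemma tm_simps [simp]:
  assumes "f \<in> Arr C" "g \<in> Arr C"
  shows "f \<odot> g \<in> Arr C" "Dom C (f \<odot> g) = Dom C f \<otimes> Dom C g" "Cod C (f \<odot> g) = Cod C f \<otimes> Cod C g"
  using tm_hom[of f "Dom C f" "Cod C f" g "Dom C g" "Cod C g"] assms by (auto simp: hom_iff)

lemmas [simp] = tm_Ide tm_unit

lemma tm_merge:
  assumes "f \<in> Arr C" "g \<in> Arr C" "f' \<in> Arr C" "g' \<in> Arr C" "Dom C f' = Cod C f" "Dom C g' = Cod C g"
  shows "(f' \<odot> g') \<cdot> (f \<odot> g) = (f' \<cdot> f) \<odot> (g' \<cdot> g)"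
  using tm_Cmp[of f "Dom C f" "Cod C f" f' "Cod C f'" g "Dom C g" "Cod C g" g' "Cod C g'"] assms
  by (auto simp: hom_iff)

lemma tm_merge':
  assumes "f \<in> Arr C" "g \<in> Arr C" "f' \<in> Arr C" "g' \<in> Arr C" "Dom C f' = Cod C f" "Dom C g' = Cod C g"
    "h \<in> Arr C" "Dom C f \<otimes> Dom C g = Cod C h"
  shows "(f' \<odot> g') \<cdot> (f \<odot> g) \<cdot> h = ((f' \<cdot> f) \<odot> (g' \<cdot> g)) \<cdot> h"
  using assms by (simp add: cmp_assoc[symmetric] tm_merge)

end

context permutative_category
begin

lemma zeta_simps [simp]:
  assumes "A \<in> Obj C" "B \<in> Obj C"
  shows "\<zeta> A B \<in> Arr C" "Dom C (\<zeta> A B) = A \<oplus> B" "Cod C (\<zeta> A B) = B \<oplus> A"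
  using zeta_hom[OF assms] by (auto simp: hom_iff)

lemmas plus_assoc = tn_assoc tm_assoc
lemmas plus_merge = tm_merge tm_merge'

end

section \<open>Additive functors\<close>

text \<open>Fixing all variables but one of a multilinear functor leaves a functor of this kind. The
  conditions on a linearity constraint that involve a single variable are thus inherited by
  composites because additive functors compose.\<close>

locale additive = permutative_category C for C :: "('o, 'm) permcat" (structure) +
  fixes Fo :: "'o \<Rightarrow> 'o" and Fm :: "'m \<Rightarrow> 'm" and l :: "'o \<Rightarrow> 'o \<Rightarrow> 'm"
  assumes Fo_Obj [simp]: "A \<in> Obj C \<Longrightarrow> Fo A \<in> Obj C"
    and Fm_Arr [simp]: "f \<in> Arr C \<Longrightarrow> Fm f \<in> Arr C"
      "f \<in> Arr C \<Longrightarrow> Dom C (Fm f) = Fo (Dom C f)" "f \<in> Arr C \<Longrightarrow> Cod C (Fm f) = Fo (Cod C f)"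
    and Fm_Ide [simp]: "A \<in> Obj C \<Longrightarrow> Fm (Ide C A) = Ide C (Fo A)"
    and Fm_Cmp: "f \<in> Arr C \<Longrightarrow> g \<in> Arr C \<Longrightarrow> Dom C g = Cod C f \<Longrightarrow> Fm (g \<cdot> f) = Fm g \<cdot> Fm f"
    and Fo_zero [simp]: "Fo \<zero> = \<zero>"
    and l_Arr [simp]: "A \<in> Obj C \<Longrightarrow> B \<in> Obj C \<Longrightarrow> l A B \<in> Arr C"
      "A \<in> Obj C \<Longrightarrow> B \<in> Obj C \<Longrightarrow> Dom C (l A B) = Fo A \<oplus> Fo B"
      "A \<in> Obj C \<Longrightarrow> B \<in> Obj C \<Longrightarrow> Cod C (l A B) = Fo (A \<oplus> B)"
    and l_nat: "f \<in> Arr C \<Longrightarrow> g \<in> Arr C \<Longrightarrow>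
      l (Cod C f) (Cod C g) \<cdot> (Fm f \<boxplus> Fm g) = Fm (f \<boxplus> g) \<cdot> l (Dom C f) (Dom C g)"
    and l_zero [simp]: "A \<in> Obj C \<Longrightarrow> l A \<zero> = Ide C (Fo A)" "A \<in> Obj C \<Longrightarrow> l \<zero> A = Ide C (Fo A)"
    and l_assoc: "A \<in> Obj C \<Longrightarrow> B \<in> Obj C \<Longrightarrow> D \<in> Obj C \<Longrightarrow>
      l (A \<oplus> B) D \<cdot> (l A B \<boxplus> Ide C (Fo D)) = l A (B \<oplus> D) \<cdot> (Ide C (Fo A) \<boxplus> l B D)"
    and l_zeta: "A \<in> Obj C \<Longrightarrow> B \<in> Obj C \<Longrightarrow>
      Fm (\<zeta> A B) \<cdot> l A B = l B A \<cdot> \<zeta> (Fo A) (Fo B)"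
begin

lemma sum4_eq:
  assumes [simp]: "A \<in> Obj C" "B \<in> Obj C" "D \<in> Obj C" "E \<in> Obj C"
  shows "l (A \<oplus> B) (D \<oplus> E) \<cdot> (l A B \<boxplus> l D E) =
    l A (B \<oplus> (D \<oplus> E)) \<cdot> (Ide C (Fo A) \<boxplus> (l (B \<oplus> D) E \<cdot> (l B D \<boxplus> Ide C (Fo E))))"
proof -
  have "l (A \<oplus> B) (D \<oplus> E) \<cdot> (l A B \<boxplus> l D E) =
      (l (A \<oplus> B) (D \<oplus> E) \<cdot> (l A B \<boxplus> Ide C (Fo (D \<oplus> E)))) \<cdot> (Ide C (Fo A \<oplus> Fo B) \<boxplus> l D E)"
    by (simp add: cmp_assoc plus_merge)
  also have "\<dots> = l A (B \<oplus> (D \<oplus> E)) \<cdot> (Ide C (Fo A) \<boxplus> l B (D \<oplus> E)) \<cdot>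
      (Ide C (Fo A) \<boxplus> (Ide C (Fo B) \<boxplus> l D E))"
    by (simp add: l_assoc cmp_assoc plus_assoc flip: tm_Ide)
  also have "\<dots> = l A (B \<oplus> (D \<oplus> E)) \<cdot> (Ide C (Fo A) \<boxplus> (l B (D \<oplus> E) \<cdot> (Ide C (Fo B) \<boxplus> l D E)))"
    by (simp add: plus_merge)
  finally show ?thesis
    by (simp add: l_assoc)
qed

text \<open>An additive functor respects the interchange of the inner summands: both sides bring the
  four summands together in the order that starts with the two inner ones.\<close>

lemma sum4_interchange:
  assumes [simp]: "A \<in> Obj C" "B \<in> Obj C" "D \<in> Obj C" "E \<in> Obj C"
  shows "Fm (Ide C A \<boxplus> \<zeta> B D \<boxplus> Ide C E) \<cdot> l (A \<oplus> B) (D \<oplus> E) \<cdot> (l A B \<boxplus> l D E) =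
    l (A \<oplus> D) (B \<oplus> E) \<cdot> (l A D \<boxplus> l B E) \<cdot>
      (Ide C (Fo A) \<boxplus> \<zeta> (Fo B) (Fo D) \<boxplus> Ide C (Fo E))"
proof -
  let ?f = "\<zeta> B D \<boxplus> Ide C E"
  have 1: "Fm ?f \<cdot> l (B \<oplus> D) E = l (D \<oplus> B) E \<cdot> (Fm (\<zeta> B D) \<boxplus> Ide C (Fo E))"
    using l_nat[of "\<zeta> B D" "Ide C E"] by simp
  have 2: "Fm ?f \<cdot> l (B \<oplus> D) E \<cdot> (l B D \<boxplus> Ide C (Fo E)) =
      l (D \<oplus> B) E \<cdot> (l D B \<boxplus> Ide C (Fo E)) \<cdot> (\<zeta> (Fo B) (Fo D) \<boxplus> Ide C (Fo E))"
    by (simp add: cmp_assoc[symmetric] 1) (simp add: cmp_assoc plus_merge l_zeta)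
  have 3: "Fm (Ide C A \<boxplus> ?f) \<cdot> l A (B \<oplus> (D \<oplus> E)) = l A (D \<oplus> (B \<oplus> E)) \<cdot> (Ide C (Fo A) \<boxplus> Fm ?f)"
    using l_nat[of "Ide C A" ?f] by (simp add: plus_assoc)
  have "Fm (Ide C A \<boxplus> \<zeta> B D \<boxplus> Ide C E) \<cdot> l (A \<oplus> B) (D \<oplus> E) \<cdot> (l A B \<boxplus> l D E) =
      (Fm (Ide C A \<boxplus> ?f) \<cdot> l A (B \<oplus> (D \<oplus> E))) \<cdot>
        (Ide C (Fo A) \<boxplus> (l (B \<oplus> D) E \<cdot> (l B D \<boxplus> Ide C (Fo E))))"
    by (simp add: sum4_eq cmp_assoc plus_assoc)
  also have "\<dots> = l A (D \<oplus> (B \<oplus> E)) \<cdot>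
      (Ide C (Fo A) \<boxplus> (Fm ?f \<cdot> l (B \<oplus> D) E \<cdot> (l B D \<boxplus> Ide C (Fo E))))"
    unfolding 3 by (simp add: cmp_assoc plus_merge plus_assoc)
  also have "\<dots> = (l A (D \<oplus> (B \<oplus> E)) \<cdot> (Ide C (Fo A) \<boxplus> (l (D \<oplus> B) E \<cdot> (l D B \<boxplus> Ide C (Fo E))))) \<cdot>
      (Ide C (Fo A) \<boxplus> \<zeta> (Fo B) (Fo D) \<boxplus> Ide C (Fo E))"
    unfolding 2 by (simp add: cmp_assoc plus_merge plus_assoc)
  also have "\<dots> = (l (A \<oplus> D) (B \<oplus> E) \<cdot> (l A D \<boxplus> l B E)) \<cdot>
      (Ide C (Fo A) \<boxplus> \<zeta> (Fo B) (Fo D) \<boxplus> Ide C (Fo E))"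
    by (simp add: sum4_eq)
  also have "\<dots> = l (A \<oplus> D) (B \<oplus> E) \<cdot> (l A D \<boxplus> l B E) \<cdot>
      (Ide C (Fo A) \<boxplus> \<zeta> (Fo B) (Fo D) \<boxplus> Ide C (Fo E))"
    by (rule cmp_assoc) (auto simp: plus_assoc)
  finally show ?thesis .
qed

end

lemma (in permutative_category) additive_comp:
  assumes "additive C Go Gm k" "additive C Fo Fm l"
  shows "additive C (\<lambda>A. Go (Fo A)) (\<lambda>f. Gm (Fm f)) (\<lambda>A B. Gm (l A B) \<cdot> k (Fo A) (Fo B))"
proof -
  interpret F: additive C Fo Fm l by fact
  interpret G: additive C Go Gm k by fact
  note [simp] = cmp_assoc plus_merge
  show ?thesis
  proof
    fix f g assume [simp]: "f \<in> Arr C" "g \<in> Arr C"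
    have "Gm (l (Cod C f) (Cod C g)) \<cdot> k (Fo (Cod C f)) (Fo (Cod C g)) \<cdot> (Gm (Fm f) \<boxplus> Gm (Fm g)) =
      Gm (l (Cod C f) (Cod C g) \<cdot> (Fm f \<boxplus> Fm g)) \<cdot> k (Fo (Dom C f)) (Fo (Dom C g))"
      using G.l_nat[of "Fm f" "Fm g"] by (simp add: G.Fm_Cmp)
    then show "(Gm (l (Cod C f) (Cod C g)) \<cdot> k (Fo (Cod C f)) (Fo (Cod C g))) \<cdot>
          (Gm (Fm f) \<boxplus> Gm (Fm g)) =
       Gm (Fm (f \<boxplus> g)) \<cdot> Gm (l (Dom C f) (Dom C g)) \<cdot> k (Fo (Dom C f)) (Fo (Dom C g))"
      by (simp add: F.l_nat G.Fm_Cmp)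
  next
    fix A B D assume [simp]: "A \<in> Obj C" "B \<in> Obj C" "D \<in> Obj C"
    have 1: "k (Fo (A \<oplus> B)) (Fo D) \<cdot> (Gm (l A B) \<boxplus> Ide C (Go (Fo D))) =
      Gm (l A B \<boxplus> Ide C (Fo D)) \<cdot> k (Fo A \<oplus> Fo B) (Fo D)"
      using G.l_nat[of "l A B" "Ide C (Fo D)"] by simp
    have 2: "k (Fo A) (Fo (B \<oplus> D)) \<cdot> (Ide C (Go (Fo A)) \<boxplus> Gm (l B D)) =
      Gm (Ide C (Fo A) \<boxplus> l B D) \<cdot> k (Fo A) (Fo B \<oplus> Fo D)"
      using G.l_nat[of "Ide C (Fo A)" "l B D"] by simp
    have "(Gm (l (A \<oplus> B) D) \<cdot> k (Fo (A \<oplus> B)) (Fo D)) \<cdot>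
        ((Gm (l A B) \<cdot> k (Fo A) (Fo B)) \<boxplus> Ide C (Go (Fo D))) =
      Gm (l (A \<oplus> B) D) \<cdot> (k (Fo (A \<oplus> B)) (Fo D) \<cdot> (Gm (l A B) \<boxplus> Ide C (Go (Fo D)))) \<cdot>
        (k (Fo A) (Fo B) \<boxplus> Ide C (Go (Fo D)))"
      by (simp add: plus_assoc)
    also have "\<dots> = Gm (l (A \<oplus> B) D \<cdot> (l A B \<boxplus> Ide C (Fo D))) \<cdot>
        (k (Fo A \<oplus> Fo B) (Fo D) \<cdot> (k (Fo A) (Fo B) \<boxplus> Ide C (Go (Fo D))))"
      unfolding 1 by (simp add: G.Fm_Cmp)
    also have "\<dots> = Gm (l A (B \<oplus> D) \<cdot> (Ide C (Fo A) \<boxplus> l B D)) \<cdot>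
        (k (Fo A) (Fo B \<oplus> Fo D) \<cdot> (Ide C (Go (Fo A)) \<boxplus> k (Fo B) (Fo D)))"
      by (simp only: F.l_assoc G.l_assoc \<open>A \<in> Obj C\<close> \<open>B \<in> Obj C\<close> \<open>D \<in> Obj C\<close> F.Fo_Obj)
    also have "\<dots> = Gm (l A (B \<oplus> D)) \<cdot> (k (Fo A) (Fo (B \<oplus> D)) \<cdot>
        (Ide C (Go (Fo A)) \<boxplus> Gm (l B D))) \<cdot> (Ide C (Go (Fo A)) \<boxplus> k (Fo B) (Fo D))"
      unfolding 2 by (simp add: G.Fm_Cmp plus_assoc)
    also have "\<dots> = (Gm (l A (B \<oplus> D)) \<cdot> k (Fo A) (Fo (B \<oplus> D))) \<cdot>
        (Ide C (Go (Fo A)) \<boxplus> (Gm (l B D) \<cdot> k (Fo B) (Fo D)))"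
      by (simp add: plus_assoc)
    finally show "(Gm (l (A \<oplus> B) D) \<cdot> k (Fo (A \<oplus> B)) (Fo D)) \<cdot>
        ((Gm (l A B) \<cdot> k (Fo A) (Fo B)) \<boxplus> Ide C (Go (Fo D))) =
      (Gm (l A (B \<oplus> D)) \<cdot> k (Fo A) (Fo (B \<oplus> D))) \<cdot>
        (Ide C (Go (Fo A)) \<boxplus> (Gm (l B D) \<cdot> k (Fo B) (Fo D)))" .
  next
    fix A B assume [simp]: "A \<in> Obj C" "B \<in> Obj C"
    have "Gm (Fm (\<zeta> A B)) \<cdot> Gm (l A B) \<cdot> k (Fo A) (Fo B) =
      Gm (Fm (\<zeta> A B) \<cdot> l A B) \<cdot> k (Fo A) (Fo B)"
      by (simp add: G.Fm_Cmp)
    then show "Gm (Fm (\<zeta> A B)) \<cdot> Gm (l A B) \<cdot> k (Fo A) (Fo B) =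
      (Gm (l B A) \<cdot> k (Fo B) (Fo A)) \<cdot> \<zeta> (Go (Fo A)) (Go (Fo B))"
      by (simp add: F.l_zeta G.l_zeta G.Fm_Cmp)
  qed (auto simp: F.Fm_Cmp G.Fm_Cmp)
qed

lemma additive_cong:
  assumes "additive C Fo Fm l"
    and Fo: "\<And>A. A \<in> Obj C \<Longrightarrow> Go A = Fo A" and Fm: "\<And>f. f \<in> Arr C \<Longrightarrow> Gm f = Fm f"
    and l: "\<And>A B. A \<in> Obj C \<Longrightarrow> B \<in> Obj C \<Longrightarrow> k A B = l A B"
  shows "additive C Go Gm k"
proof -
  interpret additive C Fo Fm l by fact
  show ?thesis
    by standard (auto simp: Fo Fm l Fm_Cmp l_nat l_assoc l_zeta)
qed

lemma (in permutative_category) additive_id: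
  "additive C (\<lambda>A. A) (\<lambda>f. f) (\<lambda>A B. Ide C (A \<oplus> B))"
  by standard (auto simp: plus_assoc)

section \<open>Evaluating words and formal morphisms in an \<open>E\<^sub>n\<close>-monoidal category\<close>

text \<open>Words are evaluated at assignments of objects (or arrows) to all letters. Named letters, in
  place of numbered arguments, make the evaluation of a product independent of how the letters are
  distributed over its factors.\<close>

primrec obj_val :: "('o, 'm) en_data \<Rightarrow> ('x \<Rightarrow> 'o) \<Rightarrow> 'x word \<Rightarrow> 'o" where
  "obj_val S a Unit = ten_unit S"
| "obj_val S a (Letter x) = a x"
| "obj_val S a (Prod i ws) = foldr (ten_o S i) (map (obj_val S a) ws) (ten_unit S)"

primrec arr_val :: "('o, 'm) permcat \<Rightarrow> ('o, 'm) en_data \<Rightarrow> ('x \<Rightarrow> 'm) \<Rightarrow> 'x word \<Rightarrow> 'm" where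
  "arr_val C S m Unit = Ide C (ten_unit S)"
| "arr_val C S m (Letter x) = m x"
| "arr_val C S m (Prod i ws) = foldr (ten_m S i) (map (arr_val C S m) ws) (Ide C (ten_unit S))"

text \<open>The linearity constraint of a word in the variable \<open>x\<close>, with values \<open>a x\<close> and \<open>A'\<close>:
  distribute the sum over the products on the path from the root of the word to the letter \<open>x\<close>.\<close>

fun lin_val :: "('o, 'm) permcat \<Rightarrow> ('o, 'm) en_data \<Rightarrow> 'x \<Rightarrow> ('x \<Rightarrow> 'o) \<Rightarrow> 'o \<Rightarrow> 'x word \<Rightarrow> 'm"
  and lin_vals :: "('o, 'm) permcat \<Rightarrow> ('o, 'm) en_data \<Rightarrow> nat \<Rightarrow> 'x \<Rightarrow> ('x \<Rightarrow> 'o) \<Rightarrow> 'o \<Rightarrow> 'x word list \<Rightarrow> 'm"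
where
  "lin_val C S x a A' Unit = undefined"
| "lin_val C S x a A' (Letter y) = Ide C (plus_o C (a x) A')"
| "lin_val C S x a A' (Prod i ws) = lin_vals C S i x a A' ws"
| "lin_vals C S i x a A' [] = undefined"
| "lin_vals C S i x a A' (v # vs) =
    (if x \<in> set (letters v)
     then Cmp C (ten_m S i (lin_val C S x a A' v)
         (Ide C (foldr (ten_o S i) (map (obj_val S a) vs) (ten_unit S))))
       (distl S i (obj_val S a v) (obj_val S (a(x := A')) v)
         (foldr (ten_o S i) (map (obj_val S a) vs) (ten_unit S)))
     else Cmp C (ten_m S i (Ide C (obj_val S a v)) (lin_vals C S i x a A' vs))
       (distr S i (obj_val S a v) (foldr (ten_o S i) (map (obj_val S a) vs) (ten_unit S))
         (foldr (ten_o S i) (map (obj_val S (a(x := A'))) vs) (ten_unit S))))"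

primrec mor_val :: "('o, 'm) permcat \<Rightarrow> ('o, 'm) en_data \<Rightarrow> ('x \<Rightarrow> 'o) \<Rightarrow> 'x mor \<Rightarrow> 'm" where
  "mor_val C S a (Idt w) = Ide C (obj_val S a w)"
| "mor_val C S a (g \<bullet> f) = Cmp C (mor_val C S a g) (mor_val C S a f)"
| "mor_val C S a (Ten i f g) = ten_m S i (mor_val C S a f) (mor_val C S a g)"
| "mor_val C S a (Exch i j p q r s) =
    exch S i j (obj_val S a p) (obj_val S a q) (obj_val S a r) (obj_val S a s)"

locale En_category = permutative_category C for C :: "('o, 'm) permcat" (structure) +
  fixes n :: nat and S :: "('o, 'm) en_data"
  assumes n: "1 \<le> n" and En: "En_monoidal n C S"
begin

definition ok :: "nat \<Rightarrow> bool" where "ok i \<longleftrightarrow> 1 \<le> i \<and> i \<le> n"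

abbreviation unit_obj ("\<u>") where "\<u> \<equiv> ten_unit S"
abbreviation ten_obj ("(_ \<otimes>\<^bsub>_\<^esub> _)" [76, 0, 76] 75) where "A \<otimes>\<^bsub>i\<^esub> B \<equiv> ten_o S i A B"
abbreviation ten_arr ("(_ \<odot>\<^bsub>_\<^esub> _)" [76, 0, 76] 75) where "f \<odot>\<^bsub>i\<^esub> g \<equiv> ten_m S i f g"
abbreviation "dl \<equiv> distl S"
abbreviation "dr \<equiv> distr S"
abbreviation "\<eta> \<equiv> exch S"

subsection \<open>The axioms as rewrite rules\<close>

lemma strict: "ok i \<Longrightarrow> strict_monoidal C (ten_o S i) (ten_m S i) \<u>"
  using En by (auto simp: En_monoidal_def nfold_monoidal_def ok_def)

lemma ring: "ok i \<Longrightarrow> ring_category C (ten_o S i) (ten_m S i) \<u> (dl i) (dr i)"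
  using En by (auto simp: En_monoidal_def ok_def)

lemma ok_exchange:
  assumes "ok i" "i < j" "ok j"
  shows "exchange C (ten_o S i) (ten_m S i) (ten_o S j) (ten_m S j) \<u> (\<eta> i j)"
    "exchange_sum C (ten_o S i) (ten_m S i) (ten_o S j) (ten_m S j) (\<eta> i j) (dl i) (dr i) (dl j) (dr j)"
  using En assms by (auto simp: En_monoidal_def nfold_monoidal_def ok_def)

lemma ok_hexagon:
  assumes "ok i" "i < j" "j < k" "ok k"
  shows "exchange_hexagon C (ten_o S i) (ten_m S i) (ten_o S j) (ten_m S j) (ten_o S k) (ten_m S k)
    (\<eta> i j) (\<eta> i k) (\<eta> j k)"
  using En assms by (auto simp: En_monoidal_def nfold_monoidal_def ok_def)

lemma unit_Obj' [simp]: "\<u> \<in> Obj C"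
  using strict_monoidal.unit_Obj[OF strict[of 1]] n by (auto simp: ok_def)

lemma ten_simps [simp]:
  assumes "ok i"
  shows "A \<in> Obj C \<Longrightarrow> B \<in> Obj C \<Longrightarrow> A \<otimes>\<^bsub>i\<^esub> B \<in> Obj C"
    "f \<in> Arr C \<Longrightarrow> g \<in> Arr C \<Longrightarrow> f \<odot>\<^bsub>i\<^esub> g \<in> Arr C"
    "f \<in> Arr C \<Longrightarrow> g \<in> Arr C \<Longrightarrow> Dom C (f \<odot>\<^bsub>i\<^esub> g) = Dom C f \<otimes>\<^bsub>i\<^esub> Dom C g"
    "f \<in> Arr C \<Longrightarrow> g \<in> Arr C \<Longrightarrow> Cod C (f \<odot>\<^bsub>i\<^esub> g) = Cod C f \<otimes>\<^bsub>i\<^esub> Cod C g"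
    "A \<in> Obj C \<Longrightarrow> B \<in> Obj C \<Longrightarrow> Ide C A \<odot>\<^bsub>i\<^esub> Ide C B = Ide C (A \<otimes>\<^bsub>i\<^esub> B)"
    "A \<in> Obj C \<Longrightarrow> \<u> \<otimes>\<^bsub>i\<^esub> A = A" "A \<in> Obj C \<Longrightarrow> A \<otimes>\<^bsub>i\<^esub> \<u> = A"
    "f \<in> Arr C \<Longrightarrow> Ide C \<u> \<odot>\<^bsub>i\<^esub> f = f" "f \<in> Arr C \<Longrightarrow> f \<odot>\<^bsub>i\<^esub> Ide C \<u> = f"
proof -
  interpret strict_monoidal C "ten_o S i" "ten_m S i" \<u>
    using assms by (rule strict)
  show "A \<in> Obj C \<Longrightarrow> B \<in> Obj C \<Longrightarrow> A \<otimes>\<^bsub>i\<^esub> B \<in> Obj C"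
    "f \<in> Arr C \<Longrightarrow> g \<in> Arr C \<Longrightarrow> f \<odot>\<^bsub>i\<^esub> g \<in> Arr C"
    "f \<in> Arr C \<Longrightarrow> g \<in> Arr C \<Longrightarrow> Dom C (f \<odot>\<^bsub>i\<^esub> g) = Dom C f \<otimes>\<^bsub>i\<^esub> Dom C g"
    "f \<in> Arr C \<Longrightarrow> g \<in> Arr C \<Longrightarrow> Cod C (f \<odot>\<^bsub>i\<^esub> g) = Cod C f \<otimes>\<^bsub>i\<^esub> Cod C g"
    "A \<in> Obj C \<Longrightarrow> B \<in> Obj C \<Longrightarrow> Ide C A \<odot>\<^bsub>i\<^esub> Ide C B = Ide C (A \<otimes>\<^bsub>i\<^esub> B)"
    "A \<in> Obj C \<Longrightarrow> \<u> \<otimes>\<^bsub>i\<^esub> A = A" "A \<in> Obj C \<Longrightarrow> A \<otimes>\<^bsub>i\<^esub> \<u> = A"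
    "f \<in> Arr C \<Longrightarrow> Ide C \<u> \<odot>\<^bsub>i\<^esub> f = f" "f \<in> Arr C \<Longrightarrow> f \<odot>\<^bsub>i\<^esub> Ide C \<u> = f"
    by simp_all
qed

lemmas ten_assoc = strict_monoidal.tn_assoc[OF strict] strict_monoidal.tm_assoc[OF strict]
lemmas ten_merge = strict_monoidal.tm_merge[OF strict] strict_monoidal.tm_merge'[OF strict]

lemma dist_simps [simp]:
  assumes "ok i" "A \<in> Obj C" "B \<in> Obj C" "D \<in> Obj C"
  shows "dl i A B D \<in> Arr C" "Dom C (dl i A B D) = (A \<otimes>\<^bsub>i\<^esub> D) \<oplus> (B \<otimes>\<^bsub>i\<^esub> D)"
    "Cod C (dl i A B D) = (A \<oplus> B) \<otimes>\<^bsub>i\<^esub> D"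
    "dr i A B D \<in> Arr C" "Dom C (dr i A B D) = (A \<otimes>\<^bsub>i\<^esub> B) \<oplus> (A \<otimes>\<^bsub>i\<^esub> D)"
    "Cod C (dr i A B D) = A \<otimes>\<^bsub>i\<^esub> (B \<oplus> D)"
  using ring_category.dl_hom[OF ring, of i A B D] ring_category.dr_hom[OF ring, of i A B D] assms
  by (auto simp: hom_iff)

lemma dist_nat:
  assumes "ok i" "f \<in> Arr C" "g \<in> Arr C" "h \<in> Arr C"
  shows "Cod C f = A \<Longrightarrow> Cod C g = B \<Longrightarrow> Cod C h = D \<Longrightarrow>
      dl i A B D \<cdot> (f \<odot>\<^bsub>i\<^esub> h \<boxplus> g \<odot>\<^bsub>i\<^esub> h) =
      ((f \<boxplus> g) \<odot>\<^bsub>i\<^esub> h) \<cdot> dl i (Dom C f) (Dom C g) (Dom C h)"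
    "Cod C f = A \<Longrightarrow> Cod C g = B \<Longrightarrow> Cod C h = D \<Longrightarrow>
      dr i A B D \<cdot> (f \<odot>\<^bsub>i\<^esub> g \<boxplus> f \<odot>\<^bsub>i\<^esub> h) =
      (f \<odot>\<^bsub>i\<^esub> (g \<boxplus> h)) \<cdot> dr i (Dom C f) (Dom C g) (Dom C h)"
  using ring_category.dl_nat[OF ring[OF assms(1)], of f "Dom C f" "Cod C f" g "Dom C g" "Cod C g" h "Dom C h" "Cod C h"]
    ring_category.dr_nat[OF ring[OF assms(1)], of f "Dom C f" "Cod C f" g "Dom C g" "Cod C g" h "Dom C h" "Cod C h"]
    assms by (auto simp: hom_iff)

lemmas dist_unit [simp] = ring_category.dl_unit[OF ring] ring_category.dr_unit[OF ring]

lemma ten_zero [simp]: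
  assumes "ok i"
  shows "A \<in> Obj C \<Longrightarrow> \<zero> \<otimes>\<^bsub>i\<^esub> A = \<zero>" "A \<in> Obj C \<Longrightarrow> A \<otimes>\<^bsub>i\<^esub> \<zero> = \<zero>"
    "f \<in> Arr C \<Longrightarrow> Ide C \<zero> \<odot>\<^bsub>i\<^esub> f = Ide C \<zero>" "f \<in> Arr C \<Longrightarrow> f \<odot>\<^bsub>i\<^esub> Ide C \<zero> = Ide C \<zero>"
  using ring_category.zero_tn[OF ring[OF assms]] ring_category.zero_tm[OF ring[OF assms]] by auto

lemma dist_zero [simp]:
  assumes "ok i" "A \<in> Obj C" "B \<in> Obj C"
  shows "dl i \<zero> A B = Ide C (A \<otimes>\<^bsub>i\<^esub> B)" "dl i A \<zero> B = Ide C (A \<otimes>\<^bsub>i\<^esub> B)"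
    "dl i A B \<zero> = Ide C \<zero>"
    "dr i \<zero> A B = Ide C \<zero>" "dr i A \<zero> B = Ide C (A \<otimes>\<^bsub>i\<^esub> B)" "dr i A B \<zero> = Ide C (A \<otimes>\<^bsub>i\<^esub> B)"
  using assms ring_category.dl_zero[OF ring] ring_category.dr_zero[OF ring] by auto

lemma additive_ten_left:
  assumes [simp]: "ok i" "D \<in> Obj C"
  shows "additive C (\<lambda>A. A \<otimes>\<^bsub>i\<^esub> D) (\<lambda>f. f \<odot>\<^bsub>i\<^esub> Ide C D) (\<lambda>A B. dl i A B D)"
proof -
  interpret ring_category C "ten_o S i" "ten_m S i" \<u> "dl i" "dr i"
    by (rule ring) fact
  show ?thesis
    by standard (auto simp: ten_merge dist_nat dl_assoc dl_zeta)
qed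

lemma additive_ten_right:
  assumes [simp]: "ok i" "D \<in> Obj C"
  shows "additive C (\<lambda>A. D \<otimes>\<^bsub>i\<^esub> A) (\<lambda>f. Ide C D \<odot>\<^bsub>i\<^esub> f) (dr i D)"
proof -
  interpret ring_category C "ten_o S i" "ten_m S i" \<u> "dl i" "dr i"
    by (rule ring) fact
  show ?thesis
    by standard (auto simp: ten_merge dist_nat dr_assoc dr_zeta)
qed

subsection \<open>Objects and arrows\<close>

abbreviation wd :: "'x word \<Rightarrow> bool" where "wd w \<equiv> is_word n UNIV w"
abbreviation "Wo \<equiv> obj_val S"
abbreviation "Wm \<equiv> arr_val C S"
abbreviation "Lin \<equiv> lin_val C S"
abbreviation "Mv \<equiv> mor_val C S"
abbreviation "Wos i a vs \<equiv> foldr (ten_o S i) (map (Wo a) vs) \<u>"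

lemma wd_wten [simp]: "ok i \<Longrightarrow> wd v \<Longrightarrow> wd w \<Longrightarrow> wd (wten i v w)"
  by (auto simp: ok_def wten_word)

lemma wd_induct [consumes 1, case_names Unit Letter wten]:
  assumes "wd w" "P Unit" "\<And>x. P (Letter x)"
    and "\<And>i v w. ok i \<Longrightarrow> wd v \<Longrightarrow> wd w \<Longrightarrow> P v \<Longrightarrow> P w \<Longrightarrow> P (wten i v w)"
  shows "P w"
  using assms(1) by (induction rule: is_word_induct) (auto simp: ok_def assms)

lemma wd_Prod: "wd (Prod i ws) \<Longrightarrow> ok i \<and> (\<forall>w \<in> set ws. wd w)"
  by (auto simp: ok_def)

lemma wd_factors: "wd w \<Longrightarrow> v \<in> set (factors i w) \<Longrightarrow> wd v"
  by (cases w) (auto split: if_splits)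

lemma obj_val_cong: "(\<And>x. x \<in> set (letters w) \<Longrightarrow> a x = b x) \<Longrightarrow> Wo a w = Wo b w"
proof (induction w)
  case (Prod i ws)
  then have "map (Wo a) ws = map (Wo b) ws" by auto
  then show ?case by (simp only: obj_val.simps)
qed auto

lemma arr_val_cong: "(\<And>x. x \<in> set (letters w) \<Longrightarrow> a x = b x) \<Longrightarrow> Wm a w = Wm b w"
proof (induction w)
  case (Prod i ws)
  then have "map (Wm a) ws = map (Wm b) ws" by auto
  then show ?case by (simp only: arr_val.simps)
qed auto

lemma obj_val_upd [simp]: "x \<notin> set (letters w) \<Longrightarrow> Wo (a(x := A)) w = Wo a w"
  by (rule obj_val_cong) auto

lemma arr_val_upd [simp]: "x \<notin> set (letters w) \<Longrightarrow> Wm (m(x := f)) w = Wm m w"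
  by (rule arr_val_cong) auto

lemma obj_val_Obj [simp]: "asg a \<Longrightarrow> wd w \<Longrightarrow> Wo a w \<in> Obj C"
proof (induction w)
  case (Prod i ws)
  then have "ok i" "\<forall>w \<in> set ws. Wo a w \<in> Obj C"
    using wd_Prod by auto
  then show ?case
    by simp (induction ws, auto)
qed auto

lemma Wos_Obj [simp]: "asg a \<Longrightarrow> ok i \<Longrightarrow> \<forall>w \<in> set ws. wd w \<Longrightarrow> Wos i a ws \<in> Obj C"
  by (induction ws) auto

lemma Wos_append:
  "asg a \<Longrightarrow> ok i \<Longrightarrow> \<forall>w \<in> set vs. wd w \<Longrightarrow> \<forall>w \<in> set ws. wd w \<Longrightarrow>
    Wos i a (vs @ ws) = Wos i a vs \<otimes>\<^bsub>i\<^esub> Wos i a ws"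
proof (induction vs)
  case (Cons v vs)
  then have [simp]: "Wo a v \<in> Obj C" "Wos i a vs \<in> Obj C" "Wos i a ws \<in> Obj C"
    by (auto intro!: Wos_Obj)
  have "Wos i a ((v # vs) @ ws) = Wo a v \<otimes>\<^bsub>i\<^esub> Wos i a (vs @ ws)" by simp
  also have "Wos i a (vs @ ws) = Wos i a vs \<otimes>\<^bsub>i\<^esub> Wos i a ws"
    using Cons by (intro Cons.IH) auto
  finally show ?case
    using Cons.prems(2) by (simp add: ten_assoc del: foldr_append)
qed auto

lemma Wos_factors [simp]: "asg a \<Longrightarrow> wd w \<Longrightarrow> ok i \<Longrightarrow> Wos i a (factors i w) = Wo a w"
proof (cases w)
  case (Prod j ws)
  assume "asg a" "wd w" "ok i"
  then have "Wo a (Prod j ws) \<in> Obj C" using Prod by (intro obj_val_Obj) auto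
  then show ?thesis using Prod \<open>ok i\<close> by (auto simp del: is_word.simps)
qed auto

lemma obj_val_wten [simp]:
  assumes "asg a" "ok i" "wd v" "wd w"
  shows "Wo a (wten i v w) = Wo a v \<otimes>\<^bsub>i\<^esub> Wo a w"
  using Wos_append[of a i "factors i v" "factors i w"] assms wd_factors
  by (auto simp: wten_def simp del: foldr_append map_append)

lemma arr_val_Arr [simp]:
  "arr_asg m \<Longrightarrow> wd w \<Longrightarrow> Wm m w \<in> Arr C \<and> Dom C (Wm m w) = Wo (\<lambda>x. Dom C (m x)) w \<and>
    Cod C (Wm m w) = Wo (\<lambda>x. Cod C (m x)) w"
proof (induction w)
  case (Prod i ws)
  then have "ok i" "\<forall>w \<in> set ws. Wm m w \<in> Arr C \<and> Dom C (Wm m w) = Wo (\<lambda>x. Dom C (m x)) w \<and>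
    Cod C (Wm m w) = Wo (\<lambda>x. Cod C (m x)) w"
    using wd_Prod by auto
  then have "foldr (ten_m S i) (map (Wm m) ws) (Ide C \<u>) \<in> Arr C \<and>
      Dom C (foldr (ten_m S i) (map (Wm m) ws) (Ide C \<u>)) = Wos i (\<lambda>x. Dom C (m x)) ws \<and>
      Cod C (foldr (ten_m S i) (map (Wm m) ws) (Ide C \<u>)) = Wos i (\<lambda>x. Cod C (m x)) ws"
    by (induction ws) auto
  then show ?case by simp
qed auto

lemma arr_val_wten [simp]:
  assumes "arr_asg m" "ok i" "wd v" "wd w"
  shows "Wm m (wten i v w) = Wm m v \<odot>\<^bsub>i\<^esub> Wm m w"
proof -
  let ?W = "\<lambda>vs. foldr (ten_m S i) (map (Wm m) vs) (Ide C \<u>)"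
  have 1: "?W vs \<in> Arr C" if "\<forall>w \<in> set vs. wd w" for vs
    using that assms by (induction vs) auto
  have 2: "?W (vs @ ws) = ?W vs \<odot>\<^bsub>i\<^esub> ?W ws" if "\<forall>w \<in> set vs. wd w" "\<forall>w \<in> set ws. wd w" for vs ws
    using that(1)
  proof (induction vs)
    case Nil
    show ?case using 1[OF that(2)] assms by simp
  next
    case (Cons v vs)
    have "?W ((v # vs) @ ws) = Wm m v \<odot>\<^bsub>i\<^esub> ?W (vs @ ws)" by simp
    also have "?W (vs @ ws) = ?W vs \<odot>\<^bsub>i\<^esub> ?W ws" using Cons by (intro Cons.IH) auto
    finally show ?case
      using Cons.prems 1[of vs] 1[OF that(2)] assms by (simp add: ten_assoc del: foldr_append)
  qed
  have 3: "?W (factors i w) = Wm m w" if "wd w" for w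
    using that
  proof (cases w)
    case (Prod j ws)
    have "Wm m (Prod j ws) \<in> Arr C" using that Prod assms arr_val_Arr[of m "Prod j ws"] by simp
    then show ?thesis using Prod assms by (auto simp del: is_word.simps)
  qed (use assms in auto)
  show ?thesis
    using 2[of "factors i v" "factors i w"] 3 assms wd_factors
    by (auto simp: wten_def simp del: foldr_append map_append)
qed

lemma arr_val_Ide [simp]: "asg a \<Longrightarrow> wd w \<Longrightarrow> Wm (\<lambda>x. Ide C (a x)) w = Ide C (Wo a w)"
  by (rotate_tac, induction rule: wd_induct) auto

lemma arr_val_Cmp:
  "wd w \<Longrightarrow> arr_asg m \<Longrightarrow> arr_asg m' \<Longrightarrow> \<forall>x. Dom C (m' x) = Cod C (m x) \<Longrightarrow>
    Wm (\<lambda>x. m' x \<cdot> m x) w = Wm m' w \<cdot> Wm m w"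
proof (induction rule: wd_induct)
  case (wten i v w)
  have "arr_asg (\<lambda>x. m' x \<cdot> m x)"
    using wten.prems by (auto simp: arr_asg_def)
  then show ?case
    using wten by (simp add: ten_merge)
qed auto

lemma obj_val_zero: "wd w \<Longrightarrow> asg a \<Longrightarrow> y \<in> set (letters w) \<Longrightarrow> a y = \<zero> \<Longrightarrow> Wo a w = \<zero>"
  by (induction rule: wd_induct) auto

lemma arr_val_zero:
  "wd w \<Longrightarrow> arr_asg m \<Longrightarrow> y \<in> set (letters w) \<Longrightarrow> m y = Ide C \<zero> \<Longrightarrow> Wm m w = Ide C \<zero>"
  by (induction rule: wd_induct) auto

subsection \<open>Linearity constraints\<close>

\<comment> \<open>Unfolded updates would no longer match the rules for updated assignments.\<close>
declare fun_upd_apply [simp del] and fun_upd_same [simp] fun_upd_other [simp]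

lemma Wos_upd [simp]: "\<forall>w \<in> set ws. x \<notin> set (letters w) \<Longrightarrow> Wos i (a(x := A)) ws = Wos i a ws"
  by (induction ws) auto

lemma lin_vals_Arr_aux:
  assumes "ok i" "asg a" "A' \<in> Obj C" "\<forall>w \<in> set ws. wd w"
    and "distinct (concat (map letters ws))" "x \<in> set (concat (map letters ws))"
    and "\<forall>w \<in> set ws. distinct (letters w) \<longrightarrow> x \<in> set (letters w) \<longrightarrow>
      Lin x a A' w \<in> Arr C \<and> Dom C (Lin x a A' w) = Wo a w \<oplus> Wo (a(x := A')) w \<and>
      Cod C (Lin x a A' w) = Wo (a(x := a x \<oplus> A')) w"
  shows "lin_vals C S i x a A' ws \<in> Arr C \<and>
     Dom C (lin_vals C S i x a A' ws) = Wos i a ws \<oplus> Wos i (a(x := A')) ws \<and>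
     Cod C (lin_vals C S i x a A' ws) = Wos i (a(x := a x \<oplus> A')) ws"
  using assms(4-7)
proof (induction ws)
  case (Cons v vs)
  note [simp] = \<open>ok i\<close> \<open>asg a\<close> \<open>A' \<in> Obj C\<close>
  have [simp]: "wd v" "\<forall>w \<in> set vs. wd w"
    using Cons by auto
  have [simp]: "Wo a v \<in> Obj C" "Wos i a vs \<in> Obj C" "Wo (a(x := A')) v \<in> Obj C"
    "Wos i (a(x := A')) vs \<in> Obj C" "Wo (a(x := a x \<oplus> A')) v \<in> Obj C"
    "Wos i (a(x := a x \<oplus> A')) vs \<in> Obj C"
    by (auto intro!: Wos_Obj)
  show ?case
  proof (cases "x \<in> set (letters v)")
    case True
    then have [simp]: "\<forall>w \<in> set vs. x \<notin> set (letters w)"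
      using Cons by auto
    show ?thesis
      using Cons.prems True by simp
  next
    case False
    then show ?thesis
      using Cons by simp
  qed
qed auto

lemma lin_val_Arr_aux:
  "wd w \<Longrightarrow> asg a \<Longrightarrow> A' \<in> Obj C \<Longrightarrow> distinct (letters w) \<Longrightarrow> x \<in> set (letters w) \<Longrightarrow>
     Lin x a A' w \<in> Arr C \<and> Dom C (Lin x a A' w) = Wo a w \<oplus> Wo (a(x := A')) w \<and>
     Cod C (Lin x a A' w) = Wo (a(x := a x \<oplus> A')) w"
proof (induction w)
  case (Prod i ws)
  then show ?case
    using lin_vals_Arr_aux[of i a A' ws x] wd_Prod[of i ws] by simp
qed auto

lemma lin_val_Arr [simp]:
  assumes "wd w" "asg a" "A' \<in> Obj C" "distinct (letters w)" "x \<in> set (letters w)"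
  shows "Lin x a A' w \<in> Arr C" "Dom C (Lin x a A' w) = Wo a w \<oplus> Wo (a(x := A')) w"
    "Cod C (Lin x a A' w) = Wo (a(x := a x \<oplus> A')) w"
  using lin_val_Arr_aux[OF assms] by auto

text \<open>By induction on the first list of factors: a factor that is split off the front and the
  remaining ones are rebracketed by one of the three distributivity axioms for iterated products,
  according to the factor that contains \<open>x\<close>.\<close>

lemma lin_vals_append:
  assumes "ok i" "asg a" "A' \<in> Obj C" "\<forall>w \<in> set vs. wd w" "\<forall>w \<in> set ws. wd w"
    "distinct (concat (map letters vs) @ concat (map letters ws))"
  shows "x \<in> set (concat (map letters vs)) \<Longrightarrow> lin_vals C S i x a A' (vs @ ws) =
      (lin_vals C S i x a A' vs \<odot>\<^bsub>i\<^esub> Ide C (Wos i a ws)) \<cdot>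
      dl i (Wos i a vs) (Wos i (a(x := A')) vs) (Wos i a ws)" (is "_ \<Longrightarrow> ?L")
    and "x \<in> set (concat (map letters ws)) \<Longrightarrow> lin_vals C S i x a A' (vs @ ws) =
      (Ide C (Wos i a vs) \<odot>\<^bsub>i\<^esub> lin_vals C S i x a A' ws) \<cdot>
      dr i (Wos i a vs) (Wos i a ws) (Wos i (a(x := A')) ws)" (is "_ \<Longrightarrow> ?R")
proof -
  interpret ring_category C "ten_o S i" "ten_m S i" \<u> "dl i" "dr i"
    by (rule ring) fact
  note [simp] = assms(1-3)
  have Wos_simps: "Wos i a (xs @ ws) = Wos i a xs \<otimes>\<^bsub>i\<^esub> Wos i a ws"
    "Wos i (a(x := A')) (xs @ ws) = Wos i (a(x := A')) xs \<otimes>\<^bsub>i\<^esub> Wos i (a(x := A')) ws"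
    if "\<forall>w \<in> set xs. wd w" for xs
    using that assms by (auto intro!: Wos_append simp del: foldr_append map_append)
  have W [simp]: "Wos i a ws \<in> Obj C" "Wos i (a(x := A')) ws \<in> Obj C"
    using assms by (auto intro!: Wos_Obj)
  have lw [simp]: "lin_vals C S i x a A' ws \<in> Arr C"
      "Dom C (lin_vals C S i x a A' ws) = Wos i a ws \<oplus> Wos i (a(x := A')) ws"
    if "x \<in> set (concat (map letters ws))"
    using lin_vals_Arr_aux[of i a A' ws x] assms that by auto
  have "(x \<in> set (concat (map letters vs)) \<longrightarrow> ?L) \<and> (x \<in> set (concat (map letters ws)) \<longrightarrow> ?R)"
    using assms(4,6)
  proof (induction vs)
    case Nil
    show ?case by (simp add: lw)
  next
    case (Cons v vs)
    have [simp]: "wd v" "\<forall>w \<in> set vs. wd w"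
      using Cons by auto
    have [simp]: "Wos i a vs \<in> Obj C" "Wos i (a(x := A')) vs \<in> Obj C"
      by (auto intro!: Wos_Obj)
    have lv [simp]: "lin_vals C S i x a A' vs \<in> Arr C"
      "Dom C (lin_vals C S i x a A' vs) = Wos i a vs \<oplus> Wos i (a(x := A')) vs"
      if "x \<in> set (concat (map letters vs))"
      using lin_vals_Arr_aux[of i a A' vs x] Cons that by auto
    have IH: "(x \<in> set (concat (map letters vs)) \<longrightarrow> lin_vals C S i x a A' (vs @ ws) =
      (lin_vals C S i x a A' vs \<odot>\<^bsub>i\<^esub> Ide C (Wos i a ws)) \<cdot>
      dl i (Wos i a vs) (Wos i (a(x := A')) vs) (Wos i a ws)) \<and>
      (x \<in> set (concat (map letters ws)) \<longrightarrow> lin_vals C S i x a A' (vs @ ws) =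
      (Ide C (Wos i a vs) \<odot>\<^bsub>i\<^esub> lin_vals C S i x a A' ws) \<cdot>
      dr i (Wos i a vs) (Wos i a ws) (Wos i (a(x := A')) ws))"
      using Cons.prems by (intro Cons.IH) auto
    have eq: "lin_vals C S i x a A' ((v # vs) @ ws) = (if x \<in> set (letters v)
      then (Lin x a A' v \<odot>\<^bsub>i\<^esub> Ide C (Wos i a (vs @ ws))) \<cdot>
        dl i (Wo a v) (Wo (a(x := A')) v) (Wos i a (vs @ ws))
      else (Ide C (Wo a v) \<odot>\<^bsub>i\<^esub> lin_vals C S i x a A' (vs @ ws)) \<cdot>
        dr i (Wo a v) (Wos i a (vs @ ws)) (Wos i (a(x := A')) (vs @ ws)))"
      by (simp del: map_append foldr_append)
    note [simp del] = foldr_append map_append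
    have dj: "set (letters v) \<inter> set (concat (map letters vs)) = {}"
      "set (letters v) \<inter> set (concat (map letters ws)) = {}"
      "set (concat (map letters vs)) \<inter> set (concat (map letters ws)) = {}"
      using Cons.prems(2) by (simp_all add: Int_Un_distrib)
    consider (v) "x \<in> set (letters v)" "x \<notin> set (concat (map letters vs))" "x \<notin> set (concat (map letters ws))"
      | (vs) "x \<in> set (concat (map letters vs))" "x \<notin> set (letters v)" "x \<notin> set (concat (map letters ws))"
      | (ws) "x \<in> set (concat (map letters ws))" "x \<notin> set (letters v)" "x \<notin> set (concat (map letters vs))"
      | (none) "x \<notin> set (letters v)" "x \<notin> set (concat (map letters vs))" "x \<notin> set (concat (map letters ws))"
      using dj by blast
    then show ?case
    proof cases
      case v
      then have [simp]: "\<forall>w \<in> set vs. x \<notin> set (letters w)" by auto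
      have lv' [simp]: "Lin x a A' v \<in> Arr C"
        "Dom C (Lin x a A' v) = Wo a v \<oplus> Wo (a(x := A')) v"
        using v Cons.prems by auto
      have "Lin x a A' v \<odot>\<^bsub>i\<^esub> Ide C (Wos i a vs \<otimes>\<^bsub>i\<^esub> Wos i a ws) =
          (Lin x a A' v \<odot>\<^bsub>i\<^esub> Ide C (Wos i a vs)) \<odot>\<^bsub>i\<^esub> Ide C (Wos i a ws)"
        by (simp add: ten_assoc)
      then show ?thesis
        using v by (auto simp: eq Wos_simps dl_dl cmp_assoc ten_merge)
    next
      case vs
      have 1: "Ide C (Wo a v) \<odot>\<^bsub>i\<^esub> (lin_vals C S i x a A' vs \<odot>\<^bsub>i\<^esub> Ide C (Wos i a ws)) =
          (Ide C (Wo a v) \<odot>\<^bsub>i\<^esub> lin_vals C S i x a A' vs) \<odot>\<^bsub>i\<^esub> Ide C (Wos i a ws)"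
        using vs by (simp add: ten_assoc)
      have "(Ide C (Wo a v) \<odot>\<^bsub>i\<^esub> lin_vals C S i x a A' (vs @ ws)) \<cdot>
          dr i (Wo a v) (Wos i a (vs @ ws)) (Wos i (a(x := A')) (vs @ ws)) =
        (Ide C (Wo a v) \<odot>\<^bsub>i\<^esub> (lin_vals C S i x a A' vs \<odot>\<^bsub>i\<^esub> Ide C (Wos i a ws))) \<cdot>
          ((Ide C (Wo a v) \<odot>\<^bsub>i\<^esub> dl i (Wos i a vs) (Wos i (a(x := A')) vs) (Wos i a ws)) \<cdot>
          dr i (Wo a v) (Wos i a vs \<otimes>\<^bsub>i\<^esub> Wos i a ws) (Wos i (a(x := A')) vs \<otimes>\<^bsub>i\<^esub> Wos i a ws))"
        using IH vs by (simp add: Wos_simps ten_merge cmp_assoc)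
      also have "\<dots> = (((Ide C (Wo a v) \<odot>\<^bsub>i\<^esub> lin_vals C S i x a A' vs) \<cdot>
          dr i (Wo a v) (Wos i a vs) (Wos i (a(x := A')) vs)) \<odot>\<^bsub>i\<^esub> Ide C (Wos i a ws)) \<cdot>
          dl i (Wo a v \<otimes>\<^bsub>i\<^esub> Wos i a vs) (Wo a v \<otimes>\<^bsub>i\<^esub> Wos i (a(x := A')) vs) (Wos i a ws)"
        using vs 1 by (simp flip: dr_dl) (simp add: cmp_assoc ten_merge)
      finally show ?thesis
        using vs by (auto simp: eq)
    next
      case ws
      then have [simp]: "\<forall>w \<in> set vs. x \<notin> set (letters w)" by auto
      have "Ide C (Wo a v \<otimes>\<^bsub>i\<^esub> Wos i a vs) \<odot>\<^bsub>i\<^esub> lin_vals C S i x a A' ws =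
          Ide C (Wo a v) \<odot>\<^bsub>i\<^esub> (Ide C (Wos i a vs) \<odot>\<^bsub>i\<^esub> lin_vals C S i x a A' ws)"
        using ws by (simp add: ten_assoc flip: ten_simps(5))
      then show ?thesis
        using ws IH by (auto simp: eq Wos_simps dr_dr cmp_assoc ten_merge)
    next
      case none
      then show ?thesis by auto
    qed
  qed
  then show "x \<in> set (concat (map letters vs)) \<Longrightarrow> ?L" "x \<in> set (concat (map letters ws)) \<Longrightarrow> ?R"
    by auto
qed

lemma lin_vals_factors:
  assumes "ok i" "asg a" "A' \<in> Obj C" "wd w" "distinct (letters w)" "x \<in> set (letters w)"
  shows "lin_vals C S i x a A' (factors i w) = Lin x a A' w"
proof -
  note [simp] = assms(1-3)
  have [simp]: "Lin x a A' w \<in> Arr C" "Dom C (Lin x a A' w) = Wo a w \<oplus> Wo (a(x := A')) w"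
    using assms by auto
  have [simp]: "Wo a w \<in> Obj C" "Wo (a(x := A')) w \<in> Obj C"
    using assms by auto
  show ?thesis
  proof (cases w)
    case (Prod j ws)
    have "j \<noteq> i \<Longrightarrow> lin_vals C S i x a A' [w] = Lin x a A' w"
      unfolding lin_vals.simps using assms(6) by simp
    then show ?thesis
      using Prod by auto
  next
    case (Letter y)
    have "lin_vals C S i x a A' [w] = Lin x a A' w"
      unfolding lin_vals.simps using assms(6) by simp
    then show ?thesis
      using Letter by auto
  qed (use assms in auto)
qed

text \<open>The distributivity axioms for iterated products make the constraints compatible with the
  associativity of the products, so that they may be computed from any factorization of a word.\<close>

lemma lin_val_wten:
  assumes "ok i" "asg a" "A' \<in> Obj C" "wd v" "wd w" "distinct (letters v @ letters w)"
  shows "x \<in> set (letters v) \<Longrightarrow> Lin x a A' (wten i v w) =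
      (Lin x a A' v \<odot>\<^bsub>i\<^esub> Ide C (Wo a w)) \<cdot> dl i (Wo a v) (Wo (a(x := A')) v) (Wo a w)"
    and "x \<in> set (letters w) \<Longrightarrow> Lin x a A' (wten i v w) =
      (Ide C (Wo a v) \<odot>\<^bsub>i\<^esub> Lin x a A' w) \<cdot> dr i (Wo a v) (Wo a w) (Wo (a(x := A')) w)"
proof -
  note [simp] = assms(1-5)
  have fac: "\<forall>u \<in> set (factors i v). wd u" "\<forall>u \<in> set (factors i w). wd u"
    using wd_factors[of v] wd_factors[of w] assms(4,5) by blast+
  have eq: "Lin x a A' (wten i v w) = lin_vals C S i x a A' (factors i v @ factors i w)"
    if "v \<noteq> Unit" "w \<noteq> Unit"
    using that by (simp add: wten_def)
  show "Lin x a A' (wten i v w) =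
      (Lin x a A' v \<odot>\<^bsub>i\<^esub> Ide C (Wo a w)) \<cdot> dl i (Wo a v) (Wo (a(x := A')) v) (Wo a w)"
    if x: "x \<in> set (letters v)"
  proof (cases "w = Unit")
    case False
    moreover have "v \<noteq> Unit" using x by auto
    ultimately show ?thesis
      using x assms(6) lin_vals_append(1)[of i a A' "factors i v" "factors i w" x] fac
      by (simp add: eq lin_vals_factors)
  qed (use x assms(6) in simp)
  show "Lin x a A' (wten i v w) =
      (Ide C (Wo a v) \<odot>\<^bsub>i\<^esub> Lin x a A' w) \<cdot> dr i (Wo a v) (Wo a w) (Wo (a(x := A')) w)"
    if x: "x \<in> set (letters w)"
  proof (cases "v = Unit")
    case False
    moreover have "w \<noteq> Unit" using x by auto
    ultimately show ?thesis
      using x assms(6) lin_vals_append(2)[of i a A' "factors i v" "factors i w" x] fac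
      by (simp add: eq lin_vals_factors)
  qed (use x assms(6) in simp)
qed

text \<open>This contains the conditions on linearity constraints that involve one variable only. The
  functor is composed of the additive functors given by multiplication with a fixed object, along
  the path to \<open>x\<close>.\<close>

lemma additive_word:
  assumes "wd w" "asg a" "distinct (letters w)" "x \<in> set (letters w)"
  shows "additive C (\<lambda>A. Wo (a(x := A)) w) (\<lambda>f. Wm ((\<lambda>y. Ide C (a y))(x := f)) w)
    (\<lambda>A A'. Lin x (a(x := A)) A' w)"
  using assms
proof (induction rule: wd_induct)
  case (Letter y)
  then show ?case by (auto simp: additive_id)
next
  case (wten i v w)
  note [simp] = \<open>ok i\<close> \<open>wd v\<close> \<open>wd w\<close> \<open>asg a\<close>
  from wten.prems consider (v) "x \<in> set (letters v)" "x \<notin> set (letters w)"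
    | (w) "x \<in> set (letters w)" "x \<notin> set (letters v)" by auto
  then show ?case
  proof cases
    case v
    show ?thesis
      by (rule additive_cong[OF additive_comp[OF additive_ten_left[OF \<open>ok i\<close>, of "Wo a w"] wten.IH(1)]])
        (use v wten.prems in \<open>auto simp: lin_val_wten(1)\<close>)
  next
    case w
    show ?thesis
      by (rule additive_cong[OF additive_comp[OF additive_ten_right[OF \<open>ok i\<close>, of "Wo a v"] wten.IH(2)]])
        (use w wten.prems in \<open>auto simp: lin_val_wten(2)\<close>)
  qed
qed auto

lemma upd_Dom_Cod [simp]:
  "(\<lambda>y. Dom C ((m(x := f)) y)) = (\<lambda>y. Dom C (m y))(x := Dom C f)"
  "(\<lambda>y. Cod C ((m(x := f)) y)) = (\<lambda>y. Cod C (m y))(x := Cod C f)"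
  by (auto simp: fun_eq_iff fun_upd_apply)

lemma lin_val_nat:
  assumes "wd w" "arr_asg m" "f' \<in> Arr C" "distinct (letters w)" "x \<in> set (letters w)"
  shows "Lin x (\<lambda>y. Cod C (m y)) (Cod C f') w \<cdot> (Wm m w \<boxplus> Wm (m(x := f')) w) =
    Wm (m(x := m x \<boxplus> f')) w \<cdot> Lin x (\<lambda>y. Dom C (m y)) (Dom C f') w"
  using assms
proof (induction rule: wd_induct)
  case (wten i v w)
  note [simp] = \<open>ok i\<close> \<open>wd v\<close> \<open>wd w\<close> \<open>arr_asg m\<close> \<open>f' \<in> Arr C\<close>
  from wten.prems consider (v) "x \<in> set (letters v)" "x \<notin> set (letters w)"
    | (w) "x \<in> set (letters w)" "x \<notin> set (letters v)" by auto
  then show ?case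
  proof cases
    case v
    then show ?thesis
      using wten by (simp add: lin_val_wten(1) cmp_assoc dist_nat ten_merge ten_merge(2))
  next
    case w
    then show ?thesis
      using wten by (simp add: lin_val_wten(2) cmp_assoc dist_nat ten_merge)
  qed
qed auto

lemma lin_val_zero:
  assumes "wd w" "asg a" "A' \<in> Obj C" "distinct (letters w)" "x \<in> set (letters w)"
    "(\<exists>y \<in> set (letters w). a y = \<zero>) \<or> A' = \<zero>"
  shows "Lin x a A' w = Ide C (Wo (a(x := a x \<oplus> A')) w)"
  using assms
proof (induction rule: wd_induct)
  case (wten i v w)
  note [simp] = \<open>ok i\<close> \<open>wd v\<close> \<open>wd w\<close> \<open>asg a\<close> \<open>A' \<in> Obj C\<close>
  from wten.prems consider (v) "x \<in> set (letters v)" "x \<notin> set (letters w)"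
    | (w) "x \<in> set (letters w)" "x \<notin> set (letters v)" by auto
  then show ?case
  proof cases
    case v
    consider (zw) y where "y \<in> set (letters w)" "a y = \<zero>"
      | (zv) "(\<exists>y \<in> set (letters v). a y = \<zero>) \<or> A' = \<zero>"
      using wten.prems by auto
    then show ?thesis
    proof cases
      case zw
      then have "Wo a w = \<zero>" using obj_val_zero[of w a y] by simp
      then show ?thesis
        using v wten.prems by (simp add: lin_val_wten(1))
    next
      case zv
      then have "Wo a v = \<zero> \<or> Wo (a(x := A')) v = \<zero>"
        using v obj_val_zero[of v a] obj_val_zero[of v "a(x := A')" x] by auto
      moreover have L: "Lin x a A' v = Ide C (Wo (a(x := a x \<oplus> A')) v)"
        using v zv wten by auto
      moreover have "Wo (a(x := a x \<oplus> A')) v = Wo a v \<oplus> Wo (a(x := A')) v"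
        using lin_val_Arr(2)[of v a A' x] v wten.prems by (simp add: L)
      ultimately show ?thesis
        using v wten.prems by (auto simp: lin_val_wten(1))
    qed
  next
    case w
    consider (zv) y where "y \<in> set (letters v)" "a y = \<zero>"
      | (zw) "(\<exists>y \<in> set (letters w). a y = \<zero>) \<or> A' = \<zero>"
      using wten.prems by auto
    then show ?thesis
    proof cases
      case zv
      then have "Wo a v = \<zero>" using obj_val_zero[of v a y] by simp
      then show ?thesis
        using w wten.prems by (simp add: lin_val_wten(2))
    next
      case zw
      then have "Wo a w = \<zero> \<or> Wo (a(x := A')) w = \<zero>"
        using w obj_val_zero[of w a] obj_val_zero[of w "a(x := A')" x] by auto
      moreover have L: "Lin x a A' w = Ide C (Wo (a(x := a x \<oplus> A')) w)"
        using w zw wten by auto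
      moreover have "Wo (a(x := a x \<oplus> A')) w = Wo a w \<oplus> Wo (a(x := A')) w"
        using lin_val_Arr(2)[of w a A' x] w wten.prems by (simp add: L)
      ultimately show ?thesis
        using w wten.prems by (auto simp: lin_val_wten(2))
    qed
  qed
qed auto

end

context additive
begin

text \<open>\<open>a, b, c, d\<close> are the values of a functor at the four combinations of the summands in two
  variables; the hypothesis is the compatibility of its constraints in these variables, and the
  conclusion that of its composite with the additive functor.\<close>

lemma sum4_comp:
  assumes [simp]: "a \<in> Obj C" "b \<in> Obj C" "c \<in> Obj C" "d \<in> Obj C"
    and [simp]: "Q \<in> Arr C" "Dom C Q = a \<oplus> b" "R \<in> Arr C" "Dom C R = c \<oplus> d"
      "P \<in> Arr C" "Dom C P = Cod C Q \<oplus> Cod C R"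
      "Q' \<in> Arr C" "Dom C Q' = a \<oplus> c" "R' \<in> Arr C" "Dom C R' = b \<oplus> d"
      "P' \<in> Arr C" "Dom C P' = Cod C Q' \<oplus> Cod C R'"
    and E: "P \<cdot> (Q \<boxplus> R) = P' \<cdot> (Q' \<boxplus> R') \<cdot> (Ide C a \<boxplus> \<zeta> b c \<boxplus> Ide C d)"
  shows "(Fm P \<cdot> l (Cod C Q) (Cod C R)) \<cdot> ((Fm Q \<cdot> l a b) \<boxplus> (Fm R \<cdot> l c d)) =
    (Fm P' \<cdot> l (Cod C Q') (Cod C R')) \<cdot> ((Fm Q' \<cdot> l a c) \<boxplus> (Fm R' \<cdot> l b d)) \<cdot>
      (Ide C (Fo a) \<boxplus> \<zeta> (Fo b) (Fo c) \<boxplus> Ide C (Fo d))"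
proof -
  let ?Z = "Ide C a \<boxplus> \<zeta> b c \<boxplus> Ide C d"
  let ?Z' = "Ide C (Fo a) \<boxplus> \<zeta> (Fo b) (Fo c) \<boxplus> Ide C (Fo d)"
  have nat: "(Fm P \<cdot> l (Cod C Q) (Cod C R)) \<cdot> ((Fm Q \<cdot> l a b) \<boxplus> (Fm R \<cdot> l c d)) =
      Fm (P \<cdot> (Q \<boxplus> R)) \<cdot> l (a \<oplus> b) (c \<oplus> d) \<cdot> (l a b \<boxplus> l c d)"
    if [simp]: "a \<in> Obj C" "b \<in> Obj C" "c \<in> Obj C" "d \<in> Obj C"
      "Q \<in> Arr C" "Dom C Q = a \<oplus> b" "R \<in> Arr C" "Dom C R = c \<oplus> d"
      "P \<in> Arr C" "Dom C P = Cod C Q \<oplus> Cod C R" for a b c d P Q R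
  proof -
    have "(Fm P \<cdot> l (Cod C Q) (Cod C R)) \<cdot> ((Fm Q \<cdot> l a b) \<boxplus> (Fm R \<cdot> l c d)) =
        Fm P \<cdot> (l (Cod C Q) (Cod C R) \<cdot> (Fm Q \<boxplus> Fm R)) \<cdot> (l a b \<boxplus> l c d)"
      by (simp add: cmp_assoc plus_merge)
    then show ?thesis
      by (simp add: l_nat Fm_Cmp cmp_assoc)
  qed
  have "(Fm P \<cdot> l (Cod C Q) (Cod C R)) \<cdot> ((Fm Q \<cdot> l a b) \<boxplus> (Fm R \<cdot> l c d)) =
      Fm (P' \<cdot> (Q' \<boxplus> R')) \<cdot> (Fm ?Z \<cdot> l (a \<oplus> b) (c \<oplus> d) \<cdot> (l a b \<boxplus> l c d))"
    by (subst nat[of a b c d Q R P]) (simp_all add: E Fm_Cmp cmp_assoc plus_assoc)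
  also have "\<dots> = (Fm (P' \<cdot> (Q' \<boxplus> R')) \<cdot> l (a \<oplus> c) (b \<oplus> d) \<cdot> (l a c \<boxplus> l b d)) \<cdot> ?Z'"
    using sum4_interchange[of a b c d] by (simp add: cmp_assoc plus_assoc)
  also have "\<dots> = ((Fm P' \<cdot> l (Cod C Q') (Cod C R')) \<cdot> ((Fm Q' \<cdot> l a c) \<boxplus> (Fm R' \<cdot> l b d))) \<cdot> ?Z'"
    by (subst nat[of a c b d Q' R' P']) simp_all
  also have "\<dots> = (Fm P' \<cdot> l (Cod C Q') (Cod C R')) \<cdot> ((Fm Q' \<cdot> l a c) \<boxplus> (Fm R' \<cdot> l b d)) \<cdot> ?Z'"
    by (rule cmp_assoc) (simp_all add: plus_assoc)
  finally show ?thesis .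
qed

end

context permutative_category
begin

lemma zeta4_inverse:
  assumes [simp]: "a \<in> Obj C" "b \<in> Obj C" "c \<in> Obj C" "d \<in> Obj C"
  shows "(Ide C a \<boxplus> \<zeta> b c \<boxplus> Ide C d) \<cdot> (Ide C a \<boxplus> \<zeta> c b \<boxplus> Ide C d) = Ide C (a \<oplus> c \<oplus> b \<oplus> d)"
  by (simp add: plus_merge zeta_sym plus_assoc)

text \<open>The interchange of the inner summands is invertible by the same interchange. Hence the
  compatibility of the constraints in two variables is symmetric in the variables.\<close>

lemma zeta4_swap:
  assumes "p \<cdot> q = g \<cdot> (Ide C a \<boxplus> \<zeta> b c \<boxplus> Ide C d)"
    and [simp]: "a \<in> Obj C" "b \<in> Obj C" "c \<in> Obj C" "d \<in> Obj C" "p \<in> Arr C" "q \<in> Arr C" "g \<in> Arr C"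
      "Dom C g = a \<oplus> c \<oplus> (b \<oplus> d)" "Dom C q = a \<oplus> b \<oplus> (c \<oplus> d)" "Dom C p = Cod C q"
  shows "g = p \<cdot> q \<cdot> (Ide C a \<boxplus> \<zeta> c b \<boxplus> Ide C d)"
proof -
  let ?Z = "Ide C a \<boxplus> \<zeta> c b \<boxplus> Ide C d"
  have "p \<cdot> q \<cdot> ?Z = (p \<cdot> q) \<cdot> ?Z"
    by (rule cmp_assoc[symmetric]) (simp_all add: plus_assoc)
  also have "\<dots> = g"
    unfolding assms(1) by (simp add: cmp_assoc zeta4_inverse plus_assoc)
      (simp add: plus_merge zeta_sym plus_assoc)
  finally show ?thesis by simp
qed

end

context En_category
begin

text \<open>The case of one variable in each factor rests on the axiom that relates the two
  distributivity morphisms by the symmetry.\<close>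

lemma lin_lin_mixed:
  assumes [simp]: "ok i" "V \<in> Obj C" "V' \<in> Obj C" "W \<in> Obj C" "W' \<in> Obj C"
    and [simp]: "L \<in> Arr C" "Dom C L = V \<oplus> V'" "M \<in> Arr C" "Dom C M = W \<oplus> W'"
  shows "((Ide C (Cod C L) \<odot>\<^bsub>i\<^esub> M) \<cdot> dr i (Cod C L) W W') \<cdot>
      (((L \<odot>\<^bsub>i\<^esub> Ide C W) \<cdot> dl i V V' W) \<boxplus> ((L \<odot>\<^bsub>i\<^esub> Ide C W') \<cdot> dl i V V' W')) =
    ((L \<odot>\<^bsub>i\<^esub> Ide C (Cod C M)) \<cdot> dl i V V' (Cod C M)) \<cdot>
      (((Ide C V \<odot>\<^bsub>i\<^esub> M) \<cdot> dr i V W W') \<boxplus> ((Ide C V' \<odot>\<^bsub>i\<^esub> M) \<cdot> dr i V' W W')) \<cdot>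
      (Ide C (V \<otimes>\<^bsub>i\<^esub> W) \<boxplus> \<zeta> (V' \<otimes>\<^bsub>i\<^esub> W) (V \<otimes>\<^bsub>i\<^esub> W') \<boxplus> Ide C (V' \<otimes>\<^bsub>i\<^esub> W'))"
    (is "?L = ?R \<cdot> ?S \<cdot> ?Z")
proof -
  interpret ring_category C "ten_o S i" "ten_m S i" \<u> "dl i" "dr i"
    by (rule ring) fact
  let ?dl = "dl i V V' W \<boxplus> dl i V V' W'" and ?dr = "dr i V W W' \<boxplus> dr i V' W W'"
  have "dr i (Cod C L) W W' \<cdot> ((L \<odot>\<^bsub>i\<^esub> Ide C W) \<boxplus> (L \<odot>\<^bsub>i\<^esub> Ide C W')) =
      (L \<odot>\<^bsub>i\<^esub> Ide C (W \<oplus> W')) \<cdot> dr i (V \<oplus> V') W W'"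
    using dist_nat(2)[of i L "Ide C W" "Ide C W'" "Cod C L" W W'] by simp
  then have "dr i (Cod C L) W W' \<cdot> ((L \<odot>\<^bsub>i\<^esub> Ide C W) \<boxplus> (L \<odot>\<^bsub>i\<^esub> Ide C W')) \<cdot> ?dl =
      (L \<odot>\<^bsub>i\<^esub> Ide C (W \<oplus> W')) \<cdot> dr i (V \<oplus> V') W W' \<cdot> ?dl"
    by (simp flip: cmp_assoc)
  note nat1 = this
  have split1: "((L \<odot>\<^bsub>i\<^esub> Ide C W) \<cdot> dl i V V' W) \<boxplus> ((L \<odot>\<^bsub>i\<^esub> Ide C W') \<cdot> dl i V V' W') =
      ((L \<odot>\<^bsub>i\<^esub> Ide C W) \<boxplus> (L \<odot>\<^bsub>i\<^esub> Ide C W')) \<cdot> ?dl"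
    by (simp add: plus_merge)
  have "?L = (Ide C (Cod C L) \<odot>\<^bsub>i\<^esub> M) \<cdot> dr i (Cod C L) W W' \<cdot>
      ((L \<odot>\<^bsub>i\<^esub> Ide C W) \<boxplus> (L \<odot>\<^bsub>i\<^esub> Ide C W')) \<cdot> ?dl"
    unfolding split1 by (simp add: cmp_assoc)
  also have "\<dots> = (L \<odot>\<^bsub>i\<^esub> M) \<cdot> dr i (V \<oplus> V') W W' \<cdot> ?dl"
    unfolding nat1 by (simp add: ten_merge)
  finally have 1: "?L = (L \<odot>\<^bsub>i\<^esub> M) \<cdot> dr i (V \<oplus> V') W W' \<cdot> ?dl" .
  have "dl i V V' (Cod C M) \<cdot> ((Ide C V \<odot>\<^bsub>i\<^esub> M) \<boxplus> (Ide C V' \<odot>\<^bsub>i\<^esub> M)) =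
      (Ide C (V \<oplus> V') \<odot>\<^bsub>i\<^esub> M) \<cdot> dl i V V' (W \<oplus> W')"
    using dist_nat(1)[of i "Ide C V" "Ide C V'" M V V' "Cod C M"] by simp
  then have "dl i V V' (Cod C M) \<cdot> ((Ide C V \<odot>\<^bsub>i\<^esub> M) \<boxplus> (Ide C V' \<odot>\<^bsub>i\<^esub> M)) \<cdot> ?dr =
      (Ide C (V \<oplus> V') \<odot>\<^bsub>i\<^esub> M) \<cdot> dl i V V' (W \<oplus> W') \<cdot> ?dr"
    by (simp flip: cmp_assoc)
  note nat2 = this
  have split2: "?S = ((Ide C V \<odot>\<^bsub>i\<^esub> M) \<boxplus> (Ide C V' \<odot>\<^bsub>i\<^esub> M)) \<cdot> ?dr"
    by (simp add: plus_merge)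
  have "?R \<cdot> ?S = (L \<odot>\<^bsub>i\<^esub> Ide C (Cod C M)) \<cdot> dl i V V' (Cod C M) \<cdot>
      ((Ide C V \<odot>\<^bsub>i\<^esub> M) \<boxplus> (Ide C V' \<odot>\<^bsub>i\<^esub> M)) \<cdot> ?dr"
    unfolding split2 by (simp add: cmp_assoc)
  also have "\<dots> = (L \<odot>\<^bsub>i\<^esub> M) \<cdot> dl i V V' (W \<oplus> W') \<cdot> ?dr"
    unfolding nat2 by (simp add: ten_merge)
  finally have 2: "?R \<cdot> ?S = (L \<odot>\<^bsub>i\<^esub> M) \<cdot> dl i V V' (W \<oplus> W') \<cdot> ?dr" .
  have "?R \<cdot> ?S = ?L \<cdot> (Ide C (V \<otimes>\<^bsub>i\<^esub> W) \<boxplus> \<zeta> (V \<otimes>\<^bsub>i\<^esub> W') (V' \<otimes>\<^bsub>i\<^esub> W) \<boxplus> Ide C (V' \<otimes>\<^bsub>i\<^esub> W'))"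
    unfolding 1 2 using dl_dr[of V V' W W'] by (simp add: cmp_assoc plus_assoc)
  then show ?thesis
    by (rule zeta4_swap) (simp_all add: plus_assoc)
qed

lemma lin_val_cong:
  assumes "wd w" "asg a" "asg b" "A' \<in> Obj C" "distinct (letters w)" "x \<in> set (letters w)"
    "\<forall>y \<in> set (letters w). a y = b y"
  shows "Lin x a A' w = Lin x b A' w"
  using assms
proof (induction rule: wd_induct)
  case (wten i v w)
  have "Wo a v = Wo b v" "Wo a w = Wo b w" "Wo (a(x := A')) v = Wo (b(x := A')) v"
    "Wo (a(x := A')) w = Wo (b(x := A')) w"
    using wten.prems by (auto intro!: obj_val_cong simp: fun_upd_apply)
  note W = this
  show ?case
  proof (cases "x \<in> set (letters v)")
    case True
    then have "Lin x a A' v = Lin x b A' v"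
      using wten.prems by (intro wten.IH) auto
    then show ?thesis
      using True wten.hyps wten.prems(1-4) by (simp add: lin_val_wten(1) W)
  next
    case False
    then have x: "x \<in> set (letters w)"
      using wten.prems by simp
    then have "Lin x a A' w = Lin x b A' w"
      using wten.prems by (intro wten.IH) auto
    then show ?thesis
      using x wten.hyps wten.prems(1-4) by (simp add: lin_val_wten(2) W)
  qed
qed auto

lemma lin_val_upd:
  assumes "wd w" "asg a" "A' \<in> Obj C" "B \<in> Obj C" "distinct (letters w)" "x \<in> set (letters w)"
    "y \<notin> set (letters w)"
  shows "Lin x (a(y := B)) A' w = Lin x a A' w"
  using assms by (intro lin_val_cong) (auto simp: fun_upd_apply)

lemma obj_val_upd2: "x \<notin> set (letters w) \<Longrightarrow> Wo (a(x := D, y := E)) w = Wo (a(y := E)) w"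
  by (rule obj_val_cong) (auto simp: fun_upd_apply)

text \<open>Two variables in the same factor are handled by the induction hypothesis, because
  multiplication with the other factor is additive; two variables in different factors by
  \<open>lin_lin_mixed\<close>.\<close>

lemma lin_val_lin_val:
  assumes "wd w" "asg a" "A' \<in> Obj C" "B' \<in> Obj C" "distinct (letters w)"
    "x \<in> set (letters w)" "y \<in> set (letters w)" "x \<noteq> y"
  shows "Lin y (a(x := a x \<oplus> A')) B' w \<cdot> (Lin x a A' w \<boxplus> Lin x (a(y := B')) A' w) =
    Lin x (a(y := a y \<oplus> B')) A' w \<cdot> (Lin y a B' w \<boxplus> Lin y (a(x := A')) B' w) \<cdot>
      (Ide C (Wo a w) \<boxplus> \<zeta> (Wo (a(x := A')) w) (Wo (a(y := B')) w) \<boxplus> Ide C (Wo (a(x := A', y := B')) w))"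
  using assms
proof (induction arbitrary: x y A' B' rule: wd_induct)
  case (wten i v w x y A' B')
  have tw: "a(y := D, x := E) = a(x := E, y := D)" for D E
    using wten.prems by (auto simp: fun_upd_twist)
  note [simp] = wten.hyps \<open>asg a\<close> \<open>A' \<in> Obj C\<close> \<open>B' \<in> Obj C\<close> tw
    \<open>x \<noteq> y\<close> \<open>x \<noteq> y\<close>[symmetric]
  have dist: "distinct (letters v)" "distinct (letters w)" "distinct (letters v @ letters w)"
    using wten.prems by auto
  from wten.prems consider
      (v) "x \<in> set (letters v)" "x \<notin> set (letters w)" "y \<in> set (letters v)" "y \<notin> set (letters w)"
    | (w) "x \<in> set (letters w)" "x \<notin> set (letters v)" "y \<in> set (letters w)" "y \<notin> set (letters v)"
    | (vw) "x \<in> set (letters v)" "x \<notin> set (letters w)" "y \<in> set (letters w)" "y \<notin> set (letters v)"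
    | (wv) "x \<in> set (letters w)" "x \<notin> set (letters v)" "y \<in> set (letters v)" "y \<notin> set (letters w)"
    by auto
  then show ?case
  proof cases
    case v
    interpret G: additive C "\<lambda>A. A \<otimes>\<^bsub>i\<^esub> Wo a w" "\<lambda>f. f \<odot>\<^bsub>i\<^esub> Ide C (Wo a w)" "\<lambda>A B. dl i A B (Wo a w)"
      by (rule additive_ten_left) auto
    show ?thesis
      using G.sum4_comp[OF _ _ _ _ _ _ _ _ _ _ _ _ _ _ _ _ wten.IH(1)[of A' B' x y]] v dist
      by (simp add: lin_val_wten(1))
  next
    case w
    interpret G: additive C "\<lambda>A. Wo a v \<otimes>\<^bsub>i\<^esub> A" "\<lambda>f. Ide C (Wo a v) \<odot>\<^bsub>i\<^esub> f" "dr i (Wo a v)"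
      by (rule additive_ten_right) auto
    show ?thesis
      using G.sum4_comp[OF _ _ _ _ _ _ _ _ _ _ _ _ _ _ _ _ wten.IH(2)[of A' B' x y]] w dist
      by (simp add: lin_val_wten(2))
  next
    case vw
    then show ?thesis
      using lin_lin_mixed[of i "Wo a v" "Wo (a(x := A')) v" "Wo a w" "Wo (a(y := B')) w"
          "Lin x a A' v" "Lin y a B' w"] dist
      by (simp add: lin_val_wten lin_val_upd obj_val_upd2)
  next
    case wv
    show ?thesis
      by (rule zeta4_swap)
        (use lin_lin_mixed[of i "Wo a v" "Wo (a(y := B')) v" "Wo a w" "Wo (a(x := A')) w"
          "Lin y a B' v" "Lin x a A' w"] wv dist in \<open>simp_all add: lin_val_wten lin_val_upd obj_val_upd2 plus_assoc cmp_assoc\<close>)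
  qed
qed auto

subsection \<open>Exchanges\<close>

lemma ex_simps [simp]:
  assumes "ok i" "i < j" "ok j" "A \<in> Obj C" "B \<in> Obj C" "X \<in> Obj C" "Y \<in> Obj C"
  shows "\<eta> i j A B X Y \<in> Arr C"
    "Dom C (\<eta> i j A B X Y) = (A \<otimes>\<^bsub>j\<^esub> B) \<otimes>\<^bsub>i\<^esub> (X \<otimes>\<^bsub>j\<^esub> Y)"
    "Cod C (\<eta> i j A B X Y) = (A \<otimes>\<^bsub>i\<^esub> X) \<otimes>\<^bsub>j\<^esub> (B \<otimes>\<^bsub>i\<^esub> Y)"
  using exchange.ex_hom[OF ok_exchange(1)[OF assms(1-3)], of A B X Y] assms by (auto simp: hom_iff)

lemma ex_nat:
  assumes "ok i" "i < j" "ok j" "f \<in> Arr C" "g \<in> Arr C" "h \<in> Arr C" "k \<in> Arr C"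
  shows "\<eta> i j (Cod C f) (Cod C g) (Cod C h) (Cod C k) \<cdot> ((f \<odot>\<^bsub>j\<^esub> g) \<odot>\<^bsub>i\<^esub> (h \<odot>\<^bsub>j\<^esub> k)) =
    ((f \<odot>\<^bsub>i\<^esub> h) \<odot>\<^bsub>j\<^esub> (g \<odot>\<^bsub>i\<^esub> k)) \<cdot> \<eta> i j (Dom C f) (Dom C g) (Dom C h) (Dom C k)"
  using exchange.ex_nat[OF ok_exchange(1)[OF assms(1-3)], of f "Dom C f" "Cod C f" g "Dom C g" "Cod C g"
      h "Dom C h" "Cod C h" k "Dom C k" "Cod C k"] assms by (auto simp: hom_iff)

text \<open>Naturality moves \<open>L\<close> past the exchange; what remains is the exchange factorization axiom for
  the variable in question. With \<open>L\<close> the linearity constraint of a word, this is the linearity of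
  an exchange of words.\<close>

lemma ex_lin:
  assumes [simp]: "ok i" "i < j" "ok j" "P \<in> Obj C" "P' \<in> Obj C" "Q \<in> Obj C" "R \<in> Obj C" "T \<in> Obj C"
    and [simp]: "L \<in> Arr C" "Dom C L = P \<oplus> P'"
  shows "\<eta> i j (Cod C L) Q R T \<cdot>
      ((((L \<odot>\<^bsub>j\<^esub> Ide C Q) \<cdot> dl j P P' Q) \<odot>\<^bsub>i\<^esub> Ide C (R \<otimes>\<^bsub>j\<^esub> T)) \<cdot>
        dl i (P \<otimes>\<^bsub>j\<^esub> Q) (P' \<otimes>\<^bsub>j\<^esub> Q) (R \<otimes>\<^bsub>j\<^esub> T)) =
     ((((L \<odot>\<^bsub>i\<^esub> Ide C R) \<cdot> dl i P P' R) \<odot>\<^bsub>j\<^esub> Ide C (Q \<otimes>\<^bsub>i\<^esub> T)) \<cdot>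
        dl j (P \<otimes>\<^bsub>i\<^esub> R) (P' \<otimes>\<^bsub>i\<^esub> R) (Q \<otimes>\<^bsub>i\<^esub> T)) \<cdot>
      (\<eta> i j P Q R T \<boxplus> \<eta> i j P' Q R T)" (is ?thesis1)
    and "\<eta> i j Q (Cod C L) R T \<cdot>
      ((((Ide C Q \<odot>\<^bsub>j\<^esub> L) \<cdot> dr j Q P P') \<odot>\<^bsub>i\<^esub> Ide C (R \<otimes>\<^bsub>j\<^esub> T)) \<cdot>
        dl i (Q \<otimes>\<^bsub>j\<^esub> P) (Q \<otimes>\<^bsub>j\<^esub> P') (R \<otimes>\<^bsub>j\<^esub> T)) =
     ((Ide C (Q \<otimes>\<^bsub>i\<^esub> R) \<odot>\<^bsub>j\<^esub> ((L \<odot>\<^bsub>i\<^esub> Ide C T) \<cdot> dl i P P' T)) \<cdot>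
        dr j (Q \<otimes>\<^bsub>i\<^esub> R) (P \<otimes>\<^bsub>i\<^esub> T) (P' \<otimes>\<^bsub>i\<^esub> T)) \<cdot>
      (\<eta> i j Q P R T \<boxplus> \<eta> i j Q P' R T)" (is ?thesis2)
    and "\<eta> i j Q R (Cod C L) T \<cdot>
      ((Ide C (Q \<otimes>\<^bsub>j\<^esub> R) \<odot>\<^bsub>i\<^esub> ((L \<odot>\<^bsub>j\<^esub> Ide C T) \<cdot> dl j P P' T)) \<cdot>
        dr i (Q \<otimes>\<^bsub>j\<^esub> R) (P \<otimes>\<^bsub>j\<^esub> T) (P' \<otimes>\<^bsub>j\<^esub> T)) =
     ((((Ide C Q \<odot>\<^bsub>i\<^esub> L) \<cdot> dr i Q P P') \<odot>\<^bsub>j\<^esub> Ide C (R \<otimes>\<^bsub>i\<^esub> T)) \<cdot>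
        dl j (Q \<otimes>\<^bsub>i\<^esub> P) (Q \<otimes>\<^bsub>i\<^esub> P') (R \<otimes>\<^bsub>i\<^esub> T)) \<cdot>
      (\<eta> i j Q R P T \<boxplus> \<eta> i j Q R P' T)" (is ?thesis3)
    and "\<eta> i j Q R T (Cod C L) \<cdot>
      ((Ide C (Q \<otimes>\<^bsub>j\<^esub> R) \<odot>\<^bsub>i\<^esub> ((Ide C T \<odot>\<^bsub>j\<^esub> L) \<cdot> dr j T P P')) \<cdot>
        dr i (Q \<otimes>\<^bsub>j\<^esub> R) (T \<otimes>\<^bsub>j\<^esub> P) (T \<otimes>\<^bsub>j\<^esub> P')) =
     ((Ide C (Q \<otimes>\<^bsub>i\<^esub> T) \<odot>\<^bsub>j\<^esub> ((Ide C R \<odot>\<^bsub>i\<^esub> L) \<cdot> dr i R P P')) \<cdot>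
        dr j (Q \<otimes>\<^bsub>i\<^esub> T) (R \<otimes>\<^bsub>i\<^esub> P) (R \<otimes>\<^bsub>i\<^esub> P')) \<cdot>
      (\<eta> i j Q R T P \<boxplus> \<eta> i j Q R T P')" (is ?thesis4)
proof -
  interpret exchange_sum C "ten_o S i" "ten_m S i" "ten_o S j" "ten_m S j" "\<eta> i j" "dl i" "dr i" "dl j" "dr j"
    by (rule ok_exchange) auto
  have nat1: "\<eta> i j (Cod C L) Q R T \<cdot> ((L \<odot>\<^bsub>j\<^esub> Ide C Q) \<odot>\<^bsub>i\<^esub> Ide C (R \<otimes>\<^bsub>j\<^esub> T)) =
    ((L \<odot>\<^bsub>i\<^esub> Ide C R) \<odot>\<^bsub>j\<^esub> Ide C (Q \<otimes>\<^bsub>i\<^esub> T)) \<cdot> \<eta> i j (P \<oplus> P') Q R T"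
    using ex_nat[of i j L "Ide C Q" "Ide C R" "Ide C T"] by simp
  have nat2: "\<eta> i j Q (Cod C L) R T \<cdot> ((Ide C Q \<odot>\<^bsub>j\<^esub> L) \<odot>\<^bsub>i\<^esub> Ide C (R \<otimes>\<^bsub>j\<^esub> T)) =
    (Ide C (Q \<otimes>\<^bsub>i\<^esub> R) \<odot>\<^bsub>j\<^esub> (L \<odot>\<^bsub>i\<^esub> Ide C T)) \<cdot> \<eta> i j Q (P \<oplus> P') R T"
    using ex_nat[of i j "Ide C Q" L "Ide C R" "Ide C T"] by simp
  have nat3: "\<eta> i j Q R (Cod C L) T \<cdot> (Ide C (Q \<otimes>\<^bsub>j\<^esub> R) \<odot>\<^bsub>i\<^esub> (L \<odot>\<^bsub>j\<^esub> Ide C T)) =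
    ((Ide C Q \<odot>\<^bsub>i\<^esub> L) \<odot>\<^bsub>j\<^esub> Ide C (R \<otimes>\<^bsub>i\<^esub> T)) \<cdot> \<eta> i j Q R (P \<oplus> P') T"
    using ex_nat[of i j "Ide C Q" "Ide C R" L "Ide C T"] by simp
  have nat4: "\<eta> i j Q R T (Cod C L) \<cdot> (Ide C (Q \<otimes>\<^bsub>j\<^esub> R) \<odot>\<^bsub>i\<^esub> (Ide C T \<odot>\<^bsub>j\<^esub> L)) =
    (Ide C (Q \<otimes>\<^bsub>i\<^esub> T) \<odot>\<^bsub>j\<^esub> (Ide C R \<odot>\<^bsub>i\<^esub> L)) \<cdot> \<eta> i j Q R T (P \<oplus> P')"
    using ex_nat[of i j "Ide C Q" "Ide C R" "Ide C T" L] by simp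
  have "\<eta> i j (Cod C L) Q R T \<cdot>
      ((((L \<odot>\<^bsub>j\<^esub> Ide C Q) \<cdot> dl j P P' Q) \<odot>\<^bsub>i\<^esub> Ide C (R \<otimes>\<^bsub>j\<^esub> T)) \<cdot>
        dl i (P \<otimes>\<^bsub>j\<^esub> Q) (P' \<otimes>\<^bsub>j\<^esub> Q) (R \<otimes>\<^bsub>j\<^esub> T)) =
    (\<eta> i j (Cod C L) Q R T \<cdot> ((L \<odot>\<^bsub>j\<^esub> Ide C Q) \<odot>\<^bsub>i\<^esub> Ide C (R \<otimes>\<^bsub>j\<^esub> T))) \<cdot>
      (dl j P P' Q \<odot>\<^bsub>i\<^esub> Ide C (R \<otimes>\<^bsub>j\<^esub> T)) \<cdot> dl i (P \<otimes>\<^bsub>j\<^esub> Q) (P' \<otimes>\<^bsub>j\<^esub> Q) (R \<otimes>\<^bsub>j\<^esub> T)"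
    by (simp add: cmp_assoc ten_merge)
  then show ?thesis1
    unfolding nat1 by (simp add: cmp_assoc ten_merge ex_sum1)
  have "\<eta> i j Q (Cod C L) R T \<cdot>
      ((((Ide C Q \<odot>\<^bsub>j\<^esub> L) \<cdot> dr j Q P P') \<odot>\<^bsub>i\<^esub> Ide C (R \<otimes>\<^bsub>j\<^esub> T)) \<cdot>
        dl i (Q \<otimes>\<^bsub>j\<^esub> P) (Q \<otimes>\<^bsub>j\<^esub> P') (R \<otimes>\<^bsub>j\<^esub> T)) =
    (\<eta> i j Q (Cod C L) R T \<cdot> ((Ide C Q \<odot>\<^bsub>j\<^esub> L) \<odot>\<^bsub>i\<^esub> Ide C (R \<otimes>\<^bsub>j\<^esub> T))) \<cdot>
      (dr j Q P P' \<odot>\<^bsub>i\<^esub> Ide C (R \<otimes>\<^bsub>j\<^esub> T)) \<cdot> dl i (Q \<otimes>\<^bsub>j\<^esub> P) (Q \<otimes>\<^bsub>j\<^esub> P') (R \<otimes>\<^bsub>j\<^esub> T)"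
    by (simp add: cmp_assoc ten_merge)
  then show ?thesis2
    unfolding nat2 by (simp add: cmp_assoc ten_merge ex_sum2)
  have "\<eta> i j Q R (Cod C L) T \<cdot>
      ((Ide C (Q \<otimes>\<^bsub>j\<^esub> R) \<odot>\<^bsub>i\<^esub> ((L \<odot>\<^bsub>j\<^esub> Ide C T) \<cdot> dl j P P' T)) \<cdot>
        dr i (Q \<otimes>\<^bsub>j\<^esub> R) (P \<otimes>\<^bsub>j\<^esub> T) (P' \<otimes>\<^bsub>j\<^esub> T)) =
    (\<eta> i j Q R (Cod C L) T \<cdot> (Ide C (Q \<otimes>\<^bsub>j\<^esub> R) \<odot>\<^bsub>i\<^esub> (L \<odot>\<^bsub>j\<^esub> Ide C T))) \<cdot>
      (Ide C (Q \<otimes>\<^bsub>j\<^esub> R) \<odot>\<^bsub>i\<^esub> dl j P P' T) \<cdot> dr i (Q \<otimes>\<^bsub>j\<^esub> R) (P \<otimes>\<^bsub>j\<^esub> T) (P' \<otimes>\<^bsub>j\<^esub> T)"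
    by (simp add: cmp_assoc ten_merge)
  then show ?thesis3
    unfolding nat3 by (simp add: cmp_assoc ten_merge ex_sum3)
  have "\<eta> i j Q R T (Cod C L) \<cdot>
      ((Ide C (Q \<otimes>\<^bsub>j\<^esub> R) \<odot>\<^bsub>i\<^esub> ((Ide C T \<odot>\<^bsub>j\<^esub> L) \<cdot> dr j T P P')) \<cdot>
        dr i (Q \<otimes>\<^bsub>j\<^esub> R) (T \<otimes>\<^bsub>j\<^esub> P) (T \<otimes>\<^bsub>j\<^esub> P')) =
    (\<eta> i j Q R T (Cod C L) \<cdot> (Ide C (Q \<otimes>\<^bsub>j\<^esub> R) \<odot>\<^bsub>i\<^esub> (Ide C T \<odot>\<^bsub>j\<^esub> L))) \<cdot>
      (Ide C (Q \<otimes>\<^bsub>j\<^esub> R) \<odot>\<^bsub>i\<^esub> dr j T P P') \<cdot> dr i (Q \<otimes>\<^bsub>j\<^esub> R) (T \<otimes>\<^bsub>j\<^esub> P) (T \<otimes>\<^bsub>j\<^esub> P')"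
    by (simp add: cmp_assoc ten_merge)
  then show ?thesis4
    unfolding nat4 by (simp add: cmp_assoc ten_merge ex_sum4)
qed

subsection \<open>Formal morphisms\<close>

abbreviation wdm :: "'x mor \<Rightarrow> bool" where "wdm f \<equiv> is_mor n UNIV f"

lemma wdm_wd [simp]: "wdm f \<Longrightarrow> wd (mdom f)" "wdm f \<Longrightarrow> wd (mcod f)"
  by (rule is_mor_word; assumption)+

lemmas wdm_letters = set_letters_mcod[of n UNIV] distinct_letters_mcod[of n UNIV]

lemma wdm_simps:
  "wdm (Ten i f g) \<longleftrightarrow> ok i \<and> wdm f \<and> wdm g"
  "wdm (Exch i j p q r s) \<longleftrightarrow> ok i \<and> i < j \<and> ok j \<and> wd p \<and> wd q \<and> wd r \<and> wd s"
  by (auto simp: ok_def)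

lemma wdm_induct [consumes 1, case_names Idt Seq Ten Exch]:
  assumes "wdm f" "\<And>w. wd w \<Longrightarrow> P (Idt w)"
    and "\<And>g f. wdm g \<Longrightarrow> wdm f \<Longrightarrow> mdom g = mcod f \<Longrightarrow> P g \<Longrightarrow> P f \<Longrightarrow> P (g \<bullet> f)"
    and "\<And>i f g. ok i \<Longrightarrow> wdm f \<Longrightarrow> wdm g \<Longrightarrow> P f \<Longrightarrow> P g \<Longrightarrow> P (Ten i f g)"
    and "\<And>i j p q r s. ok i \<Longrightarrow> i < j \<Longrightarrow> ok j \<Longrightarrow> wd p \<Longrightarrow> wd q \<Longrightarrow> wd r \<Longrightarrow> wd s \<Longrightarrow>
      P (Exch i j p q r s)"
  shows "P f"
  using assms(1)
proof (induction f)
  case (Idt w) then show ?case by (auto intro: assms(2))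
next
  case (Seq g f) then show ?case by (auto intro: assms(3))
next
  case (Ten i f g) then show ?case unfolding wdm_simps by (auto intro: assms(4))
next
  case (Exch i j p q r s) then show ?case unfolding wdm_simps by (auto intro: assms(5))
qed

lemma mor_val_Arr [simp]:
  assumes "wdm f" "asg a"
  shows "Mv a f \<in> Arr C" "Dom C (Mv a f) = Wo a (mdom f)" "Cod C (Mv a f) = Wo a (mcod f)"
proof -
  have "Mv a f \<in> Arr C \<and> Dom C (Mv a f) = Wo a (mdom f) \<and> Cod C (Mv a f) = Wo a (mcod f)"
    using assms by (induction rule: wdm_induct) auto
  then show "Mv a f \<in> Arr C" "Dom C (Mv a f) = Wo a (mdom f)" "Cod C (Mv a f) = Wo a (mcod f)"
    by auto
qed

lemma mor_val_nat:
  assumes "wdm f" "arr_asg m"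
  shows "Mv (\<lambda>x. Cod C (m x)) f \<cdot> Wm m (mdom f) = Wm m (mcod f) \<cdot> Mv (\<lambda>x. Dom C (m x)) f"
  using assms
proof (induction rule: wdm_induct)
  case (Seq g f)
  have IHg: "Mv (\<lambda>x. Cod C (m x)) g \<cdot> Wm m (mdom g) = Wm m (mcod g) \<cdot> Mv (\<lambda>x. Dom C (m x)) g"
    using Seq by simp
  have "(Mv (\<lambda>x. Cod C (m x)) g \<cdot> Mv (\<lambda>x. Cod C (m x)) f) \<cdot> Wm m (mdom f) =
      (Mv (\<lambda>x. Cod C (m x)) g \<cdot> Wm m (mdom g)) \<cdot> Mv (\<lambda>x. Dom C (m x)) f"
    using Seq(1-3,5,6) by (simp add: cmp_assoc)
  also have "\<dots> = Wm m (mcod g) \<cdot> Mv (\<lambda>x. Dom C (m x)) g \<cdot> Mv (\<lambda>x. Dom C (m x)) f"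
    unfolding IHg using Seq(1-3,6) by (simp add: cmp_assoc)
  finally show ?case
    using Seq by simp
next
  case (Ten i f g)
  then show ?case by (simp add: ten_merge)
next
  case (Exch i j p q r s)
  then show ?case
    using ex_nat[of i j "Wm m p" "Wm m q" "Wm m r" "Wm m s"] by simp
qed auto

text \<open>The axioms of an \<open>n\<close>-fold monoidal category are what makes the evaluation of formal
  morphisms independent of representatives.\<close>

lemma mor_val_sound:
  assumes "mor_eq n UNIV f g" "asg a"
  shows "Mv a f = Mv a g"
  using assms
proof induction
  case (Seq_assoc h g f)
  then show ?case by (simp add: cmp_assoc)
next
  case (Ten_Idt i v w)
  then have "ok i" by (simp add: ok_def)
  then show ?case using Ten_Idt by simp
next
  case (Ten_Seq i f' f g' g)
  then have "ok i" by (simp add: ok_def)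
  then show ?case using Ten_Seq by (simp add: ten_merge)
next
  case (Ten_assoc i f g h)
  then have "ok i" by (simp add: ok_def)
  then show ?case using Ten_assoc by (simp add: ten_assoc)
next
  case (Unit_Ten i f)
  then have "ok i" by (simp add: ok_def)
  then show ?case using Unit_Ten by simp
next
  case (Ten_Unit i f)
  then have "ok i" by (simp add: ok_def)
  then show ?case using Ten_Unit by simp
next
  case (Exch_nat i j f g h k)
  then have "ok i" "i < j" "ok j" by (auto simp: ok_def)
  then show ?case
    using Exch_nat ex_nat[of i j "Mv a f" "Mv a g" "Mv a h" "Mv a k"] by simp
next
  case (Exch_unit1 i j v w)
  then have ok: "ok i" "i < j" "ok j" by (auto simp: ok_def)
  then show ?case using Exch_unit1 exchange.ex_unit[OF ok_exchange(1)[OF ok]] by simp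
next
  case (Exch_unit2 i j v w)
  then have ok: "ok i" "i < j" "ok j" by (auto simp: ok_def)
  then show ?case using Exch_unit2 exchange.ex_unit[OF ok_exchange(1)[OF ok]] by simp
next
  case (Exch_unit3 i j v w)
  then have ok: "ok i" "i < j" "ok j" by (auto simp: ok_def)
  then show ?case using Exch_unit3 exchange.ex_unit[OF ok_exchange(1)[OF ok]] by simp
next
  case (Exch_unit4 i j v w)
  then have ok: "ok i" "i < j" "ok j" by (auto simp: ok_def)
  then show ?case using Exch_unit4 exchange.ex_unit[OF ok_exchange(1)[OF ok]] by simp
next
  case (Exch_outer i j u v w x y z)
  then have ok: "ok i" "i < j" "ok j" by (auto simp: ok_def)
  then show ?case using Exch_outer by (simp add: exchange.ex_assoc_outer[OF ok_exchange(1)[OF ok]])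
next
  case (Exch_inner i j u v w x y z)
  then have ok: "ok i" "i < j" "ok j" by (auto simp: ok_def)
  then show ?case using Exch_inner by (simp add: exchange.ex_assoc_inner[OF ok_exchange(1)[OF ok]])
next
  case (Exch_hexagon i j k p q r s p' q' r' s')
  then have ok: "ok i" "i < j" "j < k" "ok k" "ok j" by (auto simp: ok_def)
  then show ?case using Exch_hexagon
    by (simp add: exchange_hexagon.hexagon[OF ok_hexagon[OF ok(1-4)]])
qed auto

lemma mor_val_zero:
  assumes "wdm f" "asg a" "y \<in> set (letters (mdom f))" "a y = \<zero>"
  shows "Mv a f = Ide C \<zero>"
  using assms
proof (induction rule: wdm_induct)
  case (Idt w)
  then show ?case by (auto simp: obj_val_zero)
next
  case (Seq g f)
  then show ?case by (simp add: set_letters_mcod)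
next
  case (Ten i f g)
  then show ?case by auto
next
  case (Exch i j p q r s)
  note ok = Exch(1-3)
  have "\<zero> \<in> {Wo a p, Wo a q, Wo a r, Wo a s}"
    using Exch obj_val_zero[of p a y] obj_val_zero[of q a y] obj_val_zero[of r a y]
      obj_val_zero[of s a y] by auto
  then show ?case
    using Exch exchange_sum.ex_zero[OF ok_exchange(2)[OF ok]] by simp
qed

lemma mor_val_cong:
  assumes "wdm f" "\<forall>y \<in> set (letters (mdom f)). a y = b y"
  shows "Mv a f = Mv b f"
  using assms
proof (induction rule: wdm_induct)
  case (Idt w)
  then show ?case using obj_val_cong[of w a b] by simp
next
  case (Seq g f)
  then show ?case by (simp add: set_letters_mcod)
next
  case (Exch i j p q r s)
  then show ?case
    using obj_val_cong[of p a b] obj_val_cong[of q a b] obj_val_cong[of r a b] obj_val_cong[of s a b]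
    by simp
qed auto

lemma mor_val_upd: "wdm f \<Longrightarrow> x \<notin> set (letters (mdom f)) \<Longrightarrow> Mv (a(x := A)) f = Mv a f"
  by (rule mor_val_cong) (auto simp: fun_upd_apply)

text \<open>Linearity of the transformation given by a formal morphism. For a product it is naturality of
  the distributivity morphisms, for an exchange the exchange factorization axioms.\<close>

lemma mor_val_lin:
  assumes "wdm f" "asg a" "A' \<in> Obj C" "distinct (letters (mdom f))" "x \<in> set (letters (mdom f))"
  shows "Mv (a(x := a x \<oplus> A')) f \<cdot> Lin x a A' (mdom f) =
    Lin x a A' (mcod f) \<cdot> (Mv a f \<boxplus> Mv (a(x := A')) f)"
  using assms
proof (induction rule: wdm_induct)
  case (Seq g f)
  have x: "x \<in> set (letters (mcod f))" "distinct (letters (mcod f))"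
    using Seq by (simp_all add: wdm_letters)
  have x': "x \<in> set (letters (mcod g))" "distinct (letters (mcod g))"
    using Seq x by (simp_all add: wdm_letters)
  note [simp] = Seq(1-3,6-9) x x'
  have IHf: "Mv (a(x := a x \<oplus> A')) f \<cdot> Lin x a A' (mdom f) =
    Lin x a A' (mcod f) \<cdot> (Mv a f \<boxplus> Mv (a(x := A')) f)"
    using Seq by simp
  have IHg: "Mv (a(x := a x \<oplus> A')) g \<cdot> Lin x a A' (mcod f) =
    Lin x a A' (mcod g) \<cdot> (Mv a g \<boxplus> Mv (a(x := A')) g)"
    using Seq x by simp
  have "Mv (a(x := a x \<oplus> A')) (g \<bullet> f) \<cdot> Lin x a A' (mdom f) =
    (Mv (a(x := a x \<oplus> A')) g \<cdot> Lin x a A' (mcod f)) \<cdot> (Mv a f \<boxplus> Mv (a(x := A')) f)"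
    using Seq(7-9) by (simp add: cmp_assoc IHf)
  also have "\<dots> = Lin x a A' (mcod g) \<cdot> (Mv a (g \<bullet> f) \<boxplus> Mv (a(x := A')) (g \<bullet> f))"
    unfolding IHg by (simp add: cmp_assoc plus_merge)
  finally show ?case
    using Seq by simp
next
  case (Ten i f g)
  note [simp] = Ten(1-3) \<open>asg a\<close> \<open>A' \<in> Obj C\<close>
  have dist: "distinct (letters (mdom f))" "distinct (letters (mdom g))"
      "distinct (letters (mdom f) @ letters (mdom g))"
    using Ten by auto
  then have dist': "distinct (letters (mcod f))" "distinct (letters (mcod g))"
      "distinct (letters (mcod f) @ letters (mcod g))"
    by (simp_all add: wdm_letters)
  from Ten.prems consider (f) "x \<in> set (letters (mdom f))" "x \<notin> set (letters (mdom g))"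
    | (g) "x \<in> set (letters (mdom g))" "x \<notin> set (letters (mdom f))" by auto
  then show ?case
  proof cases
    case f
    then have f': "x \<in> set (letters (mcod f))" "x \<notin> set (letters (mcod g))"
      by (simp_all add: wdm_letters)
    have "Mv (a(x := a x \<oplus> A')) f \<cdot> Lin x a A' (mdom f) =
      Lin x a A' (mcod f) \<cdot> (Mv a f \<boxplus> Mv (a(x := A')) f)"
      using Ten f dist by simp
    then show ?thesis
      using f f' dist dist'
      by (simp add: lin_val_wten(1) mor_val_upd cmp_assoc dist_nat ten_merge)
  next
    case g
    then have g': "x \<in> set (letters (mcod g))" "x \<notin> set (letters (mcod f))"
      by (simp_all add: wdm_letters)
    have "Mv (a(x := a x \<oplus> A')) g \<cdot> Lin x a A' (mdom g) =
      Lin x a A' (mcod g) \<cdot> (Mv a g \<boxplus> Mv (a(x := A')) g)"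
      using Ten g dist by simp
    then show ?thesis
      using g g' dist dist'
      by (simp add: lin_val_wten(2) mor_val_upd cmp_assoc dist_nat ten_merge)
  qed
next
  case (Exch i j p q r s)
  note [simp] = Exch(1-7) \<open>asg a\<close> \<open>A' \<in> Obj C\<close>
  have dist: "distinct (letters p)" "distinct (letters q)" "distinct (letters r)" "distinct (letters s)"
    "set (letters p) \<inter> set (letters q) = {}" "set (letters p) \<inter> set (letters r) = {}"
    "set (letters p) \<inter> set (letters s) = {}" "set (letters q) \<inter> set (letters r) = {}"
    "set (letters q) \<inter> set (letters s) = {}" "set (letters r) \<inter> set (letters s) = {}"
    using Exch.prems by auto
  have "x \<in> set (letters p) \<union> set (letters q) \<union> set (letters r) \<union> set (letters s)"
    using Exch.prems by auto
  then consider
      (p) "x \<in> set (letters p)" "x \<notin> set (letters q)" "x \<notin> set (letters r)" "x \<notin> set (letters s)"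
    | (q) "x \<in> set (letters q)" "x \<notin> set (letters p)" "x \<notin> set (letters r)" "x \<notin> set (letters s)"
    | (r) "x \<in> set (letters r)" "x \<notin> set (letters p)" "x \<notin> set (letters q)" "x \<notin> set (letters s)"
    | (s) "x \<in> set (letters s)" "x \<notin> set (letters p)" "x \<notin> set (letters q)" "x \<notin> set (letters r)"
    using dist(5-10) by blast
  then show ?case
  proof cases
    case p
    then show ?thesis
      using ex_lin(1)[of i j "Wo a p" "Wo (a(x := A')) p" "Wo a q" "Wo a r" "Wo a s" "Lin x a A' p"] dist
      by (simp add: lin_val_wten Int_Un_distrib Int_Un_distrib2 Int_commute)
  next
    case q
    then show ?thesis
      using ex_lin(2)[of i j "Wo a q" "Wo (a(x := A')) q" "Wo a p" "Wo a r" "Wo a s" "Lin x a A' q"] dist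
      by (simp add: lin_val_wten Int_Un_distrib Int_Un_distrib2 Int_commute)
  next
    case r
    then show ?thesis
      using ex_lin(3)[of i j "Wo a r" "Wo (a(x := A')) r" "Wo a p" "Wo a q" "Wo a s" "Lin x a A' r"] dist
      by (simp add: lin_val_wten Int_Un_distrib Int_Un_distrib2 Int_commute)
  next
    case s
    then show ?thesis
      using ex_lin(4)[of i j "Wo a s" "Wo (a(x := A')) s" "Wo a p" "Wo a q" "Wo a r" "Lin x a A' s"] dist
      by (simp add: lin_val_wten Int_Un_distrib Int_Un_distrib2 Int_commute)
  qed
qed auto

subsection \<open>Substitution\<close>

lemma obj_val_subst:
  assumes "wd w" "asg a" "\<forall>x \<in> set (letters w). wd (s x)"
  shows "Wo a (subst_word s w) = Wo (\<lambda>x. Wo a (s x)) w"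
  using assms(1,3)
proof (induction w)
  case (Prod i ws)
  have ok: "ok i" and ws: "\<forall>w \<in> set ws. wd (subst_word s w) \<and> Wo a (subst_word s w) = Wo (\<lambda>x. Wo a (s x)) w"
    using Prod wd_Prod[of i ws] by (auto intro: is_word_subst_word)
  have "wd (foldr (wten i) (map (subst_word s) ws) Unit) \<and>
      Wo a (foldr (wten i) (map (subst_word s) ws) Unit) = Wos i (\<lambda>x. Wo a (s x)) ws"
    using ws ok \<open>asg a\<close> by (induction ws) auto
  then show ?case by simp
qed auto

lemma mor_val_subst:
  assumes "wdm f" "asg a" "\<forall>x \<in> set (letters (mdom f)). wd (s x)"
  shows "Mv a (subst_mor s f) = Mv (\<lambda>x. Wo a (s x)) f"
  using assms
  by (induction rule: wdm_induct) (auto simp: obj_val_subst wdm_letters)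

lemma mor_val_word_mor: "Mv a (word_mor m w) = Wm (\<lambda>x. Mv a (m x)) w"
proof (induction w)
  case (Prod i ws)
  then show ?case by simp (induction ws, auto)
qed auto

text \<open>The path to \<open>x\<close> in the substituted word is the path to \<open>y\<close> in \<open>w\<close> followed by the path to
  \<open>x\<close> in \<open>s y\<close>. This is the formula for the linearity constraint of a composite.\<close>

lemma lin_val_subst:
  assumes "wd w" "asg a" "A' \<in> Obj C" "\<forall>z. wd (s z)" "distinct (letters w)"
    "distinct (letters (subst_word s w))" "y \<in> set (letters w)" "x \<in> set (letters (s y))"
  shows "Lin x a A' (subst_word s w) =
    Wm ((\<lambda>z. Ide C (Wo a (s z)))(y := Lin x a A' (s y))) w \<cdot>
    Lin y (\<lambda>z. Wo a (s z)) (Wo (a(x := A')) (s y)) w"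
  using assms
proof (induction rule: wd_induct)
  case (Letter z)
  then have [simp]: "Lin x a A' (s z) \<in> Arr C"
    "Dom C (Lin x a A' (s z)) = Wo a (s z) \<oplus> Wo (a(x := A')) (s z)"
    by auto
  show ?case
    using Letter by simp
next
  case (wten i v w)
  note [simp] = \<open>ok i\<close> \<open>wd v\<close> \<open>wd w\<close> \<open>asg a\<close> \<open>A' \<in> Obj C\<close>
  have wds [simp]: "wd (s z)" for z using wten.prems by blast
  let ?b = "\<lambda>z. Wo a (s z)"
  let ?m = "(\<lambda>z. Ide C (?b z))(y := Lin x a A' (s y))"
  have [simp]: "asg ?b" "wd (subst_word s v)" "wd (subst_word s w)"
    using obj_val_Obj[OF \<open>asg a\<close> wds] by (auto simp: asg_def[of ?b] intro!: is_word_subst_word[of n UNIV])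
  have subst [simp]: "Wo a (subst_word s u) = Wo ?b u" if "wd u" for u
    using that by (simp add: obj_val_subst)
  have dist: "distinct (letters v)" "distinct (letters w)" "distinct (letters v @ letters w)"
    "distinct (letters (subst_word s v))" "distinct (letters (subst_word s w))"
    "distinct (letters (subst_word s v) @ letters (subst_word s w))"
    using wten.prems by auto
  have "y \<in> set (letters u) \<Longrightarrow> distinct (letters (subst_word s u)) \<Longrightarrow> distinct (letters (s y))" for u
    by (auto simp: letters_subst_word distinct_concat_iff)
  then have dy: "distinct (letters (s y))"
    using wten.prems dist by (metis Un_iff letters_wten set_append)
  have [simp]: "Lin x a A' (s y) \<in> Arr C"
    "Dom C (Lin x a A' (s y)) = ?b y \<oplus> Wo (a(x := A')) (s y)"
    using dy wten.prems by auto
  have [simp]: "arr_asg ?m"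
    by simp
  have other: "Wo (a(x := A')) (subst_word s u) = Wo (?b(y := Wo (a(x := A')) (s y))) u"
    if "wd u" "y \<in> set (letters u)" "distinct (letters u)" "distinct (letters (subst_word s u))" for u
  proof -
    have "x \<notin> set (letters (s z))" if "z \<in> set (letters u)" "z \<noteq> y" for z
    proof -
      from split_list[OF that(1)] obtain us vs where "letters u = us @ z # vs" by blast
      then show ?thesis
        using that \<open>y \<in> set (letters u)\<close> \<open>distinct (letters (subst_word s u))\<close> wten.prems(7)
        by (auto simp: letters_subst_word)
    qed
    then show ?thesis
      using that by (subst obj_val_subst) (auto intro!: obj_val_cong simp: fun_upd_apply)
  qed
  have sub: "x \<in> set (letters (subst_word s u))" if "y \<in> set (letters u)" for u
    using that wten.prems(7) by (auto simp: letters_subst_word)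
  from wten.prems consider (v) "y \<in> set (letters v)" "y \<notin> set (letters w)"
    | (w) "y \<in> set (letters w)" "y \<notin> set (letters v)" by auto
  then show ?case
  proof cases
    case v
    have IH: "Lin x a A' (subst_word s v) = Wm ?m v \<cdot> Lin y ?b (Wo (a(x := A')) (s y)) v"
      using wten v dist by blast
    show ?thesis
      using v dist sub[OF v(1)]
      by (simp add: lin_val_wten(1) IH other cmp_assoc ten_merge)
  next
    case w
    have IH: "Lin x a A' (subst_word s w) = Wm ?m w \<cdot> Lin y ?b (Wo (a(x := A')) (s y)) w"
      using wten w dist by blast
    show ?thesis
      using w dist sub[OF w(1)]
      by (simp add: lin_val_wten(2) IH other cmp_assoc ten_merge)
  qed
qed auto

lemma obj_val_map: "wd w \<Longrightarrow> asg a \<Longrightarrow> Wo a (map_word h w) = Wo (\<lambda>x. a (h x)) w"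
  using obj_val_subst[of w a "\<lambda>x. Letter (h x)"] by (simp add: map_word_eq_subst_word)

lemma mor_val_map: "wdm f \<Longrightarrow> asg a \<Longrightarrow> Mv a (map_mor h f) = Mv (\<lambda>x. a (h x)) f"
  using mor_val_subst[of f a "\<lambda>x. Letter (h x)"] by (simp add: map_mor_eq_subst_mor)

lemma arr_val_map: "wd w \<Longrightarrow> Wm m (map_word h w) = Wm (\<lambda>x. m (h x)) w"
proof (induction w)
  case (Prod i ws)
  then have "map (\<lambda>w. Wm m (map_word h w)) ws = map (Wm (\<lambda>x. m (h x))) ws" by auto
  then show ?case by (simp add: comp_def del: foldr_map cong: map_cong)
qed auto

lemma arr_val_subst:
  assumes "wd w" "arr_asg m" "\<forall>x \<in> set (letters w). wd (s x)"
  shows "Wm m (subst_word s w) = Wm (\<lambda>x. Wm m (s x)) w"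
  using assms(1,3)
proof (induction w)
  case (Prod i ws)
  have ok: "ok i" and ws: "\<forall>w \<in> set ws. wd (subst_word s w) \<and> Wm m (subst_word s w) = Wm (\<lambda>x. Wm m (s x)) w"
    using Prod wd_Prod[of i ws] by (auto intro: is_word_subst_word)
  have "wd (foldr (wten i) (map (subst_word s) ws) Unit) \<and>
      Wm m (foldr (wten i) (map (subst_word s) ws) Unit) =
      foldr (ten_m S i) (map (Wm (\<lambda>x. Wm m (s x))) ws) (Ide C \<u>)"
    using ws ok \<open>arr_asg m\<close> by (induction ws) auto
  then show ?case by simp
qed auto

lemma lin_val_map:
  assumes "wd w" "asg a" "A' \<in> Obj C" "distinct (letters w)" "x \<in> set (letters w)"
    and inj: "inj_on h (set (letters w))"
  shows "Lin (h x) a A' (map_word h w) = Lin x (\<lambda>x. a (h x)) A' w"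
proof -
  let ?b = "\<lambda>x. a (h x)"
  have b: "asg ?b" using assms(2) by (auto simp: asg_def)
  have eq: "(\<lambda>z. Ide C (?b z))(x := Ide C (?b x \<oplus> A')) = (\<lambda>z. Ide C ((?b(x := ?b x \<oplus> A')) z))"
    by (auto simp: fun_upd_apply)
  have "distinct (map h (letters w))"
    using assms by (simp add: distinct_map)
  then have "Lin (h x) a A' (map_word h w) =
    Wm ((\<lambda>z. Ide C (?b z))(x := Ide C (?b x \<oplus> A'))) w \<cdot> Lin x ?b A' w"
    using lin_val_subst[of w a A' "\<lambda>x. Letter (h x)" x "h x"] assms
    by (simp add: letters_subst_word flip: map_word_eq_subst_word[of n UNIV])
  also have "\<dots> = Lin x ?b A' w"
    unfolding eq using assms b by simp
  finally show ?thesis .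
qed

end

section \<open>Powers of a category\<close>

abbreviation pow_cat :: "('o, 'm, 'z) cat_scheme \<Rightarrow> nat \<Rightarrow> ('o list, 'm list) cat" where
  "pow_cat C k \<equiv> prod_cat (replicate k C)"

lemma map2_replicate: "length xs = k \<Longrightarrow> map2 h (replicate k c) xs = map (h c) xs"
  by (induction xs arbitrary: k) auto

lemma list_all2_replicate_iff:
  "list_all2 P (replicate k c) xs \<longleftrightarrow> length xs = k \<and> (\<forall>x \<in> set xs. P c x)"
  by (auto simp: list_all2_conv_all_nth all_set_conv_all_nth)

lemma Obj_pow [simp]: "As \<in> Obj (pow_cat C k) \<longleftrightarrow> length As = k \<and> set As \<subseteq> Obj C"
  by (auto simp: prod_cat_def list_all2_replicate_iff)

lemma Arr_pow [simp]: "fs \<in> Arr (pow_cat C k) \<longleftrightarrow> length fs = k \<and> set fs \<subseteq> Arr C"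
  by (auto simp: prod_cat_def list_all2_replicate_iff)

lemma pow_simps [simp]:
  "length fs = k \<Longrightarrow> Dom (pow_cat C k) fs = map (Dom C) fs"
  "length fs = k \<Longrightarrow> Cod (pow_cat C k) fs = map (Cod C) fs"
  "length As = k \<Longrightarrow> Ide (pow_cat C k) As = map (Ide C) As"
  by (simp_all add: prod_cat_def map2_replicate)

lemma Cmp_pow [simp]:
  "length fs = k \<Longrightarrow> length gs = k \<Longrightarrow> Cmp (pow_cat C k) gs fs = map2 (Cmp C) gs fs"
  by (simp add: prod_cat_def map2_replicate)

lemma concat_replicates: "concat (map (\<lambda>k. replicate k c) ks) = replicate (sum_list ks) c"
  by (induction ks) (auto simp: replicate_add)

lemma length_blocks [simp]: "length (blocks ks xs) = length ks"
  by (induction ks arbitrary: xs) auto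

lemma blocks_nth:
  "l < length ks \<Longrightarrow> length xs = sum_list ks \<Longrightarrow>
    blocks ks xs ! l = take (ks ! l) (drop (sum_list (take l ks)) xs)"
proof (induction ks arbitrary: xs l)
  case (Cons k ks)
  then show ?case by (cases l) (auto simp: add.commute)
qed auto

lemma sum_list_take_nth_le: "l < length ks \<Longrightarrow> sum_list (take l ks) + ks ! l \<le> sum_list (ks :: nat list)"
proof (induction ks arbitrary: l)
  case (Cons k ks)
  then show ?case by (cases l) auto
qed auto

lemma length_blocks_nth:
  "l < length ks \<Longrightarrow> length xs = sum_list ks \<Longrightarrow> length (blocks ks xs ! l) = ks ! l"
  using sum_list_take_nth_le[of l ks] by (simp add: blocks_nth)

lemma blocks_nth_nth:
  "l < length ks \<Longrightarrow> length xs = sum_list ks \<Longrightarrow> p < ks ! l \<Longrightarrow>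
    blocks ks xs ! l ! p = xs ! (sum_list (take l ks) + p)"
  using sum_list_take_nth_le[of l ks] by (simp add: blocks_nth)

lemma set_blocks_nth:
  "l < length ks \<Longrightarrow> length xs = sum_list ks \<Longrightarrow> set (blocks ks xs ! l) \<subseteq> set xs"
  by (simp add: blocks_nth) (meson set_drop_subset set_take_subset subset_trans)

lemma locate_props:
  "p < sum_list ks \<Longrightarrow> locate ks p = (j, q) \<Longrightarrow>
    j < length ks \<and> q < ks ! j \<and> p = sum_list (take j ks) + q"
proof (induction ks arbitrary: p j q)
  case (Cons k ks)
  show ?case
  proof (cases "p < k")
    case False
    then obtain j' where "locate ks (p - k) = (j', q)" "j = Suc j'"
      using Cons.prems by (auto simp: apfst_def map_prod_def split: prod.splits)
    moreover have "p - k < sum_list ks"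
      using Cons.prems False by auto
    ultimately show ?thesis
      using Cons.IH[of "p - k" j' q] False by auto
  qed (use Cons.prems in auto)
qed auto

context permutative_category
begin

text \<open>Lists of arguments become assignments to all of \<open>nat\<close>; beyond the end of the
  list the value is \<open>\<zero>\<close>, so as to obtain an assignment of objects.\<close>

definition pad :: "'o list \<Rightarrow> nat \<Rightarrow> 'o" where
  "pad As j = (if j < length As then As ! j else \<zero>)"

definition arr_pad :: "'m list \<Rightarrow> nat \<Rightarrow> 'm" where
  "arr_pad fs j = (if j < length fs then fs ! j else Ide C \<zero>)"

lemma asg_pad [simp]: "set As \<subseteq> Obj C \<Longrightarrow> asg (pad As)"
  by (auto simp: asg_def pad_def)

lemma arr_asg_pad [simp]: "set fs \<subseteq> Arr C \<Longrightarrow> arr_asg (arr_pad fs)"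
  by (auto simp: arr_asg_def arr_pad_def)

lemma pad_nth [simp]: "i < length As \<Longrightarrow> pad As i = As ! i"
  "i < length fs \<Longrightarrow> arr_pad fs i = fs ! i"
  by (auto simp: pad_def arr_pad_def)

lemma pad_update [simp]:
  "i < length As \<Longrightarrow> pad (As[i := A]) = (pad As)(i := A)"
  "i < length fs \<Longrightarrow> arr_pad (fs[i := f]) = (arr_pad fs)(i := f)"
  by (auto simp: pad_def arr_pad_def fun_upd_apply fun_eq_iff)

lemma pad_map [simp]:
  "pad (map (Dom C) fs) = (\<lambda>j. Dom C (arr_pad fs j))"
  "pad (map (Cod C) fs) = (\<lambda>j. Cod C (arr_pad fs j))"
  "arr_pad (map (Ide C) As) = (\<lambda>j. Ide C (pad As j))"
  by (auto simp: pad_def arr_pad_def)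

lemma arr_pad_Cmp:
  "length fs = length gs \<Longrightarrow> arr_pad (map2 (Cmp C) gs fs) = (\<lambda>j. arr_pad gs j \<cdot> arr_pad fs j)"
  by (auto simp: arr_pad_def fun_eq_iff)

end

context En_category
begin

section \<open>The multifunctor determined by an \<open>E\<^sub>n\<close>-monoidal structure\<close>

definition word_fun :: "nat \<Rightarrow> nat word \<Rightarrow> ('o, 'm) mlfun" where
  "word_fun k w = \<lparr>
     fun_o = (\<lambda>As \<in> Obj (pow_cat C k). Wo (pad As) w),
     fun_m = (\<lambda>fs \<in> Arr (pow_cat C k). Wm (arr_pad fs) w),
     lin = (\<lambda>i As A'. if i < k \<and> As \<in> Obj (pow_cat C k) \<and> A' \<in> Obj C
       then Lin i (pad As) A' w else undefined)\<rparr>"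

definition mor_trans :: "nat \<Rightarrow> nat mor \<Rightarrow> ('o, 'm) mltrans" where
  "mor_trans k f = \<lparr>src = word_fun k (mdom f), tgt = word_fun k (mcod f),
     component = (\<lambda>As \<in> Obj (pow_cat C k). Mv (pad As) f)\<rparr>"

lemma word_fun_simps [simp]:
  "length As = k \<Longrightarrow> set As \<subseteq> Obj C \<Longrightarrow> fun_o (word_fun k w) As = Wo (pad As) w"
  "length fs = k \<Longrightarrow> set fs \<subseteq> Arr C \<Longrightarrow> fun_m (word_fun k w) fs = Wm (arr_pad fs) w"
  "i < k \<Longrightarrow> length As = k \<Longrightarrow> set As \<subseteq> Obj C \<Longrightarrow> A' \<in> Obj C \<Longrightarrow>
    lin (word_fun k w) i As A' = Lin i (pad As) A' w"
  by (simp_all add: word_fun_def)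

lemma mor_trans_simps [simp]:
  "src (mor_trans k f) = word_fun k (mdom f)" "tgt (mor_trans k f) = word_fun k (mcod f)"
  "length As = k \<Longrightarrow> set As \<subseteq> Obj C \<Longrightarrow> component (mor_trans k f) As = Mv (pad As) f"
  by (simp_all add: mor_trans_def)

lemma is_op_props:
  assumes "is_op n k w"
  shows "wd w" "distinct (letters w)" "set (letters w) = {..<k}"
  using assms by (auto simp: is_op_def is_word_iff[of n "{..<k}"])

lemma is_op_mor_props:
  assumes "is_op_mor n k f"
  shows "wdm f" "is_op n k (mdom f)" "is_op n k (mcod f)"
  using assms is_op_mor_mcod[OF assms] by (auto simp: is_op_mor_def is_mor_iff[of n "{..<k}"])

lemma multilinear_word_fun:
  assumes w: "is_op n k w"
  shows "multilinear (replicate k C) C (word_fun k w)"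
proof -
  let ?F = "word_fun k w"
  note [simp] = is_op_props[OF w]
  have sub [simp]: "set (As[i := A]) \<subseteq> Obj C" if "set As \<subseteq> Obj C" "A \<in> Obj C" for As i A
    using that set_update_subset_insert[of As i A] by auto
  have subm [simp]: "set (fs[i := f]) \<subseteq> Arr C" if "set fs \<subseteq> Arr C" "f \<in> Arr C" for fs i f
    using that set_update_subset_insert[of fs i f] by auto
  have nth [simp]: "As ! i \<in> Obj C" if "set As \<subseteq> Obj C" "i < length As" for As i
    using that by auto
  have nthm [simp]: "fs ! i \<in> Arr C" if "set fs \<subseteq> Arr C" "i < length fs" for fs i
    using that by auto
  have objs [simp]: "set (map (Dom C) fs) \<subseteq> Obj C" "set (map (Cod C) fs) \<subseteq> Obj C" if "set fs \<subseteq> Arr C" for fs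
    using that by auto
  have arrs [simp]: "set (map (Ide C) As) \<subseteq> Arr C" if "set As \<subseteq> Obj C" for As
    using that by auto
  note [simp del] = set_map
  show ?thesis
  proof
    have cmp: "fun_m ?F (map2 (Cmp C) gs fs) = fun_m ?F gs \<cdot> fun_m ?F fs"
      if [simp]: "length fs = k" "length gs = k" "set fs \<subseteq> Arr C" "set gs \<subseteq> Arr C"
        and eq: "map (Dom C) gs = map (Cod C) fs" for fs gs
    proof -
      have "Dom C (gs ! j) = Cod C (fs ! j)" if "j < k" for j
        using that arg_cong[OF eq, of "\<lambda>xs. xs ! j"] by simp
      then have "set (map2 (Cmp C) gs fs) \<subseteq> Arr C" "\<forall>j. Dom C (arr_pad gs j) = Cod C (arr_pad fs j)"
        by (auto simp: in_set_conv_nth arr_pad_def set_map set_zip)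
      then show ?thesis
        by (simp add: arr_pad_Cmp arr_val_Cmp)
    qed
    show "is_functor (pow_cat C k) C (fun_o ?F) (fun_m ?F)"
      unfolding is_functor_def using cmp by (auto simp: hom_iff)
  next
    fix i As A' assume "i < length (replicate k C)" "As \<in> Obj (pow_cat C k)" "A' \<in> Obj (replicate k C ! i)"
    then have [simp]: "i < k" "length As = k" "set As \<subseteq> Obj C" "A' \<in> Obj C" by auto
    interpret A: additive C "\<lambda>A. Wo ((pad As)(i := A)) w" "\<lambda>f. Wm ((\<lambda>y. Ide C (pad As y))(i := f)) w"
      "\<lambda>A A'. Lin i ((pad As)(i := A)) A' w"
      by (rule additive_word) auto
    have [simp]: "(pad As)(i := As ! i) = pad As"
      by (auto simp: fun_eq_iff fun_upd_apply)
    show "lin ?F i As A' \<in> hom C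
        (fun_o ?F As \<oplus> fun_o ?F (As[i := A']))
        (fun_o ?F (As[i := As ! i \<oplus>\<^bsub>replicate k C ! i\<^esub> A']))"
      by (auto simp: hom_iff)
    show "fun_m ?F ((Ide (pow_cat C k) As)[i := \<zeta>\<^bsub>replicate k C ! i\<^esub> (As ! i) A']) \<cdot>
        lin ?F i As A' =
      lin ?F i (As[i := A']) (As ! i) \<cdot>
        \<zeta> (fun_o ?F As) (fun_o ?F (As[i := A']))"
      using A.l_zeta[of "As ! i" A'] by simp
    show "lin ?F i (As[i := As ! i \<oplus>\<^bsub>replicate k C ! i\<^esub> A']) A'' \<cdot>
        (lin ?F i As A' \<boxplus> Ide C (fun_o ?F (As[i := A'']))) =
      lin ?F i As (A' \<oplus>\<^bsub>replicate k C ! i\<^esub> A'') \<cdot>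
        (Ide C (fun_o ?F As) \<boxplus> lin ?F i (As[i := A']) A'')"
      if "A'' \<in> Obj (replicate k C ! i)" for A''
      using A.l_assoc[of "As ! i" A' A''] that by simp
    show "lin ?F i As A' = Ide C (fun_o ?F (As[i := As ! i \<oplus>\<^bsub>replicate k C ! i\<^esub> A']))"
      if "(\<exists>j < length (replicate k C). As ! j = \<zero>\<^bsub>replicate k C ! j\<^esub>) \<or> A' = \<zero>\<^bsub>replicate k C ! i\<^esub>"
    proof -
      have "(\<exists>y \<in> set (letters w). pad As y = \<zero>) \<or> A' = \<zero>"
        using that by auto
      then show ?thesis
        using lin_val_zero[of w "pad As" A' i] by simp
    qed
    fix p B' assume "p < length (replicate k C)" "B' \<in> Obj (replicate k C ! p)" "i \<noteq> p"
    then show "lin ?F p (As[i := As ! i \<oplus>\<^bsub>replicate k C ! i\<^esub> A']) B' \<cdot>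
        (lin ?F i As A' \<boxplus> lin ?F i (As[p := B']) A') =
      lin ?F i (As[p := As ! p \<oplus>\<^bsub>replicate k C ! p\<^esub> B']) A' \<cdot>
        (lin ?F p As B' \<boxplus> lin ?F p (As[i := A']) B') \<cdot>
        (Ide C (fun_o ?F As) \<boxplus>
          \<zeta> (fun_o ?F (As[i := A'])) (fun_o ?F (As[p := B'])) \<boxplus>
          Ide C (fun_o ?F (As[i := A', p := B'])))"
      using lin_val_lin_val[of w "pad As" A' B' i p] by simp
  next
    fix i fs As Bs f' A' B'
    assume "i < length (replicate k C)" "fs \<in> hom (pow_cat C k) As Bs" "f' \<in> hom (replicate k C ! i) A' B'"
    then have [simp]: "i < k" "length fs = k" "set fs \<subseteq> Arr C" "f' \<in> Arr C"
      and eqs: "As = map (Dom C) fs" "Bs = map (Cod C) fs" "A' = Dom C f'" "B' = Cod C f'"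
      by (auto simp: hom_def)
    show "lin ?F i Bs B' \<cdot> (fun_m ?F fs \<boxplus> fun_m ?F (fs[i := f'])) =
      fun_m ?F (fs[i := fs ! i \<boxplus>\<^bsub>replicate k C ! i\<^esub> f']) \<cdot> lin ?F i As A'"
      unfolding eqs using lin_val_nat[of w "arr_pad fs" f' i] by simp
  next
    fix i As assume "i < length (replicate k C)" "As \<in> Obj (pow_cat C k)" "As ! i = \<zero>\<^bsub>replicate k C ! i\<^esub>"
    then show "fun_o ?F As = \<zero>"
      using obj_val_zero[of w "pad As" i] by simp
  next
    fix i fs assume "i < length (replicate k C)" "fs \<in> Arr (pow_cat C k)"
      "fs ! i = Ide (replicate k C ! i) \<zero>\<^bsub>replicate k C ! i\<^esub>"
    then show "fun_m ?F fs = Ide C \<zero>"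
      using arr_val_zero[of w "arr_pad fs" i] by simp
  qed (auto simp: word_fun_def)
qed

lemma multilinear_trans_mor_trans:
  assumes f: "is_op_mor n k f"
  shows "multilinear_trans (replicate k C) C (mor_trans k f)"
proof -
  note op = is_op_mor_props[OF f] is_op_props[OF is_op_mor_props(2)[OF f]]
  note [simp] = op(1,4-6)
  have sub [simp]: "set (As[i := A]) \<subseteq> Obj C" if "set As \<subseteq> Obj C" "A \<in> Obj C" for As i A
    using that set_update_subset_insert[of As i A] by auto
  have [simp]: "set (map (Dom C) fs) \<subseteq> Obj C" "set (map (Cod C) fs) \<subseteq> Obj C" if "set fs \<subseteq> Arr C" for fs
    using that by auto
  note [simp del] = set_map
  show ?thesis
  proof (rule multilinear_trans.intro)
    show "multilinear (replicate k C) C (src (mor_trans k f))" "multilinear (replicate k C) C (tgt (mor_trans k f))"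
      using op(2,3) by (auto intro: multilinear_word_fun)
    show "is_nat_trans (pow_cat C k) C (fun_o (src (mor_trans k f))) (fun_m (src (mor_trans k f)))
      (fun_o (tgt (mor_trans k f))) (fun_m (tgt (mor_trans k f))) (component (mor_trans k f))"
      unfolding is_nat_trans_def by (auto simp: hom_iff mor_val_nat)
  next
    fix i As A' assume "i < length (replicate k C)" "As \<in> Obj (pow_cat C k)" "A' \<in> Obj (replicate k C ! i)"
    then have [simp]: "i < k" "length As = k" "set As \<subseteq> Obj C" "A' \<in> Obj C" "As ! i \<in> Obj C" by auto
    show "component (mor_trans k f) (As[i := As ! i \<oplus>\<^bsub>replicate k C ! i\<^esub> A']) \<cdot> lin (src (mor_trans k f)) i As A' =
      lin (tgt (mor_trans k f)) i As A' \<cdot>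
        (component (mor_trans k f) As \<boxplus> component (mor_trans k f) (As[i := A']))"
      using mor_val_lin[of f "pad As" A' i] by simp
  next
    fix i As assume "i < length (replicate k C)" "As \<in> Obj (pow_cat C k)" "As ! i = \<zero>\<^bsub>replicate k C ! i\<^esub>"
    then show "component (mor_trans k f) As = Ide C \<zero>"
      using mor_val_zero[of f "pad As" i] by simp
  qed (auto simp: mor_trans_def)
qed

end

text \<open>The letters of the composite are distinct because there are as many of them as there are
  values that they take.\<close>

lemma is_op_Mon_comp1:
  assumes w: "is_op n (length ks) w" and len: "length vs = length ks"
    and vs: "\<And>l. l < length ks \<Longrightarrow> is_op n (ks ! l) (vs ! l)"
  shows "is_op n (sum_list ks) (Mon_comp1 ks w vs)"
proof -
  let ?sh = "\<lambda>l x. sum_list (take l ks) + x"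
  let ?ls = "letters (Mon_comp1 ks w vs)"
  have lw: "set (letters w) = {..<length ks}" "distinct (letters w)" "is_word n UNIV w"
    using w by (auto simp: is_op_def is_word_iff[of n "{..<_}"])
  have lv: "set (letters (vs ! l)) = {..<ks ! l}" "distinct (letters (vs ! l))" "is_word n UNIV (vs ! l)"
    if "l < length ks" for l
    using vs[OF that] by (auto simp: is_op_def is_word_iff[of n "{..<_}"])
  have ls: "?ls = concat (map (\<lambda>l. map (?sh l) (letters (vs ! l))) (letters w))"
    by (simp add: Mon_comp1_def letters_subst_word)
  have "?sh l x < sum_list ks" if "l < length ks" "x < ks ! l" for l x
    using sum_list_take_nth_le[OF that(1)] that by simp
  moreover have "\<exists>l < length ks. \<exists>x < ks ! l. p = ?sh l x" if "p < sum_list ks" for p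
    using locate_props[OF that] by (metis surj_pair)
  ultimately have set: "set ?ls = {..<sum_list ks}"
    unfolding ls using lw lv by fastforce
  have "length ?ls = (\<Sum>l \<leftarrow> letters w. length (letters (vs ! l)))"
    unfolding ls by (simp add: length_concat comp_def)
  also have "\<dots> = (\<Sum>l < length ks. length (letters (vs ! l)))"
    using lw by (simp add: sum_list_distinct_conv_sum_set)
  also have "\<dots> = (\<Sum>l < length ks. ks ! l)"
    using lv distinct_card by (intro sum.cong) fastforce+
  also have "\<dots> = sum_list ks"
    by (simp add: sum_list_sum_nth atLeast0LessThan)
  finally have "distinct ?ls"
    by (intro card_distinct) (simp add: set)
  moreover have "is_word n UNIV (Mon_comp1 ks w vs)"
    using lw lv unfolding Mon_comp1_def by (intro is_word_subst_word[of n UNIV]) auto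
  ultimately show ?thesis
    using set by (auto simp: is_op_def is_word_iff[of n "{..<_}"])
qed

definition Mon_comp_mor :: "nat list \<Rightarrow> nat mor \<Rightarrow> nat mor list \<Rightarrow> nat mor" where
  "Mon_comp_mor ks f gs = (let m = \<lambda>l. map_mor (\<lambda>x. sum_list (take l ks) + x) (gs ! l) in
     word_mor m (mcod f) \<bullet> subst_mor (\<lambda>l. mdom (m l)) f)"

lemma Mon_comp1_map:
  assumes "is_op n (length ks) w" "length gs = length ks"
  shows "Mon_comp1 ks w (map h gs) = subst_word (\<lambda>l. map_word (\<lambda>x. sum_list (take l ks) + x) (h (gs ! l))) w"
  unfolding Mon_comp1_def using assms by (intro subst_word_cong) (auto simp: is_op_def)

lemma is_op_mor_Mon_comp_mor:
  assumes f: "is_op_mor n (length ks) f" and len: "length gs = length ks"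
    and gs: "\<And>l. l < length ks \<Longrightarrow> is_op_mor n (ks ! l) (gs ! l)"
  shows "is_op_mor n (sum_list ks) (Mon_comp_mor ks f gs)"
    "mdom (Mon_comp_mor ks f gs) = Mon_comp1 ks (mdom f) (map mdom gs)"
    "mcod (Mon_comp_mor ks f gs) = Mon_comp1 ks (mcod f) (map mcod gs)"
proof -
  show md: "mdom (Mon_comp_mor ks f gs) = Mon_comp1 ks (mdom f) (map mdom gs)"
    using f len Mon_comp1_map[of n ks "mdom f" gs mdom] by (simp add: Mon_comp_mor_def is_op_mor_def)
  show "mcod (Mon_comp_mor ks f gs) = Mon_comp1 ks (mcod f) (map mcod gs)"
    using is_op_mor_mcod[OF f] len Mon_comp1_map[of n ks "mcod f" gs mcod]
    by (simp add: Mon_comp_mor_def)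
  have op: "is_op n (sum_list ks) (Mon_comp1 ks (mdom f) (map mdom gs))"
    using f gs len by (intro is_op_Mon_comp1) (auto simp: is_op_mor_def)
  have m: "is_mor n UNIV (map_mor (\<lambda>x. sum_list (take l ks) + x) (gs ! l))" if "l < length ks" for l
    using gs[OF that] by (intro is_mor_map_mor[of n UNIV]) (auto simp: is_op_mor_def is_mor_iff[of n "{..<_}"])
  have f': "is_mor n {..<length ks} f" "is_op n (length ks) (mcod f)"
    using f is_op_mor_mcod[OF f] by (auto simp: is_op_mor_def)
  have "is_mor n UNIV (Mon_comp_mor ks f gs)"
    using f' m is_mor_word(1)[OF m]
    by (auto simp: Mon_comp_mor_def is_op_def intro!: is_mor_subst_mor[of n "{..<length ks}"]
        is_mor_word_mor[of n "{..<length ks}"])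
  then show "is_op_mor n (sum_list ks) (Mon_comp_mor ks f gs)"
    using op by (simp add: is_op_mor_def md is_mor_iff[of n "{..<_}"]) (simp add: is_op_def)
qed

lemma Mon_comp2_op:
  assumes f: "is_op_mor n (length ks) f" and len: "length gs = length ks"
    and gs: "\<And>l. l < length ks \<Longrightarrow> is_op_mor n (ks ! l) (gs ! l)"
  shows "Mon_comp2 n ks (mor_class n {..<length ks} f) (map2 (\<lambda>k. mor_class n {..<k}) ks gs) =
    mor_class n {..<sum_list ks} (Mon_comp_mor ks f gs)"
  using Mon_comp2_mor_class[of n ks f gs] assms by (auto simp: Mon_comp_mor_def is_op_mor_def)

lemma is_op_map_word:
  assumes "p permutes {..<k}" "is_op n k w"
  shows "is_op n k (map_word (inv p) w)"
proof -
  have "inv p ` {..<k} = {..<k}" "inj (inv p)"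
    using permutes_inv[OF assms(1)] by (auto simp: permutes_image permutes_inj)
  then show ?thesis
    using assms(2) by (auto simp: is_op_def is_word_iff[of n "{..<_}"] distinct_map intro: inj_on_subset)
qed

lemma is_op_mor_map_mor:
  assumes "p permutes {..<k}" "is_op_mor n k f"
  shows "is_op_mor n k (map_mor (inv p) f)"
proof -
  have "is_mor n UNIV f" "is_op n k (map_word (inv p) (mdom f))"
    using assms is_op_map_word by (auto simp: is_op_mor_def is_mor_iff[of n "{..<_}"])
  then have "is_mor n UNIV (map_mor (inv p) f)"
    by (intro is_mor_map_mor[of n UNIV]) auto
  then show ?thesis
    using assms is_op_map_word[OF assms(1)]
    by (simp add: is_op_mor_def is_mor_iff[of n "{..<_}"]) (metis is_op_def letters_map_word set_map subset_refl)
qed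

context En_category
begin

lemma word_fun_undefined:
  "As \<notin> Obj (pow_cat C k) \<Longrightarrow> fun_o (word_fun k w) As = undefined"
  "fs \<notin> Arr (pow_cat C k) \<Longrightarrow> fun_m (word_fun k w) fs = undefined"
  "\<not> (i < k \<and> As \<in> Obj (pow_cat C k) \<and> A' \<in> Obj C) \<Longrightarrow> lin (word_fun k w) i As A' = undefined"
  by (auto simp: word_fun_def)

text \<open>Operadic composition shifts the letters of the \<open>l\<close>-th word by the total length of the
  preceding blocks, and the blocks of a list of arguments are found at the same offsets. Up to this
  translation, the statement is the compatibility of evaluation with substitution.\<close>

lemma comp_linear_word_fun:
  assumes w: "is_op n (length ks) w" and len: "length vs = length ks"
    and vs: "\<And>l. l < length ks \<Longrightarrow> is_op n (ks ! l) (vs ! l)"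
  shows "comp_linear (map (\<lambda>k. replicate k C) ks) (replicate (length ks) C) C
      (word_fun (length ks) w) (map2 word_fun ks vs) =
    word_fun (sum_list ks) (Mon_comp1 ks w vs)"
proof -
  let ?Bss = "map (\<lambda>k. replicate k C) ks" and ?Gs = "map2 word_fun ks vs"
  let ?sh = "\<lambda>l x. sum_list (take l ks) + x"
  let ?s = "\<lambda>l. if l < length ks then map_word (?sh l) (vs ! l) else Unit"
  note w' [simp] = is_op_props[OF w]
  note v' [simp] = is_op_props[OF vs]
  have len' [simp]: "map length ?Bss = ks" "map (length \<circ> (\<lambda>k. replicate k C)) ks = ks"
    by (simp_all add: comp_def)
  have P [simp]: "concat ?Bss = replicate (sum_list ks) C"
    by (rule concat_replicates)
  have wds [simp]: "wd (?s l)" for l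
    by simp
  have comp1: "Mon_comp1 ks w vs = subst_word ?s w"
    unfolding Mon_comp1_def by (rule subst_word_cong) simp
  have op: "is_op n (sum_list ks) (Mon_comp1 ks w vs)"
    using assms by (rule is_op_Mon_comp1)
  have wdc: "wd (Mon_comp1 ks w vs)"
    using op by (rule is_op_props)
  note [simp] = length_blocks_nth[of _ ks] blocks_nth_nth[of _ ks]
  have bl [simp]: "set (blocks ks Xs ! l) \<subseteq> D"
    if "length Xs = sum_list ks" "set Xs \<subseteq> D" "l < length ks" for Xs :: "'o list" and l D
    using that set_blocks_nth by blast
  have [simp]: "set (blocks ks fs ! l) \<subseteq> D"
    if "length fs = sum_list ks" "set fs \<subseteq> D" "l < length ks" for fs :: "'m list" and l D
    using that set_blocks_nth by blast
  have sh_lt [simp]: "?sh l x < sum_list ks" if "l < length ks" "x < ks ! l" for l x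
    using sum_list_take_nth_le[OF that(1)] that by simp
  have padb: "pad (blocks ks Xs ! l) x = pad Xs (?sh l x)"
    if "length Xs = sum_list ks" "l < length ks" "x < ks ! l" for Xs l x
    using that by simp
  have padmb: "arr_pad (blocks ks fs ! l) x = arr_pad fs (?sh l x)"
    if "length fs = sum_list ks" "l < length ks" "x < ks ! l" for fs l x
    using that by simp
  define Ys where "Ys Xs = map2 fun_o ?Gs (blocks ks Xs)" for Xs
  define fYs where "fYs fs = map2 fun_m ?Gs (blocks ks fs)" for fs
  have lenY [simp]: "length (Ys Xs) = length ks" "length (fYs fs) = length ks" for Xs fs
    by (simp_all add: Ys_def fYs_def len)
  have Ysl: "Ys Xs ! l = Wo (pad Xs) (?s l)"
    if "length Xs = sum_list ks" "set Xs \<subseteq> Obj C" "l < length ks" for Xs l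
    using that by (auto simp: Ys_def len obj_val_map padb intro!: obj_val_cong)
  have fYsl: "fYs fs ! l = Wm (arr_pad fs) (?s l)"
    if "length fs = sum_list ks" "set fs \<subseteq> Arr C" "l < length ks" for fs l
    using that by (auto simp: fYs_def len arr_val_map padmb intro!: arr_val_cong)
  have setY [simp]: "set (Ys Xs) \<subseteq> Obj C" if "length Xs = sum_list ks" "set Xs \<subseteq> Obj C" for Xs
    using that by (auto simp: in_set_conv_nth Ysl simp del: wds) 
  have setfY [simp]: "set (fYs fs) \<subseteq> Arr C" if "length fs = sum_list ks" "set fs \<subseteq> Arr C" for fs
    using that by (auto simp: in_set_conv_nth fYsl)
  show ?thesis
  proof (rule mlfun.equality)
    show "fun_o (comp_linear ?Bss (replicate (length ks) C) C (word_fun (length ks) w) ?Gs) =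
      fun_o (word_fun (sum_list ks) (Mon_comp1 ks w vs))"
    proof
      fix Xs
      show "fun_o (comp_linear ?Bss (replicate (length ks) C) C (word_fun (length ks) w) ?Gs) Xs =
        fun_o (word_fun (sum_list ks) (Mon_comp1 ks w vs)) Xs"
      proof (cases "Xs \<in> Obj (pow_cat C (sum_list ks))")
        case True
        then have [simp]: "length Xs = sum_list ks" "set Xs \<subseteq> Obj C" by auto
        have "Wo (pad (Ys Xs)) w = Wo (\<lambda>l. Wo (pad Xs) (?s l)) w"
          by (rule obj_val_cong) (simp add: Ysl)
        then show ?thesis
          using True by (simp add: comp_linear_def Let_def comp1 flip: Ys_def)
            (subst obj_val_subst, auto)
      qed (simp add: comp_linear_def Let_def word_fun_undefined del: Obj_pow Arr_pow)
    qed
    show "fun_m (comp_linear ?Bss (replicate (length ks) C) C (word_fun (length ks) w) ?Gs) =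
      fun_m (word_fun (sum_list ks) (Mon_comp1 ks w vs))"
    proof
      fix fs
      show "fun_m (comp_linear ?Bss (replicate (length ks) C) C (word_fun (length ks) w) ?Gs) fs =
        fun_m (word_fun (sum_list ks) (Mon_comp1 ks w vs)) fs"
      proof (cases "fs \<in> Arr (pow_cat C (sum_list ks))")
        case True
        then have [simp]: "length fs = sum_list ks" "set fs \<subseteq> Arr C" by auto
        have "Wm (arr_pad (fYs fs)) w = Wm (\<lambda>l. Wm (arr_pad fs) (?s l)) w"
          by (rule arr_val_cong) (simp add: fYsl)
        then show ?thesis
          using True by (simp add: comp_linear_def Let_def comp1 flip: fYs_def)
            (subst arr_val_subst, auto)
      qed (simp add: comp_linear_def Let_def word_fun_undefined del: Obj_pow Arr_pow)
    qed
    show "lin (comp_linear ?Bss (replicate (length ks) C) C (word_fun (length ks) w) ?Gs) =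
      lin (word_fun (sum_list ks) (Mon_comp1 ks w vs))"
    proof (intro ext)
      fix p Xs X'
      show "lin (comp_linear ?Bss (replicate (length ks) C) C (word_fun (length ks) w) ?Gs) p Xs X' =
        lin (word_fun (sum_list ks) (Mon_comp1 ks w vs)) p Xs X'"
      proof (cases "p < sum_list ks \<and> Xs \<in> Obj (pow_cat C (sum_list ks)) \<and> X' \<in> Obj C")
        case True
        then have [simp]: "p < sum_list ks" "length Xs = sum_list ks" "set Xs \<subseteq> Obj C" "X' \<in> Obj C" by auto
        obtain j q where jq: "locate ks p = (j, q)" by fastforce
        then have [simp]: "j < length ks" "q < ks ! j" and p: "p = ?sh j q"
          using locate_props[of p ks j q] by auto
        let ?a = "pad Xs" and ?b = "\<lambda>l. Wo (pad Xs) (?s l)"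
        have sj: "?s j = map_word (?sh j) (vs ! j)" by simp
        have L: "Lin q (pad (blocks ks Xs ! j)) X' (vs ! j) = Lin p ?a X' (?s j)"
        proof -
          have "Lin q (pad (blocks ks Xs ! j)) X' (vs ! j) = Lin q (\<lambda>x. ?a (?sh j x)) X' (vs ! j)"
            by (rule lin_val_cong) (auto simp: padb asg_def[of "\<lambda>x. ?a (?sh j x)"])
          then show ?thesis
            unfolding p sj by (subst lin_val_map) (auto simp: inj_on_def)
        qed
        have Y': "Wo (pad ((blocks ks Xs ! j)[q := X'])) (vs ! j) = Wo (?a(p := X')) (?s j)"
          unfolding sj by (subst obj_val_map) (auto simp: p padb fun_upd_apply intro!: obj_val_cong)
        then have Y'': "Wo ((pad (blocks ks Xs ! j))(q := X')) (vs ! j) =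
            Wo (?a(p := X')) (map_word (?sh j) (vs ! j))"
          by simp
        have setu: "set ((blocks ks Xs ! j)[q := X']) \<subseteq> Obj C"
          using set_update_subset_insert[of "blocks ks Xs ! j" q X'] bl[OF \<open>length Xs = sum_list ks\<close> \<open>set Xs \<subseteq> Obj C\<close> \<open>j < length ks\<close>] \<open>X' \<in> Obj C\<close> by blast
        have lm: "p \<in> set (letters (?s j))" by (auto simp: p)
        have dj: "distinct (letters (?s j))" by (simp add: distinct_map inj_on_def)
        have b [simp]: "asg ?b"
          using obj_val_Obj[OF asg_pad[OF \<open>set Xs \<subseteq> Obj C\<close>] wds] by (auto simp: asg_def[of ?b])
        have LArr [simp]: "Lin p ?a X' (?s j) \<in> Arr C"
          by (intro lin_val_Arr) (use dj lm in auto)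
        have fYarr: "set ((map (Ide C) (Ys Xs))[j := Lin p ?a X' (?s j)]) \<subseteq> Arr C"
        proof -
          have "set (Ys Xs) \<subseteq> Obj C"
            by simp
          then have "set (map (Ide C) (Ys Xs)) \<subseteq> Arr C"
            by (auto simp del: setY)
          then show ?thesis
            using set_update_subset_insert[of "map (Ide C) (Ys Xs)" j "Lin p ?a X' (?s j)"] LArr
            by blast
        qed
        have "lin (comp_linear ?Bss (replicate (length ks) C) C (word_fun (length ks) w) ?Gs) p Xs X' =
          Wm ((\<lambda>l. Ide C (pad (Ys Xs) l))(j := Lin p ?a X' (?s j))) w \<cdot>
          Lin j (pad (Ys Xs)) (Wo (?a(p := X')) (?s j)) w"
          using fYarr
          by (simp add: comp_linear_def Let_def jq len L Y'' setu nth_replicate flip: Ys_def del: if_P)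
        also have "Wm ((\<lambda>l. Ide C (pad (Ys Xs) l))(j := Lin p ?a X' (?s j))) w =
          Wm ((\<lambda>l. Ide C (?b l))(j := Lin p ?a X' (?s j))) w"
          by (rule arr_val_cong) (auto simp: fun_upd_apply Ysl)
        also have "Lin j (pad (Ys Xs)) (Wo (?a(p := X')) (?s j)) w = Lin j ?b (Wo (?a(p := X')) (?s j)) w"
          by (rule lin_val_cong) (auto simp: Ysl)
        also have "Wm ((\<lambda>l. Ide C (?b l))(j := Lin p ?a X' (?s j))) w \<cdot> Lin j ?b (Wo (?a(p := X')) (?s j)) w =
          Lin p ?a X' (subst_word ?s w)"
          using is_op_props[OF op] lm by (intro lin_val_subst[symmetric]) (auto simp: comp1)
        finally show ?thesis
          by (simp add: comp1)
      next
        case False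
        have "p < sum_list ks \<Longrightarrow> replicate (sum_list ks) C ! p = C" by simp
        then show ?thesis
          using False unfolding comp_linear_def P word_fun_undefined(3)[OF False] by (auto simp: Let_def)
      qed
    qed
  qed simp
qed

end

lemma mor_eq_UNIV:
  assumes "mor_eq n X f g"
  shows "mor_eq n UNIV f g"
  using mor_eq_map_mor[OF assms, of "\<lambda>x. x" UNIV] by (simp add: mor.map_ident)

lemma mor_class_Arr: "is_op_mor n k f \<Longrightarrow> mor_class n {..<k} f \<in> Arr (Mon_ops n k)"
  by (auto simp: Arr_Mon_ops)

context En_category
begin

lemma mor_trans_undefined:
  "As \<notin> Obj (pow_cat C k) \<Longrightarrow> component (mor_trans k f) As = undefined"
  by (simp add: mor_trans_def del: Obj_pow)

text \<open>The two composites of 2-cells are formed in different orders: in the operad, \<open>f\<close> acts first and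
  at the domains of the morphisms \<open>gs\<close>, in the multicategory last and at their codomains. They
  agree by naturality of the evaluation of \<open>f\<close>.\<close>

lemma comp_trans_mor_trans:
  assumes f: "is_op_mor n (length ks) f" and len: "length gs = length ks"
    and gs: "\<And>l. l < length ks \<Longrightarrow> is_op_mor n (ks ! l) (gs ! l)"
  shows "comp_trans (map (\<lambda>k. replicate k C) ks) (replicate (length ks) C) C
      (mor_trans (length ks) f) (map2 mor_trans ks gs) =
    mor_trans (sum_list ks) (Mon_comp_mor ks f gs)"
proof -
  let ?Bss = "map (\<lambda>k. replicate k C) ks" and ?us = "map2 mor_trans ks gs"
  let ?sh = "\<lambda>l x. sum_list (take l ks) + x"
  let ?m = "\<lambda>l. if l < length ks then map_mor (?sh l) (gs ! l) else Idt Unit"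
  note op = is_op_mor_Mon_comp_mor[OF assms]
  note f' [simp] = is_op_mor_props(1)[OF f]
  note fo = is_op_mor_props(2,3)[OF f]
  note g' [simp] = is_op_mor_props(1)[OF gs]
  note go = is_op_mor_props(2,3)[OF gs]
  have len' [simp]: "map length ?Bss = ks" "map (length \<circ> (\<lambda>k. replicate k C)) ks = ks"
    by (simp_all add: comp_def)
  have P [simp]: "concat ?Bss = replicate (sum_list ks) C"
    by (rule concat_replicates)
  note [simp] = length_blocks_nth[of _ ks] blocks_nth_nth[of _ ks]
  have bl [simp]: "set (blocks ks Xs ! l) \<subseteq> Obj C"
    if "length Xs = sum_list ks" "set Xs \<subseteq> Obj C" "l < length ks" for Xs l
    using that set_blocks_nth by blast
  have sh_lt [simp]: "?sh l x < sum_list ks" if "l < length ks" "x < ks ! l" for l x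
    using sum_list_take_nth_le[OF that(1)] that by simp
  have std_word: "map src ?us = map2 word_fun ks (map mdom gs)" "map tgt ?us = map2 word_fun ks (map mcod gs)"
    using len by (auto intro!: nth_equalityI)
  have wdm_map [simp]: "wdm (map_mor h (gs ! l))" if "l < length ks" for h :: "nat \<Rightarrow> nat" and l
    using that by (auto intro!: is_mor_map_mor[of n UNIV])
  have wdm [simp]: "wdm (?m l)" for l
    by (auto intro!: is_mor_map_mor[of n UNIV])
  have lt: "l < length ks" if "l \<in> set (letters (mdom f)) \<or> l \<in> set (letters (mcod f))" for l
    using is_op_props(3)[OF fo(1)] is_op_props(3)[OF fo(2)] that by auto
  have mor: "Mon_comp_mor ks f gs = word_mor ?m (mcod f) \<bullet> subst_mor (\<lambda>l. mdom (?m l)) f"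
  proof -
    have "wdm h \<Longrightarrow> \<forall>x \<in> set (letters (mdom h)). s x = s' x \<Longrightarrow> subst_mor s h = subst_mor s' h"
      for h :: "nat mor" and s s' :: "nat \<Rightarrow> nat word"
      by (induction rule: wdm_induct) (auto intro!: subst_word_cong simp: wdm_letters)
    then show ?thesis
      using lt by (auto simp: Mon_comp_mor_def Let_def intro!: word_mor_cong)
  qed
  show ?thesis
  proof (rule mltrans.equality)
    show "src (comp_trans ?Bss (replicate (length ks) C) C (mor_trans (length ks) f) ?us) =
      src (mor_trans (sum_list ks) (Mon_comp_mor ks f gs))"
      using len go by (simp add: comp_trans_def std_word op(2) comp_linear_word_fun fo del: map_map)
    show "tgt (comp_trans ?Bss (replicate (length ks) C) C (mor_trans (length ks) f) ?us) =
      tgt (mor_trans (sum_list ks) (Mon_comp_mor ks f gs))"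
      using len go by (simp add: comp_trans_def std_word op(3) comp_linear_word_fun fo del: map_map)
    show "component (comp_trans ?Bss (replicate (length ks) C) C (mor_trans (length ks) f) ?us) =
      component (mor_trans (sum_list ks) (Mon_comp_mor ks f gs))"
    proof
      fix Xs
      show "component (comp_trans ?Bss (replicate (length ks) C) C (mor_trans (length ks) f) ?us) Xs =
        component (mor_trans (sum_list ks) (Mon_comp_mor ks f gs)) Xs"
      proof (cases "Xs \<in> Obj (pow_cat C (sum_list ks))")
        case True
        then have lenX [simp]: "length Xs = sum_list ks" and setX [simp]: "set Xs \<subseteq> Obj C" by auto
        define Ys where "Ys = map2 (\<lambda>s. fun_o (tgt s)) ?us (blocks ks Xs)"
        define fs where "fs = map2 component ?us (blocks ks Xs)"
        let ?c = "\<lambda>l. Mv (pad Xs) (?m l)"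
        have c [simp]: "arr_asg ?c"
          using mor_val_Arr(1)[OF wdm asg_pad[OF setX]] by (auto simp: arr_asg_def)
        have lens [simp]: "length Ys = length ks" "length fs = length ks"
          by (simp_all add: Ys_def fs_def len)
        have Ysl: "Ys ! l = Cod C (?c l)" if l: "l < length ks" for l
        proof -
          have "Wo (pad (blocks ks Xs ! l)) (mcod (gs ! l)) = Wo (\<lambda>x. pad Xs (?sh l x)) (mcod (gs ! l))"
            by (rule obj_val_cong) (use is_op_props(3)[OF go(2)[OF l]] l in simp)
          then show ?thesis
            using l by (simp add: Ys_def len obj_val_map)
        qed
        have fsl: "fs ! l = ?c l" if l: "l < length ks" for l
        proof -
          have "Mv (pad (blocks ks Xs ! l)) (gs ! l) = Mv (\<lambda>x. pad Xs (?sh l x)) (gs ! l)"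
            by (rule mor_val_cong) (use is_op_props(3)[OF go(1)[OF l]] l in simp_all)
          then show ?thesis
            using l by (simp add: fs_def len mor_val_map)
        qed
        have setY [simp]: "set Ys \<subseteq> Obj C"
          using c by (auto simp: in_set_conv_nth Ysl arr_asg_def simp del: c)
        have setf [simp]: "set fs \<subseteq> Arr C"
          using c by (auto simp: in_set_conv_nth fsl arr_asg_def simp del: c)
        have "Mv (pad Ys) f = Mv (\<lambda>l. Cod C (?c l)) f"
          using lt by (intro mor_val_cong) (auto simp: Ysl)
        moreover have "Wm (arr_pad fs) (mdom f) = Wm ?c (mdom f)"
          using lt by (intro arr_val_cong) (auto simp: fsl)
        moreover have "Mv (pad Xs) (subst_mor (\<lambda>l. mdom (?m l)) f) = Mv (\<lambda>l. Wo (pad Xs) (mdom (?m l))) f"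
          by (rule mor_val_subst) (use wdm wdm_wd(1) in \<open>auto simp del: wdm\<close>)
        moreover have "(\<lambda>l. Wo (pad Xs) (mdom (?m l))) = (\<lambda>l. Dom C (?c l))"
          using mor_val_Arr(2)[OF wdm asg_pad[OF setX]] by auto
        ultimately have "Mv (pad Xs) (Mon_comp_mor ks f gs) = Mv (pad Ys) f \<cdot> Wm (arr_pad fs) (mdom f)"
          by (simp only: mor mor_val.simps mor_val_word_mor mor_val_nat[OF f' c])
        then show ?thesis
          using True by (simp add: comp_trans_def Let_def flip: Ys_def fs_def)
      qed (simp add: comp_trans_def Let_def mor_trans_undefined del: Obj_pow)
    qed
  qed simp
qed

lemma pad_permute:
  "p permutes {..<length As} \<Longrightarrow> pad (permute_list (inv p) As) = (\<lambda>x. pad As (inv p x))"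
  "p permutes {..<length fs} \<Longrightarrow> arr_pad (permute_list (inv p) fs) = (\<lambda>x. arr_pad fs (inv p x))"
proof -
  have *: "inv p x < k \<longleftrightarrow> x < k" if "p permutes {..<k}" for k x
    using permutes_in_image[OF permutes_inv[OF that], of x] by simp
  show "pad (permute_list (inv p) As) = (\<lambda>x. pad As (inv p x))" if "p permutes {..<length As}"
    using that by (auto simp: pad_def * permute_list_nth permutes_inv)
  show "arr_pad (permute_list (inv p) fs) = (\<lambda>x. arr_pad fs (inv p x))" if "p permutes {..<length fs}"
    using that by (auto simp: arr_pad_def * permute_list_nth permutes_inv)
qed

lemma act_linear_word_fun:
  assumes p: "p permutes {..<k}" and w: "is_op n k w"
  shows "act_linear (replicate k C) p (word_fun k w) = word_fun k (map_word (inv p) w)"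
proof -
  note [simp] = is_op_props[OF w]
  have pk [simp]: "permute_list p (replicate k C) = replicate k C"
    using p permutes_in_image[OF p] by (intro nth_equalityI) (auto simp: permute_list_nth)
  have setp [simp]: "set (permute_list (inv p) As) = set As" if "length As = k" for As :: "'o list"
    using that permutes_inv[OF p] by (simp add: set_permute_list)
  have setpm [simp]: "set (permute_list (inv p) fs) = set fs" if "length fs = k" for fs :: "'m list"
    using that permutes_inv[OF p] by (simp add: set_permute_list)
  have pi [simp]: "inv p (p i) = i" "p i < k \<longleftrightarrow> i < k" for i
    using p permutes_inverses[OF p] permutes_in_image[OF p, of i] by auto
  have inj: "inj_on (inv p) A" for A
    using permutes_inj[OF permutes_inv[OF p]] by (rule inj_on_subset) simp
  show ?thesis
  proof (rule mlfun.equality)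
    show "fun_o (act_linear (replicate k C) p (word_fun k w)) = fun_o (word_fun k (map_word (inv p) w))"
      using p by (auto simp: act_linear_def Let_def fun_eq_iff restrict_def word_fun_undefined
          pad_permute obj_val_map)
    show "fun_m (act_linear (replicate k C) p (word_fun k w)) = fun_m (word_fun k (map_word (inv p) w))"
      using p by (auto simp: act_linear_def Let_def fun_eq_iff restrict_def word_fun_undefined
          pad_permute arr_val_map)
    show "lin (act_linear (replicate k C) p (word_fun k w)) = lin (word_fun k (map_word (inv p) w))"
    proof (intro ext)
      fix i As A'
      show "lin (act_linear (replicate k C) p (word_fun k w)) i As A' = lin (word_fun k (map_word (inv p) w)) i As A'"
      proof (cases "i < k \<and> As \<in> Obj (pow_cat C k) \<and> A' \<in> Obj C")
        case True
        then have [simp]: "i < k" "length As = k" "set As \<subseteq> Obj C" "A' \<in> Obj C" by auto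
        have "Lin i (pad As) A' (map_word (inv p) w) = Lin (p i) (\<lambda>x. pad As (inv p x)) A' w"
          using lin_val_map[of w "pad As" A' "p i" "inv p"] inj by simp
        then show ?thesis
          using p by (simp add: act_linear_def Let_def pad_permute)
      next
        case False
        have "i < k \<Longrightarrow> replicate k C ! p i = C"
          by simp
        then have "lin (act_linear (replicate k C) p (word_fun k w)) i As A' = undefined"
          using False by (auto simp: act_linear_def Let_def simp del: Obj_pow)
        then show ?thesis
          unfolding word_fun_undefined(3)[OF False] .
      qed
    qed
  qed simp
qed

lemma act_trans_mor_trans:
  assumes p: "p permutes {..<k}" and f: "is_op_mor n k f"
  shows "act_trans (replicate k C) p (mor_trans k f) = mor_trans k (map_mor (inv p) f)"
proof -
  note f' = is_op_mor_props[OF f]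
  have pk [simp]: "permute_list p (replicate k C) = replicate k C"
    using p permutes_in_image[OF p] by (intro nth_equalityI) (auto simp: permute_list_nth)
  have [simp]: "set (permute_list (inv p) As) = set As" if "length As = k" for As :: "'o list"
    using that permutes_inv[OF p] by (simp add: set_permute_list)
  show ?thesis
    using p f' by (auto simp: act_trans_def mor_trans_def act_linear_word_fun fun_eq_iff restrict_def
        pad_permute mor_val_map)
qed

definition structure_functor ::
  "(unit, nat word, nat mor set, ('o, 'm) permcat, ('o, 'm) mlfun, ('o, 'm) mltrans) mfunctor" where
  "structure_functor = \<lparr>on_obj = (\<lambda>_. C),
     on1 = (\<lambda>cs d. \<lambda>w \<in> Obj (Mon_ops n (length cs)). word_fun (length cs) w),
     on2 = (\<lambda>cs d. \<lambda>c \<in> Arr (Mon_ops n (length cs)). mor_trans (length cs) (rep c))\<rparr>"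

lemma mor_trans_rep [simp]:
  assumes "is_op_mor n k f"
  shows "mor_trans k (rep (mor_class n {..<k} f)) = mor_trans k f"
proof -
  have f: "is_mor n {..<k} f" using assms by (rule is_op_mor_is_mor)
  have "mor_eq n UNIV (rep (mor_class n {..<k} f)) f"
    using mor_eq_UNIV[OF rep_mor_class[OF f]] by (rule mor_eq.sym)
  then have "Mv (pad As) (rep (mor_class n {..<k} f)) = Mv (pad As) f" if "set As \<subseteq> Obj C" for As
    using that by (intro mor_val_sound) auto
  then show ?thesis
    using f by (auto simp: mor_trans_def fun_eq_iff)
qed

lemma structure_functor_simps [simp]:
  "on_obj structure_functor = (\<lambda>_. C)"
  "is_op n (length cs) w \<Longrightarrow> on1 structure_functor cs d w = word_fun (length cs) w"
  "is_op_mor n (length cs) f \<Longrightarrow>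
    on2 structure_functor cs d (mor_class n {..<length cs} f) = mor_trans (length cs) f"
  using mor_class_Arr by (auto simp: structure_functor_def)

lemma structure_functor_is_functor:
  "is_functor (Mon_ops n (length cs)) (multilinear_cat (replicate (length cs) C) C)
     (on1 structure_functor cs d) (on2 structure_functor cs d)"
proof -
  let ?k = "length cs"
  have Ide: "mor_trans ?k (Idt w) = Ide (multilinear_cat (replicate ?k C) C) (word_fun ?k w)"
    if "is_op n ?k w" for w
    using is_op_props[OF that] by (auto simp: multilinear_cat_def mor_trans_def fun_eq_iff)
  have Cmp: "mor_trans ?k (g \<bullet> f) = Cmp (multilinear_cat (replicate ?k C) C) (mor_trans ?k g) (mor_trans ?k f)"
    if "is_op_mor n ?k g" "is_op_mor n ?k f" for g f
    by (auto simp: multilinear_cat_def mor_trans_def fun_eq_iff)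
  have Idt: "is_op_mor n ?k (Idt w)" if "is_op n ?k w" for w
    using that by (auto simp: is_op_mor_def is_op_def)
  have "on2 structure_functor cs d (Cmp (Mon_ops n ?k) c' c) =
      Cmp (multilinear_cat (replicate ?k C) C) (on2 structure_functor cs d c') (on2 structure_functor cs d c)"
    if c: "c \<in> Arr (Mon_ops n ?k)" "c' \<in> Arr (Mon_ops n ?k)" "Dom (Mon_ops n ?k) c' = Cod (Mon_ops n ?k) c" for c c'
  proof -
    obtain f g where fg: "is_op_mor n ?k f" "is_op_mor n ?k g" "c = mor_class n {..<?k} f" "c' = mor_class n {..<?k} g"
      using c by (auto simp: Arr_Mon_ops)
    then have m: "is_mor n {..<?k} (g \<bullet> f)"
      using c by (auto simp: is_op_mor_def)
    then have "is_op_mor n ?k (g \<bullet> f)"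
      using fg by (auto simp: is_op_mor_def)
    then show ?thesis
      using fg Cmp[of g f] by (simp add: Cmp_Mon_ops[OF m])
  qed
  moreover have "on2 structure_functor cs d (mor_class n {..<?k} f) \<in>
      hom (multilinear_cat (replicate ?k C) C) (word_fun ?k (mdom f)) (word_fun ?k (mcod f))"
    if "is_op_mor n ?k f" for f
    using that multilinear_trans_mor_trans[OF that] by (auto simp: hom_def multilinear_cat_def)
  moreover have "on1 structure_functor cs d w \<in> Obj (multilinear_cat (replicate ?k C) C)"
    if "is_op n ?k w" for w
    using that multilinear_word_fun[OF that] by (auto simp: multilinear_cat_def)
  ultimately show ?thesis
    unfolding is_functor_def
    using Ide Idt is_op_mor_props(2,3) by (auto simp: Arr_Mon_ops is_op_mor_is_mor)
qed

lemma Ops_tuple: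
  assumes "length cs = length bss" "ys \<in> Obj (prod_cat (map2 (Ops (Mon n)) bss cs))"
  shows "length ys = length bss" "\<And>l. l < length bss \<Longrightarrow> is_op n (length (bss ! l)) (ys ! l)"
  using assms by (auto simp: prod_cat_def Mon_def list_all2_conv_all_nth)

lemma Ops_arr_tuple:
  assumes "length cs = length bss" "ds \<in> Arr (prod_cat (map2 (Ops (Mon n)) bss cs))"
  obtains gs where "length gs = length bss" "\<And>l. l < length bss \<Longrightarrow> is_op_mor n (length (bss ! l)) (gs ! l)"
    "ds = map2 (\<lambda>k. mor_class n {..<k}) (map length bss) gs"
proof -
  have len: "length ds = length bss" and "\<forall>l < length bss. \<exists>g. is_op_mor n (length (bss ! l)) g \<and>
      ds ! l = mor_class n {..<length (bss ! l)} g"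
    using assms by (auto simp: prod_cat_def Mon_def list_all2_conv_all_nth Arr_Mon_ops)
  then obtain g where g: "\<forall>l < length bss. is_op_mor n (length (bss ! l)) (g l) \<and>
      ds ! l = mor_class n {..<length (bss ! l)} (g l)"
    by metis
  show thesis
    by (rule that[of "map g [0..<length bss]"]) (use g len in \<open>auto intro!: nth_equalityI\<close>)
qed

lemma cat_multifunctor_structure_functor: "cat_multifunctor (Mon n) PermCat_su structure_functor"
proof -
  have C: "permutative_category C" ..
  have rep [simp]: "map (\<lambda>_ :: unit. C) = (\<lambda>cs. replicate (length cs) C)"
    by (simp add: fun_eq_iff map_replicate_const)
  have lenc: "length (concat bss) = sum_list (map length bss)" for bss :: "unit list list"
    by (simp add: length_concat)
  show ?thesis
  proof
    show "on_obj structure_functor \<in> MObj (Mon n) \<rightarrow>\<^sub>E MObj PermCat_su"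
      using C by (auto simp: Mon_def PermCat_su_def)
  next
    fix cs :: "unit list" and d
    show "is_functor (Ops (Mon n) cs d) (Ops PermCat_su (map (on_obj structure_functor) cs) (on_obj structure_functor d))
      (on1 structure_functor cs d) (on2 structure_functor cs d)"
      using structure_functor_is_functor[of cs d] by (simp add: Mon_def PermCat_su_def)
    show "on1 structure_functor cs d \<in> extensional (Obj (Ops (Mon n) cs d))"
      "on2 structure_functor cs d \<in> extensional (Arr (Ops (Mon n) cs d))"
      by (auto simp: structure_functor_def Mon_def)
  next
    fix cs :: "unit list" and d assume "\<not> profile (Mon n) cs d"
    then have False by (simp add: profile_def Mon_def)
    then show "on1 structure_functor cs d = (\<lambda>_. undefined)" "on2 structure_functor cs d = (\<lambda>_. undefined)"
      by auto
  next
    fix c :: unit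
    have "word_fun (Suc 0) (Letter 0) = id_linear C"
    proof (rule mlfun.equality)
      show "lin (word_fun (Suc 0) (Letter 0)) = lin (id_linear C)"
        by (auto simp: fun_eq_iff word_fun_def id_linear_def Obj_pow[of _ "Suc 0" C, simplified]) 
    qed (auto simp: word_fun_def id_linear_def fun_eq_iff restrict_def Obj_pow[of _ "Suc 0" C, simplified]
         Arr_pow[of _ "Suc 0" C, simplified])
    moreover have "is_op n 1 (Letter 0)" by (auto simp: is_op_def)
    ultimately show "on1 structure_functor [c] c (ident (Mon n) c) = ident PermCat_su (on_obj structure_functor c)"
      by (simp add: Mon_def PermCat_su_def)
  next
    fix bss cs and d :: unit and x ys
    assume p: "profiles (Mon n) bss cs d" and x: "x \<in> Obj (Ops (Mon n) cs d)"
      and ys: "ys \<in> Obj (prod_cat (map2 (Ops (Mon n)) bss cs))"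
    have len: "length bss = length cs"
      using p by (auto simp: profiles_def list_all2_lengthD)
    note ys' = Ops_tuple[OF len[symmetric] ys]
    have x': "is_op n (length cs) x" using x by (simp add: Mon_def)
    have "is_op n (sum_list (map length bss)) (Mon_comp1 (map length bss) x ys)"
      using x' ys' len by (intro is_op_Mon_comp1) auto
    moreover have "map2 (\<lambda>(bs, c). on1 structure_functor bs c) (zip bss cs) ys = map2 word_fun (map length bss) ys"
      using ys' len by (auto intro!: nth_equalityI)
    ultimately show "on1 structure_functor (concat bss) d (comp1 (Mon n) bss cs d x ys) =
      comp1 PermCat_su (map (map (on_obj structure_functor)) bss) (map (on_obj structure_functor) cs)
        (on_obj structure_functor d) (on1 structure_functor cs d x)
        (map2 (\<lambda>(bs, c). on1 structure_functor bs c) (zip bss cs) ys)"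
      using comp_linear_word_fun[of "map length bss" x ys] x' ys' len
      by (simp add: Mon_def PermCat_su_def lenc comp_def)
  next
    fix bss cs and d :: unit and c ds
    assume p: "profiles (Mon n) bss cs d" and c: "c \<in> Arr (Ops (Mon n) cs d)"
      and ds: "ds \<in> Arr (prod_cat (map2 (Ops (Mon n)) bss cs))"
    have len: "length bss = length cs"
      using p by (auto simp: profiles_def list_all2_lengthD)
    obtain gs where gs: "length gs = length bss" "\<And>l. l < length bss \<Longrightarrow> is_op_mor n (length (bss ! l)) (gs ! l)"
      "ds = map2 (\<lambda>k. mor_class n {..<k}) (map length bss) gs"
      using Ops_arr_tuple[OF len[symmetric] ds] by blast
    obtain f where f: "is_op_mor n (length cs) f" "c = mor_class n {..<length cs} f"
      using c by (auto simp: Mon_def Arr_Mon_ops)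
    let ?ks = "map length bss"
    have comp: "Mon_comp2 n ?ks (mor_class n {..<length cs} f) (map2 (\<lambda>k. mor_class n {..<k}) ?ks gs) = mor_class n {..<sum_list ?ks} (Mon_comp_mor ?ks f gs)"
      using Mon_comp2_op[of n ?ks f gs] f gs len by simp
    have "is_op_mor n (sum_list ?ks) (Mon_comp_mor ?ks f gs)"
      using f gs len by (intro is_op_mor_Mon_comp_mor) auto
    then have "on2 structure_functor (concat bss) d (mor_class n {..<length (concat bss)} (Mon_comp_mor ?ks f gs)) =
        mor_trans (length (concat bss)) (Mon_comp_mor ?ks f gs)"
      by (intro structure_functor_simps) (simp add: lenc)
    moreover have "map2 (\<lambda>(bs, c). on2 structure_functor bs c) (zip bss cs) ds = map2 mor_trans ?ks gs"
      using gs len by (auto intro!: nth_equalityI)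
    ultimately show "on2 structure_functor (concat bss) d (comp2 (Mon n) bss cs d c ds) =
      comp2 PermCat_su (map (map (on_obj structure_functor)) bss) (map (on_obj structure_functor) cs)
        (on_obj structure_functor d) (on2 structure_functor cs d c)
        (map2 (\<lambda>(bs, c). on2 structure_functor bs c) (zip bss cs) ds)"
      using comp_trans_mor_trans[of ?ks f gs] f gs len
      by (simp add: Mon_def PermCat_su_def lenc comp comp_def)
  next
    fix cs :: "unit list" and d p x
    assume p: "p permutes {..<length cs}" and "x \<in> Obj (Ops (Mon n) cs d)"
    then have x: "is_op n (length cs) x" by (simp add: Mon_def)
    then show "on1 structure_functor (permute_list p cs) d (act1 (Mon n) cs d p x) =
      act1 PermCat_su (map (on_obj structure_functor) cs) (on_obj structure_functor d) p (on1 structure_functor cs d x)"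
      using is_op_map_word[OF p x] act_linear_word_fun[OF p x] by (simp add: Mon_def PermCat_su_def)
  next
    fix cs :: "unit list" and d p c
    assume p: "p permutes {..<length cs}" and "c \<in> Arr (Ops (Mon n) cs d)"
    then obtain f where f: "is_op_mor n (length cs) f" "c = mor_class n {..<length cs} f"
      by (auto simp: Mon_def Arr_Mon_ops)
    have f': "is_mor n {..<length cs} f" using f by (auto simp: is_op_mor_def)
    have "inv p ` {..<length cs} \<subseteq> {..<length cs}"
      using permutes_image[OF permutes_inv[OF p]] by simp
    then have "mor_class n {..<length cs} (map_mor (inv p) (rep c)) = mor_class n {..<length cs} (map_mor (inv p) f)"
      unfolding f by (intro mor_class_eqI mor_eq_map_mor[OF mor_eq.sym[OF rep_mor_class[OF f']]])
    moreover have "on2 structure_functor (permute_list p cs) d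
        (mor_class n {..<length (permute_list p cs)} (map_mor (inv p) f)) =
        mor_trans (length (permute_list p cs)) (map_mor (inv p) f)"
      using is_op_mor_map_mor[OF p f(1)] by (intro structure_functor_simps) simp
    ultimately show "on2 structure_functor (permute_list p cs) d (act2 (Mon n) cs d p c) =
      act2 PermCat_su (map (on_obj structure_functor) cs) (on_obj structure_functor d) p (on2 structure_functor cs d c)"
      using act_trans_mor_trans[OF p f(1)] f by (simp add: Mon_def PermCat_su_def)
  qed
qed

end

section \<open>Standard labellings\<close>

definition position :: "'x list \<Rightarrow> 'x \<Rightarrow> nat" where
  "position xs x = length (takeWhile (\<lambda>y. y \<noteq> x) xs)"

lemma position_less: "x \<in> set xs \<Longrightarrow> position xs x < length xs"
  by (induction xs) (auto simp: position_def)

lemma nth_position [simp]: "x \<in> set xs \<Longrightarrow> xs ! position xs x = x"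
  by (induction xs) (auto simp: position_def)

lemma position_append: "position (xs @ ys) x = (if x \<in> set xs then position xs x else length xs + position ys x)"
  by (auto simp: position_def takeWhile_append)

lemma position_nth: "distinct xs \<Longrightarrow> i < length xs \<Longrightarrow> position xs (xs ! i) = i"
  by (metis position_less nth_eq_iff_index_eq nth_position nth_mem)

lemma inj_position: "inj_on (position xs) (set xs)"
  by (metis inj_onI nth_position)

lemma map_position: "distinct xs \<Longrightarrow> map (position xs) xs = [0..<length xs]"
  by (auto intro!: nth_equalityI simp: position_nth)

lemma position_map: "inj_on h (set xs) \<Longrightarrow> x \<in> set xs \<Longrightarrow> position (map h xs) (h x) = position xs x"
  by (induction xs) (auto simp: position_def inj_on_def)

text \<open>Words on arbitrary letters become operations when their letters are numbered. Numbering them in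
  the order of occurrence makes the standard form of a product an operadic composite of standard
  forms, without a permutation.\<close>

definition std_word :: "'x word \<Rightarrow> nat word" where
  "std_word w = map_word (position (letters w)) w"

definition std_mor :: "'x mor \<Rightarrow> nat mor" where
  "std_mor f = map_mor (position (letters (mdom f))) f"

lemma mdom_std_mor: "mdom (std_mor f) = std_word (mdom f)"
  by (simp add: std_mor_def std_word_def)

lemma letters_std_word: "distinct (letters w) \<Longrightarrow> letters (std_word w) = [0..<length (letters w)]"
  by (simp add: std_word_def map_position)

lemma is_op_std_word: "is_word n UNIV w \<Longrightarrow> distinct (letters w) \<Longrightarrow> is_op n (length (letters w)) (std_word w)"
  by (auto simp: is_op_def is_word_iff[of n "{..<_}"] letters_std_word) (simp add: std_word_def)

lemma is_op_std_mor:
  assumes "is_mor n UNIV f" "distinct (letters (mdom f))"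
  shows "is_op_mor n (length (letters (mdom f))) (std_mor f)"
proof -
  have "is_mor n {..<length (letters (mdom f))} (std_mor f)"
    unfolding std_mor_def using assms position_less[of _ "letters (mdom f)"]
    by (intro is_mor_map_mor[of n UNIV]) auto
  then show ?thesis
    using is_op_std_word[of n "mdom f"] assms is_mor_word by (auto simp: is_op_mor_def mdom_std_mor)
qed

lemma std_mor_map_mor:
  assumes "is_mor n UNIV f" "inj_on h (set (letters (mdom f)))"
  shows "std_mor (map_mor h f) = std_mor f"
  using assms by (auto simp: std_mor_def map_mor_map_mor position_map intro!: map_mor_cong_letters[of n UNIV])

text \<open>Every operation is a relabelling of its standard form by a permutation.\<close>

lemma relabel:
  assumes "distinct ls" "set ls = {..<k :: nat}"
  obtains p where "p permutes {..<k}" "\<And>i. i < k \<Longrightarrow> inv p i = ls ! i" "\<And>x. x < k \<Longrightarrow> p x = position ls x"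
proof -
  have len: "length ls = k"
    using assms by (metis card_lessThan distinct_card)
  define p where "p x = (if x < k then position ls x else x)" for x
  have "bij_betw (position ls) {..<k} {..<k}"
  proof -
    have inj: "inj_on (position ls) {..<k}" and "position ls ` {..<k} \<subseteq> {..<k}"
      using assms inj_position[of ls] position_less[of _ ls] len by auto
    then have "position ls ` {..<k} = {..<k}"
      by (intro endo_inj_surj) auto
    then show ?thesis
      using inj by (simp add: bij_betw_def)
  qed
  then have "bij_betw p {..<k} {..<k}"
    by (subst bij_betw_cong[of _ p "position ls"]) (auto simp: p_def)
  then have p: "p permutes {..<k}"
    by (rule bij_imp_permutes) (simp add: p_def)
  moreover have "inv p i = ls ! i" if "i < k" for i
  proof -
    have "ls ! i < k" using that len assms nth_mem[of i ls] by auto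
    then have "p (ls ! i) = i" using that len assms(1) by (simp add: p_def position_nth)
    then show ?thesis using p by (metis permutes_inverses(2))
  qed
  ultimately show thesis
    by (rule that) (auto simp: p_def)
qed

lemma relabel_word:
  assumes "is_op n k w"
  obtains p where "p permutes {..<k}" "w = map_word (inv p) (std_word w)" "is_op n k (std_word w)" "length (letters w) = k"
    "\<And>i. i < k \<Longrightarrow> inv p i = letters w ! i" "\<And>x. x < k \<Longrightarrow> p x = position (letters w) x"
proof -
  have w: "distinct (letters w)" "set (letters w) = {..<k}" "is_word n UNIV w"
    using assms by (auto simp: is_op_def is_word_iff[of n "{..<_}"])
  then have len: "length (letters w) = k"
    by (metis card_lessThan distinct_card)
  obtain p where p: "p permutes {..<k}" "\<And>i. i < k \<Longrightarrow> inv p i = letters w ! i"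
      "\<And>x. x < k \<Longrightarrow> p x = position (letters w) x"
    using relabel[OF w(1,2)] by blast
  have "map_word (inv p) (std_word w) = w"
    unfolding std_word_def map_word_map_word using w len p(2) position_less[of _ "letters w"]
    by (intro map_word_idem) auto
  then show thesis
    using that[of p] p is_op_std_word[OF w(3,1)] len by simp
qed

lemma relabel_mor:
  assumes "is_op_mor n k f"
  obtains p where "p permutes {..<k}" "f = map_mor (inv p) (std_mor f)" "is_op_mor n k (std_mor f)"
    "length (letters (mdom f)) = k" "\<And>i. i < k \<Longrightarrow> inv p i = letters (mdom f) ! i"
proof -
  have f: "is_mor n UNIV f" "is_op n k (mdom f)"
    using assms by (auto simp: is_op_mor_def is_mor_iff[of n "{..<_}"])
  obtain p where p: "p permutes {..<k}" "length (letters (mdom f)) = k"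
      "\<And>i. i < k \<Longrightarrow> inv p i = letters (mdom f) ! i"
    using relabel_word[OF f(2)] by blast
  have "map_mor (inv p) (std_mor f) = f"
    unfolding std_mor_def map_mor_map_mor using f p(2,3) position_less[of _ "letters (mdom f)"]
    by (intro map_mor_idem[of n UNIV]) auto
  then show thesis
    using that[of p] p is_op_std_mor[OF f(1)] f(2) by (simp add: is_op_def)
qed

lemma std_word_wten:
  assumes "distinct (letters v @ letters w)"
  shows "std_word (wten i v w) = Mon_comp1 [length (letters v), length (letters w)]
    (wten i (Letter 0) (Letter 1)) [std_word v, std_word w]"
proof -
  have "map_word (position (letters v @ letters w)) v = std_word v"
    unfolding std_word_def by (rule map_word_cong_letters) (simp add: position_append)
  moreover have "map_word (position (letters v @ letters w)) w = map_word (\<lambda>x. length (letters v) + x) (std_word w)"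
    unfolding std_word_def map_word_map_word
    using assms by (intro map_word_cong_letters) (auto simp: position_append)
  ultimately show ?thesis
    by (simp add: Mon_comp1_def std_word_def[of "wten i v w"] map_word_idem)
qed

lemma is_op_wten_Letters [simp]:
  "1 \<le> i \<Longrightarrow> i \<le> n \<Longrightarrow> is_op n 2 (wten i (Letter 0) (Letter 1))"
  by (auto simp: is_op_def intro!: wten_word)

lemma is_op_Unit [simp]: "is_op n 0 Unit" and is_op_Letter [simp]: "is_op n (Suc 0) (Letter 0)"
  by (auto simp: is_op_def)

lemma is_op_mor_Idt: "is_op n k w \<Longrightarrow> is_op_mor n k (Idt w)"
  by (auto simp: is_op_mor_def is_op_def)

lemma is_op_mor_Exch_Letters [simp]:
  "1 \<le> i \<Longrightarrow> i < j \<Longrightarrow> j \<le> n \<Longrightarrow>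
    is_op_mor n 4 (Exch i j (Letter 0) (Letter 1) (Letter 2) (Letter 3))"
  by (auto simp: is_op_mor_def is_op_def intro!: wten_word)

lemma std_mor_Ten:
  assumes "1 \<le> i" "i \<le> n" "is_mor n UNIV f" "is_mor n UNIV g"
    "distinct (letters (mdom f) @ letters (mdom g))"
  defines "k \<equiv> length (letters (mdom f))" and "l \<equiv> length (letters (mdom g))"
  shows "mor_eq n {..<k + l} (Mon_comp_mor [k, l] (Idt (wten i (Letter 0) (Letter 1))) [std_mor f, std_mor g])
    (std_mor (Ten i f g))"
proof -
  have f: "map_mor (position (letters (mdom f) @ letters (mdom g))) f = std_mor f"
    unfolding std_mor_def using assms by (intro map_mor_cong_letters[of n UNIV]) (auto simp: position_append)
  have g: "map_mor (position (letters (mdom f) @ letters (mdom g))) g = map_mor (\<lambda>x. k + x) (std_mor g)"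
    unfolding std_mor_def map_mor_map_mor k_def
    using assms by (intro map_mor_cong_letters[of n UNIV]) (auto simp: position_append)
  let ?m0 = "std_mor f" and ?m1 = "map_mor (\<lambda>x. k + x) (std_mor g)"
  have "is_op_mor n k (std_mor f)" "is_op_mor n l (std_mor g)"
    unfolding k_def l_def using assms by (auto intro!: is_op_std_mor)
  then have m: "is_mor n {..<k + l} ?m0" "is_mor n {..<k + l} ?m1"
    by (auto simp: is_op_mor_def is_op_def is_mor_iff[of n "{..<_}"] intro!: is_mor_map_mor[of n UNIV])
  have w: "wten i (Letter 0) (Letter 1) = Prod i [Letter 0, Letter 1]"
    by (simp add: wten_def)
  have "(+) (0 :: nat) = (\<lambda>x. x)"
    by auto
  then have m0: "map_mor ((+) 0) (std_mor f) = std_mor f"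
    by (simp add: mor.map_ident)
  let ?c = "Mon_comp_mor [k, l] (Idt (wten i (Letter 0) (Letter 1))) [std_mor f, std_mor g]"
  have c: "?c = Ten i ?m0 (Ten i ?m1 (Idt Unit)) \<bullet> Idt (wten i (mdom ?m0) (mdom ?m1))"
    unfolding Mon_comp_mor_def w by (simp add: m0 del: mdom_map_mor)
  have t: "is_mor n {..<k + l} (Ten i ?m0 (Ten i ?m1 (Idt Unit)))"
    using m assms by simp
  have "mor_eq n {..<k + l} ?c (Ten i ?m0 (Ten i ?m1 (Idt Unit)))"
    unfolding c using mor_eq.Seq_Idt[OF t] by simp
  moreover have "mor_eq n {..<k + l} (Ten i ?m0 (Ten i ?m1 (Idt Unit))) (Ten i ?m0 ?m1)"
    using m assms(1,2) by (intro mor_eq.Ten_cong mor_eq.Ten_Unit mor_eq.refl)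
  ultimately have "mor_eq n {..<k + l} ?c (Ten i ?m0 ?m1)"
    by (rule mor_eq.trans)
  then show ?thesis
    by (simp add: std_mor_def[of "Ten i f g"] f g)
qed

text \<open>The exchange of four words is the generating exchange composed with the identities of the
  words.\<close>

lemma std_mor_Exch:
  assumes "1 \<le> i" "i < j" "j \<le> n" "is_word n UNIV p" "is_word n UNIV q" "is_word n UNIV r" "is_word n UNIV s"
    "distinct (letters p @ letters q @ letters r @ letters s)"
  defines "ks \<equiv> map (\<lambda>w. length (letters w)) [p, q, r, s]"
  shows "mor_eq n {..<sum_list ks} (Mon_comp_mor ks (Exch i j (Letter 0) (Letter 1) (Letter 2) (Letter 3))
      (map (\<lambda>w. Idt (std_word w)) [p, q, r, s])) (std_mor (Exch i j p q r s))"
proof -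
  let ?f = "Exch i j (Letter 0) (Letter 1) (Letter 2) (Letter 3) :: nat mor"
  let ?gs = "map (\<lambda>w. Idt (std_word w)) [p, q, r, s]"
  let ?s = "\<lambda>l. map_word (\<lambda>x. sum_list (take l ks) + x) (map std_word [p, q, r, s] ! l)"
  let ?position = "position (letters p @ letters q @ letters r @ letters s)"
  have sw: "?s 0 = map_word ?position p" "?s 1 = map_word ?position q" "?s 2 = map_word ?position r" "?s 3 = map_word ?position s"
    using assms(8)
    by (auto simp: std_word_def map_word_map_word ks_def position_append eval_nat_numeral intro!: map_word_cong_letters)
  have lt4: "l = 0 \<or> l = 1 \<or> l = 2 \<or> l = 3" if "l < 4" for l :: nat
    using that by auto
  have "\<forall>x \<in> set (letters p) \<union> set (letters q) \<union> set (letters r) \<union> set (letters s). ?position x < sum_list ks"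
    using position_less[of _ "letters p @ letters q @ letters r @ letters s"] by (auto simp: ks_def)
  then have ws: "is_word n {..<sum_list ks} (?s l)" if "l < 4" for l
    using lt4[OF that] assms(4-7) sw by (elim disjE) (auto simp: is_word_iff[of n "{..<_}"])
  have m: "is_word n {..<4 :: nat} (mcod ?f)"
    using assms by (auto intro!: wten_word)
  have std_mor: "std_mor (Exch i j p q r s) = Exch i j (?s 0) (?s 1) (?s 2) (?s 3)"
    unfolding sw by (simp add: std_mor_def)
  have p0: "(+) (0 :: nat) = (\<lambda>x. x)"
    by auto
  let ?m = "\<lambda>l. map_mor (\<lambda>x. sum_list (take l ks) + x) (?gs ! l)"
  have "word_mor ?m (mcod ?f) = word_mor (\<lambda>l. Idt (?s l)) (mcod ?f)"
    by (rule word_mor_cong) (auto simp: nth_Cons split: nat.splits)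
  then have c: "Mon_comp_mor ks ?f ?gs = word_mor (\<lambda>l. Idt (?s l)) (mcod ?f) \<bullet> std_mor (Exch i j p q r s)"
    by (simp add: Mon_comp_mor_def std_mor del: mcod.simps) (simp add: eval_nat_numeral p0)
  have e: "is_mor n {..<sum_list ks} (std_mor (Exch i j p q r s))"
    unfolding std_mor using ws[of 0] ws[of 1] ws[of 2] ws[of 3] assms(1-3) by (simp add: p0)
  have "mor_eq n {..<sum_list ks} (word_mor (\<lambda>l. Idt (?s l)) (mcod ?f)) (Idt (subst_word ?s (mcod ?f)))"
    using m ws by (intro mor_eq_word_mor_Idt[of n "{..<4}"]) (auto simp del: mcod.simps simp: is_word_iff[of n "{..<_}"])
  moreover have cod: "mcod (std_mor (Exch i j p q r s)) = subst_word ?s (mcod ?f)"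
    unfolding std_mor by simp
  ultimately have "mor_eq n {..<sum_list ks} (Mon_comp_mor ks ?f ?gs)
      (Idt (subst_word ?s (mcod ?f)) \<bullet> std_mor (Exch i j p q r s))"
    unfolding c using e
    by (intro mor_eq.Seq_cong mor_eq.refl) (auto simp del: mcod.simps)
  then show ?thesis
    using mor_eq.Idt_Seq[OF e] unfolding cod by (rule mor_eq.trans)
qed

section \<open>Evaluating a multifunctor on words and formal morphisms\<close>

lemma unit_list_eq: "replicate (length cs) () = (cs :: unit list)"
  by (simp add: list_eq_iff_nth_eq)

lemma Mon_simps:
  "MObj (Mon n) = UNIV" "Ops (Mon n) = (\<lambda>cs d. Mon_ops n (length cs))"
  "ident (Mon n) = (\<lambda>c. Letter 0)" "comp1 (Mon n) = (\<lambda>bss cs d. Mon_comp1 (map length bss))"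
  "comp2 (Mon n) = (\<lambda>bss cs d. Mon_comp2 n (map length bss))"
  "act1 (Mon n) = (\<lambda>cs d p. map_word (inv p))"
  "act2 (Mon n) = (\<lambda>cs d p c. mor_class n {..<length cs} (map_mor (inv p) (rep c)))"
  by (simp_all add: Mon_def)

lemma PermCat_simps:
  "Ops PermCat_su = multilinear_cat" "ident PermCat_su = id_linear" "comp1 PermCat_su = comp_linear"
  "comp2 PermCat_su = comp_trans" "act1 PermCat_su = (\<lambda>Cs D. act_linear Cs)"
  "act2 PermCat_su = (\<lambda>Cs D. act_trans Cs)"
  by (simp_all add: PermCat_su_def)

locale Mon_functor = permutative_category C for C :: "('o, 'm) permcat" (structure) +
  fixes n :: nat
    and \<Phi> :: "(unit, nat word, nat mor set, ('o, 'm) permcat, ('o, 'm) mlfun, ('o, 'm) mltrans) mfunctor"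
  assumes n: "1 \<le> n"
    and multifunctor: "cat_multifunctor (Mon n) PermCat_su \<Phi>"
    and on_obj: "on_obj \<Phi> () = C"
begin

definition F :: "nat \<Rightarrow> nat word \<Rightarrow> ('o, 'm) mlfun" where
  "F k w = on1 \<Phi> (replicate k ()) () w"

definition G :: "nat \<Rightarrow> nat mor \<Rightarrow> ('o, 'm) mltrans" where
  "G k f = on2 \<Phi> (replicate k ()) () (mor_class n {..<k} f)"

lemma on_obj' [simp]: "on_obj \<Phi> = (\<lambda>_. C)"
  using on_obj by auto

lemma map_C [simp]: "map (\<lambda>_ :: unit. C) = (\<lambda>cs. replicate (length cs) C)"
  by (simp add: fun_eq_iff map_replicate_const)

lemma profile [simp]: "profile (Mon n) cs d"
  by (simp add: profile_def Mon_simps)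

lemma F_functor: "is_functor (Mon_ops n k) (multilinear_cat (replicate k C) C) (F k) (on2 \<Phi> (replicate k ()) ())"
proof -
  have "on1 \<Phi> (replicate k ()) () = F k" by (simp add: F_def fun_eq_iff)
  then show ?thesis
    using cat_multifunctor.is_functor[OF multifunctor, of "replicate k ()" "()"]
    by (simp add: Mon_simps PermCat_simps)
qed

lemma F_multilinear: "is_op n k w \<Longrightarrow> multilinear (replicate k C) C (F k w)"
  using F_functor[of k] by (auto simp: is_functor_def multilinear_cat_def)

lemma G_trans:
  assumes "is_op_mor n k f"
  shows "multilinear_trans (replicate k C) C (G k f)" "src (G k f) = F k (mdom f)" "tgt (G k f) = F k (mcod f)"
proof -
  have "G k f \<in> hom (multilinear_cat (replicate k C) C) (F k (mdom f)) (F k (mcod f))"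
    using F_functor[of k] mor_class_Arr[OF assms] assms
    by (auto simp: is_functor_def G_def is_op_mor_def)
  then show "multilinear_trans (replicate k C) C (G k f)" "src (G k f) = F k (mdom f)" "tgt (G k f) = F k (mcod f)"
    by (auto simp: hom_def multilinear_cat_def)
qed

lemma G_Idt: "is_op n k w \<Longrightarrow> G k (Idt w) = Ide (multilinear_cat (replicate k C) C) (F k w)"
  using F_functor[of k] by (auto simp: is_functor_def G_def)

lemma G_Seq:
  assumes "is_op_mor n k f" "is_mor n {..<k} (g \<bullet> f)"
  shows "G k (g \<bullet> f) = Cmp (multilinear_cat (replicate k C) C) (G k g) (G k f)"
proof -
  have g: "is_op_mor n k g"
    using assms is_op_mor_mcod[OF assms(1)] by (auto simp: is_op_mor_def)
  show ?thesis
  proof -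
    have "Dom (Mon_ops n k) (mor_class n {..<k} g) = Cod (Mon_ops n k) (mor_class n {..<k} f)"
      using assms(2) by simp
    then have "on2 \<Phi> (replicate k ()) () (Cmp (Mon_ops n k) (mor_class n {..<k} g) (mor_class n {..<k} f)) =
        Cmp (multilinear_cat (replicate k C) C) (G k g) (G k f)"
      using F_functor[of k] mor_class_Arr[OF assms(1)] mor_class_Arr[OF g]
      unfolding is_functor_def G_def by blast
    then show ?thesis
      unfolding Cmp_Mon_ops[OF assms(2)] G_def .
  qed
qed

lemma G_eq: "mor_eq n {..<k} f g \<Longrightarrow> G k f = G k g"
  by (simp add: G_def mor_class_eqI)

lemma F_ident: "F (Suc 0) (Letter 0) = id_linear C"
  using cat_multifunctor.ident[OF multifunctor, of "()"] by (simp add: Mon_simps PermCat_simps F_def)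

lemma profiles_replicate [simp]:
  "profiles (Mon n) (map (\<lambda>k. replicate k ()) ks) (replicate (length ks) ()) ()"
  by (simp add: profiles_def list_all2_conv_all_nth)

lemma F_comp:
  assumes w: "is_op n (length ks) w" and len: "length vs = length ks"
    and vs: "\<And>l. l < length ks \<Longrightarrow> is_op n (ks ! l) (vs ! l)"
  shows "F (sum_list ks) (Mon_comp1 ks w vs) =
    comp_linear (map (\<lambda>k. replicate k C) ks) (replicate (length ks) C) C (F (length ks) w) (map2 F ks vs)"
proof -
  have "map2 (\<lambda>(bs, c). on1 \<Phi> bs c) (zip (map (\<lambda>k. replicate k ()) ks) (replicate (length ks) ())) vs = map2 F ks vs"
    using len by (auto intro!: nth_equalityI simp: F_def)
  moreover have "vs \<in> Obj (prod_cat (map2 (Ops (Mon n)) (map (\<lambda>k. replicate k ()) ks) (replicate (length ks) ())))"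
    using len vs by (auto simp: prod_cat_def list_all2_conv_all_nth Mon_simps)
  ultimately show ?thesis
    using cat_multifunctor.comp1[OF multifunctor, of "map (\<lambda>k. replicate k ()) ks" "replicate (length ks) ()" "()" w vs] w
    by (simp add: Mon_simps PermCat_simps concat_replicates comp_def F_def)
qed

lemma G_comp:
  assumes f: "is_op_mor n (length ks) f" and len: "length gs = length ks"
    and gs: "\<And>l. l < length ks \<Longrightarrow> is_op_mor n (ks ! l) (gs ! l)"
  shows "G (sum_list ks) (Mon_comp_mor ks f gs) =
    comp_trans (map (\<lambda>k. replicate k C) ks) (replicate (length ks) C) C (G (length ks) f) (map2 G ks gs)"
proof -
  let ?ds = "map2 (\<lambda>k. mor_class n {..<k}) ks gs"
  have "map2 (\<lambda>(bs, c). on2 \<Phi> bs c) (zip (map (\<lambda>k. replicate k ()) ks) (replicate (length ks) ())) ?ds = map2 G ks gs"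
    using len by (auto intro!: nth_equalityI simp: G_def)
  moreover have "?ds \<in> Arr (prod_cat (map2 (Ops (Mon n)) (map (\<lambda>k. replicate k ()) ks) (replicate (length ks) ())))"
    using len gs by (auto simp: prod_cat_def list_all2_conv_all_nth Mon_simps mor_class_Arr)
  ultimately show ?thesis
    using cat_multifunctor.comp2[OF multifunctor, of "map (\<lambda>k. replicate k ()) ks" "replicate (length ks) ()" "()"
        "mor_class n {..<length ks} f" ?ds] mor_class_Arr[OF f] Mon_comp2_op[OF f len gs]
    by (simp add: Mon_simps PermCat_simps concat_replicates comp_def G_def)
qed

lemma F_act:
  assumes "p permutes {..<k}" "is_op n k w"
  shows "F k (map_word (inv p) w) = act_linear (replicate k C) p (F k w)"
  using cat_multifunctor.act1[OF multifunctor, of "replicate k ()" "()" p w] assms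
  by (simp add: Mon_simps PermCat_simps F_def) (metis length_permute_list length_replicate unit_list_eq)

lemma G_act:
  assumes p: "p permutes {..<k}" and f: "is_op_mor n k f"
  shows "G k (map_mor (inv p) f) = act_trans (replicate k C) p (G k f)"
proof -
  have f': "is_mor n {..<k} f" using f by (auto simp: is_op_mor_def)
  have "inv p ` {..<k} \<subseteq> {..<k}"
    using permutes_image[OF permutes_inv[OF p]] by simp
  then have "mor_class n {..<k} (map_mor (inv p) (rep (mor_class n {..<k} f))) = mor_class n {..<k} (map_mor (inv p) f)"
    by (intro mor_class_eqI mor_eq_map_mor[OF mor_eq.sym[OF rep_mor_class[OF f']]])
  moreover have "permute_list p (replicate k ()) = replicate k ()"
    by (metis length_permute_list length_replicate unit_list_eq)
  ultimately show ?thesis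
    using cat_multifunctor.act2[OF multifunctor, of "replicate k ()" "()" p "mor_class n {..<k} f"]
      p mor_class_Arr[OF f]
    by (simp add: Mon_simps PermCat_simps G_def)
qed

abbreviation wd :: "'x word \<Rightarrow> bool" where "wd w \<equiv> is_word n UNIV w"
abbreviation wdm :: "'x mor \<Rightarrow> bool" where "wdm f \<equiv> is_mor n UNIV f"

text \<open>The values of the multifunctor at words and formal morphisms on named letters. They do not
  depend on the labelling, by equivariance, and are then computed by recursion, since the standard
  form of a product is an operadic composite of standard forms.\<close>

definition eval_obj :: "('x \<Rightarrow> 'o) \<Rightarrow> 'x word \<Rightarrow> 'o" where
  "eval_obj a w = fun_o (F (length (letters w)) (std_word w)) (map a (letters w))"

definition eval_arr :: "('x \<Rightarrow> 'm) \<Rightarrow> 'x word \<Rightarrow> 'm" where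
  "eval_arr m w = fun_m (F (length (letters w)) (std_word w)) (map m (letters w))"

definition eval_lin :: "'x \<Rightarrow> ('x \<Rightarrow> 'o) \<Rightarrow> 'o \<Rightarrow> 'x word \<Rightarrow> 'm" where
  "eval_lin x a A' w = lin (F (length (letters w)) (std_word w)) (position (letters w) x) (map a (letters w)) A'"

definition eval_mor :: "('x \<Rightarrow> 'o) \<Rightarrow> 'x mor \<Rightarrow> 'm" where
  "eval_mor a f = component (G (length (letters (mdom f))) (std_mor f)) (map a (letters (mdom f)))"

abbreviation "S \<equiv> En_structure_of n C \<Phi>"
abbreviation "T i \<equiv> F 2 (wten i (Letter 0) (Letter 1))"
abbreviation "E i j \<equiv> G 4 (Exch i j (Letter 0) (Letter 1) (Letter 2) (Letter 3))"

lemma S_simps: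
  "1 \<le> i \<Longrightarrow> i \<le> n \<Longrightarrow> ten_o S i A B = fun_o (T i) [A, B]"
  "1 \<le> i \<Longrightarrow> i \<le> n \<Longrightarrow> ten_m S i f g = fun_m (T i) [f, g]"
  "ten_unit S = fun_o (F 0 Unit) []"
  "1 \<le> i \<Longrightarrow> i \<le> n \<Longrightarrow> distl S i A B D = lin (T i) 0 [A, D] B"
  "1 \<le> i \<Longrightarrow> i \<le> n \<Longrightarrow> distr S i A B D = lin (T i) 1 [A, B] D"
  "1 \<le> i \<Longrightarrow> i < j \<Longrightarrow> j \<le> n \<Longrightarrow> exch S i j A B X Y = component (E i j) [A, B, X, Y]"
  by (simp_all add: En_structure_of_def Let_def F_def G_def numeral_2_eq_2 eval_nat_numeral)

lemma map_asg [simp]: "asg a \<Longrightarrow> map a xs \<in> Obj (pow_cat C (length xs))"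
  "arr_asg m \<Longrightarrow> map m xs \<in> Arr (pow_cat C (length xs))"
  by auto

lemma F_wten:
  assumes "1 \<le> i" "i \<le> n" "wd v" "wd w" "distinct (letters v @ letters w)"
  defines "k \<equiv> length (letters v)" and "l \<equiv> length (letters w)"
  shows "F (k + l) (std_word (wten i v w)) =
    comp_linear [replicate k C, replicate l C] [C, C] C (T i) [F k (std_word v), F l (std_word w)]"
proof -
  have "is_op n ([k, l] ! x) ([std_word v, std_word w] ! x)" if "x < length [k, l]" for x
    using that assms by (cases x) (auto simp: k_def l_def intro!: is_op_std_word)
  then show ?thesis
    using F_comp[of "[k, l]" "wten i (Letter 0) (Letter 1)" "[std_word v, std_word w]"] assms
      is_op_wten_Letters[OF assms(1,2)]
    by (simp add: std_word_wten k_def l_def numeral_2_eq_2)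
qed

lemma eval_obj_wten:
  assumes "1 \<le> i" "i \<le> n" "wd v" "wd w" "distinct (letters v @ letters w)" "asg a"
  shows "eval_obj a (wten i v w) = ten_o S i (eval_obj a v) (eval_obj a w)"
  using F_wten[OF assms(1-5)] assms(1,2,6)
  by (auto simp: eval_obj_def comp_linear_def Let_def S_simps replicate_add[symmetric])

lemma eval_arr_wten:
  assumes "1 \<le> i" "i \<le> n" "wd v" "wd w" "distinct (letters v @ letters w)" "arr_asg m"
  shows "eval_arr m (wten i v w) = ten_m S i (eval_arr m v) (eval_arr m w)"
  using F_wten[OF assms(1-5)] assms(1,2,6)
  by (auto simp: eval_arr_def comp_linear_def Let_def S_simps replicate_add[symmetric])

lemma map_update_position:
  "distinct xs \<Longrightarrow> x \<in> set xs \<Longrightarrow> (map a xs)[position xs x := A] = map (a(x := A)) xs"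
  by (auto intro!: nth_equalityI simp: nth_list_update position_less position_nth fun_upd_apply)

lemma eval_lin_wten:
  assumes "1 \<le> i" "i \<le> n" "wd v" "wd w" "distinct (letters v @ letters w)" "asg a" "A' \<in> Obj C"
  shows "x \<in> set (letters v) \<Longrightarrow> eval_lin x a A' (wten i v w) =
      ten_m S i (eval_lin x a A' v) (Ide C (eval_obj a w)) \<cdot>
      distl S i (eval_obj a v) (eval_obj (a(x := A')) v) (eval_obj a w)"
    and "x \<in> set (letters w) \<Longrightarrow> eval_lin x a A' (wten i v w) =
      ten_m S i (Ide C (eval_obj a v)) (eval_lin x a A' w) \<cdot>
      distr S i (eval_obj a v) (eval_obj a w) (eval_obj (a(x := A')) w)"
proof -
  let ?k = "length (letters v)" and ?l = "length (letters w)"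
  note F = F_wten[OF assms(1-5)]
  have P: "replicate ?k C @ replicate ?l C = replicate (?k + ?l) C"
    by (simp add: replicate_add)
  have Ide [simp]: "Ide (pow_cat C 2) [A, B] = [Ide C A, Ide C B]" "Ide (prod_cat [C, C]) [A, B] = [Ide C A, Ide C B]" for A B
    by (simp_all add: prod_cat_def numeral_2_eq_2)
  have up: "(map a (letters u))[position (letters u) x := A'] = map (a(x := A')) (letters u)"
    if "distinct (letters u)" "x \<in> set (letters u)" for u
    using that by (rule map_update_position)
  show "eval_lin x a A' (wten i v w) =
      ten_m S i (eval_lin x a A' v) (Ide C (eval_obj a w)) \<cdot>
      distl S i (eval_obj a v) (eval_obj (a(x := A')) v) (eval_obj a w)" if "x \<in> set (letters v)"
    using F assms(1,2,5-7) that position_less[OF that] up[of v]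
    by (auto simp: eval_lin_def eval_obj_def comp_linear_def Let_def S_simps P nth_append
        position_append simp del: replicate_add)
  have "position (letters v @ letters w) x = ?k + position (letters w) x" if "x \<in> set (letters w)"
    using that assms(5) by (auto simp: position_append)
  then show "eval_lin x a A' (wten i v w) =
      ten_m S i (Ide C (eval_obj a v)) (eval_lin x a A' w) \<cdot>
      distr S i (eval_obj a v) (eval_obj a w) (eval_obj (a(x := A')) w)" if "x \<in> set (letters w)"
    using F assms(1,2,5-7) that position_less[OF that] up[of w]
    by (auto simp: eval_lin_def eval_obj_def comp_linear_def Let_def S_simps P nth_append)
qed

lemma eval_Letter [simp]:
  "asg a \<Longrightarrow> eval_obj a (Letter x) = a x" "arr_asg m \<Longrightarrow> eval_arr m (Letter x) = m x"
  "asg a \<Longrightarrow> A' \<in> Obj C \<Longrightarrow> eval_lin x a A' (Letter x) = Ide C (a x \<oplus> A')"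
proof -
  have P: "Obj (prod_cat [C]) = Obj (pow_cat C 1)" "Arr (prod_cat [C]) = Arr (pow_cat C 1)"
    by simp_all
  show "asg a \<Longrightarrow> eval_obj a (Letter x) = a x" "arr_asg m \<Longrightarrow> eval_arr m (Letter x) = m x"
    "asg a \<Longrightarrow> A' \<in> Obj C \<Longrightarrow> eval_lin x a A' (Letter x) = Ide C (a x \<oplus> A')"
    by (simp_all add: eval_obj_def eval_arr_def eval_lin_def std_word_def position_def F_ident id_linear_def P del: One_nat_def)
qed

lemma eval_Unit [simp]: "eval_obj a Unit = ten_unit S" "eval_arr m Unit = Ide C (ten_unit S)"
proof -
  show "eval_obj a Unit = ten_unit S"
    by (simp add: eval_obj_def std_word_def S_simps)
  have "is_functor (pow_cat C 0) C (fun_o (F 0 Unit)) (fun_m (F 0 Unit))"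
    using multilinear.is_functor[OF F_multilinear[of 0 Unit]] by simp
  then show "eval_arr m Unit = Ide C (ten_unit S)"
    by (auto simp: is_functor_def eval_arr_def std_word_def S_simps prod_cat_def)
qed

lemma F_arr:
  assumes w: "is_op n k w"
  shows "As \<in> Obj (pow_cat C k) \<Longrightarrow> fun_o (F k w) As \<in> Obj C"
    "fs \<in> Arr (pow_cat C k) \<Longrightarrow> fun_m (F k w) fs \<in> Arr C"
    "fs \<in> Arr (pow_cat C k) \<Longrightarrow> Dom C (fun_m (F k w) fs) = fun_o (F k w) (map (Dom C) fs)"
    "fs \<in> Arr (pow_cat C k) \<Longrightarrow> Cod C (fun_m (F k w) fs) = fun_o (F k w) (map (Cod C) fs)"
    "As \<in> Obj (pow_cat C k) \<Longrightarrow> fun_m (F k w) (map (Ide C) As) = Ide C (fun_o (F k w) As)"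
    "fs \<in> Arr (pow_cat C k) \<Longrightarrow> gs \<in> Arr (pow_cat C k) \<Longrightarrow> map (Dom C) gs = map (Cod C) fs \<Longrightarrow>
      fun_m (F k w) (map2 (Cmp C) gs fs) = fun_m (F k w) gs \<cdot> fun_m (F k w) fs"
proof -
  have fn: "is_functor (pow_cat C k) C (fun_o (F k w)) (fun_m (F k w))"
    using multilinear.is_functor[OF F_multilinear[OF w]] .
  show "As \<in> Obj (pow_cat C k) \<Longrightarrow> fun_o (F k w) As \<in> Obj C"
    using fn by (simp add: is_functor_def del: Obj_pow)
  show "fs \<in> Arr (pow_cat C k) \<Longrightarrow> fun_m (F k w) fs \<in> Arr C"
    "fs \<in> Arr (pow_cat C k) \<Longrightarrow> Dom C (fun_m (F k w) fs) = fun_o (F k w) (map (Dom C) fs)"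
    "fs \<in> Arr (pow_cat C k) \<Longrightarrow> Cod C (fun_m (F k w) fs) = fun_o (F k w) (map (Cod C) fs)"
    using fn by (auto simp: is_functor_def hom_def)
  show "As \<in> Obj (pow_cat C k) \<Longrightarrow> fun_m (F k w) (map (Ide C) As) = Ide C (fun_o (F k w) As)"
    using fn by (auto simp: is_functor_def)
  show "fs \<in> Arr (pow_cat C k) \<Longrightarrow> gs \<in> Arr (pow_cat C k) \<Longrightarrow> map (Dom C) gs = map (Cod C) fs \<Longrightarrow>
      fun_m (F k w) (map2 (Cmp C) gs fs) = fun_m (F k w) gs \<cdot> fun_m (F k w) fs"
    using fn by (auto simp: is_functor_def)
qed

lemma G_arr:
  assumes f: "is_op_mor n k f" and As: "As \<in> Obj (pow_cat C k)"
  shows "component (G k f) As \<in> Arr C"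
    "Dom C (component (G k f) As) = fun_o (F k (mdom f)) As"
    "Cod C (component (G k f) As) = fun_o (F k (mcod f)) As"
  using multilinear_trans.nat_trans[OF G_trans(1)[OF f]] G_trans(2,3)[OF f] As
  by (auto simp: is_nat_trans_def hom_def)

lemma permute_pad:
  assumes "\<And>i. i < k \<Longrightarrow> inv p i = ls ! i" "length As = k" "length ls = k" "set ls \<subseteq> {..<k}" "p permutes {..<k}"
  shows "permute_list (inv p) As = map (pad As) ls"
proof (rule nth_equalityI)
  fix i assume "i < length (permute_list (inv p) As)"
  then have i: "i < k" using assms(2) by simp
  then have "ls ! i < k" using assms(3,4) nth_mem[of i ls] by blast
  then show "permute_list (inv p) As ! i = map (pad As) ls ! i"
    using assms i permutes_inv[OF assms(5)] by (simp add: permute_list_nth)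
qed (use assms in simp)

lemma permute_arr_pad:
  assumes "\<And>i. i < k \<Longrightarrow> inv p i = ls ! i" "length fs = k" "length ls = k" "set ls \<subseteq> {..<k}" "p permutes {..<k}"
  shows "permute_list (inv p) fs = map (arr_pad fs) ls"
proof (rule nth_equalityI)
  fix i assume "i < length (permute_list (inv p) fs)"
  then have i: "i < k" using assms(2) by simp
  then have "ls ! i < k" using assms(3,4) nth_mem[of i ls] by blast
  then show "permute_list (inv p) fs ! i = map (arr_pad fs) ls ! i"
    using assms i permutes_inv[OF assms(5)] by (simp add: permute_list_nth)
qed (use assms in simp)

text \<open>Equivariance makes the standard form as good as any other labelling.\<close>

lemma F_eval:
  assumes w: "is_op n k w"
  shows "As \<in> Obj (pow_cat C k) \<Longrightarrow> fun_o (F k w) As = eval_obj (pad As) w"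
    "fs \<in> Arr (pow_cat C k) \<Longrightarrow> fun_m (F k w) fs = eval_arr (arr_pad fs) w"
    "i < k \<Longrightarrow> As \<in> Obj (pow_cat C k) \<Longrightarrow> A' \<in> Obj C \<Longrightarrow> lin (F k w) i As A' = eval_lin i (pad As) A' w"
proof -
  let ?ls = "letters w"
  obtain p where p: "p permutes {..<k}" "w = map_word (inv p) (std_word w)" "is_op n k (std_word w)" "length ?ls = k"
    "\<And>i. i < k \<Longrightarrow> inv p i = ?ls ! i" "\<And>x. x < k \<Longrightarrow> p x = position ?ls x"
    using relabel_word[OF w] by blast
  have ls: "set ?ls = {..<k}"
    using w by (simp add: is_op_def)
  have F: "F k w = act_linear (replicate k C) p (F k (std_word w))"
    using F_act[OF p(1,3)] p(2) by simp
  have pk: "permute_list p (replicate k C) = replicate k C"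
    using p(1) permutes_in_image[OF p(1)] by (intro nth_equalityI) (auto simp: permute_list_nth)
  show "fun_o (F k w) As = eval_obj (pad As) w" if "As \<in> Obj (pow_cat C k)"
    unfolding F using that permute_pad[of k p ?ls As] p(1,4-6) ls
    by (simp add: act_linear_def Let_def pk eval_obj_def)
  show "fun_m (F k w) fs = eval_arr (arr_pad fs) w" if "fs \<in> Arr (pow_cat C k)"
    unfolding F using that permute_arr_pad[of k p ?ls fs] p(1,4-6) ls
    by (simp add: act_linear_def Let_def pk eval_arr_def)
  show "lin (F k w) i As A' = eval_lin i (pad As) A' w" if "i < k" "As \<in> Obj (pow_cat C k)" "A' \<in> Obj C"
    unfolding F using that permute_pad[of k p ?ls As] p(1,4-6) ls permutes_in_image[OF p(1), of i]
    by (simp add: act_linear_def Let_def pk eval_lin_def)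
qed

lemma G_eval:
  assumes f: "is_op_mor n k f" and As: "As \<in> Obj (pow_cat C k)"
  shows "component (G k f) As = eval_mor (pad As) f"
proof -
  let ?ls = "letters (mdom f)"
  obtain p where p: "p permutes {..<k}" "f = map_mor (inv p) (std_mor f)" "is_op_mor n k (std_mor f)" "length ?ls = k"
    "\<And>i. i < k \<Longrightarrow> inv p i = ?ls ! i"
    using relabel_mor[OF f] by blast
  have ls: "set ?ls = {..<k}"
    using f by (simp add: is_op_mor_def is_op_def)
  have G: "G k f = act_trans (replicate k C) p (G k (std_mor f))"
    using G_act[OF p(1,3)] p(2) by simp
  have pk: "permute_list p (replicate k C) = replicate k C"
    using p(1) permutes_in_image[OF p(1)] by (intro nth_equalityI) (auto simp: permute_list_nth)
  show ?thesis
    unfolding G using As permute_pad[of k p ?ls As] p(1,4,5) ls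
    by (simp add: act_trans_def pk eval_mor_def)
qed

lemma eval_mor_eq:
  assumes "mor_eq n (set (letters (mdom f))) f g" "distinct (letters (mdom f))"
  shows "eval_mor a f = eval_mor a g"
proof -
  have m: "mdom g = mdom f"
    using mor_eq_is_mor[OF assms(1)] by simp
  have "mor_eq n {..<length (letters (mdom f))} (std_mor f) (std_mor g)"
    unfolding std_mor_def m using position_less[of _ "letters (mdom f)"]
    by (intro mor_eq_map_mor[OF assms(1)]) auto
  then show ?thesis
    by (simp add: eval_mor_def m G_eq)
qed

lemma eval_obj_Obj [simp]: "wd w \<Longrightarrow> distinct (letters w) \<Longrightarrow> asg a \<Longrightarrow> eval_obj a w \<in> Obj C"
  unfolding eval_obj_def by (intro F_arr(1)) (auto intro: is_op_std_word)

lemma eval_mor_Idt: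
  assumes "wd w" "distinct (letters w)" "asg a"
  shows "eval_mor a (Idt w) = Ide C (eval_obj a w)"
proof -
  have "std_mor (Idt w) = Idt (std_word w)" by (simp add: std_mor_def std_word_def)
  then show ?thesis
    using G_Idt[OF is_op_std_word[OF assms(1,2)]] assms(3) by (auto simp: eval_mor_def eval_obj_def multilinear_cat_def)
qed

lemma eval_mor_map:
  assumes "wdm f" "inj_on h (set (letters (mdom f)))"
  shows "eval_mor a (map_mor h f) = eval_mor (\<lambda>x. a (h x)) f"
  using assms by (simp add: eval_mor_def std_mor_map_mor comp_def)

lemma eval_mor_cong:
  assumes "\<And>x. x \<in> set (letters (mdom f)) \<Longrightarrow> a x = b x"
  shows "eval_mor a f = eval_mor b f"
proof -
  have "map a (letters (mdom f)) = map b (letters (mdom f))" using assms by simp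
  then show ?thesis unfolding eval_mor_def by (rule arg_cong)
qed

lemma eval_mor_Seq:
  assumes f: "wdm (g \<bullet> f)" and d: "distinct (letters (mdom f))" and a: "asg a"
  shows "eval_mor a (g \<bullet> f) = eval_mor a g \<cdot> eval_mor a f"
proof -
  let ?ls = "letters (mdom f)" and ?k = "length (letters (mdom f))"
  let ?g = "map_mor (position ?ls) g"
  have gf: "wdm g" "wdm f" "mdom g = mcod f" using f by auto
  have lg: "set (letters (mdom g)) = set ?ls"
    using set_letters_mcod[OF gf(2)] gf(3) by simp
  have "is_op_mor n ?k (std_mor (g \<bullet> f))"
    using is_op_std_mor[OF f] d by simp
  moreover have eq: "std_mor (g \<bullet> f) = ?g \<bullet> std_mor f" by (simp add: std_mor_def)
  ultimately have m: "is_mor n {..<?k} (?g \<bullet> std_mor f)" "is_op_mor n ?k (std_mor f)"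
    by (auto simp: is_op_mor_def)
  have g: "is_op_mor n ?k ?g"
    using m is_op_mor_mcod[OF m(2)] by (auto simp: is_op_mor_def)
  have As: "map a ?ls \<in> Obj (pow_cat C ?k)" using a by (rule map_asg)
  have "component (G ?k ?g) (map a ?ls) = eval_mor (pad (map a ?ls)) ?g"
    using g As by (rule G_eval)
  also have "\<dots> = eval_mor (\<lambda>x. pad (map a ?ls) (position ?ls x)) g"
    using gf(1) inj_position[of ?ls] lg by (intro eval_mor_map) auto
  also have "\<dots> = eval_mor a g"
    using position_less[of _ ?ls] lg by (intro eval_mor_cong) auto
  finally show ?thesis
    using As unfolding eval_mor_def[of a "g \<bullet> f"] eq eval_mor_def[of a f]
    by (simp add: G_Seq[OF m(2,1)] multilinear_cat_def)
qed

lemma eval_mor_Arr [simp]: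
  assumes "wdm f" "distinct (letters (mdom f))" "asg a"
  shows "eval_mor a f \<in> Arr C" "Dom C (eval_mor a f) = eval_obj a (mdom f)"
  unfolding eval_mor_def using G_arr[OF is_op_std_mor[OF assms(1,2)] map_asg(1)[OF assms(3)]]
  by (auto simp: eval_obj_def mdom_std_mor)

lemma G_Ten:
  assumes i: "1 \<le> i" "i \<le> n" and "wdm f" "wdm g" "distinct (letters (mdom f) @ letters (mdom g))"
  defines "k \<equiv> length (letters (mdom f))" and "l \<equiv> length (letters (mdom g))"
  shows "G (k + l) (std_mor (Ten i f g)) = comp_trans [replicate k C, replicate l C] [C, C] C
    (G 2 (Idt (wten i (Letter 0) (Letter 1)))) [G k (std_mor f), G l (std_mor g)]"
proof -
  have ops: "is_op_mor n k (std_mor f)" "is_op_mor n l (std_mor g)"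
    using assms by (auto intro: is_op_std_mor)
  then have op: "is_op_mor n ([k, l] ! x) ([std_mor f, std_mor g] ! x)" if "x < length [k, l]" for x
    using that by (cases x) auto
  have T: "is_op n 2 (wten i (Letter 0) (Letter 1))"
    using i by (rule is_op_wten_Letters)
  have "G (k + l) (std_mor (Ten i f g)) = G (k + l) (Mon_comp_mor [k, l] (Idt (wten i (Letter 0) (Letter 1))) [std_mor f, std_mor g])"
    unfolding k_def l_def using std_mor_Ten[OF i assms(3-5)] by (intro G_eq) (rule mor_eq.sym)
  also have "\<dots> = comp_trans [replicate k C, replicate l C] [C, C] C (G 2 (Idt (wten i (Letter 0) (Letter 1))))
      [G k (std_mor f), G l (std_mor g)]"
    using G_comp[of "[k, l]" "Idt (wten i (Letter 0) (Letter 1))" "[std_mor f, std_mor g]"] op is_op_mor_Idt[OF T]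
    by (simp add: numeral_2_eq_2)
  finally show ?thesis .
qed

lemma eval_mor_Ten:
  assumes i: "1 \<le> i" "i \<le> n" and "wdm f" "wdm g" "distinct (letters (mdom f) @ letters (mdom g))" "asg a"
  shows "eval_mor a (Ten i f g) = ten_m S i (eval_mor a f) (eval_mor a g)"
proof -
  let ?k = "length (letters (mdom f))" and ?l = "length (letters (mdom g))"
  have ops: "is_op_mor n ?k (std_mor f)" "is_op_mor n ?l (std_mor g)"
    using assms by (auto intro: is_op_std_mor)
  have T: "is_op n 2 (wten i (Letter 0) (Letter 1))"
    using i by (rule is_op_wten_Letters)
  note G = G_Ten[OF assms(1-5)]
  let ?A = "fun_o (F ?k (mcod (std_mor f))) (map a (letters (mdom f)))"
  let ?B = "fun_o (F ?l (mcod (std_mor g))) (map a (letters (mdom g)))"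
  have f: "eval_mor a f \<in> Arr C" "Cod C (eval_mor a f) = ?A"
    and g: "eval_mor a g \<in> Arr C" "Cod C (eval_mor a g) = ?B"
    unfolding eval_mor_def using G_arr[OF ops(1) map_asg(1)[OF assms(6)]] G_arr[OF ops(2) map_asg(1)[OF assms(6)]] by blast+
  have AB: "[?A, ?B] \<in> Obj (pow_cat C 2)"
    using f g by (auto simp: arr_simps(2)[OF f(1), unfolded f(2)] arr_simps(2)[OF g(1), unfolded g(2)])
  have "component (G 2 (Idt (wten i (Letter 0) (Letter 1)))) [?A, ?B] = Ide C (fun_o (T i) [?A, ?B])"
    unfolding G_Idt[OF T] using AB by (simp add: multilinear_cat_def)
  moreover have "fun_m (T i) [eval_mor a f, eval_mor a g] \<in> Arr C"
    "Cod C (fun_m (T i) [eval_mor a f, eval_mor a g]) = fun_o (T i) [?A, ?B]"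
    using F_arr(2,4)[OF T, of "[eval_mor a f, eval_mor a g]"] f g by auto
  ultimately have "component (G 2 (Idt (wten i (Letter 0) (Letter 1)))) [?A, ?B] \<cdot>
      fun_m (T i) [eval_mor a f, eval_mor a g] = fun_m (T i) [eval_mor a f, eval_mor a g]"
    by simp
  then show ?thesis
    using assms(1,2,6) G_trans(2)[OF is_op_mor_Idt[OF T]] G_trans(3)[OF ops(1)] G_trans(3)[OF ops(2)]
    unfolding eval_mor_def[of a "Ten i f g"]
    by (auto simp: G comp_trans_def Let_def S_simps replicate_add[symmetric] eval_mor_def)
qed

lemma G_Exch:
  assumes i: "1 \<le> i" "i < j" "j \<le> n" and "wd p" "wd q" "wd r" "wd s"
    and "distinct (letters p @ letters q @ letters r @ letters s)"
  defines "ks \<equiv> map (\<lambda>w. length (letters w)) [p, q, r, s]"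
  shows "G (sum_list ks) (std_mor (Exch i j p q r s)) = comp_trans (map (\<lambda>k. replicate k C) ks) [C, C, C, C] C
    (G 4 (Exch i j (Letter 0) (Letter 1) (Letter 2) (Letter 3)))
    (map (\<lambda>w. G (length (letters w)) (Idt (std_word w))) [p, q, r, s])"
proof -
  let ?ws = "[p, q, r, s]"
  let ?E = "Exch i j (Letter 0) (Letter 1) (Letter 2) (Letter 3)"
  have ops: "is_op n (length (letters w)) (std_word w)" if "w \<in> set ?ws" for w
    using that assms by (intro is_op_std_word) auto
  have "list_all2 (is_op_mor n) ks (map (\<lambda>w. Idt (std_word w)) ?ws)"
    using ops by (simp add: ks_def is_op_mor_Idt)
  then have op: "is_op_mor n (ks ! l) (map (\<lambda>w. Idt (std_word w)) ?ws ! l)" if "l < length ks" for l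
    using that by (rule list_all2_nthD)
  have E: "is_op_mor n 4 ?E" using i by (rule is_op_mor_Exch_Letters)
  have "G (sum_list ks) (std_mor (Exch i j p q r s)) = G (sum_list ks) (Mon_comp_mor ks ?E (map (\<lambda>w. Idt (std_word w)) ?ws))"
    unfolding ks_def using std_mor_Exch[OF assms(1-8)] by (intro G_eq) (rule mor_eq.sym)
  also have "\<dots> = comp_trans (map (\<lambda>k. replicate k C) ks) [C, C, C, C] C (G 4 ?E)
      (map (\<lambda>w. G (length (letters w)) (Idt (std_word w))) ?ws)"
    using G_comp[of ks ?E "map (\<lambda>w. Idt (std_word w)) ?ws"] op E by (simp add: ks_def eval_nat_numeral)
  finally show ?thesis .
qed

lemma eval_mor_Exch:
  assumes i: "1 \<le> i" "i < j" "j \<le> n" and "wd p" "wd q" "wd r" "wd s"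
    and d: "distinct (letters p @ letters q @ letters r @ letters s)" and a: "asg a"
  shows "eval_mor a (Exch i j p q r s) = exch S i j (eval_obj a p) (eval_obj a q) (eval_obj a r) (eval_obj a s)"
proof -
  let ?ws = "[p, q, r, s]"
  let ?ks = "map (\<lambda>w. length (letters w)) ?ws"
  let ?E = "Exch i j (Letter 0) (Letter 1) (Letter 2) (Letter 3)"
  have ops: "is_op n (length (letters w)) (std_word w)" if "w \<in> set ?ws" for w
    using that assms by (intro is_op_std_word) auto
  have E: "is_op_mor n 4 ?E" using i by (rule is_op_mor_Exch_Letters)
  note G = G_Exch[OF assms(1-8)]
  let ?v = "map (eval_obj a) ?ws"
  have v: "?v \<in> Obj (pow_cat C 4)"
    using assms by auto
  have Idt: "component (G (length (letters w)) (Idt (std_word w))) (map a (letters w)) = Ide C (eval_obj a w)"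
    "fun_o (tgt (G (length (letters w)) (Idt (std_word w)))) (map a (letters w)) = eval_obj a w"
    if "w \<in> set ?ws" for w
    using a G_Idt[OF ops[OF that]] G_trans(3)[OF is_op_mor_Idt[OF ops[OF that]]]
    by (auto simp: multilinear_cat_def eval_obj_def)
  have E': "component (G 4 ?E) ?v \<cdot> fun_m (src (G 4 ?E)) (map (Ide C) ?v) = component (G 4 ?E) ?v"
  proof -
    have "fun_m (src (G 4 ?E)) (map (Ide C) ?v) = Ide C (fun_o (F 4 (mdom ?E)) ?v)"
      unfolding G_trans(2)[OF E] using E v by (intro F_arr(5)) (simp_all add: is_op_mor_def)
    then show ?thesis
      using G_arr[OF E v] by simp
  qed
  have "component (G (sum_list ?ks) (std_mor (Exch i j p q r s))) (map a (letters p @ letters q @ letters r @ letters s)) =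
      component (G 4 ?E) ?v \<cdot> fun_m (src (G 4 ?E)) (map (Ide C) ?v)"
    unfolding G using a Idt[of p] Idt[of q] Idt[of r] Idt[of s]
    by (auto simp: comp_trans_def Let_def replicate_add[symmetric] ac_simps)
  then show ?thesis
    unfolding E' using i by (simp add: eval_mor_def S_simps ac_simps)
qed

section \<open>The structure determined by a multifunctor is \<open>E\<^sub>n\<close>-monoidal\<close>

lemma wd_wten [simp]: "1 \<le> i \<Longrightarrow> i \<le> n \<Longrightarrow> wd v \<Longrightarrow> wd w \<Longrightarrow> wd (wten i v w)"
  by (rule wten_word)

lemma multilinear_T: "1 \<le> i \<Longrightarrow> i \<le> n \<Longrightarrow> multilinear (replicate 2 C) C (T i)"
  by (rule F_multilinear, rule is_op_wten_Letters)

lemma S_unit [simp]: "ten_unit S \<in> Obj C"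
  using F_arr(1)[OF is_op_Unit, of "[]"] by (simp add: S_simps prod_cat_def)

lemma S_ten [simp]:
  assumes i: "1 \<le> i" "i \<le> n"
  shows "A \<in> Obj C \<Longrightarrow> B \<in> Obj C \<Longrightarrow> ten_o S i A B \<in> Obj C"
    "f \<in> Arr C \<Longrightarrow> g \<in> Arr C \<Longrightarrow> ten_m S i f g \<in> Arr C"
    "f \<in> Arr C \<Longrightarrow> g \<in> Arr C \<Longrightarrow> Dom C (ten_m S i f g) = ten_o S i (Dom C f) (Dom C g)"
    "f \<in> Arr C \<Longrightarrow> g \<in> Arr C \<Longrightarrow> Cod C (ten_m S i f g) = ten_o S i (Cod C f) (Cod C g)"
    "A \<in> Obj C \<Longrightarrow> B \<in> Obj C \<Longrightarrow> ten_m S i (Ide C A) (Ide C B) = Ide C (ten_o S i A B)"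
  using F_arr(1,5)[OF is_op_wten_Letters[OF i], of "[A, B]"]
    F_arr(2-4)[OF is_op_wten_Letters[OF i], of "[f, g]"] i
  by (auto simp: S_simps)

lemma S_ten_Cmp:
  assumes i: "1 \<le> i" "i \<le> n" and "f \<in> Arr C" "f' \<in> Arr C" "g \<in> Arr C" "g' \<in> Arr C"
    "Dom C f' = Cod C f" "Dom C g' = Cod C g"
  shows "ten_m S i (f' \<cdot> f) (g' \<cdot> g) = ten_m S i f' g' \<cdot> ten_m S i f g"
  using F_arr(6)[OF is_op_wten_Letters[OF i], of "[f, g]" "[f', g']"] assms by (simp add: S_simps)

text \<open>The multifunctor takes a word of three letters to one functor, while the word is a product in two
  ways.\<close>

lemma S_strict_monoidal:
  assumes i: "1 \<le> i" "i \<le> n"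
  shows "strict_monoidal C (ten_o S i) (ten_m S i) (ten_unit S)"
proof
  fix A B D assume [simp]: "A \<in> Obj C" "B \<in> Obj C" "D \<in> Obj C"
  show "ten_o S i (ten_o S i A B) D = ten_o S i A (ten_o S i B D)"
    using arg_cong[OF wten_assoc[of i "Letter 0" "Letter 1" "Letter 2"], of "eval_obj (pad [A, B, D])"] i
    by (simp add: eval_obj_wten)
next
  fix f g h assume [simp]: "f \<in> Arr C" "g \<in> Arr C" "h \<in> Arr C"
  show "ten_m S i (ten_m S i f g) h = ten_m S i f (ten_m S i g h)"
    using arg_cong[OF wten_assoc[of i "Letter 0" "Letter 1" "Letter 2"], of "eval_arr (arr_pad [f, g, h])"] i
    by (simp add: eval_arr_wten)
next
  fix A assume [simp]: "A \<in> Obj C"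
  show "ten_o S i (ten_unit S) A = A" "ten_o S i A (ten_unit S) = A"
    using eval_obj_wten[of i Unit "Letter 0" "pad [A]"] eval_obj_wten[of i "Letter 0" Unit "pad [A]"] i
    by simp_all
next
  fix f assume [simp]: "f \<in> Arr C"
  show "ten_m S i (Ide C (ten_unit S)) f = f" "ten_m S i f (Ide C (ten_unit S)) = f"
    using eval_arr_wten[of i Unit "Letter 0" "arr_pad [f]"] eval_arr_wten[of i "Letter 0" Unit "arr_pad [f]"] i
    by simp_all
qed (use i S_ten_Cmp[OF i] in \<open>auto simp: hom_iff\<close>)

text \<open>The distributivity axioms for iterated products and for the unit compare the linearity
  constraints of one word factored in two ways. The remaining axioms are the multilinearity of the
  products.\<close>

lemma S_ring_category:
  assumes i: "1 \<le> i" "i \<le> n"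
  shows "ring_category C (ten_o S i) (ten_m S i) (ten_unit S) (distl S i) (distr S i)"
proof -
  interpret M: multilinear "replicate 2 C" C "T i"
    using i by (rule multilinear_T)
  interpret S: strict_monoidal C "ten_o S i" "ten_m S i" "ten_unit S"
    using i by (rule S_strict_monoidal)
  note Ss = S_simps(1,2,4,5)[OF i]
  have two: "(0::nat) < 2" "(1::nat) < 2" by auto
  have dl [simp]: "distl S i A B D \<in> Arr C" "Dom C (distl S i A B D) = ten_o S i A D \<oplus> ten_o S i B D"
      "Cod C (distl S i A B D) = ten_o S i (A \<oplus> B) D"
      "distr S i A B D \<in> Arr C" "Dom C (distr S i A B D) = ten_o S i A B \<oplus> ten_o S i A D"
      "Cod C (distr S i A B D) = ten_o S i A (B \<oplus> D)"
    if "A \<in> Obj C" "B \<in> Obj C" "D \<in> Obj C" for A B D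
    using M.lin_hom[of 0 "[A, D]" B] M.lin_hom[of 1 "[A, B]" D] that by (auto simp: hom_iff Ss)
  note [simp] = i i[unfolded One_nat_def] eval_obj_wten eval_lin_wten[OF i]
  show ?thesis
  proof (rule ring_category.intro[OF permutative_category_axioms], rule ring_category_axioms.intro)
    show "strict_monoidal C (ten_o S i) (ten_m S i) (ten_unit S)"
      using i by (rule S_strict_monoidal)
  next
    fix A B D assume "A \<in> Obj C" "B \<in> Obj C" "D \<in> Obj C"
    then show "distl S i A B D \<in> hom C (ten_o S i A D \<oplus> ten_o S i B D) (ten_o S i (A \<oplus> B) D)"
      "distr S i A B D \<in> hom C (ten_o S i A B \<oplus> ten_o S i A D) (ten_o S i A (B \<oplus> D))"
      by (auto simp: hom_iff)
  next
    fix f A A' g B B' h D D' assume "f \<in> hom C A A'" "g \<in> hom C B B'" "h \<in> hom C D D'"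
    then show "distl S i A' B' D' \<cdot> (ten_m S i f h \<boxplus> ten_m S i g h) = ten_m S i (f \<boxplus> g) h \<cdot> distl S i A B D"
      "distr S i A' B' D' \<cdot> (ten_m S i f g \<boxplus> ten_m S i f h) = ten_m S i f (g \<boxplus> h) \<cdot> distr S i A B D"
      using M.lin_nat[of 0 "[f, h]" "[A, D]" "[A', D']" g B B'] M.lin_nat[of 1 "[f, g]" "[A, B]" "[A', B']" h D D']
      by (auto simp: hom_def Ss)
  next
    fix A assume "A \<in> Obj C"
    then show "ten_o S i \<zero> A = \<zero>" "ten_o S i A \<zero> = \<zero>"
      using M.zero_o[of 0 "[\<zero>, A]"] M.zero_o[of 1 "[A, \<zero>]"] by (auto simp: Ss)
  next
    fix f assume "f \<in> Arr C"
    then show "ten_m S i (Ide C \<zero>) f = Ide C \<zero>" "ten_m S i f (Ide C \<zero>) = Ide C \<zero>"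
      using M.zero_m[of 0 "[Ide C \<zero>, f]"] M.zero_m[of 1 "[f, Ide C \<zero>]"] by (auto simp: Ss)
  next
    fix A B D assume A: "A \<in> Obj C" "B \<in> Obj C" "D \<in> Obj C"
    have ex: "(\<exists>j < 2. P j) \<longleftrightarrow> P 0 \<or> P (Suc 0)" for P :: "nat \<Rightarrow> bool"
      by (auto simp: numeral_2_eq_2 less_Suc_eq)
    show "distl S i A B D = Ide C (ten_o S i (A \<oplus> B) D)" if "\<zero> \<in> {A, B, D}"
      using M.lin_zero[of 0 "[A, D]" B] that A by (auto simp: Ss ex)
    show "distr S i A B D = Ide C (ten_o S i A (B \<oplus> D))" if "\<zero> \<in> {A, B, D}"
      using M.lin_zero[of 1 "[A, B]" D] that A by (auto simp: Ss ex)
    show "distl S i B A D \<cdot> \<zeta> (ten_o S i A D) (ten_o S i B D) = ten_m S i (\<zeta> A B) (Ide C D) \<cdot> distl S i A B D"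
      using M.lin_zeta[of 0 "[A, D]" B] A by (simp add: Ss)
    show "distr S i A D B \<cdot> \<zeta> (ten_o S i A B) (ten_o S i A D) = ten_m S i (Ide C A) (\<zeta> B D) \<cdot> distr S i A B D"
      using M.lin_zeta[of 1 "[A, B]" D] A by (simp add: Ss)
  next
    fix A B assume [simp]: "A \<in> Obj C" "B \<in> Obj C"
    show "distl S i A B (ten_unit S) = Ide C (A \<oplus> B)"
      using eval_lin_wten(1)[OF i, of "Letter 0" Unit "pad [A]" B 0] by simp
    show "distr S i (ten_unit S) A B = Ide C (A \<oplus> B)"
      using eval_lin_wten(2)[OF i, of Unit "Letter 0" "pad [A]" B 0] by simp
  next
    fix A A' A'' B assume "A \<in> Obj C" "A' \<in> Obj C" "A'' \<in> Obj C" "B \<in> Obj C"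
    then show "distl S i (A \<oplus> A') A'' B \<cdot> (distl S i A A' B \<boxplus> Ide C (ten_o S i A'' B)) =
        distl S i A (A' \<oplus> A'') B \<cdot> (Ide C (ten_o S i A B) \<boxplus> distl S i A' A'' B)"
      using M.lin_assoc[of 0 "[A, B]" A' A''] by (simp add: Ss)
  next
    fix A B B' B'' assume "A \<in> Obj C" "B \<in> Obj C" "B' \<in> Obj C" "B'' \<in> Obj C"
    then show "distr S i A (B \<oplus> B') B'' \<cdot> (distr S i A B B' \<boxplus> Ide C (ten_o S i A B'')) =
        distr S i A B (B' \<oplus> B'') \<cdot> (Ide C (ten_o S i A B) \<boxplus> distr S i A B' B'')"
      using M.lin_assoc[of 1 "[A, B]" B' B''] by (simp add: Ss)
  next
    fix A B X Y assume [simp]: "A \<in> Obj C" "B \<in> Obj C" "X \<in> Obj C" "Y \<in> Obj C"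
    note assoc = wten_assoc[of i "Letter 0" "Letter 1" "Letter 2"]
    show "distl S i A B (ten_o S i X Y) = ten_m S i (distl S i A B X) (Ide C Y) \<cdot>
        distl S i (ten_o S i A X) (ten_o S i B X) Y"
      using arg_cong[OF assoc, of "eval_lin 0 (pad [A, X, Y]) B"] by simp
    show "distr S i (ten_o S i A B) X Y = ten_m S i (Ide C A) (distr S i B X Y) \<cdot>
        distr S i A (ten_o S i B X) (ten_o S i B Y)"
      using arg_cong[OF assoc, of "eval_lin 2 (pad [A, B, X]) Y"] by simp
    show "ten_m S i (distr S i A B X) (Ide C Y) \<cdot> distl S i (ten_o S i A B) (ten_o S i A X) Y =
        ten_m S i (Ide C A) (distl S i B X Y) \<cdot> distr S i A (ten_o S i B Y) (ten_o S i X Y)"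
      using arg_cong[OF assoc, of "eval_lin 1 (pad [A, B, Y]) X"] by simp
    have "distr S i (A \<oplus> B) X Y \<cdot> (distl S i A B X \<boxplus> distl S i A B Y) =
        distl S i A B (X \<oplus> Y) \<cdot> (distr S i A X Y \<boxplus> distr S i B X Y) \<cdot>
        (Ide C (ten_o S i A X) \<boxplus> \<zeta> (ten_o S i B X) (ten_o S i A Y) \<boxplus> Ide C (ten_o S i B Y))"
      using M.lin_lin[of 0 1 "[A, X]" B Y] by (simp add: Ss)
    then have "distr S i (A \<oplus> B) X Y \<cdot> (distl S i A B X \<boxplus> distl S i A B Y) =
        (distl S i A B (X \<oplus> Y) \<cdot> (distr S i A X Y \<boxplus> distr S i B X Y)) \<cdot>
        (Ide C (ten_o S i A X) \<boxplus> \<zeta> (ten_o S i B X) (ten_o S i A Y) \<boxplus> Ide C (ten_o S i B Y))"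
      by (simp add: cmp_assoc plus_assoc)
    then have "distl S i A B (X \<oplus> Y) \<cdot> (distr S i A X Y \<boxplus> distr S i B X Y) =
        distr S i (A \<oplus> B) X Y \<cdot> (distl S i A B X \<boxplus> distl S i A B Y) \<cdot>
        (Ide C (ten_o S i A X) \<boxplus> \<zeta> (ten_o S i A Y) (ten_o S i B X) \<boxplus> Ide C (ten_o S i B Y))"
      by (rule zeta4_swap) simp_all
    then show "distr S i (A \<oplus> B) X Y \<cdot> (distl S i A B X \<boxplus> distl S i A B Y) \<cdot>
        (Ide C (ten_o S i A X) \<boxplus> \<zeta> (ten_o S i A Y) (ten_o S i B X) \<boxplus> Ide C (ten_o S i B Y)) =
        distl S i A B (X \<oplus> Y) \<cdot> (distr S i A X Y \<boxplus> distr S i B X Y)"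
      by simp
  qed
qed

text \<open>The axioms on exchanges are the images of the defining relations between formal morphisms,
  with distinct letters for the variables; naturality belongs to the transformations.\<close>

lemma S_exchange:
  assumes ij: "1 \<le> i" "i < j" "j \<le> n"
  shows "exchange C (ten_o S i) (ten_m S i) (ten_o S j) (ten_m S j) (ten_unit S) (exch S i j)"
proof -
  have ok [simp]: "1 \<le> i" "i \<le> n" "1 \<le> j" "j \<le> n" "Suc 0 \<le> i" "Suc 0 \<le> j" using ij by auto
  note E = is_op_mor_Exch_Letters[OF ij]
  have src: "is_op n 4 (wten i (wten j (Letter 0) (Letter 1)) (wten j (Letter 2) (Letter 3)))"
    and tgt: "is_op n 4 (wten j (wten i (Letter 0) (Letter 2)) (wten i (Letter 1) (Letter 3)))"
    using E is_op_mor_mcod[OF E] by (simp_all add: is_op_mor_def)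
  note [simp] = eval_obj_wten eval_arr_wten eval_mor_Idt eval_mor_Ten eval_mor_Exch[OF ij]
  note ex = S_simps(6)[OF ij]
  have seq: "eval_mor a g \<cdot> eval_mor a f = eval_mor a g' \<cdot> eval_mor a f'"
    if "mor_eq n (set (letters (mdom f))) (g \<bullet> f) (g' \<bullet> f')" "distinct (letters (mdom f))" "asg a" for f g f' g' a
  proof -
    have m: "mdom f' = mdom f" and w: "wdm (g \<bullet> f)" "wdm (g' \<bullet> f')"
      using mor_eq_is_mor[OF that(1)] by (auto intro: is_mor_UNIV simp del: is_mor.simps)
    have "eval_mor a (g \<bullet> f) = eval_mor a (g' \<bullet> f')"
      using that(1,2) by (intro eval_mor_eq) simp_all
    then show ?thesis
      using eval_mor_Seq[OF w(1) that(2,3)] eval_mor_Seq[OF w(2) that(2)[folded m] that(3)] by simp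
  qed
  show ?thesis
  proof
    fix A B X Y assume [simp]: "A \<in> Obj C" "B \<in> Obj C" "X \<in> Obj C" "Y \<in> Obj C"
    show "exch S i j A B X Y \<in> hom C (ten_o S i (ten_o S j A B) (ten_o S j X Y))
        (ten_o S j (ten_o S i A X) (ten_o S i B Y))"
      using G_arr[OF E, of "[A, B, X, Y]"] F_eval(1)[OF src, of "[A, B, X, Y]"] F_eval(1)[OF tgt, of "[A, B, X, Y]"]
      by (simp add: ex hom_iff)
  next
    fix f A A' g B B' h X X' k Y Y'
    assume "f \<in> hom C A A'" "g \<in> hom C B B'" "h \<in> hom C X X'" "k \<in> hom C Y Y'"
    then have "f \<in> Arr C" "g \<in> Arr C" "h \<in> Arr C" "k \<in> Arr C" and eqs: "A = Dom C f" "B = Dom C g" "X = Dom C h"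
      "Y = Dom C k" "A' = Cod C f" "B' = Cod C g" "X' = Cod C h" "Y' = Cod C k"
      by (auto simp: hom_iff)
    then have fs: "[f, g, h, k] \<in> Arr (pow_cat C 4)" by simp
    have nat: "is_nat_trans (pow_cat C 4) C (fun_o (F 4 (mdom (Exch i j (Letter 0) (Letter 1) (Letter 2) (Letter 3)))))
      (fun_m (F 4 (mdom (Exch i j (Letter 0) (Letter 1) (Letter 2) (Letter 3)))))
      (fun_o (F 4 (mcod (Exch i j (Letter 0) (Letter 1) (Letter 2) (Letter 3)))))
      (fun_m (F 4 (mcod (Exch i j (Letter 0) (Letter 1) (Letter 2) (Letter 3))))) (component (E i j))"
      using multilinear_trans.nat_trans[OF G_trans(1)[OF E]] unfolding G_trans(2,3)[OF E] .
    have "component (E i j) (map (Cod C) [f, g, h, k]) \<cdot> fun_m (F 4 (wten i (wten j (Letter 0) (Letter 1)) (wten j (Letter 2) (Letter 3)))) [f, g, h, k] =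
      fun_m (F 4 (wten j (wten i (Letter 0) (Letter 2)) (wten i (Letter 1) (Letter 3)))) [f, g, h, k] \<cdot> component (E i j) (map (Dom C) [f, g, h, k])"
      using bspec[OF conjunct2[OF nat[unfolded is_nat_trans_def]] fs] by simp
    then show "exch S i j A' B' X' Y' \<cdot> ten_m S i (ten_m S j f g) (ten_m S j h k) =
        ten_m S j (ten_m S i f h) (ten_m S i g k) \<cdot> exch S i j A B X Y"
      using fs unfolding F_eval(2)[OF src fs] F_eval(2)[OF tgt fs] by (simp add: ex eqs)
  next
    fix A B assume [simp]: "A \<in> Obj C" "B \<in> Obj C"
    let ?a = "pad [A, B]"
    show "exch S i j A B (ten_unit S) (ten_unit S) = Ide C (ten_o S j A B)"
      using eval_mor_eq[OF Exch_unit1[of i j n _ "Letter 0" "Letter 1"], of ?a] ij by simp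
    show "exch S i j (ten_unit S) (ten_unit S) A B = Ide C (ten_o S j A B)"
      using eval_mor_eq[OF Exch_unit2[of i j n _ "Letter 0" "Letter 1"], of ?a] ij by simp
    show "exch S i j A (ten_unit S) B (ten_unit S) = Ide C (ten_o S i A B)"
      using eval_mor_eq[OF Exch_unit3[of i j n _ "Letter 0" "Letter 1"], of ?a] ij by simp
    show "exch S i j (ten_unit S) A (ten_unit S) B = Ide C (ten_o S i A B)"
      using eval_mor_eq[OF Exch_unit4[of i j n _ "Letter 0" "Letter 1"], of ?a] ij by simp
  next
    fix U V W X Y Z assume [simp]: "U \<in> Obj C" "V \<in> Obj C" "W \<in> Obj C" "X \<in> Obj C" "Y \<in> Obj C" "Z \<in> Obj C"
    let ?a = "pad [U, V, W, X, Y, Z]"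
    show "exch S i j (ten_o S i U W) (ten_o S i V X) Y Z \<cdot> ten_m S i (exch S i j U V W X) (Ide C (ten_o S j Y Z)) =
        exch S i j U V (ten_o S i W Y) (ten_o S i X Z) \<cdot> ten_m S i (Ide C (ten_o S j U V)) (exch S i j W X Y Z)"
      using seq[OF Exch_outer[of i j n _ "Letter 0" "Letter 1" "Letter 2" "Letter 3" "Letter 4" "Letter 5"], of ?a] ij
      by simp
    show "ten_m S j (exch S i j U V X Y) (Ide C (ten_o S i W Z)) \<cdot> exch S i j (ten_o S j U V) W (ten_o S j X Y) Z =
        ten_m S j (Ide C (ten_o S i U X)) (exch S i j V W Y Z) \<cdot> exch S i j U (ten_o S j V W) X (ten_o S j Y Z)"
      using seq[OF Exch_inner[of i j n _ "Letter 0" "Letter 1" "Letter 2" "Letter 3" "Letter 4" "Letter 5"], of ?a] ij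
      by simp
  qed
qed

lemma S_hexagon:
  assumes ijk: "1 \<le> i" "i < j" "j < k" "k \<le> n"
  shows "exchange_hexagon C (ten_o S i) (ten_m S i) (ten_o S j) (ten_m S j) (ten_o S k) (ten_m S k)
    (exch S i j) (exch S i k) (exch S j k)"
proof
  have ok [simp]: "1 \<le> i" "i \<le> n" "1 \<le> j" "j \<le> n" "1 \<le> k" "k \<le> n" "Suc 0 \<le> i" "Suc 0 \<le> j" "Suc 0 \<le> k"
      "i < j" "i < k" "j < k"
    using ijk by auto
  note [simp] = eval_obj_wten eval_mor_Ten eval_mor_Exch
  fix A B X Y A' B' X' Y' assume [simp]: "A \<in> Obj C" "B \<in> Obj C" "X \<in> Obj C" "Y \<in> Obj C"
    "A' \<in> Obj C" "B' \<in> Obj C" "X' \<in> Obj C" "Y' \<in> Obj C"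
  define a where "a = pad [A, B, X, Y, A', B', X', Y']"
  have a [simp]: "asg a" "a 0 = A" "a (Suc 0) = B" "a 2 = X" "a 3 = Y" "a 4 = A'" "a 5 = B'" "a 6 = X'" "a 7 = Y'"
    by (simp_all add: a_def)
  have seq: "eval_mor a h \<cdot> eval_mor a g \<cdot> eval_mor a f = eval_mor a h' \<cdot> eval_mor a g' \<cdot> eval_mor a f'"
    if "mor_eq n (set (letters (mdom f))) (h \<bullet> g \<bullet> f) (h' \<bullet> g' \<bullet> f')" "distinct (letters (mdom f))" for f g h f' g' h'
  proof -
    have m: "mdom f' = mdom f" and w: "wdm (h \<bullet> g \<bullet> f)" "wdm (h' \<bullet> g' \<bullet> f')"
      using mor_eq_is_mor[OF that(1)] by (auto intro: is_mor_UNIV simp del: is_mor.simps)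
    then have w': "wdm (g \<bullet> f)" "wdm (g' \<bullet> f')" by auto
    have d: "distinct (letters (mdom (g \<bullet> f)))" "distinct (letters (mdom (g' \<bullet> f')))"
      using that(2) m by simp_all
    have "eval_mor a (h \<bullet> g \<bullet> f) = eval_mor a (h' \<bullet> g' \<bullet> f')"
      using that(1,2) by (intro eval_mor_eq) simp_all
    then show ?thesis
      using eval_mor_Seq[OF w(1) d(1) a(1)] eval_mor_Seq[OF w(2) d(2) a(1)]
        eval_mor_Seq[OF w'(1) that(2) a(1)] eval_mor_Seq[OF w'(2) that(2)[folded m] a(1)] by simp
  qed
  show "ten_m S k (exch S i j A B X Y) (exch S i j A' B' X' Y') \<cdot>
      exch S i k (ten_o S j A B) (ten_o S j A' B') (ten_o S j X Y) (ten_o S j X' Y') \<cdot>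
      ten_m S i (exch S j k A A' B B') (exch S j k X X' Y Y') =
    exch S j k (ten_o S i A X) (ten_o S i A' X') (ten_o S i B Y) (ten_o S i B' Y') \<cdot>
      ten_m S j (exch S i k A A' X X') (exch S i k B B' Y Y') \<cdot>
      exch S i j (ten_o S k A A') (ten_o S k B B') (ten_o S k X X') (ten_o S k Y Y')"
    using seq[OF Exch_hexagon[of i j k n _ "Letter 0" "Letter 1" "Letter 2" "Letter 3"
      "Letter 4" "Letter 5" "Letter 6" "Letter 7"]] ijk by simp
qed

text \<open>The exchange factorization axioms say that the image of the generating exchange is a multilinear
  transformation, once the linearity constraints of its source and target are computed.\<close>

lemma S_exchange_sum:
  assumes ij: "1 \<le> i" "i < j" "j \<le> n"
  shows "exchange_sum C (ten_o S i) (ten_m S i) (ten_o S j) (ten_m S j) (exch S i j)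
    (distl S i) (distr S i) (distl S j) (distr S j)"
proof -
  have ok [simp]: "1 \<le> i" "i \<le> n" "1 \<le> j" "j \<le> n" "Suc 0 \<le> i" "Suc 0 \<le> j" using ij by auto
  note E = is_op_mor_Exch_Letters[OF ij]
  have src: "is_op n 4 (wten i (wten j (Letter 0) (Letter 1)) (wten j (Letter 2) (Letter 3)))"
    and tgt: "is_op n 4 (wten j (wten i (Letter 0) (Letter 2)) (wten i (Letter 1) (Letter 3)))"
    using E is_op_mor_mcod[OF E] by (simp_all add: is_op_mor_def)
  interpret M: multilinear_trans "replicate 4 C" C "E i j"
    by (rule G_trans(1)[OF E])
  have std_word: "src (E i j) = F 4 (wten i (wten j (Letter 0) (Letter 1)) (wten j (Letter 2) (Letter 3)))"
    "tgt (E i j) = F 4 (wten j (wten i (Letter 0) (Letter 2)) (wten i (Letter 1) (Letter 3)))"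
    using G_trans(2,3)[OF E] by simp_all
  have "component (E i j) [A, B, X, Y] = exch S i j A B X Y" for A B X Y
    using S_simps(6)[OF ij] by simp
  note ex = this[unfolded One_nat_def]
  note [simp] = eval_obj_wten eval_lin_wten
  have lin: "component (E i j) (As[q := As ! q \<oplus> A']) \<cdot>
      eval_lin q (pad As) A' (wten i (wten j (Letter 0) (Letter 1)) (wten j (Letter 2) (Letter 3))) =
      eval_lin q (pad As) A' (wten j (wten i (Letter 0) (Letter 2)) (wten i (Letter 1) (Letter 3))) \<cdot>
      (component (E i j) As \<boxplus> component (E i j) (As[q := A']))"
    if "q < 4" "As \<in> Obj (pow_cat C 4)" "A' \<in> Obj C" for q As A'
    using M.lin[of q As A'] that F_eval(3)[OF src that] F_eval(3)[OF tgt that] unfolding std_word by simp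
  note Ri = S_ring_category[OF ok(1,2)] and Rj = S_ring_category[OF ok(3,4)]
  have [simp]: "distl S i A B D \<in> Arr C" "Cod C (distl S i A B D) = ten_o S i (A \<oplus> B) D"
      "distr S i A B D \<in> Arr C" "Cod C (distr S i A B D) = ten_o S i A (B \<oplus> D)"
      "distl S j A B D \<in> Arr C" "Cod C (distl S j A B D) = ten_o S j (A \<oplus> B) D"
      "distr S j A B D \<in> Arr C" "Cod C (distr S j A B D) = ten_o S j A (B \<oplus> D)"
      "Dom C (distl S i A B D) = ten_o S i A D \<oplus> ten_o S i B D"
      "Dom C (distr S i A B D) = ten_o S i A B \<oplus> ten_o S i A D"
      "Dom C (distl S j A B D) = ten_o S j A D \<oplus> ten_o S j B D"
      "Dom C (distr S j A B D) = ten_o S j A B \<oplus> ten_o S j A D"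
    if "A \<in> Obj C" "B \<in> Obj C" "D \<in> Obj C" for A B D
    using ring_category.dl_hom[OF Ri that] ring_category.dr_hom[OF Ri that]
      ring_category.dl_hom[OF Rj that] ring_category.dr_hom[OF Rj that] by (auto simp: hom_iff)
  have ex_Arr [simp]: "exch S i j A B X Y \<in> Arr C"
      "Dom C (exch S i j A B X Y) = ten_o S i (ten_o S j A B) (ten_o S j X Y)"
      "Cod C (exch S i j A B X Y) = ten_o S j (ten_o S i A X) (ten_o S i B Y)"
    if "A \<in> Obj C" "B \<in> Obj C" "X \<in> Obj C" "Y \<in> Obj C" for A B X Y
    using exchange.ex_hom[OF S_exchange[OF ij] that] by (auto simp: hom_iff)
  have upd: "(pad [A, B, X, Y])(0 := Z) = pad [Z, B, X, Y]" "(pad [A, B, X, Y])(Suc 0 := Z) = pad [A, Z, X, Y]"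
    "(pad [A, B, X, Y])(2 := Z) = pad [A, B, Z, Y]" "(pad [A, B, X, Y])(3 := Z) = pad [A, B, X, Z]" for A B X Y Z
    using pad_update(1)[of 0 "[A, B, X, Y]" Z] pad_update(1)[of 1 "[A, B, X, Y]" Z]
      pad_update(1)[of 2 "[A, B, X, Y]" Z] pad_update(1)[of 3 "[A, B, X, Y]" Z] by (simp_all add: eval_nat_numeral)
  show ?thesis
  proof
    fix A B X Y assume A: "A \<in> Obj C" "B \<in> Obj C" "X \<in> Obj C" "Y \<in> Obj C" "\<zero> \<in> {A, B, X, Y}"
    then obtain q where "q < 4" "[A, B, X, Y] ! q = \<zero>"
      by (auto intro: that[of 0] that[of 1] that[of 2] that[of 3])
    then show "exch S i j A B X Y = Ide C \<zero>"
      using M.zero[of q "[A, B, X, Y]"] A by (simp add: ex)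
  next
    fix A A' B X Y assume [simp]: "A \<in> Obj C" "A' \<in> Obj C" "B \<in> Obj C" "X \<in> Obj C" "Y \<in> Obj C"
    show "exch S i j (A \<oplus> A') B X Y \<cdot> ten_m S i (distl S j A A' B) (Ide C (ten_o S j X Y)) \<cdot>
        distl S i (ten_o S j A B) (ten_o S j A' B) (ten_o S j X Y) =
      ten_m S j (distl S i A A' X) (Ide C (ten_o S i B Y)) \<cdot>
        distl S j (ten_o S i A X) (ten_o S i A' X) (ten_o S i B Y) \<cdot> (exch S i j A B X Y \<boxplus> exch S i j A' B X Y)"
    proof -
      have s: "eval_lin 0 (pad [A, B, X, Y]) A' (wten i (wten j (Letter 0) (Letter 1)) (wten j (Letter 2) (Letter 3))) =
          ten_m S i (distl S j A A' B) (Ide C (ten_o S j X Y)) \<cdot>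
          distl S i (ten_o S j A B) (ten_o S j A' B) (ten_o S j X Y)"
        by (simp add: upd)
      have t: "eval_lin 0 (pad [A, B, X, Y]) A' (wten j (wten i (Letter 0) (Letter 2)) (wten i (Letter 1) (Letter 3))) =
          ten_m S j (distl S i A A' X) (Ide C (ten_o S i B Y)) \<cdot>
          distl S j (ten_o S i A X) (ten_o S i A' X) (ten_o S i B Y)"
        by (simp add: upd)
      show ?thesis
        using lin[of 0 "[A, B, X, Y]" A'] unfolding s t by (simp add: ex) (simp add: cmp_assoc)
    qed
  next
    fix A B B' X Y assume [simp]: "A \<in> Obj C" "B \<in> Obj C" "B' \<in> Obj C" "X \<in> Obj C" "Y \<in> Obj C"
    show "exch S i j A (B \<oplus> B') X Y \<cdot> ten_m S i (distr S j A B B') (Ide C (ten_o S j X Y)) \<cdot>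
        distl S i (ten_o S j A B) (ten_o S j A B') (ten_o S j X Y) =
      ten_m S j (Ide C (ten_o S i A X)) (distl S i B B' Y) \<cdot>
        distr S j (ten_o S i A X) (ten_o S i B Y) (ten_o S i B' Y) \<cdot> (exch S i j A B X Y \<boxplus> exch S i j A B' X Y)"
    proof -
      have s: "eval_lin 1 (pad [A, B, X, Y]) B' (wten i (wten j (Letter 0) (Letter 1)) (wten j (Letter 2) (Letter 3))) =
          ten_m S i (distr S j A B B') (Ide C (ten_o S j X Y)) \<cdot>
          distl S i (ten_o S j A B) (ten_o S j A B') (ten_o S j X Y)"
        by (simp add: upd)
      have t: "eval_lin 1 (pad [A, B, X, Y]) B' (wten j (wten i (Letter 0) (Letter 2)) (wten i (Letter 1) (Letter 3))) =
          ten_m S j (Ide C (ten_o S i A X)) (distl S i B B' Y) \<cdot>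
          distr S j (ten_o S i A X) (ten_o S i B Y) (ten_o S i B' Y)"
        by (simp add: upd)
      show ?thesis
        using lin[of 1 "[A, B, X, Y]" B'] unfolding s t by (simp add: ex) (simp add: cmp_assoc)
    qed
  next
    fix A B X X' Y assume [simp]: "A \<in> Obj C" "B \<in> Obj C" "X \<in> Obj C" "X' \<in> Obj C" "Y \<in> Obj C"
    show "exch S i j A B (X \<oplus> X') Y \<cdot> ten_m S i (Ide C (ten_o S j A B)) (distl S j X X' Y) \<cdot>
        distr S i (ten_o S j A B) (ten_o S j X Y) (ten_o S j X' Y) =
      ten_m S j (distr S i A X X') (Ide C (ten_o S i B Y)) \<cdot>
        distl S j (ten_o S i A X) (ten_o S i A X') (ten_o S i B Y) \<cdot> (exch S i j A B X Y \<boxplus> exch S i j A B X' Y)"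
    proof -
      have s: "eval_lin 2 (pad [A, B, X, Y]) X' (wten i (wten j (Letter 0) (Letter 1)) (wten j (Letter 2) (Letter 3))) =
          ten_m S i (Ide C (ten_o S j A B)) (distl S j X X' Y) \<cdot>
          distr S i (ten_o S j A B) (ten_o S j X Y) (ten_o S j X' Y)"
        by (simp add: upd)
      have t: "eval_lin 2 (pad [A, B, X, Y]) X' (wten j (wten i (Letter 0) (Letter 2)) (wten i (Letter 1) (Letter 3))) =
          ten_m S j (distr S i A X X') (Ide C (ten_o S i B Y)) \<cdot>
          distl S j (ten_o S i A X) (ten_o S i A X') (ten_o S i B Y)"
        by (simp add: upd)
      show ?thesis
        using lin[of 2 "[A, B, X, Y]" X'] unfolding s t by (simp add: ex) (simp add: cmp_assoc)
    qed
  next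
    fix A B X Y Y' assume [simp]: "A \<in> Obj C" "B \<in> Obj C" "X \<in> Obj C" "Y \<in> Obj C" "Y' \<in> Obj C"
    show "exch S i j A B X (Y \<oplus> Y') \<cdot> ten_m S i (Ide C (ten_o S j A B)) (distr S j X Y Y') \<cdot>
        distr S i (ten_o S j A B) (ten_o S j X Y) (ten_o S j X Y') =
      ten_m S j (Ide C (ten_o S i A X)) (distr S i B Y Y') \<cdot>
        distr S j (ten_o S i A X) (ten_o S i B Y) (ten_o S i B Y') \<cdot> (exch S i j A B X Y \<boxplus> exch S i j A B X Y')"
    proof -
      have s: "eval_lin 3 (pad [A, B, X, Y]) Y' (wten i (wten j (Letter 0) (Letter 1)) (wten j (Letter 2) (Letter 3))) =
          ten_m S i (Ide C (ten_o S j A B)) (distr S j X Y Y') \<cdot>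
          distr S i (ten_o S j A B) (ten_o S j X Y) (ten_o S j X Y')"
        by (simp add: upd)
      have t: "eval_lin 3 (pad [A, B, X, Y]) Y' (wten j (wten i (Letter 0) (Letter 2)) (wten i (Letter 1) (Letter 3))) =
          ten_m S j (Ide C (ten_o S i A X)) (distr S i B Y Y') \<cdot>
          distr S j (ten_o S i A X) (ten_o S i B Y) (ten_o S i B Y')"
        by (simp add: upd)
      show ?thesis
        using lin[of 3 "[A, B, X, Y]" Y'] unfolding s t by (simp add: ex) (simp add: cmp_assoc)
    qed
  qed
qed

lemma S_extensional: "En_extensional n C S"
proof -
  have "ten_o S i A B = undefined" if "\<not> (1 \<le> i \<and> i \<le> n \<and> A \<in> Obj C \<and> B \<in> Obj C)" for i A B
  proof (cases "1 \<le> i \<and> i \<le> n")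
    case True
    then have "fun_o (T i) \<in> extensional (Obj (pow_cat C 2))"
      using multilinear.extensional(1)[OF multilinear_T] by blast
    moreover have "[A, B] \<notin> Obj (pow_cat C 2)"
      using that True by auto
    ultimately show ?thesis
      using True unfolding extensional_def by (simp add: S_simps del: Obj_pow)
  qed (auto simp: En_structure_of_def Let_def)
  moreover have "ten_m S i f g = undefined" if "\<not> (1 \<le> i \<and> i \<le> n \<and> f \<in> Arr C \<and> g \<in> Arr C)" for i f g
  proof (cases "1 \<le> i \<and> i \<le> n")
    case True
    then have "fun_m (T i) \<in> extensional (Arr (pow_cat C 2))"
      using multilinear.extensional(2)[OF multilinear_T] by blast
    moreover have "[f, g] \<notin> Arr (pow_cat C 2)"
      using that True by auto
    ultimately show ?thesis
      using True unfolding extensional_def by (simp add: S_simps del: Arr_pow)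
  qed (auto simp: En_structure_of_def Let_def)
  moreover have "distl S i A B D = undefined \<and> distr S i A B D = undefined"
    if "\<not> (1 \<le> i \<and> i \<le> n \<and> A \<in> Obj C \<and> B \<in> Obj C \<and> D \<in> Obj C)" for i A B D
  proof (cases "1 \<le> i \<and> i \<le> n")
    case True
    then have i: "1 \<le> i" "i \<le> n" by auto
    have "\<not> (0 < length (replicate 2 C) \<and> [A, D] \<in> Obj (pow_cat C 2) \<and> B \<in> Obj (replicate 2 C ! 0))"
      using that True by auto
    then have "lin (T i) 0 [A, D] B = undefined"
      by (rule multilinear.extensional(3)[OF multilinear_T[OF i]])
    moreover have "\<not> (1 < length (replicate 2 C) \<and> [A, B] \<in> Obj (pow_cat C 2) \<and> D \<in> Obj (replicate 2 C ! 1))"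
      using that True by auto
    then have "lin (T i) 1 [A, B] D = undefined"
      by (rule multilinear.extensional(3)[OF multilinear_T[OF i]])
    ultimately show ?thesis
      using S_simps(4,5)[OF i] by simp
  qed (auto simp: En_structure_of_def Let_def)
  moreover have "exch S i j A B X Y = undefined"
    if "\<not> (1 \<le> i \<and> i < j \<and> j \<le> n \<and> A \<in> Obj C \<and> B \<in> Obj C \<and> X \<in> Obj C \<and> Y \<in> Obj C)" for i j A B X Y
  proof (cases "1 \<le> i \<and> i < j \<and> j \<le> n")
    case True
    then have "component (E i j) \<in> extensional (Obj (pow_cat C 4))"
      by (intro multilinear_trans.extensional[OF G_trans(1)] is_op_mor_Exch_Letters) auto
    moreover have "[A, B, X, Y] \<notin> Obj (pow_cat C 4)"
      using that True by auto
    ultimately show ?thesis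
      using True unfolding extensional_def by (simp add: S_simps del: Obj_pow)
  qed (auto simp: En_structure_of_def Let_def)
  ultimately show ?thesis
    unfolding En_extensional_def by blast
qed

lemma S_En_structure: "S \<in> En_structures n C"
proof -
  have "nfold_monoidal C n (ten_o S) (ten_m S) (ten_unit S) (exch S)"
    unfolding nfold_monoidal_def
  proof (intro conjI allI impI)
    fix i j k assume "1 \<le> i \<and> i < j \<and> j < k \<and> k \<le> n"
    then show "exchange_hexagon C (ten_o S i) (ten_m S i) (ten_o S j) (ten_m S j) (ten_o S k) (ten_m S k)
        (exch S i j) (exch S i k) (exch S j k)"
      by (intro S_hexagon) auto
  qed (simp_all add: S_strict_monoidal S_exchange)
  then show ?thesis
    using S_ring_category S_exchange_sum S_extensional by (simp add: En_structures_def En_monoidal_def)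
qed

end

section \<open>A multifunctor is determined by its structure\<close>

text \<open>Outside of the products of the categories, multilinear functors have the same default values.\<close>

lemma multilinear_eqI:
  assumes "multilinear (replicate k C) D M" "multilinear (replicate k C) D N"
    and "\<And>As. As \<in> Obj (pow_cat C k) \<Longrightarrow> fun_o M As = fun_o N As"
    and "\<And>fs. fs \<in> Arr (pow_cat C k) \<Longrightarrow> fun_m M fs = fun_m N fs"
    and "\<And>i As A'. i < k \<Longrightarrow> As \<in> Obj (pow_cat C k) \<Longrightarrow> A' \<in> Obj C \<Longrightarrow> lin M i As A' = lin N i As A'"
  shows "M = N"
proof (rule mlfun.equality)
  show "fun_o M = fun_o N"
    using multilinear.extensional(1)[OF assms(1)] multilinear.extensional(1)[OF assms(2)] assms(3)
    by (rule extensionalityI)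
  show "fun_m M = fun_m N"
    using multilinear.extensional(2)[OF assms(1)] multilinear.extensional(2)[OF assms(2)] assms(4)
    by (rule extensionalityI)
  show "lin M = lin N"
  proof (intro ext)
    fix i As A'
    show "lin M i As A' = lin N i As A'"
    proof (cases "i < length (replicate k C) \<and> As \<in> Obj (pow_cat C k) \<and> A' \<in> Obj (replicate k C ! i)")
      case True
      then have "i < k" "As \<in> Obj (pow_cat C k)" "A' \<in> Obj C" by (auto simp del: Obj_pow)
      then show ?thesis by (rule assms(5))
    next
      case False
      show ?thesis
        unfolding multilinear.extensional(3)[OF assms(1) False] multilinear.extensional(3)[OF assms(2) False] ..
    qed
  qed
qed simp

lemma pow2_cases:
  assumes "xs \<in> Obj (pow_cat C 2)" obtains A B where "xs = [A, B]" "A \<in> Obj C" "B \<in> Obj C"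
  using assms unfolding Obj_pow by (auto simp: numeral_2_eq_2 length_Suc_conv)

text \<open>Two multifunctors with the same structure agree on the unit, the products and the exchanges.
  The operations on which they agree are closed under operadic composition, composition of
  2-cells and relabelling, and these generate the operad.\<close>

locale two_Mon_functors =
  A: Mon_functor C n \<Phi> + B: Mon_functor C n \<Psi> for C :: "('o, 'm) permcat" and n \<Phi> \<Psi> +
  assumes same: "En_structure_of n C \<Phi> = En_structure_of n C \<Psi>"
begin

lemma T_eq: "1 \<le> i \<Longrightarrow> i \<le> n \<Longrightarrow> A.T i = B.T i"
proof (rule multilinear_eqI)
  assume i: "1 \<le> i" "i \<le> n"
  show "multilinear (replicate 2 C) C (A.T i)" "multilinear (replicate 2 C) C (B.T i)"
    using i by (auto intro: A.multilinear_T B.multilinear_T simp del: One_nat_def)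
  note S = A.S_simps(1,2,4,5)[OF i] B.S_simps(1,2,4,5)[OF i]
  show "fun_o (A.T i) As = fun_o (B.T i) As" if As: "As \<in> Obj (pow_cat C 2)" for As
  proof -
    obtain X Y where "As = [X, Y]" using As by (rule pow2_cases)
    then show ?thesis
      using S(1)[of X Y] S(5)[of X Y] same by simp
  qed
  show "fun_m (A.T i) fs = fun_m (B.T i) fs" if fs: "fs \<in> Arr (pow_cat C 2)" for fs
  proof -
    have "length fs = 2" using fs unfolding Arr_pow by blast
    then obtain f g where "fs = [f, g]" by (auto simp: numeral_2_eq_2 length_Suc_conv)
    then show ?thesis
      using S(2)[of f g] S(6)[of f g] same by simp
  qed
  show "lin (A.T i) q As A' = lin (B.T i) q As A'" if q: "q < 2" "As \<in> Obj (pow_cat C 2)" for q As A'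
  proof -
    obtain X Y where "As = [X, Y]" using q(2) by (rule pow2_cases)
    moreover have "q = 0 \<or> q = 1" using q(1) by auto
    ultimately show ?thesis
      using S(3)[of X A' Y] S(4)[of X Y A'] S(7)[of X A' Y] S(8)[of X Y A'] same
      by (elim disjE) (simp_all add: same)
  qed
qed

lemma F_Unit_eq: "A.F 0 Unit = B.F 0 Unit"
proof (rule multilinear_eqI)
  show "multilinear (replicate 0 C) C (A.F 0 Unit)" "multilinear (replicate 0 C) C (B.F 0 Unit)"
    by (rule A.F_multilinear B.F_multilinear, rule is_op_Unit)+
  have o: "fun_o (A.F 0 Unit) [] = fun_o (B.F 0 Unit) []"
    using A.S_simps(3) B.S_simps(3) same by simp
  then show "fun_o (A.F 0 Unit) As = fun_o (B.F 0 Unit) As" if "As \<in> Obj (pow_cat C 0)" for As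
    using that by (simp add: prod_cat_def)
  have "fun_m (A.F 0 Unit) [] = fun_m (B.F 0 Unit) []"
    using A.F_arr(5)[OF is_op_Unit, of "[]"] B.F_arr(5)[OF is_op_Unit, of "[]"] o by (simp add: prod_cat_def)
  then show "fun_m (A.F 0 Unit) fs = fun_m (B.F 0 Unit) fs" if "fs \<in> Arr (pow_cat C 0)" for fs
    using that by (simp add: prod_cat_def)
qed simp

lemma F_std_eq:
  assumes "is_word n UNIV w" "distinct (letters w)"
  shows "A.F (length (letters w)) (std_word w) = B.F (length (letters w)) (std_word w)"
  using assms
proof (induction rule: is_word_induct)
  case Unit
  then show ?case by (simp add: std_word_def F_Unit_eq)
next
  case (Letter x)
  then show ?case by (simp add: std_word_def position_def A.F_ident B.F_ident)
next
  case (wten i v w)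
  then have d: "distinct (letters v @ letters w)" by simp
  note i = wten.hyps(1,2)
  show ?case
    using A.F_wten[OF wten.hyps(1-4) d] B.F_wten[OF wten.hyps(1-4) d] wten.IH d T_eq[OF i]
    by (simp del: One_nat_def)
qed

lemma F_eq: "is_op n k w \<Longrightarrow> A.F k w = B.F k w"
proof -
  assume w: "is_op n k w"
  obtain p where p: "p permutes {..<k}" "w = map_word (inv p) (std_word w)" "is_op n k (std_word w)" "length (letters w) = k"
    using relabel_word[OF w] by blast
  have "is_word n UNIV w" "distinct (letters w)"
    using w by (auto simp: is_op_def is_word_iff[of n "{..<_}"])
  then have "A.F k (std_word w) = B.F k (std_word w)"
    using F_std_eq[of w] p(4) by simp
  then show ?thesis
    using A.F_act[OF p(1,3)] B.F_act[OF p(1,3)] p(2) by simp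
qed

lemma E_eq:
  assumes ij: "1 \<le> i" "i < j" "j \<le> n"
  shows "A.E i j = B.E i j"
proof (rule mltrans.equality)
  note E = is_op_mor_Exch_Letters[OF ij]
  have ops: "is_op n 4 (mdom (Exch i j (Letter 0) (Letter 1) (Letter 2) (Letter 3)))"
    "is_op n 4 (mcod (Exch i j (Letter 0) (Letter 1) (Letter 2) (Letter 3)))"
    using E is_op_mor_mcod[OF E] by (simp_all only: is_op_mor_def)
  show "src (A.E i j) = src (B.E i j)"
    unfolding A.G_trans(2)[OF E] B.G_trans(2)[OF E] using ops(1) by (rule F_eq)
  show "tgt (A.E i j) = tgt (B.E i j)"
    unfolding A.G_trans(3)[OF E] B.G_trans(3)[OF E] using ops(2) by (rule F_eq)
  show "component (A.E i j) = component (B.E i j)"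
  proof (rule extensionalityI)
    show "component (A.E i j) \<in> extensional (Obj (pow_cat C 4))" "component (B.E i j) \<in> extensional (Obj (pow_cat C 4))"
      using multilinear_trans.extensional[OF A.G_trans(1)[OF E]] multilinear_trans.extensional[OF B.G_trans(1)[OF E]]
      by blast+
    fix As assume "As \<in> Obj (pow_cat C 4)"
    then have "length As = 4" unfolding Obj_pow by blast
    then obtain V W X Y where "As = [V, W, X, Y]"
      by (auto simp: eval_nat_numeral length_Suc_conv)
    then show "component (A.E i j) As = component (B.E i j) As"
      using A.S_simps(6)[OF ij, of V W X Y] B.S_simps(6)[OF ij, of V W X Y] same by simp
  qed
qed simp

lemma G_relabel:
  assumes f: "is_op_mor n k f" and std_word: "A.G k (std_mor f) = B.G k (std_mor f)"
  shows "A.G k f = B.G k f"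
proof -
  obtain p where p: "p permutes {..<k}" "f = map_mor (inv p) (std_mor f)" "is_op_mor n k (std_mor f)"
    using relabel_mor[OF f] by blast
  then show ?thesis
    using A.G_act[OF p(1,3)] B.G_act[OF p(1,3)] std_word by simp
qed

lemma G_std_eq:
  assumes "is_mor n UNIV f" "distinct (letters (mdom f))"
  shows "A.G (length (letters (mdom f))) (std_mor f) = B.G (length (letters (mdom f))) (std_mor f)"
  using assms
proof (induction f)
  case (Idt w)
  then have "is_op n (length (letters w)) (std_word w)" by (auto intro: is_op_std_word)
  moreover have "std_mor (Idt w) = Idt (std_word w)" by (simp add: std_mor_def std_word_def)
  ultimately show ?case
    by (simp add: A.G_Idt B.G_Idt F_eq)
next
  case (Seq g f)
  let ?k = "length (letters (mdom f))" and ?g = "map_mor (position (letters (mdom f))) g"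
  have gf: "is_mor n UNIV g" "is_mor n UNIV f" "mdom g = mcod f" using Seq.prems by auto
  have lg: "set (letters (mdom g)) = set (letters (mdom f))" "length (letters (mdom g)) = ?k"
      "distinct (letters (mdom g))"
    using gf Seq.prems(2) set_letters_mcod[OF gf(2)] distinct_letters_mcod[OF gf(2)]
      mset_letters_mcod[OF gf(2)] by (auto dest: mset_eq_length)
  have eq: "std_mor (g \<bullet> f) = ?g \<bullet> std_mor f" by (simp add: std_mor_def)
  have "is_op_mor n ?k (std_mor (g \<bullet> f))"
    using is_op_std_mor[OF Seq.prems(1)] Seq.prems(2) by simp
  then have m: "is_mor n {..<?k} (?g \<bullet> std_mor f)" "is_op_mor n ?k (std_mor f)"
    unfolding eq by (auto simp: is_op_mor_def)
  have g: "is_op_mor n ?k ?g"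
    using m is_op_mor_mcod[OF m(2)] by (auto simp: is_op_mor_def)
  have "std_mor ?g = std_mor g"
    using gf(1) inj_position[of "letters (mdom f)"] lg by (intro std_mor_map_mor) auto
  then have "A.G ?k ?g = B.G ?k ?g"
    using Seq.IH(1)[OF gf(1) lg(3)] lg(2) by (intro G_relabel[OF g]) simp
  moreover have "A.G ?k (std_mor f) = B.G ?k (std_mor f)"
    using Seq.IH(2) gf(2) Seq.prems(2) by simp
  ultimately show ?case
    unfolding eq mdom.simps A.G_Seq[OF m(2,1)] B.G_Seq[OF m(2,1)] by simp
next
  case (Ten i f g)
  have i: "1 \<le> i" "i \<le> n" and fg: "is_mor n UNIV f" "is_mor n UNIV g"
    and d: "distinct (letters (mdom f) @ letters (mdom g))"
    using Ten.prems by auto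
  have "A.G 2 (Idt (wten i (Letter 0) (Letter 1))) = B.G 2 (Idt (wten i (Letter 0) (Letter 1)))"
    unfolding A.G_Idt[OF is_op_wten_Letters[OF i]] B.G_Idt[OF is_op_wten_Letters[OF i]] T_eq[OF i] ..
  then show ?case
    using A.G_Ten[OF i fg d] B.G_Ten[OF i fg d] Ten.IH fg d by simp
next
  case (Exch i j p q r s)
  have i: "1 \<le> i" "i < j" "j \<le> n" and w: "is_word n UNIV p" "is_word n UNIV q" "is_word n UNIV r" "is_word n UNIV s"
    and d: "distinct (letters p @ letters q @ letters r @ letters s)"
    using Exch.prems by auto
  have "A.G (length (letters w)) (Idt (std_word w)) = B.G (length (letters w)) (Idt (std_word w))"
    if "w \<in> {p, q, r, s}" for w
    using that w d is_op_std_word[of n w] by (auto simp: A.G_Idt B.G_Idt F_eq)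
  then show ?case
    using A.G_Exch[OF i w d] B.G_Exch[OF i w d] E_eq[OF i] w d by (simp add: add.assoc)
qed

lemma G_eq: "is_op_mor n k f \<Longrightarrow> A.G k f = B.G k f"
proof -
  assume f: "is_op_mor n k f"
  obtain p where "length (letters (mdom f)) = k"
    using relabel_mor[OF f] by blast
  moreover have "is_mor n UNIV f" "distinct (letters (mdom f))"
    using f by (auto simp: is_op_mor_def is_op_def is_mor_iff[of n "{..<_}"])
  ultimately show ?thesis
    using G_std_eq[of f] by (intro G_relabel[OF f]) simp
qed

lemma functors_eq: "\<Phi> = \<Psi>"
proof (rule mfunctor.equality)
  show "on_obj \<Phi> = on_obj \<Psi>" by simp
  show "on1 \<Phi> = on1 \<Psi>"
  proof (intro ext[of "on1 \<Phi>"] ext[of "on1 \<Phi> _"])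
    fix cs d
    show "on1 \<Phi> cs d = on1 \<Psi> cs d"
    proof (rule extensionalityI)
      show "on1 \<Phi> cs d \<in> extensional (Obj (Ops (Mon n) cs d))" "on1 \<Psi> cs d \<in> extensional (Obj (Ops (Mon n) cs d))"
        using cat_multifunctor.extensional(1)[OF A.multifunctor] cat_multifunctor.extensional(1)[OF B.multifunctor]
        by simp_all
      fix w assume "w \<in> Obj (Ops (Mon n) cs d)"
      then show "on1 \<Phi> cs d w = on1 \<Psi> cs d w"
        using F_eq[of "length cs" w] by (simp add: Mon_simps A.F_def B.F_def unit_list_eq)
    qed
  qed
  show "on2 \<Phi> = on2 \<Psi>"
  proof (intro ext[of "on2 \<Phi>"] ext[of "on2 \<Phi> _"])
    fix cs d
    show "on2 \<Phi> cs d = on2 \<Psi> cs d"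
    proof (rule extensionalityI)
      show "on2 \<Phi> cs d \<in> extensional (Arr (Ops (Mon n) cs d))" "on2 \<Psi> cs d \<in> extensional (Arr (Ops (Mon n) cs d))"
        using cat_multifunctor.extensional(2)[OF A.multifunctor] cat_multifunctor.extensional(2)[OF B.multifunctor]
        by simp_all
      fix c assume "c \<in> Arr (Ops (Mon n) cs d)"
      then obtain f where "is_op_mor n (length cs) f" "c = mor_class n {..<length cs} f"
        by (auto simp: Mon_simps Arr_Mon_ops)
      then show "on2 \<Phi> cs d c = on2 \<Psi> cs d c"
        using G_eq[of "length cs" f] by (simp add: A.G_def B.G_def unit_list_eq)
    qed
  qed
qed simp

end

section \<open>The correspondence\<close>

context En_category
begin

text \<open>A product of two letters is evaluated with the unit as a third factor, which the unit axioms
  remove; values at arguments outside of the category are \<open>undefined\<close> on both sides.\<close>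

lemma En_structure_of_structure_functor:
  assumes S: "En_extensional n C S"
  shows "En_structure_of n C structure_functor = S"
proof -
  have T: "on1 structure_functor [(), ()] () (wten i (Letter 0) (Letter 1)) = word_fun 2 (wten i (Letter 0) (Letter 1))"
    if "1 \<le> i" "i \<le> n" for i
    using structure_functor_simps(2)[of "[(), ()]" "wten i (Letter 0) (Letter 1)" "()"] is_op_wten_Letters[OF that]
    by (simp add: numeral_2_eq_2)
  have E: "on2 structure_functor [(), (), (), ()] () (mor_class n {..<4} (Exch i j (Letter 0) (Letter 1) (Letter 2) (Letter 3))) =
      mor_trans 4 (Exch i j (Letter 0) (Letter 1) (Letter 2) (Letter 3))"
    if "1 \<le> i" "i < j" "j \<le> n" for i j
    using structure_functor_simps(3)[of "[(), (), (), ()]" "Exch i j (Letter 0) (Letter 1) (Letter 2) (Letter 3)" "()"]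
      is_op_mor_Exch_Letters[OF that] by (simp add: eval_nat_numeral)
  have U: "on1 structure_functor [] () Unit = word_fun 0 Unit"
    using structure_functor_simps(2)[of "[]" Unit "()"] by simp
  have oki: "ok i" if "1 \<le> i" "i \<le> n" for i using that by (simp add: ok_def)
  have okj: "ok i" "ok j" if "1 \<le> i" "i < j" "j \<le> n" for i j using that by (simp_all add: ok_def)
  note ext' = S[unfolded En_extensional_def]
  show ?thesis
  proof (rule en_data.equality)
    show "ten_o (En_structure_of n C structure_functor) = ten_o S"
    proof (intro ext)
      fix i A B
      show "ten_o (En_structure_of n C structure_functor) i A B = ten_o S i A B"
      proof (cases "1 \<le> i \<and> i \<le> n \<and> A \<in> Obj C \<and> B \<in> Obj C")
        case True
        then show ?thesis
          using T[of i] oki[of i] by (simp add: En_structure_of_def Let_def)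
      next
        case False
        then have "ten_o S i A B = undefined" using ext' by blast
        then show ?thesis
          using False T[of i] word_fun_undefined(1)[of "[A, B]" 2] by (auto simp: En_structure_of_def Let_def)
      qed
    qed
    show "ten_m (En_structure_of n C structure_functor) = ten_m S"
    proof (intro ext)
      fix i f g
      show "ten_m (En_structure_of n C structure_functor) i f g = ten_m S i f g"
      proof (cases "1 \<le> i \<and> i \<le> n \<and> f \<in> Arr C \<and> g \<in> Arr C")
        case True
        then show ?thesis
          using T[of i] oki[of i] by (simp add: En_structure_of_def Let_def)
      next
        case False
        then have "ten_m S i f g = undefined" using ext' by blast
        then show ?thesis
          using False T[of i] word_fun_undefined(2)[of "[f, g]" 2] by (auto simp: En_structure_of_def Let_def)
      qed
    qed
    show "ten_unit (En_structure_of n C structure_functor) = ten_unit S"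
      by (simp add: En_structure_of_def Let_def U)
    show "distl (En_structure_of n C structure_functor) = distl S"
    proof (intro ext)
      fix i A B D
      show "distl (En_structure_of n C structure_functor) i A B D = distl S i A B D"
      proof (cases "1 \<le> i \<and> i \<le> n \<and> A \<in> Obj C \<and> B \<in> Obj C \<and> D \<in> Obj C")
        case True
        then show ?thesis
          using T[of i] oki[of i] lin_val_wten(1)[of i "pad [A, D]" B "Letter 0" "Letter 1" 0]
          by (simp add: En_structure_of_def Let_def)
      next
        case False
        then have "distl S i A B D = undefined" using ext' by blast
        then show ?thesis
          using False T[of i] word_fun_undefined(3)[of 0 2 "[A, D]" B] by (auto simp: En_structure_of_def Let_def)
      qed
    qed
    show "distr (En_structure_of n C structure_functor) = distr S"
    proof (intro ext)
      fix i A B D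
      show "distr (En_structure_of n C structure_functor) i A B D = distr S i A B D"
      proof (cases "1 \<le> i \<and> i \<le> n \<and> A \<in> Obj C \<and> B \<in> Obj C \<and> D \<in> Obj C")
        case True
        then show ?thesis
          using T[of i] oki[of i] lin_val_wten(2)[of i "pad [A, B]" D "Letter 0" "Letter 1" 1]
          by (simp add: En_structure_of_def Let_def)
      next
        case False
        then have "distr S i A B D = undefined" using ext' by blast
        then show ?thesis
          using False T[of i] word_fun_undefined(3)[of 1 2 "[A, B]" D] by (auto simp: En_structure_of_def Let_def)
      qed
    qed
    show "exch (En_structure_of n C structure_functor) = exch S"
    proof (intro ext)
      fix i j A B X Y
      show "exch (En_structure_of n C structure_functor) i j A B X Y = exch S i j A B X Y"
      proof (cases "1 \<le> i \<and> i < j \<and> j \<le> n \<and> A \<in> Obj C \<and> B \<in> Obj C \<and> X \<in> Obj C \<and> Y \<in> Obj C")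
        case True
        then show ?thesis
          using E[of i j] by (simp add: En_structure_of_def Let_def)
      next
        case False
        then have "exch S i j A B X Y = undefined" using ext' by blast
        then show ?thesis
          using False E[of i j] mor_trans_undefined[of "[A, B, X, Y]" 4] by (auto simp: En_structure_of_def Let_def)
      qed
    qed
  qed simp
qed

end

theorem mainTheorem16:
  fixes n :: nat and C :: "('o, 'm) permcat"
  assumes "1 \<le> n" and "permutative_category C"
  shows "bij_betw (En_structure_of n C)
    {\<Phi>. cat_multifunctor (Mon n) PermCat_su \<Phi> \<and> on_obj \<Phi> () = C}
    (En_structures n C)"
proof (rule bij_betwI')
  fix \<Phi> \<Psi> :: "(unit, nat word, nat mor set, ('o, 'm) permcat, ('o, 'm) mlfun, ('o, 'm) mltrans) mfunctor"
  assume "\<Phi> \<in> {\<Phi>. cat_multifunctor (Mon n) PermCat_su \<Phi> \<and> on_obj \<Phi> () = C}"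
    and "\<Psi> \<in> {\<Phi>. cat_multifunctor (Mon n) PermCat_su \<Phi> \<and> on_obj \<Phi> () = C}"
  then have m: "Mon_functor C n \<Phi>" "Mon_functor C n \<Psi>"
    using assms by (auto intro!: Mon_functor.intro Mon_functor_axioms.intro)
  then show "En_structure_of n C \<Phi> = En_structure_of n C \<Psi> \<longleftrightarrow> \<Phi> = \<Psi>"
    using two_Mon_functors.functors_eq[OF two_Mon_functors.intro[OF m two_Mon_functors_axioms.intro]] by blast
next
  fix \<Phi> :: "(unit, nat word, nat mor set, ('o, 'm) permcat, ('o, 'm) mlfun, ('o, 'm) mltrans) mfunctor"
  assume "\<Phi> \<in> {\<Phi>. cat_multifunctor (Mon n) PermCat_su \<Phi> \<and> on_obj \<Phi> () = C}"
  then show "En_structure_of n C \<Phi> \<in> En_structures n C"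
    using assms by (intro Mon_functor.S_En_structure) (auto intro!: Mon_functor.intro Mon_functor_axioms.intro)
next
  fix S assume S: "S \<in> En_structures n C"
  then have "En_category C n S"
    using assms by (auto simp: En_structures_def intro!: En_category.intro En_category_axioms.intro)
  then interpret En_category C n S .
  show "\<exists>\<Phi> \<in> {\<Phi>. cat_multifunctor (Mon n) PermCat_su \<Phi> \<and> on_obj \<Phi> () = C}. S = En_structure_of n C \<Phi>"
    using cat_multifunctor_structure_functor En_structure_of_structure_functor S
    by (intro bexI[of _ structure_functor]) (auto simp: En_structures_def)
qed

end
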